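(* Let $\rho_1,\rho_2\in\mathcal{B}$ be piecewise $C^1$ on $[0,T]$, and for some $\gamma$ with $\frac d2<\gamma<2$ let $u_0\in D(A^{1+\gamma/2})$ and $f\in D(A^{\gamma/2})$. Let $u_i=u(\rho_i)$, $i=1,2$, be the solution of the initial-boundary value problem $$\partial_t^\alpha u-\Delta u+\rho(t)u=f\ \text{ in }\Omega\times(0,T],\qquad \partial_\nu u=0\ \text{ on }\partial\Omega\times(0,T],\qquad u(0)=u_0\ \text{ in }\Omega,$$ with potential $\rho=\rho_i$. Let $x_0\in\overline\Omega$ be given, and suppose there are positive constants $\underline{c}_u,\overline{c}_u$ such that $\underline{c}_u\le u_i(x_0,t)\le\overline{c}_u$ for all $t\in[0,T]$ and $i=1,2$. Then for every $p\in[1,\infty]$, $$\|\rho_1-\rho_2\|_{L^p(0,T)}\le c\,\|\partial_t^\alpha(u_1-u_2)(x_0,\cdot)\|_{L^p(0,T)},$$ where the constant $c$ depends on $\underline{c}_u$, $\overline{c}_u$, $\alpha$, $\overline{c}_\rho$, $\|f\|_{D(A^{\gamma/2})}$, $\|Au_1(x_0,\cdot)\|_{C([0,T])}$ and $\|\partial_t^\alpha u_1(x_0,\cdot)\|_{C([0,T])}$.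
   Context: Throughout, $\Omega\subset\mathbb{R}^d$ ($1\le d\le 3$) is a fixed convex polyhedral domain with boundary $\partial\Omega$ and outward unit normal $\nu$, $T>0$ is a fixed final time, $\alpha\in(0,1)$, and $f=f(x)$ is independent of time. The Djrbashian–Caputo derivative is $\partial_t^\alpha u(t)=\frac{1}{\Gamma(1-\alpha)}\int_0^t(t-s)^{-\alpha}u'(s)\,ds$. The admissible set is $\mathcal{B}=\{\rho\in C[0,T]:0\le\rho\le\overline{c}_\rho\}$, with $\overline{c}_\rho>0$ a fixed constant. For a fixed constant $c_0>0$, $A=-\Delta+c_0 I$ with homogeneous Neumann boundary condition, with domain $D(A)=\{v\in L^2(\Omega):-\Delta v+c_0v\in L^2(\Omega),\ \partial_\nu v|_{\partial\Omega}=0\}$. Let $\{\lambda_\ell\},\{\varphi_\ell\}$ be the eigenvalues (nondecreasing, with multiplicity) and corresponding $L^2(\Omega)$-orthonormal eigenfunctions of $A$; for $s\ge0$, $A^sv=\sum_\ell\lambda_\ell^s(v,\varphi_\ell)\varphi_\ell$ with domain $D(A^s)=\{v\in L^2(\Omega):A^sv\in L^2(\Omega)\}$. Under the stated hypotheses on $\rho$ (in $\mathcal B$, piecewise $C^1$), $u_0$ and $f$, the initial-boundary value problem has a unique solution $u\in C^\alpha([0,T];D(A^{\gamma/2}))\cap C([0,T];D(A^{1+\gamma/2}))$ with $\partial_t^\alpha u\in C([0,T];D(A^{\gamma/2}))$; since $\gamma>d/2$, the point values at $x_0$ of $u$, $Au$, $\partial_t^\alpha u$ are well defined by Sobolev 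embedding.
   Formalization: The constant c may also depend on the norm of u_0 in D(A^{1+γ/2}) (besides the fixed Ω, T, c_0, γ); with only the listed quantities the estimate fails, e.g. on a square with x_0 a corner and rapidly oscillating u_1(x_0,·). *)

theory Defs
  imports "HOL-Analysis.Analysis" "HOL-Probability.Essential_Supremum"
begin

text \<open>
  Elements of \<open>L\<^sup>2(\<Omega>)\<close> are represented by real functions on the ambient Euclidean space; only
  their values almost everywhere in \<open>\<Omega>\<close> matter.
\<close>

definition convex_polyhedral_domain :: "'a::euclidean_space set \<Rightarrow> bool" where
  "convex_polyhedral_domain \<Omega> \<longleftrightarrow> \<Omega> \<noteq> {} \<and> (\<exists>P. polytope P \<and> \<Omega> = interior P)"

definition L2 :: "'a::euclidean_space set \<Rightarrow> ('a \<Rightarrow> real) set" where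
  "L2 \<Omega> = {v. v \<in> borel_measurable (lebesgue_on \<Omega>) \<and> integrable (lebesgue_on \<Omega>) (\<lambda>x. (v x)\<^sup>2)}"

definition L2_inner :: "'a::euclidean_space set \<Rightarrow> ('a \<Rightarrow> real) \<Rightarrow> ('a \<Rightarrow> real) \<Rightarrow> real" where
  "L2_inner \<Omega> v w = (\<integral>x. v x * w x \<partial>lebesgue_on \<Omega>)"

definition L2_norm :: "'a::euclidean_space set \<Rightarrow> ('a \<Rightarrow> real) \<Rightarrow> real" where
  "L2_norm \<Omega> v = sqrt (L2_inner \<Omega> v v)"

text \<open>
  Test functions are of class \<open>C\<^sup>1\<close> with compact support in \<open>\<Omega>\<close>; by mollification they give the
  same weak gradients as smooth ones.  \<open>weak_gradient \<Omega> v G\<close> says that \<open>v \<in> H\<^sup>1(\<Omega>)\<close> and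
  \<open>\<nabla>v = G\<close>.
\<close>

definition test_function :: "'a::euclidean_space set \<Rightarrow> ('a \<Rightarrow> real) \<Rightarrow> ('a \<Rightarrow> 'a) \<Rightarrow> bool" where
  "test_function \<Omega> \<psi> D\<psi> \<longleftrightarrow>
     (\<forall>x. (\<psi> has_derivative (\<lambda>h. D\<psi> x \<bullet> h)) (at x)) \<and> continuous_on UNIV D\<psi> \<and>
     (\<exists>K. compact K \<and> K \<subseteq> \<Omega> \<and> (\<forall>x. x \<notin> K \<longrightarrow> \<psi> x = 0))"

definition weak_gradient :: "'a::euclidean_space set \<Rightarrow> ('a \<Rightarrow> real) \<Rightarrow> ('a \<Rightarrow> 'a) \<Rightarrow> bool" where
  "weak_gradient \<Omega> v G \<longleftrightarrow>
     v \<in> L2 \<Omega> \<and>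
     G \<in> borel_measurable (lebesgue_on \<Omega>) \<and> integrable (lebesgue_on \<Omega>) (\<lambda>x. (norm (G x))\<^sup>2) \<and>
     (\<forall>\<psi> D\<psi>. test_function \<Omega> \<psi> D\<psi> \<longrightarrow>
        (\<integral>x. v x *\<^sub>R D\<psi> x \<partial>lebesgue_on \<Omega>) = - (\<integral>x. \<psi> x *\<^sub>R G x \<partial>lebesgue_on \<Omega>))"

text \<open>
  \<open>\<Delta>v = g \<in> L\<^sup>2(\<Omega>)\<close> together with \<open>\<partial>\<^sub>\<nu>v = 0\<close> on the boundary.  The normal derivative of
  \<open>v \<in> H\<^sup>1(\<Omega>)\<close> with \<open>\<Delta>v \<in> L\<^sup>2(\<Omega>)\<close> is the functional
  \<open>\<psi> \<mapsto> \<integral> \<nabla>v \<bullet> \<nabla>\<psi> + \<integral> \<Delta>v \<psi>\<close> on \<open>H\<^sup>1(\<Omega>)\<close> (Green's formula).  Taking \<open>\<psi>\<close> of compact support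
  shows that \<open>g\<close> is the distributional Laplacian.
\<close>

definition neumann_laplacian :: "'a::euclidean_space set \<Rightarrow> ('a \<Rightarrow> real) \<Rightarrow> ('a \<Rightarrow> real) \<Rightarrow> bool" where
  "neumann_laplacian \<Omega> v g \<longleftrightarrow>
     g \<in> L2 \<Omega> \<and>
     (\<exists>G. weak_gradient \<Omega> v G \<and>
        (\<forall>\<psi> H. weak_gradient \<Omega> \<psi> H \<longrightarrow>
           (\<integral>x. G x \<bullet> H x \<partial>lebesgue_on \<Omega>) + (\<integral>x. g x * \<psi> x \<partial>lebesgue_on \<Omega>) = 0))"

definition op_A_dom :: "'a::euclidean_space set \<Rightarrow> ('a \<Rightarrow> real) set" where
  "op_A_dom \<Omega> = {v. \<exists>g. neumann_laplacian \<Omega> v g}"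

definition op_A :: "'a::euclidean_space set \<Rightarrow> real \<Rightarrow> ('a \<Rightarrow> real) \<Rightarrow> 'a \<Rightarrow> real" where
  "op_A \<Omega> c0 v = (\<lambda>x. - (SOME g. neumann_laplacian \<Omega> v g) x + c0 * v x)"

text \<open>
  Completeness in \<open>L\<^sup>2(\<Omega>)\<close> expresses that all eigenvalues are listed, with multiplicity.
\<close>

definition eigensystem_A ::
    "'a::euclidean_space set \<Rightarrow> real \<Rightarrow> (nat \<Rightarrow> real) \<Rightarrow> (nat \<Rightarrow> 'a \<Rightarrow> real) \<Rightarrow> bool" where
  "eigensystem_A \<Omega> c0 lam \<phi> \<longleftrightarrow>
     mono lam \<and>
     (\<forall>l. \<phi> l \<in> op_A_dom \<Omega> \<and> (AE x in lebesgue_on \<Omega>. op_A \<Omega> c0 (\<phi> l) x = lam l * \<phi> l x)) \<and>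
     (\<forall>k l. L2_inner \<Omega> (\<phi> k) (\<phi> l) = (if k = l then 1 else 0)) \<and>
     (\<forall>v \<in> L2 \<Omega>. (\<forall>l. L2_inner \<Omega> v (\<phi> l) = 0) \<longrightarrow> (AE x in lebesgue_on \<Omega>. v x = 0))"

definition is_A_pow ::
    "'a::euclidean_space set \<Rightarrow> (nat \<Rightarrow> real) \<Rightarrow> (nat \<Rightarrow> 'a \<Rightarrow> real) \<Rightarrow> real \<Rightarrow>
     ('a \<Rightarrow> real) \<Rightarrow> ('a \<Rightarrow> real) \<Rightarrow> bool" where
  "is_A_pow \<Omega> lam \<phi> s v w \<longleftrightarrow>
     w \<in> L2 \<Omega> \<and>
     (\<lambda>n. L2_norm \<Omega> (\<lambda>x. w x - (\<Sum>l<n. lam l powr s * L2_inner \<Omega> v (\<phi> l) * \<phi> l x))) \<longlonglongrightarrow> 0"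

definition A_pow ::
    "'a::euclidean_space set \<Rightarrow> (nat \<Rightarrow> real) \<Rightarrow> (nat \<Rightarrow> 'a \<Rightarrow> real) \<Rightarrow> real \<Rightarrow>
     ('a \<Rightarrow> real) \<Rightarrow> 'a \<Rightarrow> real" where
  "A_pow \<Omega> lam \<phi> s v = (SOME w. is_A_pow \<Omega> lam \<phi> s v w)"

definition DA ::
    "'a::euclidean_space set \<Rightarrow> (nat \<Rightarrow> real) \<Rightarrow> (nat \<Rightarrow> 'a \<Rightarrow> real) \<Rightarrow> real \<Rightarrow> ('a \<Rightarrow> real) set" where
  "DA \<Omega> lam \<phi> s = {v \<in> L2 \<Omega>. \<exists>w. is_A_pow \<Omega> lam \<phi> s v w}"

definition DA_norm ::
    "'a::euclidean_space set \<Rightarrow> (nat \<Rightarrow> real) \<Rightarrow> (nat \<Rightarrow> 'a \<Rightarrow> real) \<Rightarrow> real \<Rightarrow> ('a \<Rightarrow> real) \<Rightarrow> real" where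
  "DA_norm \<Omega> lam \<phi> s v = L2_norm \<Omega> (A_pow \<Omega> lam \<phi> s v)"

definition cont_DA ::
    "'a::euclidean_space set \<Rightarrow> (nat \<Rightarrow> real) \<Rightarrow> (nat \<Rightarrow> 'a \<Rightarrow> real) \<Rightarrow> real \<Rightarrow> real \<Rightarrow>
     (real \<Rightarrow> 'a \<Rightarrow> real) \<Rightarrow> bool" where
  "cont_DA \<Omega> lam \<phi> s T u \<longleftrightarrow>
     (\<forall>t\<in>{0..T}. u t \<in> DA \<Omega> lam \<phi> s) \<and>
     (\<forall>t\<in>{0..T}. ((\<lambda>r. DA_norm \<Omega> lam \<phi> s (\<lambda>x. u r x - u t x)) \<longlongrightarrow> 0) (at t within {0..T}))"

definition holder_DA ::
    "'a::euclidean_space set \<Rightarrow> (nat \<Rightarrow> real) \<Rightarrow> (nat \<Rightarrow> 'a \<Rightarrow> real) \<Rightarrow> real \<Rightarrow> real \<Rightarrow> real \<Rightarrow>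
     (real \<Rightarrow> 'a \<Rightarrow> real) \<Rightarrow> bool" where
  "holder_DA \<Omega> lam \<phi> s T \<alpha> u \<longleftrightarrow>
     (\<forall>t\<in>{0..T}. u t \<in> DA \<Omega> lam \<phi> s) \<and>
     (\<exists>K. \<forall>t\<in>{0..T}. \<forall>r\<in>{0..T}.
        DA_norm \<Omega> lam \<phi> s (\<lambda>x. u r x - u t x) \<le> K * \<bar>r - t\<bar> powr \<alpha>)"

text \<open>
  The value at \<open>x \<in> closure \<Omega>\<close> of the continuous representative of \<open>v\<close>.
\<close>

definition point_value :: "'a::euclidean_space set \<Rightarrow> ('a \<Rightarrow> real) \<Rightarrow> 'a \<Rightarrow> real" where
  "point_value \<Omega> v x =
     (THE y. \<exists>g. continuous_on (closure \<Omega>) g \<and> (AE z in lebesgue_on \<Omega>. g z = v z) \<and> y = g x)"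

definition caputo :: "real \<Rightarrow> (real \<Rightarrow> real) \<Rightarrow> real \<Rightarrow> real" where
  "caputo \<alpha> g t = 1 / Gamma (1 - \<alpha>) * (\<integral>s. (t - s) powr (- \<alpha>) * deriv g s \<partial>lebesgue_on {0..t})"

text \<open>
  \<open>g\<close> is absolutely continuous on \<open>[0,T]\<close> and the integral in its Caputo derivative converges for
  all \<open>t \<in> (0,T]\<close>.
\<close>

definition caputo_differentiable :: "real \<Rightarrow> real \<Rightarrow> (real \<Rightarrow> real) \<Rightarrow> bool" where
  "caputo_differentiable \<alpha> T g \<longleftrightarrow>
     (AE s in lebesgue_on {0..T}. g differentiable (at s)) \<and>
     integrable (lebesgue_on {0..T}) (deriv g) \<and>
     (\<forall>t\<in>{0..T}. g t = g 0 + (\<integral>s. deriv g s \<partial>lebesgue_on {0..t})) \<and>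
     (\<forall>t\<in>{0<..T}. integrable (lebesgue_on {0..t}) (\<lambda>s. (t - s) powr (- \<alpha>) * deriv g s))"

text \<open>
  \<open>u t x\<close> is the value at time \<open>t\<close> and at the point \<open>x \<in> closure \<Omega>\<close>: every \<open>u t\<close> is the continuous
  representative of its class.  The Caputo integral is \<open>0\<close> at \<open>t = 0\<close> whereas \<open>\<partial>\<^sub>t\<^sup>\<alpha> u(t)\<close> in general
  has a nonzero limit as \<open>t \<rightarrow> 0\<close>; its membership in \<open>C([0,T]; D(A\<^sup>\<gamma>\<^sup>/\<^sup>2))\<close> refers to the
  continuous extension \<open>D\<close> from \<open>(0,T]\<close> to \<open>[0,T]\<close>.
\<close>

definition is_solution ::
    "'a::euclidean_space set \<Rightarrow> real \<Rightarrow> (nat \<Rightarrow> real) \<Rightarrow> (nat \<Rightarrow> 'a \<Rightarrow> real) \<Rightarrow> real \<Rightarrow> real \<Rightarrow>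
     (real \<Rightarrow> real) \<Rightarrow> ('a \<Rightarrow> real) \<Rightarrow> ('a \<Rightarrow> real) \<Rightarrow> (real \<Rightarrow> 'a \<Rightarrow> real) \<Rightarrow> bool" where
  "is_solution \<Omega> T lam \<phi> \<gamma> \<alpha> \<rho> u0 f u \<longleftrightarrow>
     (\<forall>t\<in>{0..T}. continuous_on (closure \<Omega>) (u t)) \<and>
     holder_DA \<Omega> lam \<phi> (\<gamma> / 2) T \<alpha> u \<and>
     cont_DA \<Omega> lam \<phi> (1 + \<gamma> / 2) T u \<and>
     (\<forall>x\<in>closure \<Omega>. caputo_differentiable \<alpha> T (\<lambda>s. u s x)) \<and>
     (\<exists>D. cont_DA \<Omega> lam \<phi> (\<gamma> / 2) T D \<and>
        (\<forall>t\<in>{0<..T}. continuous_on (closure \<Omega>) (D t) \<and>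
           (\<forall>x\<in>closure \<Omega>. D t x = caputo \<alpha> (\<lambda>s. u s x) t))) \<and>
     (\<forall>t\<in>{0<..T}. \<exists>g. neumann_laplacian \<Omega> (u t) g \<and>
        (AE x in lebesgue_on \<Omega>. caputo \<alpha> (\<lambda>s. u s x) t - g x + \<rho> t * u t x = f x)) \<and>
     (AE x in lebesgue_on \<Omega>. u 0 x = u0 x)"

definition admissible :: "real \<Rightarrow> real \<Rightarrow> (real \<Rightarrow> real) set" where
  "admissible T c\<rho> = {\<rho>. continuous_on {0..T} \<rho> \<and> (\<forall>t\<in>{0..T}. 0 \<le> \<rho> t \<and> \<rho> t \<le> c\<rho>)}"

definition Lp_norm :: "ennreal \<Rightarrow> real \<Rightarrow> (real \<Rightarrow> real) \<Rightarrow> real" where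
  "Lp_norm p T g =
     (if p = \<infinity> then real_of_ereal (esssup (lebesgue_on {0<..<T}) (\<lambda>t. ereal \<bar>g t\<bar>))
      else (\<integral>t. \<bar>g t\<bar> powr enn2real p \<partial>lebesgue_on {0<..<T}) powr (1 / enn2real p))"

end

theory Submission
  imports Defs
begin

text \<open>
  At \<open>x\<^sub>0\<close> the difference of the two equations reads
  \<open>(\<rho>\<^sub>1 - \<rho>\<^sub>2) u\<^sub>1 = \<Delta>(u\<^sub>1 - u\<^sub>2) - \<partial>\<^sub>t\<^sup>\<alpha>(u\<^sub>1 - u\<^sub>2) - \<rho>\<^sub>2 (u\<^sub>1 - u\<^sub>2)\<close>, where \<open>u\<^sub>1\<close> is bounded away from zero.
  Each eigencoefficient of \<open>u\<^sub>1 - u\<^sub>2\<close> solves a scalar fractional equation with source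
  \<open>\<rho>\<^sub>2 - \<rho>\<^sub>1\<close> times the coefficient of \<open>u\<^sub>1\<close>, so a comparison principle bounds it by a multiple of
  the fractional integral of \<open>\<bar>\<rho>\<^sub>1 - \<rho>\<^sub>2\<bar>\<close>.  Through the embedding of \<open>D(A\<^sup>\<gamma>\<^sup>/\<^sup>2)\<close> into the continuous
  functions this fractional integral controls the first and the last term on the right, and a Gronwall
  argument in \<open>L\<^sup>p(0,T)\<close>, with an exponential weight that makes the kernel small, absorbs it.

  The embedding needs no elliptic regularity: Stampacchia's truncation method, based on a
  Faber--Krahn inequality for convex domains, bounds the supremum of \<open>v\<close> by the \<open>L\<^sup>2\<close> norms of \<open>v\<close> and
  \<open>\<Delta>v\<close>, and this bound is applied to dyadic spectral windows.
\<close>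

section \<open>Square-integrable functions\<close>

text \<open>The critical term is \<Delta>(u1 - u2) at x0, which costs two derivatives more than the
  embedding pays for. They come from the data: since \<open>f\<close> does not depend on time, every
  coefficient of u1 stays, uniformly in t, below the fixed profile |u0_l| + K |f_l| /
  \<open>lam l\<close>, and this profile remains square summable after multiplication by
  \<open>lam l powr (1 + \<gamma> / 2)\<close>. The source of the difference is therefore |\<rho>1 -
  \<rho>2| times one fixed profile, the weighted sum over l factors out, and the time kernel stays
  t^(\<alpha>-1), which is integrable at 0. The elliptic part is -\<Delta> and not A, so the scalar
  coefficient is \<open>lam l - c0 + \<rho> s\<close>: it may vanish for the lowest eigenvalue, and
  for the difference only its sign is used. In time the solution is absolutely continuous at each
  point and no more. The scalar equations are thus obtained as Volterra equations, through Fubini,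
  and the comparison principle has to argue at a minimum of a continuous function without
  differentiating it. In space, convexity of \<Omega> enters because the segment between a point and
  its translate must stay in \<Omega>.\<close>

definition square_integrable :: "'a measure \<Rightarrow> ('a \<Rightarrow> real) \<Rightarrow> bool" where
  "square_integrable M f \<longleftrightarrow> f \<in> borel_measurable M \<and> integrable M (\<lambda>x. (f x)\<^sup>2)"

definition l2norm :: "'a measure \<Rightarrow> ('a \<Rightarrow> real) \<Rightarrow> real" where
  "l2norm M f = sqrt (\<integral>x. (f x)\<^sup>2 \<partial>M)"

lemma square_integrableD:
  assumes "square_integrable M f"
  shows "f \<in> borel_measurable M" "integrable M (\<lambda>x. (f x)\<^sup>2)"
  using assms by (auto simp: square_integrable_def)

lemma square_integrable_bound:
  assumes "square_integrable M f" "g \<in> borel_measurable M" "AE x in M. \<bar>g x\<bar> \<le> \<bar>f x\<bar>"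
  shows "square_integrable M g"
  unfolding square_integrable_def
proof
  show "integrable M (\<lambda>x. (g x)\<^sup>2)"
    by (rule Bochner_Integration.integrable_bound[OF square_integrableD(2)[OF assms(1)]])
      (use assms in \<open>auto simp: abs_le_square_iff\<close>)
qed (use assms in auto)

lemma square_integrable_cmult:
  assumes "square_integrable M f"
  shows "square_integrable M (\<lambda>x. c * f x)"
  using assms by (auto simp: square_integrable_def power_mult_distrib)

lemma square_integrable_uminus:
  assumes "square_integrable M f"
  shows "square_integrable M (\<lambda>x. - f x)"
  using assms by (auto simp: square_integrable_def)

lemma square_integrable_zero: "square_integrable M (\<lambda>x. 0)"
  by (auto simp: square_integrable_def)

lemma square_integrable_add:
  assumes "square_integrable M f" "square_integrable M g"
  shows "square_integrable M (\<lambda>x. f x + g x)"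
  unfolding square_integrable_def
proof
  show "(\<lambda>x. f x + g x) \<in> borel_measurable M"
    using assms by (auto simp: square_integrable_def)
  have "norm ((a + b)\<^sup>2) \<le> norm (2 * a\<^sup>2 + 2 * b\<^sup>2)" for a b :: real
  proof -
    have "(a + b)\<^sup>2 \<le> 2 * a\<^sup>2 + 2 * b\<^sup>2"
      using sum_squares_bound[of a b] unfolding power2_sum by linarith
    then show ?thesis by (simp only: real_norm_def)  (rule order_trans[OF _ abs_ge_self], simp)
  qed
  then have "AE x in M. norm ((f x + g x)\<^sup>2) \<le> norm (2 * (f x)\<^sup>2 + 2 * (g x)\<^sup>2)"
    by (intro AE_I2)
  moreover have "integrable M (\<lambda>x. 2 * (f x)\<^sup>2 + 2 * (g x)\<^sup>2)"
    by (intro Bochner_Integration.integrable_add integrable_mult_right square_integrableD assms)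
  moreover have "(\<lambda>x. (f x + g x)\<^sup>2) \<in> borel_measurable M"
    by (intro borel_measurable_power borel_measurable_add square_integrableD assms)
  ultimately show "integrable M (\<lambda>x. (f x + g x)\<^sup>2)"
    using Bochner_Integration.integrable_bound by blast
qed

lemma square_integrable_diff:
  assumes "square_integrable M f" "square_integrable M g"
  shows "square_integrable M (\<lambda>x. f x - g x)"
  using square_integrable_add[OF assms(1) square_integrable_uminus[OF assms(2)]] by simp

lemma square_integrable_sum:
  assumes "\<And>i. i \<in> I \<Longrightarrow> square_integrable M (f i)"
  shows "square_integrable M (\<lambda>x. \<Sum>i\<in>I. f i x)"
  using assms
  by (induction I rule: infinite_finite_induct)
    (auto intro: square_integrable_zero square_integrable_add)

lemma square_integrable_abs:
  assumes "square_integrable M f"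
  shows "square_integrable M (\<lambda>x. \<bar>f x\<bar>)"
  using assms by (auto simp: square_integrable_def)

lemma square_integrable_mult:
  assumes "square_integrable M f" "square_integrable M g"
  shows "integrable M (\<lambda>x. f x * g x)"
proof (rule Bochner_Integration.integrable_bound[of M "\<lambda>x. (f x)\<^sup>2 + (g x)\<^sup>2"])
  have "norm (a * b) \<le> norm (a\<^sup>2 + b\<^sup>2)" for a b :: real
  proof -
    have "2 * (\<bar>a\<bar> * \<bar>b\<bar>) \<le> a\<^sup>2 + b\<^sup>2"
      using sum_squares_bound[of "\<bar>a\<bar>" "\<bar>b\<bar>"] by (simp add: mult.assoc)
    then have "\<bar>a\<bar> * \<bar>b\<bar> \<le> a\<^sup>2 + b\<^sup>2"
      using mult_nonneg_nonneg[of "\<bar>a\<bar>" "\<bar>b\<bar>"] by linarith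
    then show ?thesis by (simp add: abs_mult)
  qed
  then show "AE x in M. norm (f x * g x) \<le> norm ((f x)\<^sup>2 + (g x)\<^sup>2)"
    by (intro AE_I2)
  show "integrable M (\<lambda>x. (f x)\<^sup>2 + (g x)\<^sup>2)"
    by (rule Bochner_Integration.integrable_add[OF square_integrableD(2)[OF assms(1)]
          square_integrableD(2)[OF assms(2)]])
  show "(\<lambda>x. f x * g x) \<in> borel_measurable M"
    by (rule borel_measurable_times[OF square_integrableD(1)[OF assms(1)]
          square_integrableD(1)[OF assms(2)]])
qed

lemma integrable_of_square_integrable:
  assumes "finite_measure M" "square_integrable M f"
  shows "integrable M f"
proof -
  interpret finite_measure M by fact
  have "square_integrable M (\<lambda>x. 1)"
    by (auto simp: square_integrable_def)
  from square_integrable_mult[OF assms(2) this] show ?thesis by simp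
qed

lemma square_integrable_bounded:
  assumes "finite_measure M" "f \<in> borel_measurable M" "AE x in M. \<bar>f x\<bar> \<le> B"
  shows "square_integrable M f"
proof -
  interpret finite_measure M by fact
  have "square_integrable M (\<lambda>x. B)"
    by (auto simp: square_integrable_def)
  from square_integrable_bound[OF this assms(2)] show ?thesis
    using AE_mp[OF assms(3)] by force
qed

lemma l2norm_nonneg: "0 \<le> l2norm M f"
  by (simp add: l2norm_def)

lemma l2norm_power2: "(l2norm M f)\<^sup>2 = (\<integral>x. (f x)\<^sup>2 \<partial>M)"
  by (simp add: l2norm_def)

lemma l2norm_zero_AE:
  assumes "square_integrable M f" "l2norm M f = 0"
  shows "AE x in M. f x = 0"
proof -
  have "(\<integral>x. (f x)\<^sup>2 \<partial>M) = 0" using assms(2) l2norm_power2[of M f] by simp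
  then show ?thesis
    using integral_nonneg_eq_0_iff_AE[OF square_integrableD(2)[OF assms(1)]] by auto
qed

lemma l2norm_cong_AE:
  assumes "f \<in> borel_measurable M" "g \<in> borel_measurable M" "AE x in M. f x = g x"
  shows "l2norm M f = l2norm M g"
  unfolding l2norm_def by (rule arg_cong[where f=sqrt], rule integral_cong_AE) (use assms in auto)

lemma l2norm_mono:
  assumes "square_integrable M g" "f \<in> borel_measurable M" "AE x in M. \<bar>f x\<bar> \<le> \<bar>g x\<bar>"
  shows "l2norm M f \<le> l2norm M g"
proof -
  have "square_integrable M f" using square_integrable_bound assms by blast
  then show ?thesis
    unfolding l2norm_def
    by (intro real_sqrt_le_mono integral_mono_AE)
      (use assms in \<open>auto simp: square_integrable_def abs_le_square_iff\<close>)
qed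

lemma l2norm_cmult: "l2norm M (\<lambda>x. c * f x) = \<bar>c\<bar> * l2norm M f"
  by (simp add: l2norm_def power_mult_distrib real_sqrt_mult)

text \<open>The integral of (|f| - s |g|)^2 is a nonnegative quadratic in s; its value at the
  minimiser \<open>c / b\<close> is the claim.\<close>

lemma l2_Cauchy_Schwarz_abs:
  assumes "square_integrable M f" "square_integrable M g"
  shows "(\<integral>x. \<bar>f x * g x\<bar> \<partial>M) \<le> l2norm M f * l2norm M g"
proof -
  define a b c where "a = (\<integral>x. (f x)\<^sup>2 \<partial>M)" and "b = (\<integral>x. (g x)\<^sup>2 \<partial>M)"
    and "c = (\<integral>x. \<bar>f x * g x\<bar> \<partial>M)"
  have nn: "a \<ge> 0" "b \<ge> 0" "c \<ge> 0" by (auto simp: a_def b_def c_def)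
  note int = square_integrableD[OF assms(1)] square_integrableD[OF assms(2)]
    square_integrable_mult[OF assms]
  have q: "0 \<le> a - 2 * s * c + s\<^sup>2 * b" for s
  proof -
    have "0 \<le> (\<integral>x. (\<bar>f x\<bar> - s * \<bar>g x\<bar>)\<^sup>2 \<partial>M)" by simp
    also have "\<dots> = (\<integral>x. ((f x)\<^sup>2 - 2 * s * \<bar>f x * g x\<bar>) + s\<^sup>2 * (g x)\<^sup>2 \<partial>M)"
      by (rule Bochner_Integration.integral_cong)
        (auto simp: power2_diff power_mult_distrib abs_mult algebra_simps)
    also have "\<dots> = (\<integral>x. (f x)\<^sup>2 - 2 * s * \<bar>f x * g x\<bar> \<partial>M) + (\<integral>x. s\<^sup>2 * (g x)\<^sup>2 \<partial>M)"
      by (rule Bochner_Integration.integral_add) (use int in auto)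
    also have "(\<integral>x. (f x)\<^sup>2 - 2 * s * \<bar>f x * g x\<bar> \<partial>M) = a - (\<integral>x. 2 * s * \<bar>f x * g x\<bar> \<partial>M)"
      unfolding a_def by (rule Bochner_Integration.integral_diff) (use int in auto)
    finally show ?thesis by (simp add: b_def c_def)
  qed
  have "c\<^sup>2 \<le> a * b"
  proof (cases "b = 0")
    case True
    have "c = 0"
    proof (rule ccontr)
      assume "c \<noteq> 0"
      \<comment> \<open>With \<open>b = 0\<close> the quadratic is affine in s, and at this s it
        takes the value -1.\<close>
      then show False using q[of "(a + 1) / (2 * c)"] True by simp
    qed
    then show ?thesis using nn by simp
  next
    case False
    then have "b > 0" using nn by simp
    then show ?thesis using q[of "c / b"] by (simp add: field_simps power2_eq_square)
  qed
  then have "sqrt (c\<^sup>2) \<le> sqrt (a * b)" by (rule real_sqrt_le_mono)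
  then show ?thesis using nn by (simp add: real_sqrt_mult l2norm_def a_def b_def c_def)
qed

lemma l2_Cauchy_Schwarz:
  assumes "square_integrable M f" "square_integrable M g"
  shows "\<bar>\<integral>x. f x * g x \<partial>M\<bar> \<le> l2norm M f * l2norm M g"
proof -
  have "\<bar>\<integral>x. f x * g x \<partial>M\<bar> \<le> (\<integral>x. \<bar>f x * g x\<bar> \<partial>M)"
    by (rule integral_abs_bound)
  then show ?thesis using l2_Cauchy_Schwarz_abs[OF assms] by linarith
qed

lemma l2norm_triangle:
  assumes "square_integrable M f" "square_integrable M g"
  shows "l2norm M (\<lambda>x. f x + g x) \<le> l2norm M f + l2norm M g"
proof -
  note int = square_integrableD[OF assms(1)] square_integrableD[OF assms(2)]
    square_integrable_mult[OF assms]
  have "(l2norm M (\<lambda>x. f x + g x))\<^sup>2 = (\<integral>x. ((f x)\<^sup>2 + (g x)\<^sup>2) + 2 * (f x * g x) \<partial>M)"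
    unfolding l2norm_power2
    by (rule Bochner_Integration.integral_cong) (auto simp: power2_sum algebra_simps)
  also have "\<dots> = (l2norm M f)\<^sup>2 + (l2norm M g)\<^sup>2 + 2 * (\<integral>x. f x * g x \<partial>M)"
    unfolding l2norm_power2 using int by simp
  also have "\<dots> \<le> (l2norm M f)\<^sup>2 + (l2norm M g)\<^sup>2 + 2 * (l2norm M f * l2norm M g)"
    using l2_Cauchy_Schwarz[OF assms] by linarith
  also have "\<dots> = (l2norm M f + l2norm M g)\<^sup>2" by (simp add: power2_sum)
  finally show ?thesis
    by (rule power2_le_imp_le) (simp add: l2norm_nonneg)
qed

lemma l2norm_diff_commute: "l2norm M (\<lambda>x. f x - g x) = l2norm M (\<lambda>x. g x - f x)"
  by (simp add: l2norm_def power2_commute)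

lemma l2norm_triangle3:
  assumes "square_integrable M f" "square_integrable M g" "square_integrable M h"
  shows "l2norm M (\<lambda>x. f x - h x) \<le> l2norm M (\<lambda>x. f x - g x) + l2norm M (\<lambda>x. g x - h x)"
  using l2norm_triangle[of M "\<lambda>x. f x - g x" "\<lambda>x. g x - h x"] assms
  by (simp add: square_integrable_diff)

lemma l2_tendsto_dominated:
  assumes g: "square_integrable M g" and f: "\<And>n. f n \<in> borel_measurable M"
    and le: "\<And>n. AE x in M. \<bar>f n x\<bar> \<le> g x"
    and lim: "AE x in M. (\<lambda>n. f n x) \<longlonglongrightarrow> 0"
  shows "(\<lambda>n. l2norm M (f n)) \<longlonglongrightarrow> 0"
proof -
  have "(\<lambda>n. \<integral>x. (f n x)\<^sup>2 \<partial>M) \<longlonglongrightarrow> (\<integral>x. 0 \<partial>M)"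
  proof (rule integral_dominated_convergence[where w="\<lambda>x. (g x)\<^sup>2"])
    show "AE x in M. (\<lambda>n. (f n x)\<^sup>2) \<longlonglongrightarrow> 0"
      using lim by (rule AE_mp) (auto intro!: AE_I2 tendsto_eq_intros)
    show "AE x in M. norm ((f n x)\<^sup>2) \<le> (g x)\<^sup>2" for n
      using le[of n] by (rule AE_mp) (auto intro!: AE_I2 simp: power2_le_iff_abs_le)
  qed (use f square_integrableD[OF g] in auto)
  then have "(\<lambda>n. sqrt (\<integral>x. (f n x)\<^sup>2 \<partial>M)) \<longlonglongrightarrow> sqrt 0"
    by (intro tendsto_real_sqrt) simp
  then show ?thesis by (simp add: l2norm_def)
qed

lemma l2_tendsto_AE_subseq:
  assumes f: "\<And>n. square_integrable M (f n)" and lim: "(\<lambda>n. l2norm M (f n)) \<longlonglongrightarrow> 0"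
  shows "\<exists>r::nat\<Rightarrow>nat. strict_mono r \<and> (AE x in M. (\<lambda>n. f (r n) x) \<longlonglongrightarrow> 0)"
proof -
  have "(\<lambda>n. (l2norm M (f n))\<^sup>2) \<longlonglongrightarrow> 0"
    using tendsto_power[OF lim, of 2] by simp
  then have "(\<lambda>n. \<integral>x. norm ((f n x)\<^sup>2) \<partial>M) \<longlonglongrightarrow> 0"
    by (simp add: l2norm_power2)
  from tendsto_L1_AE_subseq[OF _ this] square_integrableD[OF f]
  obtain r :: "nat \<Rightarrow> nat" where r: "strict_mono r" "AE x in M. (\<lambda>n. (f (r n) x)\<^sup>2) \<longlonglongrightarrow> 0"
    by auto
  have "(\<lambda>n. f (r n) x) \<longlonglongrightarrow> 0" if "(\<lambda>n. (f (r n) x)\<^sup>2) \<longlonglongrightarrow> 0" for x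
  proof -
    have "(\<lambda>n. sqrt ((f (r n) x)\<^sup>2)) \<longlonglongrightarrow> sqrt 0" using that by (rule tendsto_real_sqrt)
    then show ?thesis by (simp add: tendsto_rabs_zero_iff)
  qed
  then show ?thesis using r by auto
qed

lemma L2_iff: "v \<in> L2 \<Omega> \<longleftrightarrow> square_integrable (lebesgue_on \<Omega>) v"
  by (simp add: L2_def square_integrable_def)

lemma L2_norm_eq: "L2_norm \<Omega> v = l2norm (lebesgue_on \<Omega>) v"
  by (simp add: L2_norm_def L2_inner_def l2norm_def power2_eq_square)

section \<open>Test functions\<close>

text \<open>Squaring the positive part makes it continuously differentiable. Cutoffs and truncations
  are both built from it, since one continuous derivative is all that \<open>test_function\<close>
  and the chain rule ask for.\<close>

definition qramp :: "real \<Rightarrow> real" where "qramp s = (max 0 s)\<^sup>2"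

lemma qramp_deriv: "(qramp has_real_derivative 2 * max 0 s) (at s)"
proof -
  consider "s > 0" | "s < 0" | "s = 0" by linarith
  then show ?thesis
  proof cases
    case 1
    have "((\<lambda>s. s\<^sup>2) has_real_derivative 2 * max 0 s) (at s)"
      using 1 by (auto intro!: derivative_eq_intros)
    then show ?thesis
      by (rule has_field_derivative_transform_within_open[where S="{0<..}"])
        (use 1 in \<open>auto simp: qramp_def\<close>)
  next
    case 2
    have "((\<lambda>s. 0) has_real_derivative 2 * max 0 s) (at s)"
      using 2 by (auto intro!: derivative_eq_intros)
    then show ?thesis
      by (rule has_field_derivative_transform_within_open[where S="{..<0}"])
        (use 2 in \<open>auto simp: qramp_def\<close>)
  next
    case 3
    have "((\<lambda>h. qramp h / h) \<longlongrightarrow> 0) (at 0)"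
    proof (rule Lim_null_comparison)
      show "\<forall>\<^sub>F h in at 0. norm (qramp h / h) \<le> \<bar>h\<bar>"
        by (rule eventually_at_filter[THEN iffD2, OF always_eventually])
          (auto simp: qramp_def max_def power2_eq_square)
      show "((\<lambda>h::real. \<bar>h\<bar>) \<longlongrightarrow> 0) (at 0)"
        by (auto intro!: tendsto_eq_intros)
    qed
    then show ?thesis using 3 by (simp add: DERIV_def qramp_def)
  qed
qed

lemma qramp_eq_0: "s \<le> 0 \<Longrightarrow> qramp s = 0"
  by (auto simp: qramp_def)

lemma qramp_range: "s \<le> 1 \<Longrightarrow> 0 \<le> qramp s \<and> qramp s \<le> 1"
  by (auto simp: qramp_def max_def intro: power_le_one)

text \<open>The complement of the compact set is open and \<open>\<psi>\<close> is 0 on it, hence so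
  is the gradient; the third fact adds this to the definition.\<close>

lemma test_functionD:
  assumes "test_function \<Omega> \<psi> D"
  shows "\<And>x. (\<psi> has_derivative (\<lambda>h. D x \<bullet> h)) (at x)" "continuous_on UNIV D"
    "\<exists>K. compact K \<and> K \<subseteq> \<Omega> \<and> (\<forall>x. x \<notin> K \<longrightarrow> \<psi> x = 0 \<and> D x = 0)"
proof -
  show 1: "(\<psi> has_derivative (\<lambda>h. D x \<bullet> h)) (at x)" for x
    using assms by (auto simp: test_function_def)
  show "continuous_on UNIV D"
    using assms by (auto simp: test_function_def)
  obtain K where K: "compact K" "K \<subseteq> \<Omega>" "\<And>x. x \<notin> K \<Longrightarrow> \<psi> x = 0"
    using assms by (auto simp: test_function_def)
  have "D x = 0" if "x \<notin> K" for x
  proof -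
    have "((\<lambda>x. 0) has_derivative (\<lambda>h. D x \<bullet> h)) (at x)"
      by (rule has_derivative_transform_within_open[OF 1[of x], where s="- K"])
        (use K that in \<open>auto simp: compact_imp_closed open_Compl\<close>)
    then have "(\<lambda>h. D x \<bullet> h) = (\<lambda>h. 0)"
      by (rule has_derivative_unique) (auto intro!: derivative_eq_intros)
    then have "D x \<bullet> D x = 0" by (rule fun_cong)
    then show ?thesis by simp
  qed
  then show "\<exists>K. compact K \<and> K \<subseteq> \<Omega> \<and> (\<forall>x. x \<notin> K \<longrightarrow> \<psi> x = 0 \<and> D x = 0)"
    using K by blast
qed

lemma test_function_continuous:
  assumes "test_function \<Omega> \<psi> D"
  shows "continuous_on UNIV \<psi>"
  by (intro continuous_at_imp_continuous_on ballI has_derivative_continuous[OF test_functionD(1)[OF assms]])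

lemma test_function_zero: "test_function \<Omega> (\<lambda>x. 0) (\<lambda>x. 0)"
  by (auto simp: test_function_def intro!: derivative_eq_intros exI[of _ "{}"])

lemma test_function_add:
  assumes "test_function \<Omega> \<psi> D" "test_function \<Omega> \<theta> E"
  shows "test_function \<Omega> (\<lambda>x. \<psi> x + \<theta> x) (\<lambda>x. D x + E x)"
proof -
  obtain K L where "compact K" "K \<subseteq> \<Omega>" "\<And>x. x \<notin> K \<Longrightarrow> \<psi> x = 0"
    "compact L" "L \<subseteq> \<Omega>" "\<And>x. x \<notin> L \<Longrightarrow> \<theta> x = 0"
    using assms by (auto simp: test_function_def)
  moreover have "((\<lambda>x. \<psi> x + \<theta> x) has_derivative (\<lambda>h. (D x + E x) \<bullet> h)) (at x)" for x
    by (rule has_derivative_eq_rhs[OF has_derivative_add[OF test_functionD(1)[OF assms(1)]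
          test_functionD(1)[OF assms(2)]]]) (auto simp: inner_add_left)
  moreover have "continuous_on UNIV (\<lambda>x. D x + E x)"
    by (intro continuous_on_add test_functionD(2)[OF assms(1)] test_functionD(2)[OF assms(2)])
  ultimately show ?thesis
    unfolding test_function_def by (intro conjI allI exI[of _ "K \<union> L"]) auto
qed

lemma test_function_mult:
  assumes "\<And>x. (\<psi> has_derivative (\<lambda>h. D x \<bullet> h)) (at x)" "continuous_on UNIV D"
    and "test_function \<Omega> \<theta> E"
  shows "test_function \<Omega> (\<lambda>x. \<psi> x * \<theta> x) (\<lambda>x. \<psi> x *\<^sub>R E x + \<theta> x *\<^sub>R D x)"
proof -
  have c: "continuous_on UNIV \<psi>"
    by (intro continuous_at_imp_continuous_on ballI has_derivative_continuous[OF assms(1)])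
  obtain L where "compact L" "L \<subseteq> \<Omega>" "\<And>x. x \<notin> L \<Longrightarrow> \<theta> x = 0"
    using assms by (auto simp: test_function_def)
  moreover have "((\<lambda>x. \<psi> x * \<theta> x) has_derivative (\<lambda>h. (\<psi> x *\<^sub>R E x + \<theta> x *\<^sub>R D x) \<bullet> h)) (at x)" for x
    by (rule has_derivative_eq_rhs[OF has_derivative_mult[OF assms(1) test_functionD(1)[OF assms(3)]]])
      (auto simp: inner_add_left)
  moreover have "continuous_on UNIV (\<lambda>x. \<psi> x *\<^sub>R E x + \<theta> x *\<^sub>R D x)"
    by (intro continuous_intros c assms test_functionD(2)[OF assms(3)] test_function_continuous[OF assms(3)])
  ultimately show ?thesis
    unfolding test_function_def by auto
qed

lemma test_function_cmult:
  assumes "test_function \<Omega> \<psi> D"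
  shows "test_function \<Omega> (\<lambda>x. c * \<psi> x) (\<lambda>x. c *\<^sub>R D x)"
  using test_function_mult[of "\<lambda>x. c" "\<lambda>x. 0", OF _ _ assms] by simp

lemma test_function_mono: "test_function \<Omega> \<psi> D \<Longrightarrow> \<Omega> \<subseteq> \<Omega>' \<Longrightarrow> test_function \<Omega>' \<psi> D"
  unfolding test_function_def by blast

lemma test_function_shift:
  assumes "test_function \<Omega> \<psi> D" "\<And>x. x \<in> \<Omega> \<Longrightarrow> x + h \<in> \<Omega>'"
  shows "test_function \<Omega>' (\<lambda>x. \<psi> (x - h)) (\<lambda>x. D (x - h))"
proof -
  obtain K where K: "compact K" "K \<subseteq> \<Omega>" "\<And>x. x \<notin> K \<Longrightarrow> \<psi> x = 0"
    using assms by (auto simp: test_function_def)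
  have "((\<lambda>x. \<psi> (x - h)) has_derivative (\<lambda>k. D (x - h) \<bullet> k)) (at x)" for x
  proof -
    have "(\<psi> \<circ> (\<lambda>x. x - h) has_derivative (\<lambda>k. D (x - h) \<bullet> k) \<circ> (\<lambda>k. k)) (at x)"
      by (rule diff_chain_at) (auto intro!: derivative_eq_intros test_functionD(1)[OF assms(1)])
    then show ?thesis by (simp add: o_def)
  qed
  moreover have "continuous_on UNIV (\<lambda>x. D (x - h))"
    using test_functionD(2)[OF assms(1)]
    by (rule continuous_on_compose2) (auto intro!: continuous_intros)
  moreover have "compact ((\<lambda>x. x + h) ` K)"
    by (intro compact_continuous_image continuous_intros K)
  moreover have "x \<notin> (\<lambda>x. x + h) ` K \<Longrightarrow> \<psi> (x - h) = 0" for x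
    using K(3)[of "x - h"] by (force simp: image_iff)
  ultimately show ?thesis
    unfolding test_function_def using K(2) assms(2)
    by (intro conjI allI exI[of _ "(\<lambda>x. x + h) ` K"]) auto
qed

lemma test_function_ball:
  fixes x0 :: "'a::euclidean_space"
  assumes "r > 0" "cball x0 (2 * r) \<subseteq> U"
  shows "\<exists>\<psi> D. test_function U \<psi> D \<and> (\<forall>x. 0 \<le> \<psi> x \<and> \<psi> x \<le> 1) \<and> (\<forall>x\<in>ball x0 r. \<psi> x = 1)"
proof -
  \<comment> \<open>The squared distance is smooth at the centre as well. \<open>s\<close> is at
    most 0 on the ball of radius r and at least 1 outside the ball of radius 2r, so the inner
    \<open>qramp\<close> is 0 on the former and at least 1 outside the latter; the outer
    \<open>qramp\<close> then gives 1 and 0.\<close>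
  define s where "s x = (x - x0) \<bullet> (x - x0) / r\<^sup>2 - 1" for x
  define \<psi> where "\<psi> x = qramp (1 - qramp (s x))" for x
  define D where "D x = (2 * max 0 (1 - qramp (s x)) * - (2 * max 0 (s x)) * 2 / r\<^sup>2) *\<^sub>R (x - x0)" for x
  have qcont: "continuous_on UNIV qramp"
    by (intro continuous_at_imp_continuous_on ballI DERIV_isCont[OF qramp_deriv])
  have scont: "continuous_on UNIV s"
    unfolding s_def using assms by (intro continuous_intros) auto
  have "(\<psi> has_derivative (\<lambda>h. D x \<bullet> h)) (at x)" for x
  proof -
    have "(s has_derivative (\<lambda>h. 2 * ((x - x0) \<bullet> h) / r\<^sup>2)) (at x)"
      unfolding s_def using assms
      by (auto intro!: derivative_eq_intros simp: inner_commute field_simps)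
    moreover have "(qramp has_derivative (*) (2 * max 0 (s x))) (at (s x))"
      using qramp_deriv[of "s x"] by (simp add: has_field_derivative_def)
    ultimately have "(qramp \<circ> s has_derivative (*) (2 * max 0 (s x)) \<circ> (\<lambda>h. 2 * ((x - x0) \<bullet> h) / r\<^sup>2)) (at x)"
      by (rule diff_chain_at)
    then have "((\<lambda>x. 1 - qramp (s x)) has_derivative
        (\<lambda>h. - (2 * max 0 (s x) * (2 * ((x - x0) \<bullet> h) / r\<^sup>2)))) (at x)"
      by (auto intro!: derivative_eq_intros simp: o_def)
    moreover have "(qramp has_derivative (*) (2 * max 0 (1 - qramp (s x)))) (at (1 - qramp (s x)))"
      using qramp_deriv[of "1 - qramp (s x)"] by (simp add: has_field_derivative_def)
    ultimately have "(qramp \<circ> (\<lambda>x. 1 - qramp (s x)) has_derivative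
       (*) (2 * max 0 (1 - qramp (s x))) \<circ> (\<lambda>h. - (2 * max 0 (s x) * (2 * ((x - x0) \<bullet> h) / r\<^sup>2)))) (at x)"
      by (rule diff_chain_at)
    moreover have "qramp \<circ> (\<lambda>x. 1 - qramp (s x)) = \<psi>" by (auto simp: \<psi>_def)
    ultimately have "(\<psi> has_derivative
       (\<lambda>h. 2 * max 0 (1 - qramp (s x)) * - (2 * max 0 (s x) * (2 * ((x - x0) \<bullet> h) / r\<^sup>2)))) (at x)"
      by (simp add: o_def)
    then show ?thesis
      by (rule has_derivative_eq_rhs) (simp add: D_def fun_eq_iff)
  qed
  moreover have "continuous_on UNIV (\<lambda>x. qramp (s x))"
    by (rule continuous_on_compose2[OF qcont scont]) auto
  then have "continuous_on UNIV D"
    unfolding D_def using assms scont by (intro continuous_intros) auto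
  moreover have "\<psi> x = 0" if "x \<notin> cball x0 (2 * r)" for x
  proof -
    have "2 * r < norm (x - x0)" using that by (simp add: dist_norm norm_minus_commute)
    then have "(2 * r)\<^sup>2 \<le> (norm (x - x0))\<^sup>2"
      using assms by (intro power_mono) auto
    then have "2 * r\<^sup>2 \<le> (x - x0) \<bullet> (x - x0)"
    proof -
      have "4 * r\<^sup>2 \<le> (x - x0) \<bullet> (x - x0)"
        using \<open>(2 * r)\<^sup>2 \<le> (norm (x - x0))\<^sup>2\<close> by (simp add: power2_norm_eq_inner power_mult_distrib)
      moreover have "0 \<le> r\<^sup>2" by simp
      ultimately show ?thesis by linarith
    qed
    then have "s x \<ge> 1" using assms
      by (simp add: s_def field_simps)
    then have "qramp (s x) \<ge> 1" by (auto simp: qramp_def one_le_power)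
    then show ?thesis by (simp add: \<psi>_def qramp_eq_0)
  qed
  ultimately have "test_function U \<psi> D"
    unfolding test_function_def using assms by (blast intro: compact_cball)
  moreover have "0 \<le> \<psi> x \<and> \<psi> x \<le> 1" for x
    unfolding \<psi>_def by (rule qramp_range) (simp add: qramp_def)
  moreover have "\<psi> x = 1" if "x \<in> ball x0 r" for x
  proof -
    have "(norm (x - x0))\<^sup>2 \<le> r\<^sup>2"
      using that assms by (intro power_mono) (auto simp: dist_norm norm_minus_commute)
    then have "s x \<le> 0" using assms
      by (simp add: s_def power2_norm_eq_inner field_simps)
    then show ?thesis by (simp add: \<psi>_def qramp_def)
  qed
  ultimately show ?thesis by blast
qed

lemma test_function_cutoff:
  fixes K :: "'a::euclidean_space set"
  assumes "compact K" "open U" "K \<subseteq> U"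
  shows "\<exists>\<psi> D. test_function U \<psi> D \<and> (\<forall>x. 0 \<le> \<psi> x \<and> \<psi> x \<le> 1) \<and> (\<forall>x\<in>K. \<psi> x = 1)"
proof -
  have "\<exists>r>0. cball x (2 * r) \<subseteq> U" if "x \<in> K" for x
  proof -
    obtain e where "e > 0" "cball x e \<subseteq> U" using assms \<open>x \<in> K\<close> open_contains_cball by blast
    then show ?thesis by (intro exI[of _ "e/2"]) auto
  qed
  then obtain r where r: "\<And>x. x \<in> K \<Longrightarrow> r x > 0" "\<And>x. x \<in> K \<Longrightarrow> cball x (2 * r x) \<subseteq> U"
    by metis
  have "K \<subseteq> (\<Union>x\<in>K. ball x (r x))" using r by fastforce
  then obtain F where F: "F \<subseteq> K" "finite F" "K \<subseteq> (\<Union>x\<in>F. ball x (r x))"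
    using compactE_image[OF assms(1), of K "\<lambda>x. ball x (r x)"] by auto
  have "\<exists>\<psi> D. test_function U \<psi> D \<and> (\<forall>x. 0 \<le> \<psi> x \<and> \<psi> x \<le> 1) \<and> (\<forall>x\<in>(\<Union>x\<in>F. ball x (r x)). \<psi> x = 1)"
    using F(2,1)
  proof (induction F)
    case empty
    show ?case using test_function_zero by (intro exI[of _ "\<lambda>x. 0"]) auto
  next
    case (insert a F)
    from insert.prems have "F \<subseteq> K" by simp
    from insert.IH[OF this] obtain \<psi> D where "test_function U \<psi> D \<and>
        (\<forall>x. 0 \<le> \<psi> x \<and> \<psi> x \<le> 1) \<and> (\<forall>x\<in>(\<Union>x\<in>F. ball x (r x)). \<psi> x = 1)"
      by (elim exE)
    then have 1: "test_function U \<psi> D" "\<And>x. 0 \<le> \<psi> x \<and> \<psi> x \<le> 1"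
      "\<And>x. x \<in> (\<Union>x\<in>F. ball x (r x)) \<Longrightarrow> \<psi> x = 1"
      by blast+
    obtain \<theta> E where 2: "test_function U \<theta> E" "\<And>x. 0 \<le> \<theta> x \<and> \<theta> x \<le> 1"
      "\<And>x. x \<in> ball a (r a) \<Longrightarrow> \<theta> x = 1"
      using test_function_ball[of "r a" a U] r[of a] insert.prems by auto
    have 3: "test_function U (\<lambda>x. (1 - \<psi> x) * \<theta> x) (\<lambda>x. (1 - \<psi> x) *\<^sub>R E x + \<theta> x *\<^sub>R - D x)"
      by (rule test_function_mult[OF _ _ 2(1)])
        (auto intro!: derivative_eq_intros test_functionD(1)[OF 1(1)] continuous_intros
          test_functionD(2)[OF 1(1)])
    \<comment> \<open>This is \<open>1 - (1 - \<psi> x) * (1 - \<theta> x)\<close>: it stays in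
      [0,1] and equals 1 wherever one of the two cutoffs does.\<close>
    let ?f = "\<lambda>x. \<psi> x + (1 - \<psi> x) * \<theta> x"
    have "0 \<le> ?f x \<and> ?f x \<le> 1" for x
    proof -
      have "(1 - \<psi> x) * \<theta> x \<le> (1 - \<psi> x) * 1" using 1(2)[of x] 2(2)[of x]
        by (intro mult_left_mono) auto
      then show ?thesis using 1(2)[of x] 2(2)[of x] by auto
    qed
    moreover have "?f x = 1" if "x \<in> (\<Union>x\<in>insert a F. ball x (r x))" for x
      using that 1(3)[of x] 2(3)[of x] by (cases "x \<in> ball a (r a)") auto
    ultimately show ?case using test_function_add[OF 1(1) 3] by blast
  qed
  then obtain \<psi> D where "test_function U \<psi> D \<and> (\<forall>x. 0 \<le> \<psi> x \<and> \<psi> x \<le> 1) \<and>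
      (\<forall>x\<in>(\<Union>x\<in>F. ball x (r x)). \<psi> x = 1)"
    by (elim exE)
  with F(3) show ?thesis by (intro exI[of _ \<psi>] exI[of _ D]) (meson subsetD)
qed

lemma test_function_bounded:
  assumes "test_function \<Omega> \<psi> D"
  shows "\<exists>B. \<forall>x. \<bar>\<psi> x\<bar> \<le> B \<and> norm (D x) \<le> B"
proof -
  obtain K where K: "compact K" "\<And>x. x \<notin> K \<Longrightarrow> \<psi> x = 0 \<and> D x = 0"
    using test_functionD(3)[OF assms] by blast
  have "bounded (\<psi> ` K)" "bounded (D ` K)"
    using K(1) continuous_on_subset[OF test_function_continuous[OF assms]]
      continuous_on_subset[OF test_functionD(2)[OF assms]]
    by (auto intro!: compact_imp_bounded compact_continuous_image)
  then obtain B C where "\<And>x. x \<in> K \<Longrightarrow> \<bar>\<psi> x\<bar> \<le> B" "\<And>x. x \<in> K \<Longrightarrow> norm (D x) \<le> C"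
    unfolding bounded_iff by auto
  then have "\<bar>\<psi> x\<bar> \<le> max 0 (max B C) \<and> norm (D x) \<le> max 0 (max B C)" for x
    using K(2)[of x] by (cases "x \<in> K") (auto simp: le_max_iff_disj)
  then show ?thesis by blast
qed

lemma test_function_measurable:
  assumes "test_function \<Omega> \<psi> D"
  shows "\<psi> \<in> borel_measurable borel" "D \<in> borel_measurable borel"
  using test_function_continuous[OF assms] test_functionD(2)[OF assms]
  by (auto intro: borel_measurable_continuous_onI)

section \<open>Density of test functions in L^2 of a bounded open set\<close>

lemma square_integrable_indicator:
  assumes "A \<in> sets M" "emeasure M A < \<infinity>"
  shows "square_integrable M (indicator A)"
proof -
  have "(\<lambda>x. (indicator A x :: real)\<^sup>2) = indicator A"
    by (auto simp: indicator_def)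
  then show ?thesis
    using assms by (simp add: square_integrable_def)
qed

lemma test_function_square_integrable:
  fixes \<psi> :: "'a::euclidean_space \<Rightarrow> real"
  assumes "test_function \<Omega> \<psi> D"
  shows "square_integrable lborel \<psi>"
proof -
  obtain K where K: "compact K" "\<And>x. x \<notin> K \<Longrightarrow> \<psi> x = 0 \<and> D x = 0"
    using test_functionD(3)[OF assms] by blast
  obtain B where B: "\<And>x. \<bar>\<psi> x\<bar> \<le> B" using test_function_bounded[OF assms] by blast
  have K': "K \<in> sets lborel" "emeasure lborel K < \<infinity>"
    using borel_compact[OF K(1)] emeasure_compact_finite[OF K(1)] by simp_all
  have 1: "square_integrable lborel (\<lambda>x. B * indicator K x)"
    by (rule square_integrable_cmult[OF square_integrable_indicator[OF K']])
  have "\<bar>\<psi> x\<bar> \<le> \<bar>B * indicator K x\<bar>" for x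
    using B[of x] K(2)[of x] by (cases "x \<in> K") simp_all
  then have 2: "AE x in lborel. \<bar>\<psi> x\<bar> \<le> \<bar>B * indicator K x\<bar>"
    by (rule AE_I2)
  have "\<psi> \<in> borel_measurable lborel"
    using test_function_measurable(1)[OF assms] by simp
  from square_integrable_bound[OF 1 this 2] show ?thesis .
qed

lemma l2norm_indicator:
  assumes "A \<in> sets M"
  shows "l2norm M (indicator A) = sqrt (measure M A)"
proof -
  have "(\<lambda>x. (indicator A x :: real)\<^sup>2) = indicator A"
    by (auto simp: indicator_def)
  then show ?thesis using assms by (simp add: l2norm_def)
qed

text \<open>Regularity of Lebesgue measure encloses S between a closed C and an open T with T - C of
  measure at most 2d. A cutoff that is 1 on C and supported in T differs from the indicator by at
  most 1, and only on T - C. With d = e^2 / 3 the error is below e.\<close>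

lemma test_dense_indicator:
  fixes U :: "'a::euclidean_space set"
  assumes "open U" "bounded U" "S \<in> sets borel" "S \<subseteq> U" "e > 0"
  shows "\<exists>\<psi> D. test_function U \<psi> D \<and> l2norm lborel (\<lambda>x. indicator S x - \<psi> x) < e"
proof -
  define d where "d = e\<^sup>2 / 3"
  have "d > 0" using assms by (simp add: d_def)
  have SL: "S \<in> sets lebesgue" using assms(3) by simp
  obtain T where T: "open T" "S \<subseteq> T" "emeasure lebesgue (T - S) < ennreal d"
    using sets_lebesgue_outer_open[OF SL \<open>d > 0\<close>] by metis
  obtain C where C: "closed C" "C \<subseteq> S" "emeasure lebesgue (S - C) < ennreal d"
    using sets_lebesgue_inner_closed[OF SL \<open>d > 0\<close>] by metis
  have "compact C"
    using C assms by (meson bounded_subset compact_eq_bounded_closed)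
  then obtain \<psi> D where \<psi>: "test_function (T \<inter> U) \<psi> D" "\<And>x. 0 \<le> \<psi> x \<and> \<psi> x \<le> 1" "\<And>x. x \<in> C \<Longrightarrow> \<psi> x = 1"
    using test_function_cutoff[of C "T \<inter> U"] T C assms by (metis inf.bounded_iff open_Int subset_trans)
  have z: "\<psi> x = 0" if "x \<notin> T" for x
    using test_functionD(3)[OF \<psi>(1)] that by blast
  have TS: "T - S \<in> sets borel" "S - C \<in> sets borel" "T - C \<in> sets borel"
    using T(1) C(1) assms(3) by auto
  have "emeasure lborel (T - C) = emeasure lborel ((T - S) \<union> (S - C))"
    using T(2) C(2) by (intro arg_cong[where f="emeasure lborel"]) auto
  also have "\<dots> \<le> emeasure lborel (T - S) + emeasure lborel (S - C)"
    using TS by (intro emeasure_subadditive) auto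
  also have "\<dots> \<le> ennreal d + ennreal d"
    using T(3) C(3) TS by (intro add_mono) (auto simp: emeasure_completion)
  also have "\<dots> = ennreal (2 * d)" using \<open>d > 0\<close> by (simp flip: ennreal_plus)
  finally have le: "emeasure lborel (T - C) \<le> ennreal (2 * d)" .
  then have fin: "emeasure lborel (T - C) < \<infinity>"
    using le_less_trans[OF le ennreal_less_top] by simp
  have "measure lborel (T - C) \<le> 2 * d"
    using le \<open>d > 0\<close> by (simp add: measure_def enn2real_leI)
  have si: "square_integrable lborel (indicator (T - C))"
    using TS fin by (intro square_integrable_indicator) auto
  have "\<bar>indicator S x - \<psi> x\<bar> \<le> \<bar>indicator (T - C) x\<bar>" for x
    using \<psi>(2)[of x] \<psi>(3)[of x] z[of x] T(2) C(2)
    by (cases "x \<in> T"; cases "x \<in> C"; cases "x \<in> S") auto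
  then have "AE x in lborel. \<bar>indicator S x - \<psi> x\<bar> \<le> \<bar>indicator (T - C) x\<bar>"
    by (rule AE_I2)
  moreover have "(\<lambda>x. indicator S x - \<psi> x) \<in> borel_measurable lborel"
    using test_function_measurable(1)[OF \<psi>(1)] assms(3) by simp
  ultimately have "l2norm lborel (\<lambda>x. indicator S x - \<psi> x) \<le> l2norm lborel (indicator (T - C))"
    using l2norm_mono[OF si] by blast
  also have "\<dots> = sqrt (measure lborel (T - C))"
    using TS by (intro l2norm_indicator) auto
  also have "\<dots> \<le> sqrt (2 * d)"
    using \<open>measure lborel (T - C) \<le> 2 * d\<close> by (rule real_sqrt_le_mono)
  also have "\<dots> < sqrt (e\<^sup>2)"
    using assms(5) by (intro real_sqrt_less_mono) (simp add: d_def)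
  finally show ?thesis
    using assms(5) \<psi>(1) test_function_mono[OF \<psi>(1), of U] by auto
qed

definition test_approx :: "'a::euclidean_space set \<Rightarrow> ('a \<Rightarrow> real) \<Rightarrow> bool" where
  "test_approx U f \<longleftrightarrow> square_integrable lborel f \<and>
     (\<forall>e>0. \<exists>\<psi> D. test_function U \<psi> D \<and> l2norm lborel (\<lambda>x. f x - \<psi> x) < e)"

lemma test_approxD: "test_approx U f \<Longrightarrow> square_integrable lborel f"
  by (simp add: test_approx_def)

lemma test_approxE:
  assumes "test_approx U f" "e > 0"
  obtains \<psi> D where "test_function U \<psi> D" "l2norm lborel (\<lambda>x. f x - \<psi> x) < e"
proof -
  from assms(1) have "\<forall>e>0. \<exists>\<psi> D. test_function U \<psi> D \<and> l2norm lborel (\<lambda>x. f x - \<psi> x) < e"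
    unfolding test_approx_def by (rule conjunct2)
  from this[rule_format, OF assms(2)] show thesis by (elim exE conjE) (rule that)
qed

lemma test_approx_add:
  assumes "test_approx U f" "test_approx U g"
  shows "test_approx U (\<lambda>x. f x + g x)"
  unfolding test_approx_def
proof (intro conjI allI impI)
  show si: "square_integrable lborel (\<lambda>x. f x + g x)"
    by (rule square_integrable_add[OF test_approxD[OF assms(1)] test_approxD[OF assms(2)]])
  fix e :: real assume "e > 0"
  then have "e / 2 > 0" by simp
  obtain \<psi> D where \<psi>: "test_function U \<psi> D" "l2norm lborel (\<lambda>x. f x - \<psi> x) < e / 2"
    using test_approxE[OF assms(1) \<open>e / 2 > 0\<close>] .
  obtain \<theta> E where \<theta>: "test_function U \<theta> E" "l2norm lborel (\<lambda>x. g x - \<theta> x) < e / 2"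
    using test_approxE[OF assms(2) \<open>e / 2 > 0\<close>] .
  have "square_integrable lborel (\<lambda>x. f x - \<psi> x)" "square_integrable lborel (\<lambda>x. g x - \<theta> x)"
    by (intro square_integrable_diff test_approxD[OF assms(1)] test_approxD[OF assms(2)]
        test_function_square_integrable[OF \<psi>(1)] test_function_square_integrable[OF \<theta>(1)])+
  note tri = l2norm_triangle[OF this]
  have "(\<lambda>x. f x + g x - (\<psi> x + \<theta> x)) = (\<lambda>x. (f x - \<psi> x) + (g x - \<theta> x))"
    by (simp add: fun_eq_iff)
  then have "l2norm lborel (\<lambda>x. f x + g x - (\<psi> x + \<theta> x)) < e"
    using tri \<psi>(2) \<theta>(2) by simp
  then show "\<exists>\<psi> D. test_function U \<psi> D \<and> l2norm lborel (\<lambda>x. f x + g x - \<psi> x) < e"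
    using test_function_add[OF \<psi>(1) \<theta>(1)] by blast
qed

lemma test_approx_cmult:
  assumes "test_approx U f"
  shows "test_approx U (\<lambda>x. c * f x)"
  unfolding test_approx_def
proof (intro conjI allI impI)
  show si: "square_integrable lborel (\<lambda>x. c * f x)"
    by (rule square_integrable_cmult[OF test_approxD[OF assms]])
  fix e :: real assume "e > 0"
  then have "e / (\<bar>c\<bar> + 1) > 0" by simp
  then obtain \<psi> D where *: "test_function U \<psi> D" "l2norm lborel (\<lambda>x. f x - \<psi> x) < e / (\<bar>c\<bar> + 1)"
    using test_approxE[OF assms] by metis
  have "l2norm lborel (\<lambda>x. c * f x - c * \<psi> x) = \<bar>c\<bar> * l2norm lborel (\<lambda>x. f x - \<psi> x)"
    using l2norm_cmult[of lborel c "\<lambda>x. f x - \<psi> x"] by (simp add: right_diff_distrib)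
  also have "\<dots> \<le> (\<bar>c\<bar> + 1) * l2norm lborel (\<lambda>x. f x - \<psi> x)"
    by (intro mult_right_mono l2norm_nonneg) auto
  also have "\<dots> < e" using *(2) by (simp add: field_simps)
  finally show "\<exists>\<psi> D. test_function U \<psi> D \<and> l2norm lborel (\<lambda>x. c * f x - \<psi> x) < e"
    using test_function_cmult[OF *(1)] by blast
qed

lemma test_approx_zero: "test_approx U (\<lambda>x. 0)"
  unfolding test_approx_def
proof (intro conjI allI impI square_integrable_zero)
  fix e :: real assume "e > 0"
  then have "test_function U (\<lambda>x. 0) (\<lambda>x. 0) \<and> l2norm lborel (\<lambda>x. 0 - 0) < e"
    by (simp add: test_function_zero l2norm_def)
  then show "\<exists>\<psi> D. test_function U \<psi> D \<and> l2norm lborel (\<lambda>x. 0 - \<psi> x) < e"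
    by (intro exI)
qed

lemma test_approx_sum:
  assumes "\<And>i. i \<in> I \<Longrightarrow> test_approx U (f i)"
  shows "test_approx U (\<lambda>x. \<Sum>i\<in>I. f i x)"
  using assms
proof (induction I rule: infinite_finite_induct)
  case (insert i I)
  then show ?case by (simp add: test_approx_add)
qed (simp_all add: test_approx_zero)

lemma test_approx_limit:
  assumes f: "square_integrable lborel f" and s: "\<And>n::nat. test_approx U (s n)"
    and lim: "(\<lambda>n. l2norm lborel (\<lambda>x. f x - s n x)) \<longlonglongrightarrow> 0"
  shows "test_approx U f"
  unfolding test_approx_def
proof (intro conjI allI impI f)
  fix e :: real assume "e > 0"
  then have e2: "e / 2 > 0" by simp
  obtain n where n: "l2norm lborel (\<lambda>x. f x - s n x) < e / 2"
    using order_tendstoD(2)[OF lim e2] eventually_happens'[OF sequentially_bot] by blast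
  obtain \<psi> D where *: "test_function U \<psi> D" "l2norm lborel (\<lambda>x. s n x - \<psi> x) < e / 2"
    using test_approxE[OF s e2] .
  have sn: "square_integrable lborel (s n)" using s by (simp add: test_approx_def)
  have "l2norm lborel (\<lambda>x. f x - \<psi> x) < e"
    using l2norm_triangle3[OF f sn test_function_square_integrable[OF *(1)]] n *(2) by linarith
  then show "\<exists>\<psi> D. test_function U \<psi> D \<and> l2norm lborel (\<lambda>x. f x - \<psi> x) < e"
    using *(1) by blast
qed

text \<open>The approximating simple functions are taken with |s_i| <= 2 |f|. They then vanish off U
  together with f, so each nonzero level set is a Borel subset of U, to which the indicator case
  applies, and 3 |f| dominates the error.\<close>

lemma test_function_dense:
  fixes U :: "'a::euclidean_space set"
  assumes U: "open U" "bounded U" and f: "square_integrable lborel f" "\<And>x. x \<notin> U \<Longrightarrow> f x = 0"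
  shows "test_approx U f"
proof -
  have fm: "f \<in> borel_measurable borel" using square_integrableD(1)[OF f(1)] by simp
  obtain s where s: "\<And>i. simple_function borel (s i)" "\<And>x. (\<lambda>i. s i x) \<longlonglongrightarrow> f x"
    and "\<And>i x. dist (s i x) 0 \<le> 2 * dist (f x) 0"
    using borel_measurable_implies_sequence_metric[OF fm, of 0] by (metis UNIV_I space_borel)
  then have s3: "norm (s i x) \<le> 2 * norm (f x)" for i x
    by simp
  have sm: "s i \<in> borel_measurable borel" for i
    using s(1) by (rule borel_measurable_simple_function)
  have "test_approx U (s i)" for i
  proof -
    have fin: "finite (range (s i))"
      using s(1)[of i] by (simp add: simple_function_def)
    have rep: "s i x = (\<Sum>y\<in>range (s i) - {0}. y * indicator (s i -` {y}) x)" for x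
    proof -
      have "(\<Sum>y\<in>range (s i) - {0}. y * indicator (s i -` {y}) x)
          = (\<Sum>y\<in>range (s i) - {0}. if s i x = y then y else 0)"
        by (rule sum.cong) auto
      also have "\<dots> = s i x" using fin by simp
      finally show ?thesis by simp
    qed
    have "test_approx U (\<lambda>x. \<Sum>y\<in>range (s i) - {0}. y * indicator (s i -` {y}) x)"
    proof (intro test_approx_sum test_approx_cmult)
      fix y assume y: "y \<in> range (s i) - {0}"
      have "x \<in> U" if "s i x = y" for x
      proof (rule ccontr)
        assume "x \<notin> U"
        then have "norm (s i x) \<le> 0" using s3[of i x] f(2)[of x] by simp
        then have "y = 0" unfolding that by simp
        then show False using y by blast
      qed
      then have sub: "s i -` {y} \<subseteq> U" by auto
      have meas: "s i -` {y} \<in> sets borel"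
        using measurable_sets[OF sm, of "{y}" i] by simp
      have "emeasure lborel (s i -` {y}) < \<infinity>"
        using emeasure_bounded_finite[OF bounded_subset[OF U(2) sub]] by (simp add: top.not_eq_extremum)
      then show "test_approx U (indicator (s i -` {y}))"
        unfolding test_approx_def
        using test_dense_indicator[OF U meas sub] square_integrable_indicator[of "s i -` {y}" lborel] meas
        by simp
    qed
    moreover have "s i = (\<lambda>x. \<Sum>y\<in>range (s i) - {0}. y * indicator (s i -` {y}) x)"
      by (rule ext) (rule rep)
    ultimately show ?thesis by (rule back_subst[of "test_approx U", OF _ sym])
  qed
  moreover have "(\<lambda>n. l2norm lborel (\<lambda>x. f x - s n x)) \<longlonglongrightarrow> 0"
  proof (rule l2_tendsto_dominated)
    show "square_integrable lborel (\<lambda>x. 3 * \<bar>f x\<bar>)"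
      by (intro square_integrable_cmult square_integrable_abs f)
    show "(\<lambda>x. f x - s n x) \<in> borel_measurable lborel" for n
      using fm sm by simp
    have "\<bar>f x - s n x\<bar> \<le> 3 * \<bar>f x\<bar>" for n x
      using s3[of n x] by simp
    then show "AE x in lborel. \<bar>f x - s n x\<bar> \<le> 3 * \<bar>f x\<bar>" for n
      by (rule AE_I2)
    have "(\<lambda>n. f x - s n x) \<longlonglongrightarrow> 0" for x
      using tendsto_diff[OF tendsto_const s(2), of "f x" x] by simp
    then show "AE x in lborel. (\<lambda>n. f x - s n x) \<longlonglongrightarrow> 0"
      by (rule AE_I2)
  qed
  ultimately show ?thesis
    using test_approx_limit[OF f(1)] by blast
qed

text \<open>If f itself could be tested, the bound would read |f|^2 <= M |f| in norms. A test
  function within e of f loses only e (|f| + M), and e is arbitrary. It serves to estimate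
  translation increments, which are accessible only through their pairings with test
  functions.\<close>

lemma l2norm_le_by_duality:
  fixes U :: "'a::euclidean_space set"
  assumes U: "open U" "bounded U" and f: "square_integrable lborel f" "\<And>x. x \<notin> U \<Longrightarrow> f x = 0"
    and M: "M \<ge> 0" and le: "\<And>\<psi> D. test_function U \<psi> D \<Longrightarrow> \<bar>\<integral>x. f x * \<psi> x \<partial>lborel\<bar> \<le> M * l2norm lborel \<psi>"
  shows "l2norm lborel f \<le> M"
proof -
  let ?n = "l2norm lborel f"
  have key: "?n\<^sup>2 \<le> M * ?n + e * (?n + M)" if "e > 0" for e
  proof -
    obtain \<psi> D where *: "test_function U \<psi> D" "l2norm lborel (\<lambda>x. f x - \<psi> x) < e"
      using test_approxE[OF test_function_dense[OF U f] \<open>e > 0\<close>] by blast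
    note sp = test_function_square_integrable[OF *(1)]
    note sd = square_integrable_diff[OF f(1) sp]
    have "?n\<^sup>2 = (\<integral>x. f x * \<psi> x + f x * (f x - \<psi> x) \<partial>lborel)"
      unfolding l2norm_power2
      by (rule Bochner_Integration.integral_cong) (auto simp: algebra_simps power2_eq_square)
    also have "\<dots> = (\<integral>x. f x * \<psi> x \<partial>lborel) + (\<integral>x. f x * (f x - \<psi> x) \<partial>lborel)"
      by (rule Bochner_Integration.integral_add) (intro square_integrable_mult f sp sd)+
    also have "\<dots> \<le> M * l2norm lborel \<psi> + ?n * e"
    proof -
      have "?n * l2norm lborel (\<lambda>x. f x - \<psi> x) \<le> ?n * e"
        using *(2) by (intro mult_left_mono l2norm_nonneg) auto
      then show ?thesis
        using le[OF *(1)] l2_Cauchy_Schwarz[OF f(1) sd] by linarith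
    qed
    also have "M * l2norm lborel \<psi> \<le> M * (?n + e)"
    proof (rule mult_left_mono[OF _ M])
      have "l2norm lborel (\<lambda>x. \<psi> x - 0) \<le> l2norm lborel (\<lambda>x. \<psi> x - f x) + l2norm lborel (\<lambda>x. f x - 0)"
        by (rule l2norm_triangle3[OF sp f(1) square_integrable_zero])
      then show "l2norm lborel \<psi> \<le> ?n + e"
        using *(2) l2norm_diff_commute[of lborel \<psi> f] by simp
    qed
    finally show ?thesis by (simp add: algebra_simps)
  qed
  have n0: "?n \<ge> 0" by (rule l2norm_nonneg)
  have "?n\<^sup>2 \<le> M * ?n"
  proof (rule field_le_epsilon)
    fix e :: real assume "e > 0"
    then have "e / (?n + M + 1) > 0" using M n0 by simp
    moreover have "e / (?n + M + 1) * (?n + M) \<le> e"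
      using \<open>e > 0\<close> M n0 by (simp add: field_simps)
    ultimately show "?n\<^sup>2 \<le> M * ?n + e"
      using key[of "e / (?n + M + 1)"] by linarith
  qed
  then show ?thesis
    using n0 M by (cases "?n = 0") (simp_all add: power2_eq_square)
qed

section \<open>Weak gradients\<close>

lemma lborel_integral_shift:
  fixes f :: "'a::euclidean_space \<Rightarrow> real"
  assumes "f \<in> borel_measurable borel"
  shows "(\<integral>x. f (x + h) \<partial>lborel) = (\<integral>x. f x \<partial>lborel)"
proof -
  have "(\<integral>x. f x \<partial>lborel) = (\<integral>x. f x \<partial>distr lborel borel ((+) h))"
    by (simp add: lborel_distr_plus)
  also have "\<dots> = (\<integral>x. f (h + x) \<partial>lborel)"
    by (rule integral_distr) (use assms in auto)
  finally show ?thesis by (simp add: add.commute)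
qed

lemma lborel_integrable_shift:
  fixes f :: "'a::euclidean_space \<Rightarrow> real"
  assumes "integrable lborel f"
  shows "integrable lborel (\<lambda>x. f (x + h))"
proof -
  have "integrable (distr lborel borel ((+) h)) f"
    using assms by (simp add: lborel_distr_plus)
  then have "integrable lborel (\<lambda>x. f (h + x))"
    by (rule integrable_distr[rotated]) simp
  then show ?thesis by (simp add: add.commute)
qed

lemma square_integrable_shift:
  fixes f :: "'a::euclidean_space \<Rightarrow> real"
  assumes "square_integrable lborel f"
  shows "square_integrable lborel (\<lambda>x. f (x + h))"
proof -
  have "(\<lambda>x. f (x + h)) \<in> borel_measurable borel"
    by (rule measurable_compose[of _ _ borel]) (use square_integrableD(1)[OF assms] in simp_all)
  then show ?thesis
    using lborel_integrable_shift[OF square_integrableD(2)[OF assms]]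
    by (simp add: square_integrable_def)
qed

lemma l2norm_shift:
  fixes f :: "'a::euclidean_space \<Rightarrow> real"
  assumes "f \<in> borel_measurable borel"
  shows "l2norm lborel (\<lambda>x. f (x + h)) = l2norm lborel f"
  unfolding l2norm_def
  by (subst lborel_integral_shift[of "\<lambda>x. (f x)\<^sup>2"]) (use assms in simp_all)

lemma test_function_lipschitz:
  fixes \<psi> :: "'a::euclidean_space \<Rightarrow> real"
  assumes "test_function \<Omega> \<psi> D" "\<And>x. norm (D x) \<le> B"
  shows "\<bar>\<psi> y - \<psi> x\<bar> \<le> B * norm (y - x)"
proof -
  have "norm (\<psi> y - \<psi> x) \<le> B * norm (y - x)"
  proof (rule differentiable_bound[of UNIV])
    show "(\<psi> has_derivative (\<lambda>h. D x \<bullet> h)) (at x within UNIV)" for x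
      using test_functionD(1)[OF assms(1)] .
    show "onorm (\<lambda>h. D x \<bullet> h) \<le> B" for x
      using assms(2)[of x] Cauchy_Schwarz_ineq2[of "D x"]
      by (intro onorm_le) (metis mult_right_mono norm_ge_zero order_trans real_norm_def)
  qed auto
  then show ?thesis by simp
qed

text \<open>The quotients of \<open>\<psi>\<close> are bounded by its Lipschitz constant times |h|,
  so |F| dominates and the limit passes under the integral. \<open>F\<close> needs no smoothness
  because the translation acts on \<open>\<psi>\<close> alone.\<close>

lemma shift_integral_derivative:
  fixes F :: "'a::euclidean_space \<Rightarrow> real"
  assumes F: "integrable lborel F" and \<psi>: "test_function \<Omega> \<psi> D"
  shows "((\<lambda>s. \<integral>z. F z * \<psi> (z - s *\<^sub>R h) \<partial>lborel) has_real_derivative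
           - (\<integral>z. F z * (D (z - s *\<^sub>R h) \<bullet> h) \<partial>lborel)) (at s)"
proof -
  obtain B where B: "\<And>x. \<bar>\<psi> x\<bar> \<le> B" "\<And>x. norm (D x) \<le> B"
    using test_function_bounded[OF \<psi>] by blast
  have meas: "\<psi> \<in> borel_measurable borel" "D \<in> borel_measurable borel" "F \<in> borel_measurable borel"
    using test_function_measurable[OF \<psi>] borel_measurable_integrable[OF F] by simp_all
  let ?\<phi> = "\<lambda>s. \<integral>z. F z * \<psi> (z - s *\<^sub>R h) \<partial>lborel"
  have int: "integrable lborel (\<lambda>z. F z * \<psi> (z - s *\<^sub>R h))" for s
  proof (rule Bochner_Integration.integrable_bound)
    show "integrable lborel (\<lambda>z. B * F z)" using F by simp
    show "(\<lambda>z. F z * \<psi> (z - s *\<^sub>R h)) \<in> borel_measurable lborel"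
      using meas by measurable
    have "norm (F z * \<psi> (z - s *\<^sub>R h)) \<le> norm (B * F z)" for z
    proof -
      have "\<bar>F z\<bar> * \<bar>\<psi> (z - s *\<^sub>R h)\<bar> \<le> \<bar>F z\<bar> * \<bar>B\<bar>"
        using B(1)[of "z - s *\<^sub>R h"] by (intro mult_left_mono) auto
      then show ?thesis by (simp add: abs_mult mult.commute)
    qed
    then show "AE z in lborel. norm (F z * \<psi> (z - s *\<^sub>R h)) \<le> norm (B * F z)"
      by (rule AE_I2)
  qed
  have "((\<lambda>k. (?\<phi> (s + k) - ?\<phi> s) / k) \<longlongrightarrow> - (\<integral>z. F z * (D (z - s *\<^sub>R h) \<bullet> h) \<partial>lborel)) (at 0)"
    unfolding tendsto_at_iff_sequentially
  proof (intro allI impI)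
    fix X :: "nat \<Rightarrow> real"
    assume X: "\<forall>i. X i \<in> UNIV - {0}" "X \<longlonglongrightarrow> 0"
    let ?q = "\<lambda>n z. F z * ((\<psi> (z - (s + X n) *\<^sub>R h) - \<psi> (z - s *\<^sub>R h)) / X n)"
    have "(\<lambda>n. \<integral>z. ?q n z \<partial>lborel) \<longlonglongrightarrow> (\<integral>z. F z * - (D (z - s *\<^sub>R h) \<bullet> h) \<partial>lborel)"
    proof (rule integral_dominated_convergence[where w="\<lambda>z. B * norm h * \<bar>F z\<bar>"])
      show "integrable lborel (\<lambda>z. B * norm h * \<bar>F z\<bar>)" using F by simp
      show "(\<lambda>z. F z * - (D (z - s *\<^sub>R h) \<bullet> h)) \<in> borel_measurable lborel"
        "\<And>n. ?q n \<in> borel_measurable lborel"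
        using meas by measurable
      have "(\<lambda>n. ?q n z) \<longlonglongrightarrow> F z * - (D (z - s *\<^sub>R h) \<bullet> h)" for z
      proof -
        have "((\<lambda>k. z - (s + k) *\<^sub>R h) has_derivative (\<lambda>k. - k *\<^sub>R h)) (at 0)"
          by (auto intro!: derivative_eq_intros simp: algebra_simps)
        from diff_chain_at[OF this] test_functionD(1)[OF \<psi>, of "z - s *\<^sub>R h"]
        have "(\<psi> \<circ> (\<lambda>k. z - (s + k) *\<^sub>R h) has_derivative (\<lambda>k. D (z - s *\<^sub>R h) \<bullet> k) \<circ> (\<lambda>k. - k *\<^sub>R h)) (at 0)"
          by simp
        then have 0: "((\<lambda>k. \<psi> (z - (s + k) *\<^sub>R h)) has_derivative (*) (- (D (z - s *\<^sub>R h) \<bullet> h))) (at 0)"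
        proof -
          assume 1: "(\<psi> \<circ> (\<lambda>k. z - (s + k) *\<^sub>R h) has_derivative
            (\<lambda>k. D (z - s *\<^sub>R h) \<bullet> k) \<circ> (\<lambda>k. - k *\<^sub>R h)) (at 0)"
          have 2: "(\<lambda>k. D (z - s *\<^sub>R h) \<bullet> k) \<circ> (\<lambda>k. - k *\<^sub>R h) = (*) (- (D (z - s *\<^sub>R h) \<bullet> h))"
            by (simp add: fun_eq_iff)
          show ?thesis using 1 unfolding 2 unfolding o_def .
        qed
        then have "((\<lambda>k. \<psi> (z - (s + k) *\<^sub>R h)) has_real_derivative - (D (z - s *\<^sub>R h) \<bullet> h)) (at 0)"
          unfolding has_field_derivative_def .
        then have "((\<lambda>k. (\<psi> (z - (s + k) *\<^sub>R h) - \<psi> (z - s *\<^sub>R h)) / k) \<longlongrightarrow> - (D (z - s *\<^sub>R h) \<bullet> h)) (at 0)"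
          by (simp add: DERIV_def)
        then have "(\<lambda>n. (\<psi> (z - (s + X n) *\<^sub>R h) - \<psi> (z - s *\<^sub>R h)) / X n) \<longlonglongrightarrow> - (D (z - s *\<^sub>R h) \<bullet> h)"
          using X unfolding tendsto_at_iff_sequentially by (auto simp: o_def)
        then show ?thesis by (intro tendsto_mult tendsto_const)
      qed
      then show "AE z in lborel. (\<lambda>n. ?q n z) \<longlonglongrightarrow> F z * - (D (z - s *\<^sub>R h) \<bullet> h)"
        by (rule AE_I2)
      have "norm (?q n z) \<le> B * norm h * \<bar>F z\<bar>" for n z
      proof -
        have "\<bar>\<psi> (z - (s + X n) *\<^sub>R h) - \<psi> (z - s *\<^sub>R h)\<bar> \<le> B * norm ((z - (s + X n) *\<^sub>R h) - (z - s *\<^sub>R h))"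
          by (rule test_function_lipschitz[OF \<psi> B(2)])
        also have "(z - (s + X n) *\<^sub>R h) - (z - s *\<^sub>R h) = - (X n *\<^sub>R h)"
          by (simp add: algebra_simps)
        finally have "\<bar>\<psi> (z - (s + X n) *\<^sub>R h) - \<psi> (z - s *\<^sub>R h)\<bar> \<le> (B * norm h) * \<bar>X n\<bar>"
          by (simp add: mult_ac)
        moreover have "\<bar>X n\<bar> > 0" using X(1) by simp
        ultimately have "\<bar>(\<psi> (z - (s + X n) *\<^sub>R h) - \<psi> (z - s *\<^sub>R h)) / X n\<bar> \<le> B * norm h"
          unfolding abs_divide by (simp only: pos_divide_le_eq)
        then have "\<bar>F z\<bar> * \<bar>(\<psi> (z - (s + X n) *\<^sub>R h) - \<psi> (z - s *\<^sub>R h)) / X n\<bar> \<le> \<bar>F z\<bar> * (B * norm h)"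
          by (intro mult_left_mono) auto
        then show ?thesis by (simp add: abs_mult mult_ac)
      qed
      then show "AE z in lborel. norm (?q n z) \<le> B * norm h * \<bar>F z\<bar>" for n
        by (rule AE_I2)
    qed
    moreover have "(?\<phi> (s + X n) - ?\<phi> s) / X n = (\<integral>z. ?q n z \<partial>lborel)" for n
    proof -
      have "(?\<phi> (s + X n) - ?\<phi> s) / X n
         = (\<integral>z. F z * \<psi> (z - (s + X n) *\<^sub>R h) - F z * \<psi> (z - s *\<^sub>R h) \<partial>lborel) / X n"
        by (simp add: Bochner_Integration.integral_diff[OF int int])
      also have "\<dots> = (\<integral>z. (F z * \<psi> (z - (s + X n) *\<^sub>R h) - F z * \<psi> (z - s *\<^sub>R h)) / X n \<partial>lborel)"
        by simp
      also have "\<dots> = (\<integral>z. ?q n z \<partial>lborel)"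
        by (rule Bochner_Integration.integral_cong) (auto simp: right_diff_distrib)
      finally show ?thesis .
    qed
    ultimately show "((\<lambda>k. (?\<phi> (s + k) - ?\<phi> s) / k) \<circ> X) \<longlonglongrightarrow> - (\<integral>z. F z * (D (z - s *\<^sub>R h) \<bullet> h) \<partial>lborel)"
      unfolding o_def by (simp only: mult_minus_right Bochner_Integration.integral_minus)
  qed
  then show ?thesis unfolding DERIV_def .
qed

lemma AE_lebesgue_on_iff:
  fixes \<Omega> :: "'a::euclidean_space set"
  assumes "\<Omega> \<in> sets borel"
  shows "(AE x in lebesgue_on \<Omega>. P x) \<longleftrightarrow> (AE x in lborel. x \<in> \<Omega> \<longrightarrow> P x)"
proof -
  have "(AE x in lebesgue_on \<Omega>. P x) \<longleftrightarrow> (AE x in lebesgue. x \<in> \<Omega> \<longrightarrow> P x)"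
    by (rule AE_restrict_space_iff) (use assms in simp)
  then show ?thesis by (simp add: AE_completion_iff)
qed

lemma lebesgue_on_integral_borel:
  fixes F :: "'a::euclidean_space \<Rightarrow> 'b::{banach,second_countable_topology}"
  assumes "\<Omega> \<in> sets borel" "F \<in> borel_measurable borel"
  shows "(\<integral>x. F x \<partial>lebesgue_on \<Omega>) = (\<integral>x. indicator \<Omega> x *\<^sub>R F x \<partial>lborel)"
    "integrable (lebesgue_on \<Omega>) F \<longleftrightarrow> integrable lborel (\<lambda>x. indicator \<Omega> x *\<^sub>R F x)"
proof -
  have "(\<integral>x. F x \<partial>lebesgue_on \<Omega>) = (\<integral>x. indicator \<Omega> x *\<^sub>R F x \<partial>lebesgue)"
    by (rule integral_restrict_space) (use assms in simp)
  then show "(\<integral>x. F x \<partial>lebesgue_on \<Omega>) = (\<integral>x. indicator \<Omega> x *\<^sub>R F x \<partial>lborel)"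
    using assms by (simp add: integral_completion)
  have "integrable (lebesgue_on \<Omega>) F \<longleftrightarrow> integrable lebesgue (\<lambda>x. indicator \<Omega> x *\<^sub>R F x)"
    by (rule integrable_restrict_space) (use assms in simp)
  then show "integrable (lebesgue_on \<Omega>) F \<longleftrightarrow> integrable lborel (\<lambda>x. indicator \<Omega> x *\<^sub>R F x)"
    using assms by (simp add: integrable_completion)
qed

lemma borel_imp_lebesgue_on_measurable:
  assumes "F \<in> borel_measurable borel"
  shows "F \<in> borel_measurable (lebesgue_on \<Omega>)"
  by (intro measurable_restrict_space1 measurable_completion) (use assms in simp)

lemma borel_representative_real:
  fixes v :: "'a::euclidean_space \<Rightarrow> real"
  assumes "\<Omega> \<in> sets borel" "v \<in> borel_measurable (lebesgue_on \<Omega>)"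
  shows "\<exists>v'\<in>borel_measurable borel. (\<forall>x. x \<notin> \<Omega> \<longrightarrow> v' x = 0) \<and> (AE x in lebesgue_on \<Omega>. v x = v' x)"
proof -
  have "(\<lambda>x. indicator \<Omega> x *\<^sub>R v x) \<in> borel_measurable lebesgue"
    using assms borel_measurable_restrict_space_iff[of \<Omega> lebesgue v] by simp
  then obtain w where w: "w \<in> borel_measurable lborel" "AE x in lborel. indicator \<Omega> x *\<^sub>R v x = w x"
    using completion_ex_borel_measurable_real[of "\<lambda>x. indicator \<Omega> x *\<^sub>R v x" lborel] by metis
  have "AE x in lborel. x \<in> \<Omega> \<longrightarrow> v x = indicator \<Omega> x * w x"
    using w(2) by (rule AE_mp) (rule AE_I2, auto simp: indicator_def)
  then show ?thesis
    using w(1) assms(1) by (intro bexI[of _ "\<lambda>x. indicator \<Omega> x * w x"]) (simp_all add: AE_lebesgue_on_iff)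
qed

lemma borel_representative:
  fixes v :: "'a::euclidean_space \<Rightarrow> 'b::euclidean_space"
  assumes "\<Omega> \<in> sets borel" "v \<in> borel_measurable (lebesgue_on \<Omega>)"
  shows "\<exists>v'\<in>borel_measurable borel. (\<forall>x. x \<notin> \<Omega> \<longrightarrow> v' x = 0) \<and> (AE x in lebesgue_on \<Omega>. v x = v' x)"
proof -
  have "\<exists>w\<in>borel_measurable borel. (\<forall>x. x \<notin> \<Omega> \<longrightarrow> w x = 0) \<and> (AE x in lebesgue_on \<Omega>. v x \<bullet> b = w x)" for b
    by (rule borel_representative_real[OF assms(1)]) (use assms(2) in simp)
  then obtain w where w: "\<And>b. w b \<in> borel_measurable borel" "\<And>b x. x \<notin> \<Omega> \<Longrightarrow> w b x = 0"
    "\<And>b. AE x in lebesgue_on \<Omega>. v x \<bullet> b = w b x"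
    by metis
  let ?v = "\<lambda>x. \<Sum>b\<in>Basis. w b x *\<^sub>R b"
  have "AE x in lebesgue_on \<Omega>. \<forall>b\<in>Basis. v x \<bullet> b = w b x"
    by (rule AE_finite_allI) (simp_all add: w(3))
  then have "AE x in lebesgue_on \<Omega>. v x = ?v x"
  proof (rule AE_mp, intro AE_I2 impI)
    fix x assume "\<forall>b\<in>Basis. v x \<bullet> b = w b x"
    then have "?v x = (\<Sum>b\<in>Basis. (v x \<bullet> b) *\<^sub>R b)" by (intro sum.cong) simp_all
    then show "v x = ?v x" by (simp add: euclidean_representation)
  qed
  moreover have "?v \<in> borel_measurable borel" using w(1) by measurable
  moreover have "\<forall>x. x \<notin> \<Omega> \<longrightarrow> ?v x = 0" using w(2) by simp
  ultimately show ?thesis by (intro bexI[of _ ?v] conjI)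
qed

text \<open>
  Weak gradients with Borel representatives that vanish off the domain, so that translations act on
  Lebesgue--Borel measure of the whole space.
\<close>

definition borel_weak_gradient :: "'a::euclidean_space set \<Rightarrow> ('a \<Rightarrow> real) \<Rightarrow> ('a \<Rightarrow> 'a) \<Rightarrow> bool" where
  "borel_weak_gradient \<Omega> v G \<longleftrightarrow>
     square_integrable lborel v \<and> G \<in> borel_measurable borel \<and>
     square_integrable lborel (\<lambda>x. norm (G x)) \<and>
     (\<forall>x. x \<notin> \<Omega> \<longrightarrow> v x = 0 \<and> G x = 0) \<and>
     (\<forall>\<psi> D e. test_function \<Omega> \<psi> D \<longrightarrow>
        (\<integral>x. v x * (D x \<bullet> e) \<partial>lborel) = - (\<integral>x. \<psi> x * (G x \<bullet> e) \<partial>lborel))"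

lemma borel_weak_gradientD:
  assumes "borel_weak_gradient \<Omega> v G"
  shows "square_integrable lborel v" "G \<in> borel_measurable borel" "v \<in> borel_measurable borel"
    "square_integrable lborel (\<lambda>x. norm (G x))" "\<And>x. x \<notin> \<Omega> \<Longrightarrow> v x = 0" "\<And>x. x \<notin> \<Omega> \<Longrightarrow> G x = 0"
    "\<And>\<psi> D e. test_function \<Omega> \<psi> D \<Longrightarrow> (\<integral>x. v x * (D x \<bullet> e) \<partial>lborel) = - (\<integral>x. \<psi> x * (G x \<bullet> e) \<partial>lborel)"
  using assms unfolding borel_weak_gradient_def square_integrable_def by simp_all

lemma square_integrable_inner:
  fixes G :: "'a \<Rightarrow> 'b::euclidean_space"
  assumes "G \<in> borel_measurable M" "square_integrable M (\<lambda>x. norm (G x))"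
  shows "square_integrable M (\<lambda>x. G x \<bullet> e)" "l2norm M (\<lambda>x. G x \<bullet> e) \<le> norm e * l2norm M (\<lambda>x. norm (G x))"
proof -
  have "\<bar>G x \<bullet> e\<bar> \<le> \<bar>norm e * norm (G x)\<bar>" for x
    using Cauchy_Schwarz_ineq2[of "G x" e] by (simp add: mult.commute)
  then have ae: "AE x in M. \<bar>G x \<bullet> e\<bar> \<le> \<bar>norm e * norm (G x)\<bar>" by (rule AE_I2)
  have si: "square_integrable M (\<lambda>x. norm e * norm (G x))"
    by (rule square_integrable_cmult[OF assms(2)])
  have m: "(\<lambda>x. G x \<bullet> e) \<in> borel_measurable M" using assms(1) by simp
  show "square_integrable M (\<lambda>x. G x \<bullet> e)"
    by (rule square_integrable_bound[OF si m ae])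
  have "l2norm M (\<lambda>x. G x \<bullet> e) \<le> l2norm M (\<lambda>x. norm e * norm (G x))"
    by (rule l2norm_mono[OF si m ae])
  also have "\<dots> = norm e * l2norm M (\<lambda>x. norm (G x))"
    by (subst l2norm_cmult) simp
  finally show "l2norm M (\<lambda>x. G x \<bullet> e) \<le> norm e * l2norm M (\<lambda>x. norm (G x))" .
qed

lemma square_integrable_imp_integrable_bounded_support:
  fixes v :: "'a::euclidean_space \<Rightarrow> real"
  assumes "square_integrable lborel v" "\<And>x. x \<notin> \<Omega> \<Longrightarrow> v x = 0" "\<Omega> \<in> sets borel" "bounded \<Omega>"
  shows "integrable lborel v"
proof -
  have "square_integrable lborel (indicator \<Omega> :: 'a \<Rightarrow> real)"
    using assms(3) emeasure_bounded_finite[OF assms(4)]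
    by (intro square_integrable_indicator) (simp_all add: top.not_eq_extremum)
  from square_integrable_mult[OF assms(1) this] have "integrable lborel (\<lambda>x. v x * indicator \<Omega> x)" .
  moreover have "v x * indicator \<Omega> x = v x" for x using assms(2)[of x] by (cases "x \<in> \<Omega>") auto
  ultimately show ?thesis by simp
qed

section \<open>Translations and difference quotients of functions with a weak gradient\<close>

abbreviation shift_domain :: "'a::euclidean_space set \<Rightarrow> 'a \<Rightarrow> 'a set" where
  "shift_domain \<Omega> h \<equiv> {x \<in> \<Omega>. x + h \<in> \<Omega>}"

lemma shift_domain_open: "open \<Omega> \<Longrightarrow> open (shift_domain \<Omega> h)"
proof -
  assume "open \<Omega>"
  then have "open ((\<lambda>x. x + h) -` \<Omega>)"
    by (intro open_vimage continuous_intros)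
  then have "open (\<Omega> \<inter> (\<lambda>x. x + h) -` \<Omega>)" using \<open>open \<Omega>\<close> by (rule open_Int[rotated])
  moreover have "\<Omega> \<inter> (\<lambda>x. x + h) -` \<Omega> = shift_domain \<Omega> h" by auto
  ultimately show ?thesis by simp
qed

text \<open>A discrete integration by parts: the translation is moved from v to
  \<open>\<psi>\<close> by invariance of the measure. The indicator may be dropped since
  \<open>\<psi>\<close> vanishes off the shifted domain.\<close>

lemma translation_increment_test:
  fixes v :: "'a::euclidean_space \<Rightarrow> real"
  assumes v: "integrable lborel v" and \<psi>: "test_function (shift_domain \<Omega> h) \<psi> D"
  shows "(\<integral>x. indicator (shift_domain \<Omega> h) x * (v (x + h) - v x) * \<psi> x \<partial>lborel)
    = (\<integral>z. v z * \<psi> (z - h) \<partial>lborel) - (\<integral>z. v z * \<psi> z \<partial>lborel)"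
proof -
  obtain B where B: "\<And>x. \<bar>\<psi> x\<bar> \<le> B" using test_function_bounded[OF \<psi>] by blast
  have meas: "\<psi> \<in> borel_measurable borel" "v \<in> borel_measurable borel"
    using test_function_measurable[OF \<psi>] borel_measurable_integrable[OF v] by simp_all
  have bd: "integrable lborel (\<lambda>x. F x * \<psi> x)" if F: "integrable lborel F" for F
  proof (rule Bochner_Integration.integrable_bound)
    show "integrable lborel (\<lambda>z. B * F z)" using F by simp
    show "(\<lambda>z. F z * \<psi> z) \<in> borel_measurable lborel"
      using meas borel_measurable_integrable[OF F] by simp
    have "norm (F z * \<psi> z) \<le> norm (B * F z)" for z
    proof -
      have "\<bar>F z\<bar> * \<bar>\<psi> z\<bar> \<le> \<bar>F z\<bar> * \<bar>B\<bar>"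
        using B[of z] by (intro mult_left_mono) auto
      then show ?thesis by (simp add: abs_mult mult.commute)
    qed
    then show "AE z in lborel. norm (F z * \<psi> z) \<le> norm (B * F z)" by (rule AE_I2)
  qed
  have z: "\<psi> x = 0" if "x \<notin> shift_domain \<Omega> h" for x
    using test_functionD(3)[OF \<psi>] that by blast
  have "(\<integral>x. indicator (shift_domain \<Omega> h) x * (v (x + h) - v x) * \<psi> x \<partial>lborel)
      = (\<integral>x. v (x + h) * \<psi> x - v x * \<psi> x \<partial>lborel)"
  proof (rule Bochner_Integration.integral_cong[OF refl])
    show "indicator (shift_domain \<Omega> h) x * (v (x + h) - v x) * \<psi> x = v (x + h) * \<psi> x - v x * \<psi> x" for x
      using z[of x] by (cases "x \<in> shift_domain \<Omega> h") (simp_all add: left_diff_distrib)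
  qed
  also have "\<dots> = (\<integral>x. v (x + h) * \<psi> x \<partial>lborel) - (\<integral>z. v z * \<psi> z \<partial>lborel)"
    by (rule Bochner_Integration.integral_diff[OF bd[OF lborel_integrable_shift[OF v]] bd[OF v]])
  also have "(\<integral>x. v (x + h) * \<psi> x \<partial>lborel) = (\<integral>z. v z * \<psi> (z - h) \<partial>lborel)"
    using lborel_integral_shift[of "\<lambda>z. v z * \<psi> (z - h)" h] meas by simp
  finally show ?thesis .
qed

text \<open>By duality it is enough to test with \<open>\<psi>\<close> supported in the shifted
  domain. The function \<open>\<phi>\<close> interpolates between the two integrals of the tested
  increment. Since \<Omega> is convex, \<open>\<psi>\<close> translated by any fraction of h is
  still a test function on \<Omega>, so the derivative of \<open>\<phi>\<close> is a pairing with G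
  and the mean value theorem gives the bound.\<close>

lemma translation_estimate:
  fixes \<Omega> :: "'a::euclidean_space set"
  assumes \<Omega>: "open \<Omega>" "bounded \<Omega>" "convex \<Omega>" and wg: "borel_weak_gradient \<Omega> v G"
  shows "square_integrable lborel (\<lambda>x. indicator (shift_domain \<Omega> h) x * (v (x + h) - v x))"
    "l2norm lborel (\<lambda>x. indicator (shift_domain \<Omega> h) x * (v (x + h) - v x))
      \<le> norm h * l2norm lborel (\<lambda>x. norm (G x))"
proof -
  note vD = borel_weak_gradientD[OF wg]
  let ?U = "shift_domain \<Omega> h" and ?N = "l2norm lborel (\<lambda>x. norm (G x))"
  have U: "open ?U" "bounded ?U" using \<Omega> shift_domain_open by (auto intro: bounded_subset)
  have sd: "square_integrable lborel (\<lambda>x. v (x + h) - v x)"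
    by (rule square_integrable_diff[OF square_integrable_shift[OF vD(1)] vD(1)])
  show si: "square_integrable lborel (\<lambda>x. indicator ?U x * (v (x + h) - v x))"
  proof (rule square_integrable_bound[OF sd])
    show "(\<lambda>x. indicator ?U x * (v (x + h) - v x)) \<in> borel_measurable lborel"
      using U(1) square_integrableD(1)[OF sd] by (intro borel_measurable_times borel_measurable_indicator) simp_all
    show "AE x in lborel. \<bar>indicator ?U x * (v (x + h) - v x)\<bar> \<le> \<bar>v (x + h) - v x\<bar>"
      by (rule AE_I2) (simp add: indicator_def)
  qed
  have vint: "integrable lborel v"
    by (rule square_integrable_imp_integrable_bounded_support[OF vD(1,5) borel_open[OF \<Omega>(1)] \<Omega>(2)])
  show "l2norm lborel (\<lambda>x. indicator ?U x * (v (x + h) - v x)) \<le> norm h * ?N"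
  proof (rule l2norm_le_by_duality[OF U si])
    show "indicator ?U x * (v (x + h) - v x) = 0" if "x \<notin> ?U" for x using that by simp
    show "0 \<le> norm h * ?N" by (simp add: l2norm_nonneg)
    fix \<psi> D assume \<psi>: "test_function ?U \<psi> D"
    define \<phi> where "\<phi> s = (\<integral>z. v z * \<psi> (z - s *\<^sub>R h) \<partial>lborel)" for s
    have psis: "square_integrable lborel \<psi>" by (rule test_function_square_integrable[OF \<psi>])
    have pm: "\<psi> \<in> borel_measurable borel" by (rule test_function_measurable[OF \<psi>])
    have Gh: "square_integrable lborel (\<lambda>x. G x \<bullet> h)" "l2norm lborel (\<lambda>x. G x \<bullet> h) \<le> norm h * ?N"
      using square_integrable_inner[of G lborel h] vD(2,4) by simp_all
    have der: "(\<phi> has_real_derivative (\<integral>z. \<psi> (z - s *\<^sub>R h) * (G z \<bullet> h) \<partial>lborel)) (at s)"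
      if s: "0 \<le> s" "s \<le> 1" for s
    proof -
      have "test_function \<Omega> (\<lambda>x. \<psi> (x - s *\<^sub>R h)) (\<lambda>x. D (x - s *\<^sub>R h))"
      proof (rule test_function_shift[OF \<psi>])
        fix x assume "x \<in> ?U"
        then have "x \<in> \<Omega>" "x + h \<in> \<Omega>" by auto
        then have "(1 - s) *\<^sub>R x + s *\<^sub>R (x + h) \<in> \<Omega>"
          using \<Omega>(3) s by (simp add: convex_alt)
        then show "x + s *\<^sub>R h \<in> \<Omega>" by (simp add: algebra_simps)
      qed
      from vD(7)[OF this, of h]
      have "- (\<integral>z. v z * (D (z - s *\<^sub>R h) \<bullet> h) \<partial>lborel) = (\<integral>z. \<psi> (z - s *\<^sub>R h) * (G z \<bullet> h) \<partial>lborel)"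
        by simp
      then show ?thesis
        using shift_integral_derivative[OF vint \<psi>, of h s] unfolding \<phi>_def by simp
    qed
    have bd: "\<bar>\<integral>z. \<psi> (z - s *\<^sub>R h) * (G z \<bullet> h) \<partial>lborel\<bar> \<le> (norm h * ?N) * l2norm lborel \<psi>" for s
    proof -
      have sp: "square_integrable lborel (\<lambda>z. \<psi> (z - s *\<^sub>R h))"
        using square_integrable_shift[OF psis, of "- (s *\<^sub>R h)"] by simp
      have np: "l2norm lborel (\<lambda>z. \<psi> (z - s *\<^sub>R h)) = l2norm lborel \<psi>"
        using l2norm_shift[OF pm, of "- (s *\<^sub>R h)"] by simp
      have "\<bar>\<integral>z. \<psi> (z - s *\<^sub>R h) * (G z \<bullet> h) \<partial>lborel\<bar> \<le> l2norm lborel \<psi> * l2norm lborel (\<lambda>x. G x \<bullet> h)"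
        using l2_Cauchy_Schwarz[OF sp Gh(1)] np by simp
      also have "\<dots> \<le> l2norm lborel \<psi> * (norm h * ?N)"
        by (rule mult_left_mono[OF Gh(2) l2norm_nonneg])
      finally show ?thesis by (simp add: mult.commute)
    qed
    have "\<exists>s. 0 < s \<and> s < 1 \<and> \<phi> 1 - \<phi> 0 = (1 - 0) * (\<integral>z. \<psi> (z - s *\<^sub>R h) * (G z \<bullet> h) \<partial>lborel)"
      by (rule MVT2) (use der in simp_all)
    then obtain s where "\<phi> 1 - \<phi> 0 = (\<integral>z. \<psi> (z - s *\<^sub>R h) * (G z \<bullet> h) \<partial>lborel)" by auto
    then have "\<bar>\<phi> 1 - \<phi> 0\<bar> \<le> (norm h * ?N) * l2norm lborel \<psi>" using bd[of s] by simp
    then show "\<bar>\<integral>x. indicator ?U x * (v (x + h) - v x) * \<psi> x \<partial>lborel\<bar> \<le> norm h * ?N * l2norm lborel \<psi>"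
      using translation_increment_test[OF vint \<psi>] by (simp add: \<phi>_def)
  qed
qed

definition diff_quot :: "'a::euclidean_space set \<Rightarrow> ('a \<Rightarrow> real) \<Rightarrow> 'a \<Rightarrow> real \<Rightarrow> 'a \<Rightarrow> real" where
  "diff_quot \<Omega> v e t x = (indicator (shift_domain \<Omega> (t *\<^sub>R e)) x * (v (x + t *\<^sub>R e) - v x)) / t"

lemma diff_quot_l2:
  fixes \<Omega> :: "'a::euclidean_space set"
  assumes \<Omega>: "open \<Omega>" "bounded \<Omega>" "convex \<Omega>" and wg: "borel_weak_gradient \<Omega> v G" and "t > 0"
  shows "square_integrable lborel (diff_quot \<Omega> v e t)"
    "l2norm lborel (diff_quot \<Omega> v e t) \<le> norm e * l2norm lborel (\<lambda>x. norm (G x))"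
proof -
  note te = translation_estimate[OF \<Omega> wg, of "t *\<^sub>R e"]
  have eq: "diff_quot \<Omega> v e t = (\<lambda>x. (1 / t) * (indicator (shift_domain \<Omega> (t *\<^sub>R e)) x * (v (x + t *\<^sub>R e) - v x)))"
    by (simp add: diff_quot_def fun_eq_iff)
  show "square_integrable lborel (diff_quot \<Omega> v e t)"
    unfolding eq by (rule square_integrable_cmult[OF te(1)])
  have "l2norm lborel (diff_quot \<Omega> v e t) \<le> (1 / t) * (norm (t *\<^sub>R e) * l2norm lborel (\<lambda>x. norm (G x)))"
    unfolding eq l2norm_cmult using \<open>t > 0\<close> by (intro mult_mono te(2) l2norm_nonneg) simp_all
  also have "\<dots> = norm e * l2norm lborel (\<lambda>x. norm (G x))" using \<open>t > 0\<close> by simp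
  finally show "l2norm lborel (diff_quot \<Omega> v e t) \<le> norm e * l2norm lborel (\<lambda>x. norm (G x))" .
qed

lemma test_function_eventually_shift_domain:
  fixes \<Omega> :: "'a::euclidean_space set"
  assumes "open \<Omega>" "test_function \<Omega> \<psi> D" "X \<longlonglongrightarrow> (0::real)"
  shows "\<forall>\<^sub>F n in sequentially. test_function (shift_domain \<Omega> (X n *\<^sub>R e)) \<psi> D"
proof -
  obtain K where K: "compact K" "K \<subseteq> \<Omega>" "\<And>x. x \<notin> K \<Longrightarrow> \<psi> x = 0"
    using assms(2) unfolding test_function_def by blast
  obtain d where d: "d > 0" "(\<Union>x\<in>K. ball x d) \<subseteq> \<Omega>"
    using compact_subset_open_imp_ball_epsilon_subset[OF K(1) assms(1) K(2)] by blast
  have "(\<lambda>n. X n *\<^sub>R e) \<longlonglongrightarrow> 0 *\<^sub>R e" by (intro tendsto_scaleR assms(3) tendsto_const)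
  then have "(\<lambda>n. X n *\<^sub>R e) \<longlonglongrightarrow> 0" by simp
  then have "\<forall>\<^sub>F n in sequentially. norm (X n *\<^sub>R e) < d"
    using d(1) tendstoD[of "\<lambda>n. X n *\<^sub>R e" 0 sequentially d] by (simp add: dist_norm)
  then show ?thesis
  proof (rule eventually_mono)
    fix n assume n: "norm (X n *\<^sub>R e) < d"
    have "K \<subseteq> shift_domain \<Omega> (X n *\<^sub>R e)"
    proof
      fix x assume x: "x \<in> K"
      then have "x + X n *\<^sub>R e \<in> ball x d" using n by (simp add: dist_norm)
      then show "x \<in> shift_domain \<Omega> (X n *\<^sub>R e)" using d(2) K(2) x by blast
    qed
    then show "test_function (shift_domain \<Omega> (X n *\<^sub>R e)) \<psi> D"
      using assms(2) K unfolding test_function_def by blast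
  qed
qed

text \<open>Integrability of \<open>w\<close> suffices, so the lemma applies to v and also to
  \<eta>(v) before anything is known about a weak gradient of the latter. The quotients are cut off
  to the shifted domain, but the support of \<open>\<psi>\<close> lies in it once the shift is
  small.\<close>

lemma diff_quot_test_tendsto:
  fixes \<Omega> :: "'a::euclidean_space set"
  assumes "open \<Omega>" "integrable lborel w" "test_function \<Omega> \<psi> D" "X \<longlonglongrightarrow> (0::real)" "\<And>n. X n > 0"
  shows "(\<lambda>n. \<integral>x. diff_quot \<Omega> w e (X n) x * \<psi> x \<partial>lborel) \<longlonglongrightarrow> - (\<integral>x. w x * (D x \<bullet> e) \<partial>lborel)"
proof -
  define \<phi> where "\<phi> s = (\<integral>z. w z * \<psi> (z - s *\<^sub>R e) \<partial>lborel)" for s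
  have "(\<phi> has_real_derivative - (\<integral>x. w x * (D x \<bullet> e) \<partial>lborel)) (at 0)"
    unfolding \<phi>_def using shift_integral_derivative[OF assms(2,3), of e 0] by simp
  then have "((\<lambda>k. (\<phi> k - \<phi> 0) / k) \<longlongrightarrow> - (\<integral>x. w x * (D x \<bullet> e) \<partial>lborel)) (at 0)"
    by (simp add: DERIV_def)
  then have *: "(\<lambda>n. (\<phi> (X n) - \<phi> 0) / X n) \<longlonglongrightarrow> - (\<integral>x. w x * (D x \<bullet> e) \<partial>lborel)"
  proof (rule filterlim_compose)
    have "X n \<noteq> 0" for n using assms(5)[of n] by simp
    then show "filterlim X (at 0) sequentially"
      using assms(4) by (simp add: filterlim_at)
  qed
  have "\<forall>\<^sub>F n in sequentially. (\<phi> (X n) - \<phi> 0) / X n = (\<integral>x. diff_quot \<Omega> w e (X n) x * \<psi> x \<partial>lborel)"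
    using test_function_eventually_shift_domain[OF assms(1,3,4)]
  proof (rule eventually_mono)
    fix n assume "test_function (shift_domain \<Omega> (X n *\<^sub>R e)) \<psi> D"
    from translation_increment_test[OF assms(2) this]
    have "(\<phi> (X n) - \<phi> 0) / X n
      = (\<integral>x. indicator (shift_domain \<Omega> (X n *\<^sub>R e)) x * (w (x + X n *\<^sub>R e) - w x) * \<psi> x \<partial>lborel) / X n"
      by (simp add: \<phi>_def)
    also have "\<dots> = (\<integral>x. (indicator (shift_domain \<Omega> (X n *\<^sub>R e)) x * (w (x + X n *\<^sub>R e) - w x) * \<psi> x) / X n \<partial>lborel)"
      by (rule integral_divide_zero[symmetric])
    also have "\<dots> = (\<integral>x. diff_quot \<Omega> w e (X n) x * \<psi> x \<partial>lborel)"
      by (simp add: diff_quot_def)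
    finally show "(\<phi> (X n) - \<phi> 0) / X n = (\<integral>x. diff_quot \<Omega> w e (X n) x * \<psi> x \<partial>lborel)" .
  qed
  then show ?thesis by (rule Lim_transform_eventually[OF *])
qed

text \<open>The quotients are bounded in L^2, so convergence against the dense set of test functions
  extends to all f. The error splits into three parts: two replacements of f by
  \<open>\<theta>\<close>, each at most \<open>N * d\<close>, and the convergence for
  \<open>\<theta>\<close>.\<close>

lemma diff_quot_weak_limit:
  fixes \<Omega> :: "'a::euclidean_space set"
  assumes \<Omega>: "open \<Omega>" "bounded \<Omega>" "convex \<Omega>" and wg: "borel_weak_gradient \<Omega> v G"
    and X: "X \<longlonglongrightarrow> (0::real)" "\<And>n. X n > 0"
    and f: "square_integrable lborel f" "\<And>x. x \<notin> \<Omega> \<Longrightarrow> f x = 0"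
  shows "(\<lambda>n. \<integral>x. diff_quot \<Omega> v e (X n) x * f x \<partial>lborel) \<longlonglongrightarrow> (\<integral>x. f x * (G x \<bullet> e) \<partial>lborel)"
proof (rule LIMSEQ_I)
  note vD = borel_weak_gradientD[OF wg]
  define N where "N = norm e * l2norm lborel (\<lambda>x. norm (G x))"
  have N: "N \<ge> 0" by (simp add: N_def l2norm_nonneg)
  have Ge: "square_integrable lborel (\<lambda>x. G x \<bullet> e)" "l2norm lborel (\<lambda>x. G x \<bullet> e) \<le> N"
    unfolding N_def using square_integrable_inner[of G lborel e] vD(2,4) by simp_all
  have dq: "square_integrable lborel (diff_quot \<Omega> v e (X n))" "l2norm lborel (diff_quot \<Omega> v e (X n)) \<le> N" for n
    unfolding N_def by (rule diff_quot_l2[OF \<Omega> wg X(2)])+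
  fix r :: real assume "r > 0"
  define d where "d = r / (3 * (N + 1))"
  have d: "d > 0" using \<open>r > 0\<close> N by (simp add: d_def)
  have Nd: "N * d < r / 3"
    using \<open>r > 0\<close> N by (simp add: d_def field_simps)
  obtain \<theta> E where th: "test_function \<Omega> \<theta> E" "l2norm lborel (\<lambda>x. f x - \<theta> x) < d"
    using test_approxE[OF test_function_dense[OF \<Omega>(1,2) f] d] .
  have ths: "square_integrable lborel \<theta>" by (rule test_function_square_integrable[OF th(1)])
  have sd: "square_integrable lborel (\<lambda>x. f x - \<theta> x)" by (rule square_integrable_diff[OF f(1) ths])
  have vint: "integrable lborel v"
    by (rule square_integrable_imp_integrable_bounded_support[OF vD(1,5) borel_open[OF \<Omega>(1)] \<Omega>(2)])
  have "(\<lambda>n. \<integral>x. diff_quot \<Omega> v e (X n) x * \<theta> x \<partial>lborel) \<longlonglongrightarrow> (\<integral>x. \<theta> x * (G x \<bullet> e) \<partial>lborel)"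
    using diff_quot_test_tendsto[OF \<Omega>(1) vint th(1) X, of e] vD(7)[OF th(1), of e] by simp
  from LIMSEQ_D[OF this, of "r / 3"] \<open>r > 0\<close> obtain no where no: "\<And>n. n \<ge> no \<Longrightarrow>
    norm ((\<integral>x. diff_quot \<Omega> v e (X n) x * \<theta> x \<partial>lborel) - (\<integral>x. \<theta> x * (G x \<bullet> e) \<partial>lborel)) < r / 3"
    by auto
  have small: "\<bar>(\<integral>x. g x * f x \<partial>lborel) - (\<integral>x. g x * \<theta> x \<partial>lborel)\<bar> \<le> N * d"
    if g: "square_integrable lborel g" "l2norm lborel g \<le> N" for g
  proof -
    have "(\<integral>x. g x * f x \<partial>lborel) - (\<integral>x. g x * \<theta> x \<partial>lborel) = (\<integral>x. g x * f x - g x * \<theta> x \<partial>lborel)"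
      by (rule Bochner_Integration.integral_diff[symmetric]) (intro square_integrable_mult g f ths)+
    also have "\<dots> = (\<integral>x. g x * (f x - \<theta> x) \<partial>lborel)" by (simp add: right_diff_distrib)
    finally have "\<bar>(\<integral>x. g x * f x \<partial>lborel) - (\<integral>x. g x * \<theta> x \<partial>lborel)\<bar>
        \<le> l2norm lborel g * l2norm lborel (\<lambda>x. f x - \<theta> x)"
      using l2_Cauchy_Schwarz[OF g(1) sd] by simp
    also have "\<dots> \<le> N * d"
      using th(2) g(2) N by (intro mult_mono l2norm_nonneg) simp_all
    finally show ?thesis .
  qed
  show "\<exists>no. \<forall>n\<ge>no. norm ((\<integral>x. diff_quot \<Omega> v e (X n) x * f x \<partial>lborel) - (\<integral>x. f x * (G x \<bullet> e) \<partial>lborel)) < r"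
  proof (intro exI[of _ no] allI impI)
    fix n assume "n \<ge> no"
    have "\<bar>(\<integral>x. f x * (G x \<bullet> e) \<partial>lborel) - (\<integral>x. \<theta> x * (G x \<bullet> e) \<partial>lborel)\<bar> \<le> N * d"
      using small[OF Ge] by (simp add: mult.commute)
    then show "norm ((\<integral>x. diff_quot \<Omega> v e (X n) x * f x \<partial>lborel) - (\<integral>x. f x * (G x \<bullet> e) \<partial>lborel)) < r"
      using small[OF dq, of n] no[OF \<open>n \<ge> no\<close>] Nd
      by (simp only: real_norm_def abs_le_iff abs_less_iff) linarith
  qed
qed

text \<open>
  Difference quotients of \<open>v\<close> converge weakly to \<open>G \<bullet> e\<close> against all of \<open>L\<^sup>2\<close>, in particular against
  \<open>\<eta>'(v) \<psi>\<close>; this replaces the approximation of \<open>v\<close> by smooth functions.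
\<close>

lemma borel_weak_gradient_chain:
  fixes \<Omega> :: "'a::euclidean_space set"
  assumes \<Omega>: "open \<Omega>" "bounded \<Omega>" "convex \<Omega>" and wg: "borel_weak_gradient \<Omega> v G"
    and \<eta>: "\<eta> 0 = 0" "\<And>s. (\<eta> has_real_derivative \<eta>' s) (at s)" "continuous_on UNIV \<eta>'"
      "\<And>s. \<bar>\<eta>' s\<bar> \<le> B"
  shows "borel_weak_gradient \<Omega> (\<lambda>x. \<eta> (v x)) (\<lambda>x. \<eta>' (v x) *\<^sub>R G x)"
proof -
  note vD = borel_weak_gradientD[OF wg]
  have lip: "\<bar>\<eta> a - \<eta> b\<bar> \<le> B * \<bar>a - b\<bar>" for a b
  proof -
    have "norm (\<eta> a - \<eta> b) \<le> B * norm (a - b)"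
      by (rule field_differentiable_bound[of UNIV \<eta> \<eta>']) (use \<eta>(2,4) in simp_all)
    then show ?thesis by simp
  qed
  have em: "\<eta> \<in> borel_measurable borel" "\<eta>' \<in> borel_measurable borel"
  proof -
    have "continuous_on UNIV \<eta>"
      by (intro continuous_at_imp_continuous_on ballI DERIV_isCont[OF \<eta>(2)])
    then show "\<eta> \<in> borel_measurable borel" by (rule borel_measurable_continuous_onI)
    show "\<eta>' \<in> borel_measurable borel" by (rule borel_measurable_continuous_onI[OF \<eta>(3)])
  qed
  have B: "B \<ge> 0" using \<eta>(4)[of 0] by simp
  have wm: "(\<lambda>x. \<eta> (v x)) \<in> borel_measurable borel" "(\<lambda>x. \<eta>' (v x)) \<in> borel_measurable borel"
    using measurable_compose[OF vD(3) em(1)] measurable_compose[OF vD(3) em(2)] by simp_all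
  have si1: "square_integrable lborel (\<lambda>x. \<eta> (v x))"
  proof (rule square_integrable_bound[OF square_integrable_cmult[OF vD(1), of B]])
    show "(\<lambda>x. \<eta> (v x)) \<in> borel_measurable lborel" using wm by simp
    have "\<bar>\<eta> (v x)\<bar> \<le> \<bar>B * v x\<bar>" for x
      using lip[of "v x" 0] \<eta>(1) B by (simp add: abs_mult)
    then show "AE x in lborel. \<bar>\<eta> (v x)\<bar> \<le> \<bar>B * v x\<bar>" by (rule AE_I2)
  qed
  have Hm: "(\<lambda>x. \<eta>' (v x) *\<^sub>R G x) \<in> borel_measurable borel"
    using wm(2) vD(2) by simp
  have si2: "square_integrable lborel (\<lambda>x. norm (\<eta>' (v x) *\<^sub>R G x))"
  proof (rule square_integrable_bound[OF square_integrable_cmult[OF vD(4), of B]])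
    have "(\<lambda>x. \<eta>' (v x) *\<^sub>R G x) \<in> borel_measurable lborel" using Hm by simp
    then show "(\<lambda>x. norm (\<eta>' (v x) *\<^sub>R G x)) \<in> borel_measurable lborel"
      by (rule measurable_compose[OF _ borel_measurable_norm])
    have "\<bar>norm (\<eta>' (v x) *\<^sub>R G x)\<bar> \<le> \<bar>B * norm (G x)\<bar>" for x
      using mult_right_mono[OF \<eta>(4)[of "v x"], of "norm (G x)"] B by simp
    then show "AE x in lborel. \<bar>norm (\<eta>' (v x) *\<^sub>R G x)\<bar> \<le> \<bar>B * norm (G x)\<bar>" by (rule AE_I2)
  qed
  have main: "(\<integral>x. \<eta> (v x) * (D x \<bullet> e) \<partial>lborel) = - (\<integral>x. \<psi> x * (\<eta>' (v x) *\<^sub>R G x \<bullet> e) \<partial>lborel)"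
    if \<psi>: "test_function \<Omega> \<psi> D" for \<psi> D e
  proof -
    define X where "X n = 1 / real (Suc n)" for n
    have X0: "X \<longlonglongrightarrow> 0" unfolding X_def by (rule LIMSEQ_Suc[OF lim_1_over_n])
    have Xp: "X n > 0" for n by (simp add: X_def)
    let ?N = "norm e * l2norm lborel (\<lambda>x. norm (G x))"
    let ?U = "\<lambda>n. shift_domain \<Omega> (X n *\<^sub>R e)"
    let ?i = "\<lambda>n x. indicator (?U n) x * (v (x + X n *\<^sub>R e) - v x) :: real"
    \<comment> \<open>The composition \<eta>'(v) is controlled pointwise, so convergence almost
      everywhere is required. The translation estimate gives increments of size
      \<open>X n * ?N\<close> in L^2, hence such convergence along a subsequence.\<close>
    obtain r :: "nat \<Rightarrow> nat" where r: "strict_mono r" "AE x in lborel. (\<lambda>n. ?i (r n) x) \<longlonglongrightarrow> 0"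
    proof -
      have "(\<lambda>n. l2norm lborel (?i n)) \<longlonglongrightarrow> 0"
      proof (rule tendsto_sandwich[OF _ _ tendsto_const])
        show "\<forall>\<^sub>F n in sequentially. 0 \<le> l2norm lborel (?i n)" by (simp add: l2norm_nonneg)
        have "l2norm lborel (?i n) \<le> X n * ?N" for n
          using translation_estimate(2)[OF \<Omega> wg, of "X n *\<^sub>R e"] Xp[of n] by (simp add: mult.assoc)
        then show "\<forall>\<^sub>F n in sequentially. l2norm lborel (?i n) \<le> X n * ?N" by simp
        show "(\<lambda>n. X n * ?N) \<longlonglongrightarrow> 0" using tendsto_mult_right[OF X0, of ?N] by simp
      qed
      from l2_tendsto_AE_subseq[OF translation_estimate(1)[OF \<Omega> wg] this] show thesis
        using that by blast
    qed
    define Y where "Y n = X (r n)" for n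
    have Y0: "Y \<longlonglongrightarrow> 0" unfolding Y_def using LIMSEQ_subseq_LIMSEQ[OF X0 r(1)] by (simp add: o_def)
    have Yp: "Y n > 0" for n by (simp add: Y_def Xp)
    have ae: "AE x in lborel. (\<lambda>n. indicator (shift_domain \<Omega> (Y n *\<^sub>R e)) x * (v (x + Y n *\<^sub>R e) - v x)) \<longlonglongrightarrow> 0"
      using r(2) unfolding Y_def .
    \<comment> \<open>The divided difference of \<open>\<eta>\<close> between the two values of v,
      completed by the derivative on the diagonal: the difference quotient of \<eta>(v) is exactly
      \<open>a n x\<close> times that of v.\<close>
    define a where "a n x = (if v (x + Y n *\<^sub>R e) = v x then \<eta>' (v x)
       else (\<eta> (v (x + Y n *\<^sub>R e)) - \<eta> (v x)) / (v (x + Y n *\<^sub>R e) - v x))" for n x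
    have ab: "\<bar>a n x\<bar> \<le> B" for n x
      using \<eta>(4)[of "v x"] lip[of "v (x + Y n *\<^sub>R e)" "v x"]
      by (simp add: a_def abs_divide pos_divide_le_eq)
    have vs: "(\<lambda>x. v (x + Y n *\<^sub>R e)) \<in> borel_measurable borel" for n
      by (rule measurable_compose[OF _ vD(3)]) simp
    have am: "a n \<in> borel_measurable borel" for n
    proof -
      have "(\<lambda>x. \<eta> (v (x + Y n *\<^sub>R e))) \<in> borel_measurable borel"
        by (rule measurable_compose[OF vs em(1)])
      then show ?thesis unfolding a_def using vs[of n] wm vD(3) by simp
    qed
    have \<psi>m: "\<psi> \<in> borel_measurable borel" by (rule test_function_measurable[OF \<psi>])
    have \<psi>s: "square_integrable lborel \<psi>" by (rule test_function_square_integrable[OF \<psi>])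
    have \<psi>z: "\<psi> x = 0" if "x \<notin> \<Omega>" for x using test_functionD(3)[OF \<psi>] that by blast
    have bs: "square_integrable lborel (\<lambda>x. b x * \<psi> x)" if "b \<in> borel_measurable borel" "\<And>x. \<bar>b x\<bar> \<le> B" for b
    proof (rule square_integrable_bound[OF square_integrable_cmult[OF \<psi>s, of B]])
      show "(\<lambda>x. b x * \<psi> x) \<in> borel_measurable lborel" using that(1) \<psi>m by simp
      have "\<bar>b x * \<psi> x\<bar> \<le> \<bar>B * \<psi> x\<bar>" for x
        using mult_right_mono[OF that(2)[of x], of "\<bar>\<psi> x\<bar>"] B by (simp add: abs_mult)
      then show "AE x in lborel. \<bar>b x * \<psi> x\<bar> \<le> \<bar>B * \<psi> x\<bar>" by (rule AE_I2)
    qed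
    let ?f = "\<lambda>x. \<eta>' (v x) * \<psi> x"
    have fs: "square_integrable lborel ?f" by (rule bs[OF wm(2) \<eta>(4)])
    have as: "square_integrable lborel (\<lambda>x. a n x * \<psi> x)" for n by (rule bs[OF am ab])
    have "(\<lambda>n. l2norm lborel (\<lambda>x. a n x * \<psi> x - ?f x)) \<longlonglongrightarrow> 0"
    proof (rule l2_tendsto_dominated)
      show "square_integrable lborel (\<lambda>x. (2 * B) * \<bar>\<psi> x\<bar>)"
        by (rule square_integrable_cmult[OF square_integrable_abs[OF \<psi>s]])
      show "(\<lambda>x. a n x * \<psi> x - ?f x) \<in> borel_measurable lborel" for n
        using am[of n] \<psi>m wm by simp
      have "\<bar>a n x * \<psi> x - ?f x\<bar> \<le> (2 * B) * \<bar>\<psi> x\<bar>" for n x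
      proof -
        have "\<bar>a n x * \<psi> x - ?f x\<bar> = \<bar>a n x - \<eta>' (v x)\<bar> * \<bar>\<psi> x\<bar>"
          by (simp add: abs_mult[symmetric] left_diff_distrib)
        also have "\<dots> \<le> (2 * B) * \<bar>\<psi> x\<bar>"
          using ab[of n x] \<eta>(4)[of "v x"] by (intro mult_right_mono) simp_all
        finally show ?thesis .
      qed
      then show "AE x in lborel. \<bar>a n x * \<psi> x - ?f x\<bar> \<le> (2 * B) * \<bar>\<psi> x\<bar>" for n
        by (rule AE_I2)
      show "AE x in lborel. (\<lambda>n. a n x * \<psi> x - ?f x) \<longlonglongrightarrow> 0"
        using ae
      proof (rule AE_mp, intro AE_I2 impI)
        fix x assume lim: "(\<lambda>n. indicator (shift_domain \<Omega> (Y n *\<^sub>R e)) x * (v (x + Y n *\<^sub>R e) - v x)) \<longlonglongrightarrow> 0"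
        show "(\<lambda>n. a n x * \<psi> x - ?f x) \<longlonglongrightarrow> 0"
        proof (cases "x \<in> \<Omega>")
          case False
          then show ?thesis using \<psi>z[of x] by simp
        next
          case True
          have "(\<lambda>n. x + Y n *\<^sub>R e) \<longlonglongrightarrow> x + 0 *\<^sub>R e"
            by (intro tendsto_add tendsto_const tendsto_scaleR Y0)
          then have "(\<lambda>n. x + Y n *\<^sub>R e) \<longlonglongrightarrow> x" by simp
          then have "\<forall>\<^sub>F n in sequentially. x + Y n *\<^sub>R e \<in> \<Omega>"
            by (rule topological_tendstoD[OF _ \<Omega>(1) True])
          then have "\<forall>\<^sub>F n in sequentially. indicator (shift_domain \<Omega> (Y n *\<^sub>R e)) x * (v (x + Y n *\<^sub>R e) - v x)
              = v (x + Y n *\<^sub>R e) - v x"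
            by (rule eventually_mono) (use True in simp)
          from Lim_transform_eventually[OF lim this] have vl: "(\<lambda>n. v (x + Y n *\<^sub>R e) - v x) \<longlonglongrightarrow> 0" .
          define q where "q k = (if k = 0 then \<eta>' (v x) else (\<eta> (v x + k) - \<eta> (v x)) / k)" for k
          have "((\<lambda>k. (\<eta> (v x + k) - \<eta> (v x)) / k) \<longlongrightarrow> \<eta>' (v x)) (at 0)"
            using \<eta>(2)[of "v x"] by (simp add: DERIV_def)
          moreover have "((\<lambda>k. (\<eta> (v x + k) - \<eta> (v x)) / k) \<longlongrightarrow> \<eta>' (v x)) (at 0)
              \<longleftrightarrow> (q \<longlongrightarrow> \<eta>' (v x)) (at 0)"
            by (rule LIM_equal) (simp add: q_def)
          ultimately have "(q \<longlongrightarrow> q 0) (at 0)" by (simp add: q_def)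
          then have "isCont q 0" by (simp add: isCont_def)
          then have "(\<lambda>n. q (v (x + Y n *\<^sub>R e) - v x)) \<longlonglongrightarrow> q 0"
            by (rule isCont_tendsto_compose[OF _ vl])
          moreover have "q (v (x + Y n *\<^sub>R e) - v x) = a n x" for n
            by (simp add: q_def a_def)
          ultimately have "(\<lambda>n. a n x) \<longlonglongrightarrow> \<eta>' (v x)" by (simp add: q_def)
          then have "(\<lambda>n. a n x * \<psi> x - ?f x) \<longlonglongrightarrow> ?f x - ?f x"
            by (intro tendsto_diff tendsto_mult tendsto_const)
          then show ?thesis by simp
        qed
      qed
    qed
    note al = this
    \<comment> \<open>Product of a weakly and a strongly convergent sequence: the quotients converge
      against the fixed \<open>?f\<close>, and replacing \<open>?f\<close> by
      \<open>a n x * \<psi> x\<close> costs at most \<open>?N\<close> times a null sequence.\<close>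
    have "(\<lambda>n. \<integral>x. diff_quot \<Omega> v e (Y n) x * ?f x \<partial>lborel) \<longlonglongrightarrow> (\<integral>x. ?f x * (G x \<bullet> e) \<partial>lborel)"
      by (rule diff_quot_weak_limit[OF \<Omega> wg Y0 Yp fs]) (simp add: \<psi>z)
    moreover have "(\<lambda>n. (\<integral>x. diff_quot \<Omega> v e (Y n) x * (a n x * \<psi> x) \<partial>lborel)
        - (\<integral>x. diff_quot \<Omega> v e (Y n) x * ?f x \<partial>lborel)) \<longlonglongrightarrow> 0"
    proof (rule Lim_null_comparison)
      show "\<forall>\<^sub>F n in sequentially. norm ((\<integral>x. diff_quot \<Omega> v e (Y n) x * (a n x * \<psi> x) \<partial>lborel)
        - (\<integral>x. diff_quot \<Omega> v e (Y n) x * ?f x \<partial>lborel)) \<le> ?N * l2norm lborel (\<lambda>x. a n x * \<psi> x - ?f x)"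
      proof (rule always_eventually, rule allI)
        fix n
        note dq = diff_quot_l2[OF \<Omega> wg Yp[of n], of e]
        have "(\<integral>x. diff_quot \<Omega> v e (Y n) x * (a n x * \<psi> x) \<partial>lborel) - (\<integral>x. diff_quot \<Omega> v e (Y n) x * ?f x \<partial>lborel)
          = (\<integral>x. diff_quot \<Omega> v e (Y n) x * (a n x * \<psi> x) - diff_quot \<Omega> v e (Y n) x * ?f x \<partial>lborel)"
          by (rule Bochner_Integration.integral_diff[symmetric]) (rule square_integrable_mult[OF dq(1) as] square_integrable_mult[OF dq(1) fs])+
        also have "\<dots> = (\<integral>x. diff_quot \<Omega> v e (Y n) x * (a n x * \<psi> x - ?f x) \<partial>lborel)"
          by (simp only: right_diff_distrib)
        finally have "norm ((\<integral>x. diff_quot \<Omega> v e (Y n) x * (a n x * \<psi> x) \<partial>lborel) - (\<integral>x. diff_quot \<Omega> v e (Y n) x * ?f x \<partial>lborel))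
          \<le> l2norm lborel (diff_quot \<Omega> v e (Y n)) * l2norm lborel (\<lambda>x. a n x * \<psi> x - ?f x)"
          using l2_Cauchy_Schwarz[OF dq(1) square_integrable_diff[OF as fs]] by simp
        also have "\<dots> \<le> ?N * l2norm lborel (\<lambda>x. a n x * \<psi> x - ?f x)"
          by (rule mult_right_mono[OF dq(2) l2norm_nonneg])
        finally show "norm ((\<integral>x. diff_quot \<Omega> v e (Y n) x * (a n x * \<psi> x) \<partial>lborel)
        - (\<integral>x. diff_quot \<Omega> v e (Y n) x * ?f x \<partial>lborel)) \<le> ?N * l2norm lborel (\<lambda>x. a n x * \<psi> x - ?f x)" .
      qed
      show "(\<lambda>n. ?N * l2norm lborel (\<lambda>x. a n x * \<psi> x - ?f x)) \<longlonglongrightarrow> 0"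
        using tendsto_mult_left[OF al, of ?N] by simp
    qed
    ultimately have "(\<lambda>n. \<integral>x. diff_quot \<Omega> v e (Y n) x * (a n x * \<psi> x) \<partial>lborel) \<longlonglongrightarrow> (\<integral>x. ?f x * (G x \<bullet> e) \<partial>lborel)"
      using tendsto_add by fastforce
    moreover have "diff_quot \<Omega> v e (Y n) x * (a n x * \<psi> x) = diff_quot \<Omega> (\<lambda>x. \<eta> (v x)) e (Y n) x * \<psi> x" for n x
      by (simp add: diff_quot_def a_def)
    ultimately have "(\<lambda>n. \<integral>x. diff_quot \<Omega> (\<lambda>x. \<eta> (v x)) e (Y n) x * \<psi> x \<partial>lborel) \<longlonglongrightarrow> (\<integral>x. ?f x * (G x \<bullet> e) \<partial>lborel)"
      by simp
    moreover have "integrable lborel (\<lambda>x. \<eta> (v x))"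
      by (rule square_integrable_imp_integrable_bounded_support[OF si1 _ borel_open[OF \<Omega>(1)] \<Omega>(2)])
        (simp add: vD(5) \<eta>(1))
    from diff_quot_test_tendsto[OF \<Omega>(1) this \<psi> Y0 Yp, of e]
    have "(\<lambda>n. \<integral>x. diff_quot \<Omega> (\<lambda>x. \<eta> (v x)) e (Y n) x * \<psi> x \<partial>lborel) \<longlonglongrightarrow> - (\<integral>x. \<eta> (v x) * (D x \<bullet> e) \<partial>lborel)" .
    ultimately have "(\<integral>x. ?f x * (G x \<bullet> e) \<partial>lborel) = - (\<integral>x. \<eta> (v x) * (D x \<bullet> e) \<partial>lborel)"
      by (rule LIMSEQ_unique)
    then show ?thesis by (simp add: mult_ac)
  qed
  show ?thesis
    unfolding borel_weak_gradient_def
    by (intro conjI allI impI si1 si2 Hm main) (simp_all add: vD(5,6) \<eta>(1))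
qed

section \<open>Sup bounds for the Neumann problem\<close>

lemma emeasure_lborel_affine:
  fixes S :: "'a::euclidean_space set"
  assumes "S \<in> sets borel" "m \<noteq> 0"
  shows "{h. x + (1 / m) *\<^sub>R h \<in> S} \<in> sets borel"
    "emeasure lborel {h. x + (1 / m) *\<^sub>R h \<in> S} = ennreal (\<bar>m\<bar> ^ DIM('a)) * emeasure lborel S"
proof -
  have "(\<lambda>h. x + (1 / m) *\<^sub>R h) \<in> borel_measurable borel" by simp
  from measurable_sets[OF this assms(1)] show meas: "{h. x + (1 / m) *\<^sub>R h \<in> S} \<in> sets borel"
    by (simp add: vimage_def)
  have "{h. x + (1 / m) *\<^sub>R h \<in> S} = (\<lambda>z. m *\<^sub>R z + - (m *\<^sub>R x)) ` S"
  proof (intro set_eqI iffI)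
    fix h assume "h \<in> {h. x + (1 / m) *\<^sub>R h \<in> S}"
    then show "h \<in> (\<lambda>z. m *\<^sub>R z + - (m *\<^sub>R x)) ` S"
      using assms(2) by (intro image_eqI[of _ _ "x + (1 / m) *\<^sub>R h"]) (simp_all add: scaleR_add_right)
  next
    fix h assume "h \<in> (\<lambda>z. m *\<^sub>R z + - (m *\<^sub>R x)) ` S"
    then show "h \<in> {h. x + (1 / m) *\<^sub>R h \<in> S}"
      using assms(2) by (auto simp: scaleR_diff_right)
  qed
  then have "emeasure lebesgue {h. x + (1 / m) *\<^sub>R h \<in> S} = ennreal (\<bar>m\<bar> ^ DIM('a)) * emeasure lebesgue S"
    using emeasure_lebesgue_affine[of m "- (m *\<^sub>R x)" S] by simp
  then show "emeasure lborel {h. x + (1 / m) *\<^sub>R h \<in> S} = ennreal (\<bar>m\<bar> ^ DIM('a)) * emeasure lborel S"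
    using meas assms(1) by (simp add: emeasure_completion)
qed

lemma l2norm_nn_integral:
  assumes "square_integrable M f"
  shows "(\<integral>\<^sup>+x. ennreal ((f x)\<^sup>2) \<partial>M) = ennreal ((l2norm M f)\<^sup>2)"
  unfolding l2norm_power2
  by (rule nn_integral_eq_integral[OF square_integrableD(2)[OF assms]]) simp

text \<open>
  The increments of \<open>w\<close> from \<open>x\<close> into the dilate \<open>x + r(\<Omega> - x) \<subseteq> \<Omega>\<close> are averaged over \<open>x\<close>: they are
  bounded above by the gradient, and below by \<open>w\<close> itself, because \<open>w\<close> vanishes on at least
  half of the dilate.  Choosing \<open>r\<close> just large enough for this gives the Faber--Krahn inequality.
\<close>

lemma double_increment_upper:
  fixes \<Omega> :: "'a::euclidean_space set"
  assumes \<Omega>: "open \<Omega>" "bounded \<Omega>" "convex \<Omega>" and wg: "borel_weak_gradient \<Omega> w H"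
    and M: "\<And>x. x \<in> \<Omega> \<Longrightarrow> norm x \<le> M" and r: "0 < r" "r \<le> 1"
  shows "(\<integral>\<^sup>+h. (\<integral>\<^sup>+x. ennreal (indicator {x \<in> \<Omega>. x + (1 / r) *\<^sub>R h \<in> \<Omega>} x * (w (x + h) - w x)\<^sup>2) \<partial>lborel) \<partial>lborel)
    \<le> ennreal ((2 * M * r)\<^sup>2 * (l2norm lborel (\<lambda>x. norm (H x)))\<^sup>2 * r ^ DIM('a) * measure lborel (cball (0::'a) (2 * M)))"
proof -
  let ?N = "l2norm lborel (\<lambda>x. norm (H x))"
  have cb: "{h. 0 + (1 / r) *\<^sub>R h \<in> cball (0::'a) (2 * M)} = cball 0 (2 * M * r)"
    using r by (auto simp: field_simps)
  \<comment> \<open>Two points of \<Omega> are at distance at most 2M, so only displacements of norm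
    at most 2Mr contribute, a ball whose volume scales like r^d.\<close>
  have inner: "(\<integral>\<^sup>+x. ennreal (indicator {x \<in> \<Omega>. x + (1 / r) *\<^sub>R h \<in> \<Omega>} x * (w (x + h) - w x)\<^sup>2) \<partial>lborel)
      \<le> ennreal ((2 * M * r)\<^sup>2 * ?N\<^sup>2) * indicator (cball (0::'a) (2 * M * r)) h" for h
  proof (cases "h \<in> cball 0 (2 * M * r)")
    case True
    note te = translation_estimate[OF \<Omega> wg, of h]
    let ?f = "\<lambda>x. indicator (shift_domain \<Omega> h) x * (w (x + h) - w x)"
    have sub: "x \<in> shift_domain \<Omega> h" if "x \<in> \<Omega>" "x + (1 / r) *\<^sub>R h \<in> \<Omega>" for x
    proof -
      have "(1 - r) *\<^sub>R x + r *\<^sub>R (x + (1 / r) *\<^sub>R h) \<in> \<Omega>"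
        using \<Omega>(3) r that by (simp add: convex_alt)
      then show ?thesis using r that(1) by (simp add: algebra_simps)
    qed
    have le: "indicator {x \<in> \<Omega>. x + (1 / r) *\<^sub>R h \<in> \<Omega>} x * (w (x + h) - w x)\<^sup>2 \<le> (?f x)\<^sup>2" for x
    proof (cases "x \<in> {x \<in> \<Omega>. x + (1 / r) *\<^sub>R h \<in> \<Omega>}")
      case True
      then have "x \<in> shift_domain \<Omega> h" using sub[of x] by simp
      then show ?thesis using True by simp
    qed simp
    have "(\<integral>\<^sup>+x. ennreal (indicator {x \<in> \<Omega>. x + (1 / r) *\<^sub>R h \<in> \<Omega>} x * (w (x + h) - w x)\<^sup>2) \<partial>lborel)
        \<le> (\<integral>\<^sup>+x. ennreal ((?f x)\<^sup>2) \<partial>lborel)"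
      by (rule nn_integral_mono) (rule ennreal_leI[OF le])
    also have "\<dots> = ennreal ((l2norm lborel ?f)\<^sup>2)" by (rule l2norm_nn_integral[OF te(1)])
    also have "\<dots> \<le> ennreal ((2 * M * r)\<^sup>2 * ?N\<^sup>2)"
    proof (rule ennreal_leI)
      have "l2norm lborel ?f \<le> norm h * ?N" by (rule te(2))
      also have "\<dots> \<le> (2 * M * r) * ?N"
        using True by (intro mult_right_mono l2norm_nonneg) simp
      finally have "(l2norm lborel ?f)\<^sup>2 \<le> ((2 * M * r) * ?N)\<^sup>2"
        by (rule power_mono[OF _ l2norm_nonneg])
      then show "(l2norm lborel ?f)\<^sup>2 \<le> (2 * M * r)\<^sup>2 * ?N\<^sup>2" by (simp add: power_mult_distrib)
    qed
    finally show ?thesis using True by simp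
  next
    case False
    have "\<not> (x \<in> \<Omega> \<and> x + (1 / r) *\<^sub>R h \<in> \<Omega>)" for x
    proof
      assume "x \<in> \<Omega> \<and> x + (1 / r) *\<^sub>R h \<in> \<Omega>"
      then have "norm (x + (1 / r) *\<^sub>R h) \<le> M" "norm x \<le> M" using M by simp_all
      then have "norm ((x + (1 / r) *\<^sub>R h) - x) \<le> M + M"
        using norm_triangle_ineq4[of "x + (1 / r) *\<^sub>R h" x] by linarith
      then have "norm h \<le> 2 * M * r" using r by (simp add: field_simps)
      then show False using False by simp
    qed
    then have "{x \<in> \<Omega>. x + (1 / r) *\<^sub>R h \<in> \<Omega>} = {}" by simp
    then show ?thesis by simp
  qed
  have "(\<integral>\<^sup>+h. (\<integral>\<^sup>+x. ennreal (indicator {x \<in> \<Omega>. x + (1 / r) *\<^sub>R h \<in> \<Omega>} x * (w (x + h) - w x)\<^sup>2) \<partial>lborel) \<partial>lborel)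
     \<le> (\<integral>\<^sup>+h. ennreal ((2 * M * r)\<^sup>2 * ?N\<^sup>2) * indicator (cball (0::'a) (2 * M * r)) h \<partial>lborel)"
    by (rule nn_integral_mono) (rule inner)
  also have "\<dots> = ennreal ((2 * M * r)\<^sup>2 * ?N\<^sup>2) * emeasure lborel (cball (0::'a) (2 * M * r))"
    by (rule nn_integral_cmult_indicator) simp
  also have "emeasure lborel (cball (0::'a) (2 * M * r)) = ennreal (r ^ DIM('a)) * emeasure lborel (cball (0::'a) (2 * M))"
    using emeasure_lborel_affine(2)[of "cball (0::'a) (2 * M)" r 0] r unfolding cb by simp
  also have "emeasure lborel (cball (0::'a) (2 * M)) = ennreal (measure lborel (cball (0::'a) (2 * M)))"
    using emeasure_lborel_cball_finite[of "0::'a" "2 * M"]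
    by (intro emeasure_eq_ennreal_measure) (simp add: top.not_eq_extremum)
  finally show ?thesis
    using r by (simp add: ennreal_mult'[symmetric] ennreal_mult[symmetric] mult_ac)
qed

lemma double_increment_lower:
  fixes \<Omega> :: "'a::euclidean_space set"
  assumes \<Omega>: "open \<Omega>" "bounded \<Omega>" and w: "square_integrable lborel w" "\<And>x. x \<notin> \<Omega> \<Longrightarrow> w x = 0"
    and r: "0 < r" and E: "E = {x. w x \<noteq> 0}" and m: "2 * measure lborel E \<le> r ^ DIM('a) * measure lborel \<Omega>"
  shows "ennreal (measure lborel E * (l2norm lborel w)\<^sup>2) \<le>
    (\<integral>\<^sup>+x. (\<integral>\<^sup>+h. ennreal (indicator {x \<in> \<Omega>. x + (1 / r) *\<^sub>R h \<in> \<Omega>} x * (w (x + h) - w x)\<^sup>2) \<partial>lborel) \<partial>lborel)"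
proof -
  have wm: "w \<in> borel_measurable borel" using square_integrableD(1)[OF w(1)] by simp
  have Em: "E \<in> sets borel" unfolding E using measurable_sets[OF wm, of "- {0}"] by (simp add: vimage_def)
  have Esub: "E \<subseteq> \<Omega>" using w(2) E by blast
  have Om: "\<Omega> \<in> sets borel" using \<Omega>(1) by simp
  have fin: "emeasure lborel \<Omega> = ennreal (measure lborel \<Omega>)" "emeasure lborel E = ennreal (measure lborel E)"
    using emeasure_bounded_finite[OF \<Omega>(2)] emeasure_bounded_finite[OF bounded_subset[OF \<Omega>(2) Esub]]
    by (simp_all add: emeasure_eq_ennreal_measure)
  have inner: "ennreal (measure lborel E) * ennreal ((w x)\<^sup>2) \<le>
      (\<integral>\<^sup>+h. ennreal (indicator {x \<in> \<Omega>. x + (1 / r) *\<^sub>R h \<in> \<Omega>} x * (w (x + h) - w x)\<^sup>2) \<partial>lborel)" for x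
  proof (cases "x \<in> \<Omega>")
    case True
    \<comment> \<open>\<open>?A\<close> consists of the displacements into the dilate and has
      measure r^d |\<Omega>| >= 2 |E|; \<open>?B\<close> consists of those that land where w is
      nonzero and has measure |E|. On \<open>?A - ?B\<close>, of measure at least |E|, the increment
      is exactly -w(x).\<close>
    let ?A = "{h. x + (1 / r) *\<^sub>R h \<in> \<Omega>}" and ?B = "{h. x + (1 / 1) *\<^sub>R h \<in> E}"
    note A = emeasure_lborel_affine[OF Om, of r x]
    note B = emeasure_lborel_affine[OF Em, of 1 x]
    have A': "?A \<in> sets borel" "emeasure lborel ?A = ennreal (r ^ DIM('a) * measure lborel \<Omega>)"
      using A r fin by (simp_all add: ennreal_mult[symmetric])
    have B': "?B \<in> sets borel" "emeasure lborel ?B = ennreal (measure lborel E)"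
      using B fin by simp_all
    have "emeasure lborel ?A \<le> emeasure lborel ((?A - ?B) \<union> ?B)"
      using A' B' by (intro emeasure_mono) auto
    also have "\<dots> \<le> emeasure lborel (?A - ?B) + emeasure lborel ?B"
      using A' B' by (intro emeasure_subadditive) auto
    finally have "ennreal (r ^ DIM('a) * measure lborel \<Omega>) \<le> emeasure lborel (?A - ?B) + ennreal (measure lborel E)"
      using A' B' by simp
    moreover have "ennreal (measure lborel E) + ennreal (measure lborel E) \<le> ennreal (r ^ DIM('a) * measure lborel \<Omega>)"
      using m by (simp add: ennreal_plus[symmetric] ennreal_leI del: ennreal_plus)
    ultimately have "ennreal (measure lborel E) + ennreal (measure lborel E) \<le> emeasure lborel (?A - ?B) + ennreal (measure lborel E)"
      by (rule order_trans[rotated])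
    then have ge: "ennreal (measure lborel E) \<le> emeasure lborel (?A - ?B)"
      by (simp add: ennreal_add_left_cancel_le add.commute)
    have "ennreal (measure lborel E) * ennreal ((w x)\<^sup>2) \<le> ennreal ((w x)\<^sup>2) * emeasure lborel (?A - ?B)"
      using mult_right_mono[OF ge, of "ennreal ((w x)\<^sup>2)"] by (simp add: mult.commute)
    also have "\<dots> = (\<integral>\<^sup>+h. ennreal ((w x)\<^sup>2) * indicator (?A - ?B) h \<partial>lborel)"
      using A' B' by (intro nn_integral_cmult_indicator[symmetric]) auto
    also have "\<dots> \<le> (\<integral>\<^sup>+h. ennreal (indicator {x \<in> \<Omega>. x + (1 / r) *\<^sub>R h \<in> \<Omega>} x * (w (x + h) - w x)\<^sup>2) \<partial>lborel)"
    proof (rule nn_integral_mono)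
      fix h :: 'a
      show "ennreal ((w x)\<^sup>2) * indicator (?A - ?B) h
        \<le> ennreal (indicator {x \<in> \<Omega>. x + (1 / r) *\<^sub>R h \<in> \<Omega>} x * (w (x + h) - w x)\<^sup>2)"
      proof (cases "h \<in> ?A - ?B")
        case h: True
        then have "w (x + h) = 0" using E by simp
        then show ?thesis using h True by simp
      qed simp
    qed
    finally show ?thesis .
  qed (simp add: w(2))
  have "ennreal (measure lborel E * (l2norm lborel w)\<^sup>2) = ennreal (measure lborel E) * (\<integral>\<^sup>+x. ennreal ((w x)\<^sup>2) \<partial>lborel)"
    unfolding l2norm_nn_integral[OF w(1)] by (simp add: ennreal_mult)
  also have "\<dots> = (\<integral>\<^sup>+x. ennreal (measure lborel E) * ennreal ((w x)\<^sup>2) \<partial>lborel)"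
    by (rule nn_integral_cmult[symmetric]) (use wm in simp)
  also have "\<dots> \<le> (\<integral>\<^sup>+x. (\<integral>\<^sup>+h. ennreal (indicator {x \<in> \<Omega>. x + (1 / r) *\<^sub>R h \<in> \<Omega>} x * (w (x + h) - w x)\<^sup>2) \<partial>lborel) \<partial>lborel)"
    by (rule nn_integral_mono) (rule inner)
  finally show ?thesis .
qed

lemma faber_krahn:
  fixes \<Omega> :: "'a::euclidean_space set"
  assumes \<Omega>: "open \<Omega>" "bounded \<Omega>" "convex \<Omega>" "\<Omega> \<noteq> {}"
  shows "\<exists>C>0. \<forall>w H. borel_weak_gradient \<Omega> w H \<and> measure lborel {x. w x \<noteq> 0} \<le> measure lborel \<Omega> / 2 \<longrightarrow>
    l2norm lborel w \<le> C * measure lborel {x. w x \<noteq> 0} powr (1 / DIM('a)) * l2norm lborel (\<lambda>x. norm (H x))"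
proof -
  obtain M0 where M0: "\<And>x. x \<in> \<Omega> \<Longrightarrow> norm x \<le> M0" using \<Omega>(2) unfolding bounded_iff by blast
  define M where "M = max M0 1"
  have M: "\<And>x. x \<in> \<Omega> \<Longrightarrow> norm x \<le> M" "M > 0" using M0 by (auto simp: M_def le_max_iff_disj)
  define V where "V = measure lborel \<Omega>"
  have "\<not> negligible \<Omega>" by (rule open_not_negligible[OF \<Omega>(1,4)])
  then have "emeasure lborel \<Omega> \<noteq> 0"
    using negligible_iff_emeasure0[of \<Omega>] \<Omega>(1) by simp
  moreover have "emeasure lborel \<Omega> = ennreal V"
    unfolding V_def using emeasure_bounded_finite[OF \<Omega>(2)]
    by (intro emeasure_eq_ennreal_measure) (simp add: top.not_eq_extremum)
  ultimately have V: "V > 0"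
    by (simp add: zero_less_measure_iff V_def)
  define \<beta> where "\<beta> = measure lborel (cball (0::'a) (2 * M))"
  let ?d = "DIM('a)"
  define K where "K = (2 * M)\<^sup>2 * \<beta> * (2 / V)"
  have K: "K \<ge> 0" using V by (simp add: K_def \<beta>_def)
  define C where "C = sqrt K * (2 / V) powr (1 / ?d) + 1"
  have C: "C > 0" using K by (simp add: C_def add_nonneg_pos)
  show ?thesis
  proof (intro exI[of _ C] conjI C allI impI)
    fix w H assume A: "borel_weak_gradient \<Omega> w H \<and> measure lborel {x. w x \<noteq> 0} \<le> measure lborel \<Omega> / 2"
    then have wg: "borel_weak_gradient \<Omega> w H" by simp
    note wD = borel_weak_gradientD[OF wg]
    define E where "E = {x. w x \<noteq> 0}"
    define m where "m = measure lborel E"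
    define N where "N = l2norm lborel (\<lambda>x. norm (H x))"
    have N0: "N \<ge> 0" by (simp add: N_def l2norm_nonneg)
    have mV: "m \<le> V / 2" "m \<ge> 0" using A by (simp_all add: m_def E_def V_def)
    have "l2norm lborel w \<le> C * m powr (1 / ?d) * N"
    proof (cases "m = 0")
      \<comment> \<open>The right-hand side is 0 here because \<open>0 powr x = 0\<close>, and w
        vanishes almost everywhere.\<close>
      case True
      have Em: "E \<in> sets borel" unfolding E_def using measurable_sets[OF wD(3), of "- {0}"] by (simp add: vimage_def)
      have "E \<subseteq> \<Omega>" using wD(5) by (auto simp: E_def)
      then have "emeasure lborel E \<noteq> \<infinity>"
        using emeasure_bounded_finite[OF bounded_subset[OF \<Omega>(2)], of E] by simp
      then have "emeasure lborel E = 0"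
        using True by (simp add: m_def emeasure_eq_ennreal_measure)
      then have "AE x in lborel. w x = 0"
        using Em by (intro AE_I[of _ _ E]) (auto simp: E_def)
      then have "l2norm lborel w = l2norm lborel (\<lambda>x::'a. 0)"
        using l2norm_cong_AE[of w lborel "\<lambda>x. 0"] wD(3) by simp
      then show ?thesis using True by (simp add: l2norm_def)
    next
      case False
      then have mp: "m > 0" using mV by simp
      define r where "r = (2 * m / V) powr (1 / ?d)"
      have r0: "0 < r" using mp V by (simp add: r_def)
      have r1: "r \<le> 1" unfolding r_def using mV V by (intro powr_le1) (simp_all add: field_simps)
      have rd: "r ^ ?d = 2 * m / V"
      proof -
        have "r ^ ?d = r powr real ?d" using r0 by (simp add: powr_realpow)
        also have "\<dots> = (2 * m / V) powr (1 / ?d * real ?d)" unfolding r_def by (rule powr_powr)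
        also have "\<dots> = 2 * m / V" using mp V by simp
        finally show ?thesis .
      qed
      let ?F = "\<lambda>x h. ennreal (indicator {x \<in> \<Omega>. x + (1 / r) *\<^sub>R h \<in> \<Omega>} x * (w (x + h) - w x)\<^sup>2)"
      have Fm: "(\<lambda>(x, h). ?F x h) \<in> borel_measurable (lborel \<Otimes>\<^sub>M lborel)"
      proof -
        have op: "open {p::'a \<times> 'a. fst p \<in> \<Omega> \<and> fst p + (1 / r) *\<^sub>R snd p \<in> \<Omega>}"
        proof -
          have "open ((\<lambda>p::'a \<times> 'a. fst p) -` \<Omega> \<inter> (\<lambda>p. fst p + (1 / r) *\<^sub>R snd p) -` \<Omega>)"
            using \<Omega>(1) by (intro open_Int open_vimage continuous_intros)
          then show ?thesis by (simp add: vimage_def Int_def)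
        qed
        have wm: "(\<lambda>p::'a \<times> 'a. w (fst p + snd p)) \<in> borel_measurable borel"
          "(\<lambda>p::'a \<times> 'a. w (fst p)) \<in> borel_measurable borel"
          by (rule measurable_compose[OF _ wD(3)], intro borel_measurable_continuous_onI continuous_intros)+
        have "(\<lambda>p::'a \<times> 'a. ennreal (indicator {p. fst p \<in> \<Omega> \<and> fst p + (1 / r) *\<^sub>R snd p \<in> \<Omega>} p * (w (fst p + snd p) - w (fst p))\<^sup>2))
           \<in> borel_measurable borel"
          using wm borel_open[OF op] by simp
        then have "(\<lambda>p::'a \<times> 'a. ennreal (indicator {p. fst p \<in> \<Omega> \<and> fst p + (1 / r) *\<^sub>R snd p \<in> \<Omega>} p * (w (fst p + snd p) - w (fst p))\<^sup>2))
           \<in> borel_measurable (lborel \<Otimes>\<^sub>M lborel)"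
          unfolding lborel_prod by simp
        moreover have "(\<lambda>p::'a \<times> 'a. ennreal (indicator {p. fst p \<in> \<Omega> \<and> fst p + (1 / r) *\<^sub>R snd p \<in> \<Omega>} p * (w (fst p + snd p) - w (fst p))\<^sup>2))
          = (\<lambda>(x, h). ?F x h)"
          by (auto simp: fun_eq_iff indicator_def)
        ultimately show ?thesis by simp
      qed
      have "ennreal (m * (l2norm lborel w)\<^sup>2) \<le> (\<integral>\<^sup>+x. (\<integral>\<^sup>+h. ?F x h \<partial>lborel) \<partial>lborel)"
        unfolding m_def
        by (rule double_increment_lower[OF \<Omega>(1,2) wD(1,5) r0 E_def])
          (use rd V in \<open>simp_all add: m_def V_def\<close>)
      also have "\<dots> = (\<integral>\<^sup>+h. (\<integral>\<^sup>+x. ?F x h \<partial>lborel) \<partial>lborel)"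
        using lborel_pair.Fubini'[OF Fm] by simp
      also have "\<dots> \<le> ennreal ((2 * M * r)\<^sup>2 * N\<^sup>2 * r ^ ?d * \<beta>)"
        unfolding N_def \<beta>_def by (rule double_increment_upper[OF \<Omega>(1,2,3) wg M(1) r0 r1])
      finally have "m * (l2norm lborel w)\<^sup>2 \<le> (2 * M * r)\<^sup>2 * N\<^sup>2 * r ^ ?d * \<beta>"
        using r0 by (subst (asm) ennreal_le_iff) (simp_all add: \<beta>_def)
      also have "\<dots> = m * (K * r\<^sup>2 * N\<^sup>2)"
        unfolding rd K_def by (simp add: power_mult_distrib)
      finally have "(l2norm lborel w)\<^sup>2 \<le> K * r\<^sup>2 * N\<^sup>2" using mp by simp
      also have "\<dots> = (sqrt K * r * N)\<^sup>2" using K by (simp add: power_mult_distrib)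
      finally have "l2norm lborel w \<le> sqrt K * r * N"
        by (rule power2_le_imp_le) (use K r0 N0 in simp)
      also have "\<dots> = sqrt K * (2 / V) powr (1 / ?d) * (m powr (1 / ?d) * N)"
        using mp V unfolding r_def by (simp add: powr_mult[symmetric] mult_ac)
      also have "\<dots> \<le> C * (m powr (1 / ?d) * N)"
        unfolding C_def using N0 by (intro mult_right_mono) simp_all
      finally show ?thesis by (simp add: mult.assoc)
    qed
    then show "l2norm lborel w \<le> C * measure lborel {x. w x \<noteq> 0} powr (1 / ?d) * l2norm lborel (\<lambda>x. norm (H x))"
      unfolding m_def N_def E_def .
  qed
qed

section \<open>Stampacchia's truncation method\<close>

lemma stampacchia_iteration:
  fixes a :: "real \<Rightarrow> real"
  assumes nn: "\<And>k. 0 \<le> a k" and anti: "\<And>k h. k0 \<le> k \<Longrightarrow> k \<le> h \<Longrightarrow> a h \<le> a k"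
    and step: "\<And>k h. k0 \<le> k \<Longrightarrow> k < h \<Longrightarrow> a h \<le> B / (h - k)\<^sup>2 * a k powr \<beta>"
    and \<beta>: "\<beta> > 1" and \<delta>: "\<delta> > 0" and B: "B \<ge> 0"
    and big: "4 * B * a k0 powr (\<beta> - 1) * 2 powr (2 / (\<beta> - 1)) \<le> \<delta>\<^sup>2"
  shows "a (k0 + \<delta>) = 0"
proof (cases "a k0 = 0")
  case True
  then show ?thesis using anti[of k0 "k0 + \<delta>"] nn[of "k0 + \<delta>"] \<delta> by simp
next
  case False
  then have a0: "a k0 > 0" using nn[of k0] by simp
  \<comment> \<open>Chosen so that \<open>4 * q powr \<beta> = q\<close>. The levels below approach
    \<open>k0 + \<delta>\<close> by halved steps, and each halving multiplies
    \<open>B / (h - k)\<^sup>2\<close> by 4; the power \<beta> > 1 of the geometric bound q^n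
    absorbs these factors, and \<open>big\<close> starts the induction with one factor q to
    spare.\<close>
  define q where "q = 2 powr (- (2 / (\<beta> - 1)))"
  have q: "0 < q" "q < 1"
    using \<beta> powr_less_mono[of "- (2 / (\<beta> - 1))" 0 2] by (simp_all add: q_def)
  have q1: "4 * q powr \<beta> = q"
  proof -
    have "q powr (\<beta> - 1) = 2 powr (- (2 / (\<beta> - 1)) * (\<beta> - 1))"
      unfolding q_def by (rule powr_powr)
    also have "- (2 / (\<beta> - 1)) * (\<beta> - 1) = -2"
    proof -
      have "2 / (\<beta> - 1) * (\<beta> - 1) = 2" using \<beta> by (simp add: field_simps)
      then show ?thesis unfolding mult_minus_left by (rule arg_cong)
    qed
    also have "2 powr (-2) = (1 / 4 :: real)" by (simp add: powr_minus powr_numeral)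
    finally have "q powr (\<beta> - 1) = 1 / 4" .
    moreover have "q powr \<beta> = q powr (\<beta> - 1) * q"
      using q powr_add[of q "\<beta> - 1" 1] by simp
    ultimately show ?thesis by simp
  qed
  have big': "4 * B * a k0 powr (\<beta> - 1) \<le> \<delta>\<^sup>2 * q"
  proof -
    have "2 powr (2 / (\<beta> - 1)) * q = 1"
      unfolding q_def by (simp add: powr_minus)
    then have "4 * B * a k0 powr (\<beta> - 1) = (4 * B * a k0 powr (\<beta> - 1) * 2 powr (2 / (\<beta> - 1))) * q"
      by (simp add: mult.assoc)
    also have "\<dots> \<le> \<delta>\<^sup>2 * q" using big q by (intro mult_right_mono) simp_all
    finally show ?thesis .
  qed
  define k where "k n = k0 + \<delta> * (1 - (1 / 2) ^ n)" for n :: nat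
  have kk: "k0 \<le> k n" "k (Suc n) - k n = \<delta> * (1 / 2) ^ Suc n" "k n \<le> k0 + \<delta>" for n
    using \<delta> by (simp_all add: k_def power_le_one algebra_simps)
  have dec: "a (k n) \<le> a k0 * q ^ n" for n
  proof (induction n)
    case 0
    then show ?case by (simp add: k_def)
  next
    case (Suc n)
    have "0 < k (Suc n) - k n" unfolding kk(2) using \<delta> by simp
    then have lt: "k n < k (Suc n)" by simp
    have "a (k (Suc n)) \<le> B / (k (Suc n) - k n)\<^sup>2 * a (k n) powr \<beta>"
      by (rule step[OF kk(1) lt])
    also have "\<dots> \<le> B / (k (Suc n) - k n)\<^sup>2 * (a k0 * q ^ n) powr \<beta>"
      using B nn Suc \<beta> by (intro mult_left_mono powr_mono2) simp_all
    also have "(k (Suc n) - k n)\<^sup>2 = \<delta>\<^sup>2 * (1 / 4) ^ Suc n"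
      unfolding kk(2) by (simp add: power_mult_distrib power_even_eq[symmetric] power2_eq_square power_mult_distrib[symmetric])
    also have "B / (\<delta>\<^sup>2 * (1 / 4) ^ Suc n) * (a k0 * q ^ n) powr \<beta>
        = (4 * B * a k0 powr (\<beta> - 1)) / \<delta>\<^sup>2 * a k0 * (4 * q powr \<beta>) ^ n"
    proof -
      have "(a k0 * q ^ n) powr \<beta> = a k0 powr \<beta> * (q powr \<beta>) ^ n"
        using a0 q by (simp add: powr_mult powr_realpow[symmetric] powr_powr mult.commute)
      moreover have "a k0 powr \<beta> = a k0 powr (\<beta> - 1) * a k0"
        using a0 powr_add[of "a k0" "\<beta> - 1" 1] by simp
      ultimately show ?thesis
        by (simp add: power_mult_distrib power_one_over field_simps)
    qed
    also have "\<dots> \<le> q * a k0 * q ^ n"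
      unfolding q1 using big' \<delta> a0 q
      by (intro mult_right_mono) (simp_all add: pos_divide_le_eq mult.commute)
    finally show ?case by (simp add: mult_ac)
  qed
  have "a (k0 + \<delta>) \<le> a k0 * q ^ n" for n
    using anti[OF kk(1)[of n] kk(3)[of n]] dec[of n] by linarith
  moreover have "(\<lambda>n. a k0 * q ^ n) \<longlonglongrightarrow> 0"
    using q tendsto_mult_right_zero[OF LIMSEQ_power_zero[of q]] by simp
  ultimately have "a (k0 + \<delta>) \<le> 0"
    by (intro LIMSEQ_le_const) auto
  then show ?thesis using nn[of "k0 + \<delta>"] by simp
qed

text \<open>The truncation max(s - k, 0) with its corner rounded off on [k, k + \<delta>], where the
  slope rises linearly from 0 to 1; beyond that interval it is s - k - \<delta>/2. The corner itself
  would be outside the reach of the chain rule, which is proved for continuously differentiable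
  functions.\<close>

definition soft_ramp :: "real \<Rightarrow> real \<Rightarrow> real \<Rightarrow> real" where
  "soft_ramp k \<delta> s = \<delta> * (qramp ((s - k) / \<delta>) / 2 - qramp ((s - k) / \<delta> - 1) / 2)"

definition soft_ramp' :: "real \<Rightarrow> real \<Rightarrow> real \<Rightarrow> real" where
  "soft_ramp' k \<delta> s = max 0 ((s - k) / \<delta>) - max 0 ((s - k) / \<delta> - 1)"

lemma soft_ramp_deriv:
  assumes "\<delta> > 0"
  shows "(soft_ramp k \<delta> has_real_derivative soft_ramp' k \<delta> s) (at s)"
proof -
  have 1: "((\<lambda>s. qramp ((s - k) / \<delta>)) has_real_derivative (2 * max 0 ((s - k) / \<delta>)) * (1 / \<delta>)) (at s)"
    by (rule DERIV_chain2[OF qramp_deriv]) (use assms in \<open>auto intro!: derivative_eq_intros\<close>)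
  have 2: "((\<lambda>s. qramp ((s - k) / \<delta> - 1)) has_real_derivative (2 * max 0 ((s - k) / \<delta> - 1)) * (1 / \<delta>)) (at s)"
    by (rule DERIV_chain2[OF qramp_deriv]) (use assms in \<open>auto intro!: derivative_eq_intros\<close>)
  show ?thesis
    unfolding soft_ramp_def
    by (rule DERIV_cong[OF DERIV_cmult[OF DERIV_diff[OF DERIV_cdivide[OF 1] DERIV_cdivide[OF 2]]]])
      (use assms in \<open>simp add: soft_ramp'_def field_simps\<close>)
qed

lemma soft_ramp_props:
  assumes "\<delta> > 0"
  shows "0 \<le> soft_ramp' k \<delta> s" "soft_ramp' k \<delta> s \<le> 1" "continuous_on UNIV (soft_ramp' k \<delta>)"
    "soft_ramp k \<delta> s \<noteq> 0 \<longleftrightarrow> s > k" "s > k + \<delta> \<Longrightarrow> \<delta> / 2 \<le> soft_ramp k \<delta> s"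
proof -
  show "0 \<le> soft_ramp' k \<delta> s" "soft_ramp' k \<delta> s \<le> 1"
    by (auto simp: soft_ramp'_def)
  show "continuous_on UNIV (soft_ramp' k \<delta>)"
    unfolding soft_ramp'_def using assms by (intro continuous_intros) auto
  define t where "t = (s - k) / \<delta>"
  have eq: "soft_ramp k \<delta> s = \<delta> * (qramp t / 2 - qramp (t - 1) / 2)"
    by (simp add: soft_ramp_def t_def)
  have t: "t > 0 \<longleftrightarrow> s > k" "s > k + \<delta> \<Longrightarrow> t > 1"
    using assms by (simp_all add: t_def field_simps)
  have big: "qramp t / 2 - qramp (t - 1) / 2 = t - 1 / 2" if "t > 1"
    using that by (simp add: qramp_def power2_eq_square field_simps)
  have "qramp t / 2 - qramp (t - 1) / 2 \<noteq> 0 \<longleftrightarrow> t > 0"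
  proof (cases "t > 1")
    case True
    then show ?thesis using big by simp
  next
    case False
    then show ?thesis by (auto simp: qramp_def)
  qed
  then show "soft_ramp k \<delta> s \<noteq> 0 \<longleftrightarrow> s > k"
    unfolding eq using assms t(1) by simp
  show "\<delta> / 2 \<le> soft_ramp k \<delta> s" if "s > k + \<delta>"
    unfolding eq big[OF t(2)[OF that]] using assms t(2)[OF that] by simp
qed

definition borel_weak_laplacian :: "'a::euclidean_space set \<Rightarrow> ('a \<Rightarrow> real) \<Rightarrow> ('a \<Rightarrow> 'a) \<Rightarrow> ('a \<Rightarrow> real) \<Rightarrow> bool" where
  "borel_weak_laplacian \<Omega> v G g \<longleftrightarrow> borel_weak_gradient \<Omega> v G \<and> square_integrable lborel g \<and>
     (\<forall>\<psi> H. borel_weak_gradient \<Omega> \<psi> H \<longrightarrow> (\<integral>x. G x \<bullet> H x \<partial>lborel) + (\<integral>x. g x * \<psi> x \<partial>lborel) = 0)"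

text \<open>The exponent \<open>4/d\<close> exceeds \<open>1\<close> exactly when \<open>d \<le> 3\<close>, as the iteration lemma requires.\<close>

lemma level_set_estimate:
  fixes \<Omega> :: "'a::euclidean_space set"
  assumes \<Omega>: "open \<Omega>" "bounded \<Omega>" "convex \<Omega>"
    and fk: "\<And>w H. borel_weak_gradient \<Omega> w H \<Longrightarrow> measure lborel {x. w x \<noteq> 0} \<le> measure lborel \<Omega> / 2 \<Longrightarrow>
    l2norm lborel w \<le> C * measure lborel {x. w x \<noteq> 0} powr (1 / DIM('a)) * l2norm lborel (\<lambda>x. norm (H x))"
    and C: "C > 0" and lap: "borel_weak_laplacian \<Omega> v G g" and k: "0 \<le> k" "k < h"
    and small: "measure lborel {x. v x > k} \<le> measure lborel \<Omega> / 2"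
  shows "measure lborel {x. v x > h} \<le> 4 * C ^ 4 * (l2norm lborel g)\<^sup>2 / (h - k)\<^sup>2
           * measure lborel {x. v x > k} powr (4 / DIM('a))"
proof -
  define \<delta> where "\<delta> = h - k"
  have \<delta>: "\<delta> > 0" using k by (simp add: \<delta>_def)
  have wg: "borel_weak_gradient \<Omega> v G" and gs: "square_integrable lborel g"
    using lap by (simp_all add: borel_weak_laplacian_def)
  note vD = borel_weak_gradientD[OF wg] and sr = soft_ramp_props[OF \<delta>]
  define w where "w x = soft_ramp k \<delta> (v x)" for x
  define H where "H x = soft_ramp' k \<delta> (v x) *\<^sub>R G x" for x
  have wgw: "borel_weak_gradient \<Omega> w H"
    unfolding w_def H_def
  proof (rule borel_weak_gradient_chain[OF \<Omega> wg _ soft_ramp_deriv[OF \<delta>] sr(3)])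
    show "soft_ramp k \<delta> 0 = 0" using sr(4)[of k 0] k by auto
    show "\<bar>soft_ramp' k \<delta> s\<bar> \<le> 1" for s using sr(1,2)[of k s] by simp
  qed
  note wD = borel_weak_gradientD[OF wgw]
  define m where "m = measure lborel {x. v x > k}"
  have Eq: "{x. w x \<noteq> 0} = {x. v x > k}" using sr(4) by (simp add: w_def)
  let ?n = "l2norm lborel w" and ?N = "l2norm lborel (\<lambda>x. norm (H x))" and ?g = "l2norm lborel g"
  let ?p = "m powr (1 / DIM('a))"
  have fk': "?n \<le> C * ?p * ?N"
    using fk[OF wgw] small unfolding Eq m_def by simp
  have HG: "square_integrable lborel (\<lambda>x. norm (H x))" by (rule wD(4))
  \<comment> \<open>The truncation is used as test function. Its slope lies in [0,1], so the square
    of the slope is at most the slope, and the energy of w is bounded by the pairing of the two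
    gradients.\<close>
  have "?N\<^sup>2 \<le> (\<integral>x. G x \<bullet> H x \<partial>lborel)"
    unfolding l2norm_power2
  proof (rule integral_mono)
    show "integrable lborel (\<lambda>x. (norm (H x))\<^sup>2)" by (rule square_integrableD(2)[OF HG])
    show "integrable lborel (\<lambda>x. G x \<bullet> H x)"
    proof (rule Bochner_Integration.integrable_bound[OF square_integrable_mult[OF vD(4) HG]])
      show "(\<lambda>x. G x \<bullet> H x) \<in> borel_measurable lborel"
        using vD(2) wD(2) by simp
      show "AE x in lborel. norm (G x \<bullet> H x) \<le> norm (norm (G x) * norm (H x))"
        by (rule AE_I2) (simp add: Cauchy_Schwarz_ineq2)
    qed
    fix x
    have "(soft_ramp' k \<delta> (v x))\<^sup>2 \<le> soft_ramp' k \<delta> (v x)"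
      using sr(1,2)[of k "v x"] by (simp add: power2_eq_square mult_left_le)
    then have "(soft_ramp' k \<delta> (v x))\<^sup>2 * (norm (G x))\<^sup>2 \<le> soft_ramp' k \<delta> (v x) * (norm (G x))\<^sup>2"
      by (rule mult_right_mono) simp
    then show "(norm (H x))\<^sup>2 \<le> G x \<bullet> H x"
      by (simp add: H_def power_mult_distrib power2_norm_eq_inner)
  qed
  also have "\<dots> = - (\<integral>x. g x * w x \<partial>lborel)"
    using lap wgw unfolding borel_weak_laplacian_def by (simp add: eq_neg_iff_add_eq_0)
  also have "\<dots> \<le> ?g * ?n"
    using l2_Cauchy_Schwarz[OF gs wD(1)] by linarith
  finally have N2: "?N\<^sup>2 \<le> ?g * ?n" .
  have n0: "?n \<ge> 0" "?g \<ge> 0" "?N \<ge> 0" by (rule l2norm_nonneg)+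
  \<comment> \<open>Squaring the Faber-Krahn bound and inserting the energy bound leaves the norm of
    w squared on the left and to first power on the right, so one factor cancels.\<close>
  have nb: "?n \<le> C\<^sup>2 * ?p\<^sup>2 * ?g"
  proof (cases "?n = 0")
    case False
    then have np: "?n > 0" using n0 by simp
    have "?n\<^sup>2 \<le> (C * ?p * ?N)\<^sup>2" by (rule power_mono[OF fk' n0(1)])
    also have "\<dots> = (C\<^sup>2 * ?p\<^sup>2) * ?N\<^sup>2" by (simp add: power_mult_distrib)
    also have "\<dots> \<le> (C\<^sup>2 * ?p\<^sup>2) * (?g * ?n)" by (rule mult_left_mono[OF N2]) simp
    finally have "?n * ?n \<le> (C\<^sup>2 * ?p\<^sup>2 * ?g) * ?n" by (simp add: power2_eq_square mult_ac)
    then show ?thesis using np by simp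
  qed (simp add: n0)
  define A where "A = {x. v x > h}"
  have Am: "A \<in> sets borel" unfolding A_def using vD(3) by simp
  \<comment> \<open>Above h = k + \<delta> the rounded truncation is at least \<delta>/2, which
    turns the bound on its norm into one on the measure of the level set; the factor 2 becomes the 4
    of the statement.\<close>
  have "\<delta> / 2 * sqrt (measure lborel A) = l2norm lborel (\<lambda>x. \<delta> / 2 * indicator A x)"
    unfolding l2norm_cmult using l2norm_indicator[of A lborel] Am \<delta> by simp
  also have "\<dots> \<le> ?n"
  proof (rule l2norm_mono[OF wD(1)])
    show "(\<lambda>x. \<delta> / 2 * indicator A x) \<in> borel_measurable lborel" using Am by simp
    have "\<bar>\<delta> / 2 * indicator A x\<bar> \<le> \<bar>w x\<bar>" for x
      using sr(5)[of k "v x"] \<delta> by (cases "x \<in> A") (simp_all add: A_def w_def \<delta>_def)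
    then show "AE x in lborel. \<bar>\<delta> / 2 * indicator A x\<bar> \<le> \<bar>w x\<bar>" by (rule AE_I2)
  qed
  finally have "(\<delta> / 2 * sqrt (measure lborel A))\<^sup>2 \<le> (C\<^sup>2 * ?p\<^sup>2 * ?g)\<^sup>2"
    using nb \<delta> by (intro power_mono) simp_all
  then have "\<delta>\<^sup>2 * measure lborel A \<le> 4 * C ^ 4 * ?g\<^sup>2 * ?p ^ 4"
    by (simp add: power_mult_distrib power_divide power_mult[symmetric] mult_ac)
  then have "measure lborel A \<le> 4 * C ^ 4 * ?g\<^sup>2 / \<delta>\<^sup>2 * ?p ^ 4"
    using \<delta> by (simp add: field_simps)
  also have "?p ^ 4 = m powr (4 / DIM('a))"
  proof (cases "m = 0")
    case False
    then have "m > 0" by (simp add: m_def zero_less_measure_iff)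
    then have "?p ^ 4 = ?p powr (real 4)" by (intro powr_realpow[symmetric]) simp
    then show ?thesis by (simp add: powr_powr)
  qed simp
  finally show ?thesis unfolding A_def m_def \<delta>_def .
qed

lemma l2_chebyshev:
  fixes v :: "'a::euclidean_space \<Rightarrow> real"
  assumes v: "square_integrable lborel v" and k: "k > 0"
  shows "measure lborel {x. v x > k} \<le> (l2norm lborel v / k)\<^sup>2"
proof -
  have vm: "v \<in> borel_measurable borel" using square_integrableD(1)[OF v] by simp
  let ?A = "{x. v x > k}"
  have A: "?A \<in> sets lborel" using vm by simp
  have "sqrt (measure lborel ?A) = l2norm lborel (indicator ?A)"
    by (rule l2norm_indicator[OF A, symmetric])
  also have "\<dots> \<le> l2norm lborel (\<lambda>x. (1 / k) * v x)"
  proof (rule l2norm_mono[OF square_integrable_cmult[OF v]])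
    show "indicator ?A \<in> borel_measurable lborel" using A by simp
    have "\<bar>indicator ?A x\<bar> \<le> \<bar>(1 / k) * v x\<bar>" for x
      using k by (cases "x \<in> ?A") simp_all
    then show "AE x in lborel. \<bar>indicator ?A x\<bar> \<le> \<bar>(1 / k) * v x\<bar>" by (rule AE_I2)
  qed
  also have "\<dots> = l2norm lborel v / k" unfolding l2norm_cmult using k by simp
  finally have "(sqrt (measure lborel ?A))\<^sup>2 \<le> (l2norm lborel v / k)\<^sup>2"
    by (rule power_mono) simp
  then show ?thesis by simp
qed

text \<open>The initial level is fixed by Chebyshev: above k0 = R^(-d/2) |v| the level set has
  measure at most R^d, small enough for Faber-Krahn. The length R is left free so that the bound can
  later be balanced at the scale of a frequency.\<close>

lemma stampacchia_upper_bound: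
  fixes \<Omega> :: "'a::euclidean_space set"
  assumes \<Omega>: "open \<Omega>" "bounded \<Omega>" "convex \<Omega>" "\<Omega> \<noteq> {}" and d3: "DIM('a) \<le> 3"
  shows "\<exists>C>0. \<exists>R0>0. \<forall>v G g R. borel_weak_laplacian \<Omega> v G g \<and> 0 < R \<and> R \<le> R0 \<longrightarrow>
    (AE x in lborel. v x \<le> C * (R powr (- real DIM('a) / 2) * l2norm lborel v + R powr (2 - real DIM('a) / 2) * l2norm lborel g))"
proof -
  obtain C where C: "C > 0" and fk0: "\<forall>w H. borel_weak_gradient \<Omega> w H \<and> measure lborel {x. w x \<noteq> 0} \<le> measure lborel \<Omega> / 2 \<longrightarrow>
    l2norm lborel w \<le> C * measure lborel {x. w x \<noteq> 0} powr (1 / DIM('a)) * l2norm lborel (\<lambda>x. norm (H x))"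
    using faber_krahn[OF \<Omega>] by metis
  have fk: "l2norm lborel w \<le> C * measure lborel {x. w x \<noteq> 0} powr (1 / DIM('a)) * l2norm lborel (\<lambda>x. norm (H x))"
    if "borel_weak_gradient \<Omega> w H" "measure lborel {x. w x \<noteq> 0} \<le> measure lborel \<Omega> / 2" for w H
    using fk0 that by simp
  define V where "V = measure lborel \<Omega>"
  have "\<not> negligible \<Omega>" by (rule open_not_negligible[OF \<Omega>(1,4)])
  then have "emeasure lborel \<Omega> \<noteq> 0"
    using negligible_iff_emeasure0[of \<Omega>] \<Omega>(1) by simp
  moreover have "emeasure lborel \<Omega> = ennreal V"
    unfolding V_def using emeasure_bounded_finite[OF \<Omega>(2)]
    by (intro emeasure_eq_ennreal_measure) (simp add: top.not_eq_extremum)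
  ultimately have V: "V > 0" by (simp add: zero_less_measure_iff V_def)
  let ?d = "real DIM('a)"
  have d: "1 \<le> ?d" "?d \<le> 3" using d3 DIM_positive[where 'a='a] by (simp_all add: Suc_leI)
  \<comment> \<open>R0^d is half the volume of \<Omega>, the largest level set that the Faber-Krahn
    inequality admits.\<close>
  define R0 where "R0 = (V / 2) powr (1 / ?d)"
  have R0: "R0 > 0" using V by (simp add: R0_def)
  define \<beta> where "\<beta> = 4 / ?d"
  have \<beta>: "\<beta> > 1" using d by (simp add: \<beta>_def field_simps)
  define D where "D = sqrt (16 * C ^ 4 * 2 powr (2 / (\<beta> - 1)))"
  have D: "D > 0" using C by (simp add: D_def)
  have main: "AE x in lborel. v x \<le> (1 + D) * (R powr (- ?d / 2) * l2norm lborel v + R powr (2 - ?d / 2) * l2norm lborel g)"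
    if lap: "borel_weak_laplacian \<Omega> v G g" and R: "0 < R" "R \<le> R0" for v G g R
  proof (cases "l2norm lborel v = 0")
    case True
    have vs: "square_integrable lborel v"
      using lap borel_weak_gradientD(1) unfolding borel_weak_laplacian_def by blast
    have "AE x in lborel. v x = 0" by (rule l2norm_zero_AE[OF vs True])
    then show ?thesis
    proof (rule AE_mp, intro AE_I2 impI)
      fix x assume "v x = 0"
      then show "v x \<le> (1 + D) * (R powr (- ?d / 2) * l2norm lborel v + R powr (2 - ?d / 2) * l2norm lborel g)"
        using D by (simp add: l2norm_nonneg)
    qed
  next
    case False
    define n where "n = l2norm lborel v"
    define gn where "gn = l2norm lborel g"
    have n: "n > 0" using False l2norm_nonneg[of lborel v] by (simp add: n_def)
    have gn: "gn \<ge> 0" by (simp add: gn_def l2norm_nonneg)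
    have wg: "borel_weak_gradient \<Omega> v G" using lap by (simp add: borel_weak_laplacian_def)
    note vD = borel_weak_gradientD[OF wg]
    define a where "a k = measure lborel {x. v x > k}" for k
    define k0 where "k0 = R powr (- ?d / 2) * n"
    have k0: "k0 > 0" using n R by (simp add: k0_def)
    have meas: "{x. v x > k} \<in> sets borel" for k using vD(3) by simp
    have sub: "{x. v x > k} \<subseteq> \<Omega>" if "k \<ge> 0" for k using vD(5) that by force
    have fin: "emeasure lborel {x. v x > k} < \<infinity>" if "k \<ge> 0" for k
      using emeasure_bounded_finite[OF bounded_subset[OF \<Omega>(2) sub[OF that]]] by (simp add: top.not_eq_extremum)
    have anti: "a h \<le> a k" if "k0 \<le> k" "k \<le> h" for k h
    proof -
      have "k \<ge> 0" using that k0 by simp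
      then have "{x. v x > k} \<in> fmeasurable lborel"
        using meas fin by (intro fmeasurableI) simp_all
      then show ?thesis
        unfolding a_def using that meas by (intro measure_mono_fmeasurable) auto
    qed
    have Rd: "R powr ?d \<le> V / 2"
    proof -
      have "R powr ?d \<le> R0 powr ?d" using R d by (intro powr_mono2) simp_all
      also have "\<dots> = V / 2" unfolding R0_def using V d by (simp add: powr_powr)
      finally show ?thesis .
    qed
    have a0: "a k0 \<le> R powr ?d"
    proof -
      have "a k0 \<le> (n / k0)\<^sup>2"
        unfolding a_def n_def by (rule l2_chebyshev[OF vD(1) k0])
      also have "n / k0 = R powr (?d / 2)"
        using n R by (simp add: k0_def powr_minus field_simps)
      also have "(R powr (?d / 2))\<^sup>2 = R powr ?d"
        by (simp add: power2_eq_square powr_add[symmetric])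
      finally show ?thesis .
    qed
    \<comment> \<open>The second summand makes \<open>Gm\<close>, and with it the height \<delta>,
      positive when g = 0. Its contribution to \<delta> is D times \<open>k0\<close>, so the final
      bound keeps its form.\<close>
    define Gm where "Gm = gn + R powr (-2) * n"
    have Gm: "Gm > 0" "gn \<le> Gm" using gn n R by (simp_all add: Gm_def add_nonneg_pos)
    define B where "B = 4 * C ^ 4 * Gm\<^sup>2"
    \<comment> \<open>The exponent comes from \<open>big\<close>: the measure R^d raised to \<beta>
      - 1 = 4/d - 1 is R^(4-d), the square of R^(2-d/2). The constant \<open>D\<close> collects the
      remaining factors, including the 4 and the power of 2 from the iteration.\<close>
    define \<delta> where "\<delta> = D * Gm * R powr (2 - ?d / 2)"
    have \<delta>: "\<delta> > 0" using D Gm R by (simp add: \<delta>_def)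
    have step: "a h \<le> B / (h - k)\<^sup>2 * a k powr \<beta>" if kh: "k0 \<le> k" "k < h" for k h
    proof -
      have k: "0 \<le> k" using kh k0 by simp
      have "measure lborel {x. v x > k} \<le> measure lborel \<Omega> / 2"
        using anti[of k0 k] kh a0 Rd unfolding a_def V_def by simp
      from level_set_estimate[OF \<Omega>(1-3) fk C lap k kh(2) this]
      have "a h \<le> 4 * C ^ 4 * gn\<^sup>2 / (h - k)\<^sup>2 * a k powr \<beta>"
        unfolding a_def gn_def \<beta>_def .
      also have "\<dots> \<le> B / (h - k)\<^sup>2 * a k powr \<beta>"
        unfolding B_def using gn Gm C
        by (intro mult_right_mono divide_right_mono mult_left_mono power_mono) simp_all
      finally show ?thesis .
    qed
    have big: "4 * B * a k0 powr (\<beta> - 1) * 2 powr (2 / (\<beta> - 1)) \<le> \<delta>\<^sup>2"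
    proof -
      have "a k0 powr (\<beta> - 1) \<le> (R powr ?d) powr (\<beta> - 1)"
        using a0 \<beta> by (intro powr_mono2) (simp_all add: a_def)
      also have "\<dots> = R powr (?d * (\<beta> - 1))" by (rule powr_powr)
      also have "?d * (\<beta> - 1) = (2 - ?d / 2) + (2 - ?d / 2)" using d by (simp add: \<beta>_def right_diff_distrib)
      also have "R powr ((2 - ?d / 2) + (2 - ?d / 2)) = (R powr (2 - ?d / 2))\<^sup>2"
        unfolding powr_add power2_eq_square ..
      finally have *: "a k0 powr (\<beta> - 1) \<le> (R powr (2 - ?d / 2))\<^sup>2" .
      have "4 * B * a k0 powr (\<beta> - 1) * 2 powr (2 / (\<beta> - 1)) \<le> 4 * B * (R powr (2 - ?d / 2))\<^sup>2 * 2 powr (2 / (\<beta> - 1))"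
        using C by (intro mult_right_mono mult_left_mono[OF *]) (simp_all add: B_def)
      also have "\<dots> = D\<^sup>2 * (Gm\<^sup>2 * (R powr (2 - ?d / 2))\<^sup>2)"
        unfolding B_def D_def using C by simp
      also have "\<dots> = \<delta>\<^sup>2" by (simp add: \<delta>_def power_mult_distrib)
      finally show ?thesis .
    qed
    have "a (k0 + \<delta>) = 0"
      by (rule stampacchia_iteration[OF _ anti step \<beta> \<delta> _ big]) (simp_all add: a_def B_def)
    then have "emeasure lborel {x. v x > k0 + \<delta>} = 0"
      using fin[of "k0 + \<delta>"] k0 \<delta> unfolding a_def
      by (subst emeasure_eq_ennreal_measure) (simp_all add: top.not_eq_extremum)
    then have "AE x in lborel. v x \<le> k0 + \<delta>"
      using meas by (intro AE_I[of _ _ "{x. v x > k0 + \<delta>}"]) auto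
    then show ?thesis
    proof (rule AE_mp, intro AE_I2 impI)
      fix x assume "v x \<le> k0 + \<delta>"
      also have "\<delta> = D * (R powr (2 - ?d / 2) * gn) + D * (R powr (-2) * R powr (2 - ?d / 2) * n)"
        by (simp add: \<delta>_def Gm_def algebra_simps)
      also have "R powr (-2) * R powr (2 - ?d / 2) = R powr (- ?d / 2)"
        by (simp add: powr_add[symmetric])
      finally have "v x \<le> k0 + (D * (R powr (2 - ?d / 2) * gn) + D * k0)"
        by (simp add: k0_def)
      also have "\<dots> \<le> (1 + D) * (k0 + R powr (2 - ?d / 2) * gn)"
        using gn by (simp add: algebra_simps)
      finally show "v x \<le> (1 + D) * (R powr (- ?d / 2) * l2norm lborel v + R powr (2 - ?d / 2) * l2norm lborel g)"
        by (simp add: k0_def n_def gn_def)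
    qed
  qed
  show ?thesis
    by (rule exI[of _ "1 + D"], rule conjI[rotated], rule exI[of _ R0], intro conjI allI impI R0, elim conjE, rule main)
      (use D in simp_all)
qed

lemma borel_weak_gradient_uminus:
  assumes "borel_weak_gradient \<Omega> v G"
  shows "borel_weak_gradient \<Omega> (\<lambda>x. - v x) (\<lambda>x. - G x)"
  using assms unfolding borel_weak_gradient_def
  by (simp add: square_integrable_uminus)

lemma borel_weak_laplacian_uminus:
  assumes "borel_weak_laplacian \<Omega> v G g"
  shows "borel_weak_laplacian \<Omega> (\<lambda>x. - v x) (\<lambda>x. - G x) (\<lambda>x. - g x)"
  unfolding borel_weak_laplacian_def
proof (intro conjI allI impI)
  show "borel_weak_gradient \<Omega> (\<lambda>x. - v x) (\<lambda>x. - G x)"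
    using assms by (intro borel_weak_gradient_uminus) (simp add: borel_weak_laplacian_def)
  show "square_integrable lborel (\<lambda>x. - g x)"
    using assms by (intro square_integrable_uminus) (simp add: borel_weak_laplacian_def)
  fix \<psi> H assume "borel_weak_gradient \<Omega> \<psi> H"
  then have "(\<integral>x. G x \<bullet> H x \<partial>lborel) + (\<integral>x. g x * \<psi> x \<partial>lborel) = 0"
    using assms by (simp add: borel_weak_laplacian_def)
  then show "(\<integral>x. - G x \<bullet> H x \<partial>lborel) + (\<integral>x. - g x * \<psi> x \<partial>lborel) = 0"
    by simp
qed

section \<open>Passing between Lebesgue and Borel representatives\<close>

lemma lborel_off_domain:
  fixes F :: "'a::euclidean_space \<Rightarrow> real"
  assumes "\<Omega> \<in> sets borel" "F \<in> borel_measurable borel" "\<And>x. x \<notin> \<Omega> \<Longrightarrow> F x = 0"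
  shows "(\<integral>x. F x \<partial>lebesgue_on \<Omega>) = (\<integral>x. F x \<partial>lborel)"
    "integrable (lebesgue_on \<Omega>) F \<longleftrightarrow> integrable lborel F"
proof -
  have eq: "(\<lambda>x. indicator \<Omega> x *\<^sub>R F x) = F"
  proof
    fix x show "indicator \<Omega> x *\<^sub>R F x = F x"
      using assms(3)[of x] by (cases "x \<in> \<Omega>") auto
  qed
  show "(\<integral>x. F x \<partial>lebesgue_on \<Omega>) = (\<integral>x. F x \<partial>lborel)"
    "integrable (lebesgue_on \<Omega>) F \<longleftrightarrow> integrable lborel F"
    using lebesgue_on_integral_borel[OF assms(1,2)] unfolding eq by simp_all
qed

lemma square_integrable_off_domain:
  fixes F :: "'a::euclidean_space \<Rightarrow> real"
  assumes "\<Omega> \<in> sets borel" "F \<in> borel_measurable borel" "\<And>x. x \<notin> \<Omega> \<Longrightarrow> F x = 0"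
  shows "square_integrable (lebesgue_on \<Omega>) F \<longleftrightarrow> square_integrable lborel F"
    "l2norm (lebesgue_on \<Omega>) F = l2norm lborel F"
  using lborel_off_domain[of \<Omega> "\<lambda>x. (F x)\<^sup>2"] assms borel_imp_lebesgue_on_measurable[OF assms(2)]
  by (simp_all add: square_integrable_def l2norm_def)

lemma finite_measure_lebesgue_on:
  fixes \<Omega> :: "'a::euclidean_space set"
  assumes "open \<Omega>" "bounded \<Omega>"
  shows "finite_measure (lebesgue_on \<Omega>)"
  using assms emeasure_bounded_finite[OF assms(2)]
  by (intro finite_measure_lebesgue_on fmeasurableI) (simp_all add: top.not_eq_extremum emeasure_completion)

lemma weak_gradient_imp_borel:
  fixes \<Omega> :: "'a::euclidean_space set"
  assumes \<Omega>: "open \<Omega>" "bounded \<Omega>" and wg: "weak_gradient \<Omega> v G"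
  shows "\<exists>v' G'. borel_weak_gradient \<Omega> v' G' \<and> (AE x in lebesgue_on \<Omega>. v x = v' x) \<and> (AE x in lebesgue_on \<Omega>. G x = G' x)"
proof -
  have Om: "\<Omega> \<in> sets borel" using \<Omega> by simp
  have v: "square_integrable (lebesgue_on \<Omega>) v" "v \<in> borel_measurable (lebesgue_on \<Omega>)"
    and Gm: "G \<in> borel_measurable (lebesgue_on \<Omega>)"
    and Gs: "square_integrable (lebesgue_on \<Omega>) (\<lambda>x. norm (G x))"
    using wg by (auto simp: weak_gradient_def L2_iff square_integrable_def)
  obtain v' where v': "v' \<in> borel_measurable borel" "\<And>x. x \<notin> \<Omega> \<Longrightarrow> v' x = 0" "AE x in lebesgue_on \<Omega>. v x = v' x"
    using borel_representative_real[OF Om v(2)] by blast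
  obtain G' where G': "G' \<in> borel_measurable borel" "\<And>x. x \<notin> \<Omega> \<Longrightarrow> G' x = 0" "AE x in lebesgue_on \<Omega>. G x = G' x"
    using borel_representative[OF Om Gm] by blast
  note v'm = borel_imp_lebesgue_on_measurable[OF v'(1), of \<Omega>]
  note G'm = borel_imp_lebesgue_on_measurable[OF G'(1), of \<Omega>]
  have nG': "(\<lambda>x. norm (G' x)) \<in> borel_measurable borel"
    by (rule measurable_compose[OF G'(1) borel_measurable_norm])
  have "square_integrable (lebesgue_on \<Omega>) v'"
  proof (rule square_integrable_bound[OF v(1) v'm])
    show "AE x in lebesgue_on \<Omega>. \<bar>v' x\<bar> \<le> \<bar>v x\<bar>"
      using v'(3) by (rule AE_mp) (rule AE_I2, simp)
  qed
  then have v's: "square_integrable lborel v'"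
    using square_integrable_off_domain(1)[OF Om v'(1,2)] by simp
  have "square_integrable (lebesgue_on \<Omega>) (\<lambda>x. norm (G' x))"
  proof (rule square_integrable_bound[OF Gs borel_imp_lebesgue_on_measurable[OF nG']])
    show "AE x in lebesgue_on \<Omega>. \<bar>norm (G' x)\<bar> \<le> \<bar>norm (G x)\<bar>"
      using G'(3) by (rule AE_mp) (rule AE_I2, simp)
  qed
  then have G's: "square_integrable lborel (\<lambda>x. norm (G' x))"
    using square_integrable_off_domain(1)[OF Om nG'] G'(2) by simp
  have "(\<integral>x. v' x * (D x \<bullet> e) \<partial>lborel) = - (\<integral>x. \<psi> x * (G' x \<bullet> e) \<partial>lborel)"
    if \<psi>: "test_function \<Omega> \<psi> D" for \<psi> D e
  proof -
    interpret finite_measure "lebesgue_on \<Omega>" by (rule finite_measure_lebesgue_on[OF \<Omega>])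
    obtain B where B: "\<And>x. \<bar>\<psi> x\<bar> \<le> B" "\<And>x. norm (D x) \<le> B" using test_function_bounded[OF \<psi>] by blast
    have \<psi>m: "\<psi> \<in> borel_measurable (lebesgue_on \<Omega>)" "D \<in> borel_measurable (lebesgue_on \<Omega>)"
      using test_function_measurable[OF \<psi>] borel_imp_lebesgue_on_measurable by blast+
    have i1: "integrable (lebesgue_on \<Omega>) (\<lambda>x. v x *\<^sub>R D x)"
    proof (rule Bochner_Integration.integrable_bound)
      show "integrable (lebesgue_on \<Omega>) (\<lambda>x. B * v x)"
        using integrable_of_square_integrable[OF finite_measure_axioms v(1)] by simp
      show "(\<lambda>x. v x *\<^sub>R D x) \<in> borel_measurable (lebesgue_on \<Omega>)" using v(2) \<psi>m(2) by simp
      have "norm (v x *\<^sub>R D x) \<le> norm (B * v x)" for x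
      proof -
        have "B \<ge> 0" using norm_ge_zero[of "D x"] B(2)[of x] by linarith
        then show ?thesis
          using mult_right_mono[OF B(2)[of x], of "\<bar>v x\<bar>"] by (simp add: abs_mult mult.commute)
      qed
      then show "AE x in lebesgue_on \<Omega>. norm (v x *\<^sub>R D x) \<le> norm (B * v x)" by (rule AE_I2)
    qed
    have i2: "integrable (lebesgue_on \<Omega>) (\<lambda>x. \<psi> x *\<^sub>R G x)"
    proof (rule Bochner_Integration.integrable_bound)
      show "integrable (lebesgue_on \<Omega>) (\<lambda>x. B * norm (G x))"
        using integrable_of_square_integrable[OF finite_measure_axioms Gs] by simp
      show "(\<lambda>x. \<psi> x *\<^sub>R G x) \<in> borel_measurable (lebesgue_on \<Omega>)" using \<psi>m(1) Gm by simp
      have "norm (\<psi> x *\<^sub>R G x) \<le> norm (B * norm (G x))" for x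
      proof -
        have "B \<ge> 0" using B(1)[of x] by linarith
        then show ?thesis
          using mult_right_mono[OF B(1)[of x], of "norm (G x)"] by (simp add: abs_mult)
      qed
      then show "AE x in lebesgue_on \<Omega>. norm (\<psi> x *\<^sub>R G x) \<le> norm (B * norm (G x))" by (rule AE_I2)
    qed
    have eq: "(\<integral>x. v x *\<^sub>R D x \<partial>lebesgue_on \<Omega>) = - (\<integral>x. \<psi> x *\<^sub>R G x \<partial>lebesgue_on \<Omega>)"
      using wg \<psi> by (simp add: weak_gradient_def)
    have "(\<integral>x. v' x * (D x \<bullet> e) \<partial>lborel) = (\<integral>x. v' x * (D x \<bullet> e) \<partial>lebesgue_on \<Omega>)"
      using test_function_measurable[OF \<psi>] v' Om
      by (intro lborel_off_domain(1)[symmetric]) simp_all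
    also have "\<dots> = (\<integral>x. v x *\<^sub>R D x \<bullet> e \<partial>lebesgue_on \<Omega>)"
    proof (rule integral_cong_AE)
      show "AE x in lebesgue_on \<Omega>. v' x * (D x \<bullet> e) = v x *\<^sub>R D x \<bullet> e"
        using v'(3) by (rule AE_mp) (rule AE_I2, simp)
    qed (use v'm v(2) \<psi>m in simp_all)
    also have "\<dots> = (\<integral>x. v x *\<^sub>R D x \<partial>lebesgue_on \<Omega>) \<bullet> e"
      using integral_inner_left[OF i1, of e] by simp
    also have "\<dots> = - ((\<integral>x. \<psi> x *\<^sub>R G x \<partial>lebesgue_on \<Omega>) \<bullet> e)" unfolding eq by simp
    also have "(\<integral>x. \<psi> x *\<^sub>R G x \<partial>lebesgue_on \<Omega>) \<bullet> e = (\<integral>x. \<psi> x *\<^sub>R G x \<bullet> e \<partial>lebesgue_on \<Omega>)"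
      using integral_inner_left[OF i2, of e] by simp
    also have "\<dots> = (\<integral>x. \<psi> x * (G' x \<bullet> e) \<partial>lebesgue_on \<Omega>)"
    proof (rule integral_cong_AE)
      show "AE x in lebesgue_on \<Omega>. \<psi> x *\<^sub>R G x \<bullet> e = \<psi> x * (G' x \<bullet> e)"
        using G'(3) by (rule AE_mp) (rule AE_I2, simp)
    qed (use G'm Gm \<psi>m in simp_all)
    also have "\<dots> = (\<integral>x. \<psi> x * (G' x \<bullet> e) \<partial>lborel)"
      using test_function_measurable[OF \<psi>] G' Om
      by (intro lborel_off_domain(1)) simp_all
    finally show ?thesis .
  qed
  then have "borel_weak_gradient \<Omega> v' G'"
    unfolding borel_weak_gradient_def using v's G'(1) G's v'(2) G'(2) by simp
  then show ?thesis using v'(3) G'(3) by blast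
qed

text \<open>Needed on the test side: \<open>neumann_laplacian\<close> quantifies over pairs with
  \<open>weak_gradient\<close>, so every Borel pair must qualify as such a pair before the
  variational identity can be transferred.\<close>

lemma borel_imp_weak_gradient:
  fixes \<Omega> :: "'a::euclidean_space set"
  assumes \<Omega>: "open \<Omega>" "bounded \<Omega>" and wg: "borel_weak_gradient \<Omega> v G"
  shows "weak_gradient \<Omega> v G"
  unfolding weak_gradient_def
proof (intro conjI allI impI)
  have Om: "\<Omega> \<in> sets borel" using \<Omega> by simp
  note vD = borel_weak_gradientD[OF wg]
  have nG: "(\<lambda>x. norm (G x)) \<in> borel_measurable borel"
    by (rule measurable_compose[OF vD(2) borel_measurable_norm])
  show "v \<in> L2 \<Omega>"
    using square_integrable_off_domain(1)[OF Om vD(3,5)] vD(1) by (simp add: L2_iff)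
  show "G \<in> borel_measurable (lebesgue_on \<Omega>)"
    by (rule borel_imp_lebesgue_on_measurable[OF vD(2)])
  show "integrable (lebesgue_on \<Omega>) (\<lambda>x. (norm (G x))\<^sup>2)"
    using square_integrable_off_domain(1)[OF Om nG] vD(4,6) by (simp add: square_integrable_def)
  fix \<psi> D assume \<psi>: "test_function \<Omega> \<psi> D"
  obtain B where B: "\<And>x. \<bar>\<psi> x\<bar> \<le> B" "\<And>x. norm (D x) \<le> B" using test_function_bounded[OF \<psi>] by blast
  have \<psi>m: "\<psi> \<in> borel_measurable borel" "D \<in> borel_measurable borel"
    by (rule test_function_measurable[OF \<psi>])+
  have B0: "B \<ge> 0" using B(1)[of 0] by linarith
  have vint: "integrable lborel v"
    by (rule square_integrable_imp_integrable_bounded_support[OF vD(1,5) Om \<Omega>(2)])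
  have Gint: "integrable lborel (\<lambda>x. norm (G x))"
    by (rule square_integrable_imp_integrable_bounded_support[OF vD(4) _ Om \<Omega>(2)]) (simp add: vD(6))
  have i1: "integrable lborel (\<lambda>x. v x *\<^sub>R D x)"
  proof (rule Bochner_Integration.integrable_bound)
    show "integrable lborel (\<lambda>x. B * v x)" using vint by simp
    show "(\<lambda>x. v x *\<^sub>R D x) \<in> borel_measurable lborel" using vD(3) \<psi>m(2) by simp
    have "norm (v x *\<^sub>R D x) \<le> norm (B * v x)" for x
      using mult_right_mono[OF B(2)[of x], of "\<bar>v x\<bar>"] B0 by (simp add: abs_mult mult.commute)
    then show "AE x in lborel. norm (v x *\<^sub>R D x) \<le> norm (B * v x)" by (rule AE_I2)
  qed
  have i2: "integrable lborel (\<lambda>x. \<psi> x *\<^sub>R G x)"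
  proof (rule Bochner_Integration.integrable_bound)
    show "integrable lborel (\<lambda>x. B * norm (G x))" using Gint by simp
    show "(\<lambda>x. \<psi> x *\<^sub>R G x) \<in> borel_measurable lborel" using \<psi>m(1) vD(2) by simp
    have "norm (\<psi> x *\<^sub>R G x) \<le> norm (B * norm (G x))" for x
      using mult_right_mono[OF B(1)[of x], of "norm (G x)"] B0 by (simp add: abs_mult)
    then show "AE x in lborel. norm (\<psi> x *\<^sub>R G x) \<le> norm (B * norm (G x))" by (rule AE_I2)
  qed
  have e1: "(\<lambda>x. indicator \<Omega> x *\<^sub>R (v x *\<^sub>R D x)) = (\<lambda>x. v x *\<^sub>R D x)"
  proof
    fix x show "indicator \<Omega> x *\<^sub>R (v x *\<^sub>R D x) = v x *\<^sub>R D x"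
      using vD(5)[of x] by (cases "x \<in> \<Omega>") auto
  qed
  have e2: "(\<lambda>x. indicator \<Omega> x *\<^sub>R (\<psi> x *\<^sub>R G x)) = (\<lambda>x. \<psi> x *\<^sub>R G x)"
  proof
    fix x show "indicator \<Omega> x *\<^sub>R (\<psi> x *\<^sub>R G x) = \<psi> x *\<^sub>R G x"
      using vD(6)[of x] by (cases "x \<in> \<Omega>") auto
  qed
  have "(\<integral>x. v x *\<^sub>R D x \<partial>lborel) = - (\<integral>x. \<psi> x *\<^sub>R G x \<partial>lborel)"
  proof (rule euclidean_eqI)
    fix b :: 'a assume "b \<in> Basis"
    have "(\<integral>x. v x *\<^sub>R D x \<partial>lborel) \<bullet> b = (\<integral>x. v x * (D x \<bullet> b) \<partial>lborel)"
      using integral_inner_left[OF i1, of b] by simp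
    also have "\<dots> = - (\<integral>x. \<psi> x * (G x \<bullet> b) \<partial>lborel)" by (rule vD(7)[OF \<psi>])
    also have "(\<integral>x. \<psi> x * (G x \<bullet> b) \<partial>lborel) = (\<integral>x. \<psi> x *\<^sub>R G x \<partial>lborel) \<bullet> b"
      using integral_inner_left[OF i2, of b] by simp
    finally show "(\<integral>x. v x *\<^sub>R D x \<partial>lborel) \<bullet> b = - (\<integral>x. \<psi> x *\<^sub>R G x \<partial>lborel) \<bullet> b" by simp
  qed
  then show "(\<integral>x. v x *\<^sub>R D x \<partial>lebesgue_on \<Omega>) = - (\<integral>x. \<psi> x *\<^sub>R G x \<partial>lebesgue_on \<Omega>)"
    using lebesgue_on_integral_borel(1)[OF Om, of "\<lambda>x. v x *\<^sub>R D x"]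
      lebesgue_on_integral_borel(1)[OF Om, of "\<lambda>x. \<psi> x *\<^sub>R G x"] vD(2,3) \<psi>m
    unfolding e1 e2 by simp
qed

lemma neumann_laplacian_imp_borel:
  fixes \<Omega> :: "'a::euclidean_space set"
  assumes \<Omega>: "open \<Omega>" "bounded \<Omega>" and nl: "neumann_laplacian \<Omega> v g"
  shows "\<exists>v' G' g'. borel_weak_laplacian \<Omega> v' G' g' \<and> (AE x in lebesgue_on \<Omega>. v x = v' x) \<and>
    l2norm lborel v' = L2_norm \<Omega> v \<and> l2norm lborel g' = L2_norm \<Omega> g"
proof -
  have Om: "\<Omega> \<in> sets borel" using \<Omega> by simp
  obtain G where wg: "weak_gradient \<Omega> v G"
    and eq: "\<And>\<psi> H. weak_gradient \<Omega> \<psi> H \<Longrightarrow>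
       (\<integral>x. G x \<bullet> H x \<partial>lebesgue_on \<Omega>) + (\<integral>x. g x * \<psi> x \<partial>lebesgue_on \<Omega>) = 0"
    and g: "square_integrable (lebesgue_on \<Omega>) g"
    using nl unfolding neumann_laplacian_def L2_iff by blast
  have vm: "v \<in> borel_measurable (lebesgue_on \<Omega>)" and Gm: "G \<in> borel_measurable (lebesgue_on \<Omega>)"
    using wg by (auto simp: weak_gradient_def L2_iff square_integrable_def)
  have gm: "g \<in> borel_measurable (lebesgue_on \<Omega>)" by (rule square_integrableD(1)[OF g])
  obtain v' G' where v': "borel_weak_gradient \<Omega> v' G'" "AE x in lebesgue_on \<Omega>. v x = v' x"
    "AE x in lebesgue_on \<Omega>. G x = G' x"
    using weak_gradient_imp_borel[OF \<Omega> wg] by blast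
  note vD = borel_weak_gradientD[OF v'(1)]
  obtain g' where g': "g' \<in> borel_measurable borel" "\<And>x. x \<notin> \<Omega> \<Longrightarrow> g' x = 0" "AE x in lebesgue_on \<Omega>. g x = g' x"
    using borel_representative_real[OF Om gm] by blast
  note g'm = borel_imp_lebesgue_on_measurable[OF g'(1), of \<Omega>]
  have "square_integrable (lebesgue_on \<Omega>) g'"
  proof (rule square_integrable_bound[OF g g'm])
    show "AE x in lebesgue_on \<Omega>. \<bar>g' x\<bar> \<le> \<bar>g x\<bar>"
      using g'(3) by (rule AE_mp) (rule AE_I2, simp)
  qed
  then have g's: "square_integrable lborel g'"
    using square_integrable_off_domain(1)[OF Om g'(1,2)] by simp
  have "(\<integral>x. G' x \<bullet> H x \<partial>lborel) + (\<integral>x. g' x * \<psi> x \<partial>lborel) = 0" if \<psi>: "borel_weak_gradient \<Omega> \<psi> H" for \<psi> H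
  proof -
    note pD = borel_weak_gradientD[OF \<psi>]
    have "(\<integral>x. G' x \<bullet> H x \<partial>lborel) = (\<integral>x. G' x \<bullet> H x \<partial>lebesgue_on \<Omega>)"
      using vD(2,6) pD(2) Om by (intro lborel_off_domain(1)[symmetric]) simp_all
    also have "\<dots> = (\<integral>x. G x \<bullet> H x \<partial>lebesgue_on \<Omega>)"
    proof (rule integral_cong_AE)
      show "AE x in lebesgue_on \<Omega>. G' x \<bullet> H x = G x \<bullet> H x"
        using v'(3) by (rule AE_mp) (rule AE_I2, simp)
    qed (use Gm borel_imp_lebesgue_on_measurable[OF vD(2)] borel_imp_lebesgue_on_measurable[OF pD(2)] in simp_all)
    finally have 1: "(\<integral>x. G' x \<bullet> H x \<partial>lborel) = (\<integral>x. G x \<bullet> H x \<partial>lebesgue_on \<Omega>)" .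
    have "(\<integral>x. g' x * \<psi> x \<partial>lborel) = (\<integral>x. g' x * \<psi> x \<partial>lebesgue_on \<Omega>)"
      using g' pD(3) Om by (intro lborel_off_domain(1)[symmetric]) simp_all
    also have "\<dots> = (\<integral>x. g x * \<psi> x \<partial>lebesgue_on \<Omega>)"
    proof (rule integral_cong_AE)
      show "AE x in lebesgue_on \<Omega>. g' x * \<psi> x = g x * \<psi> x"
        using g'(3) by (rule AE_mp) (rule AE_I2, simp)
    qed (use gm g'm borel_imp_lebesgue_on_measurable[OF pD(3)] in simp_all)
    finally show ?thesis
      using 1 eq[OF borel_imp_weak_gradient[OF \<Omega> \<psi>]] by simp
  qed
  then have "borel_weak_laplacian \<Omega> v' G' g'"
    using v'(1) g's by (simp add: borel_weak_laplacian_def)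
  moreover have "l2norm lborel v' = L2_norm \<Omega> v"
    unfolding L2_norm_eq
    using square_integrable_off_domain(2)[OF Om vD(3,5)]
      l2norm_cong_AE[OF vm borel_imp_lebesgue_on_measurable[OF vD(3)] v'(2)] by simp
  moreover have "l2norm lborel g' = L2_norm \<Omega> g"
    unfolding L2_norm_eq
    using square_integrable_off_domain(2)[OF Om g'(1,2)] l2norm_cong_AE[OF gm g'm g'(3)] by simp
  ultimately show ?thesis using v'(2) by blast
qed

text \<open>The one-sided bound is applied to v and to -v. C and R0 depend on the domain only, and R
  remains a free scale.\<close>

theorem neumann_sup_bound:
  fixes \<Omega> :: "'a::euclidean_space set"
  assumes \<Omega>: "open \<Omega>" "bounded \<Omega>" "convex \<Omega>" "\<Omega> \<noteq> {}" and d3: "DIM('a) \<le> 3"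
  shows "\<exists>C>0. \<exists>R0>0. \<forall>v g R. neumann_laplacian \<Omega> v g \<and> 0 < R \<and> R \<le> R0 \<longrightarrow>
    (AE x in lebesgue_on \<Omega>. \<bar>v x\<bar> \<le> C * (R powr (- real DIM('a) / 2) * L2_norm \<Omega> v + R powr (2 - real DIM('a) / 2) * L2_norm \<Omega> g))"
proof -
  have Om: "\<Omega> \<in> sets borel" using \<Omega> by simp
  obtain C R0 where C: "C > 0" "R0 > 0" and ub0: "\<forall>v G g R. borel_weak_laplacian \<Omega> v G g \<and> 0 < R \<and> R \<le> R0 \<longrightarrow>
    (AE x in lborel. v x \<le> C * (R powr (- real DIM('a) / 2) * l2norm lborel v + R powr (2 - real DIM('a) / 2) * l2norm lborel g))"
    using stampacchia_upper_bound[OF \<Omega> d3] by metis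
  have ub: "AE x in lborel. v x \<le> C * (R powr (- real DIM('a) / 2) * l2norm lborel v + R powr (2 - real DIM('a) / 2) * l2norm lborel g)"
    if "borel_weak_laplacian \<Omega> v G g" "0 < R" "R \<le> R0" for v G g R
    using ub0 that by simp
  have main: "AE x in lebesgue_on \<Omega>. \<bar>v x\<bar> \<le> C * (R powr (- real DIM('a) / 2) * L2_norm \<Omega> v + R powr (2 - real DIM('a) / 2) * L2_norm \<Omega> g)"
    if nl: "neumann_laplacian \<Omega> v g" and R: "0 < R" "R \<le> R0" for v g R
  proof -
    obtain v' G' g' where v': "borel_weak_laplacian \<Omega> v' G' g'" "AE x in lebesgue_on \<Omega>. v x = v' x"
      "l2norm lborel v' = L2_norm \<Omega> v" "l2norm lborel g' = L2_norm \<Omega> g"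
      using neumann_laplacian_imp_borel[OF \<Omega>(1,2) nl] by blast
    have neg: "l2norm lborel (\<lambda>x. - f x) = l2norm lborel f" for f :: "'a \<Rightarrow> real"
      by (simp add: l2norm_def)
    let ?B = "C * (R powr (- real DIM('a) / 2) * L2_norm \<Omega> v + R powr (2 - real DIM('a) / 2) * L2_norm \<Omega> g)"
    have 1: "AE x in lborel. v' x \<le> ?B" using ub[OF v'(1) R] unfolding v'(3,4) .
    have 2: "AE x in lborel. - v' x \<le> ?B"
      using ub[OF borel_weak_laplacian_uminus[OF v'(1)] R] unfolding neg v'(3,4) .
    have 3: "AE x in lborel. x \<in> \<Omega> \<longrightarrow> v x = v' x"
      using v'(2) unfolding AE_lebesgue_on_iff[OF Om] .
    show ?thesis unfolding AE_lebesgue_on_iff[OF Om]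
      using 1 2 3 by eventually_elim auto
  qed
  show ?thesis
    by (rule exI[of _ C], intro conjI C(1), rule exI[of _ R0], intro conjI allI impI C(2), rule main) simp_all
qed

section \<open>Eigenfunction expansions\<close>

lemma weak_gradient_integrable:
  fixes \<Omega> :: "'a::euclidean_space set"
  assumes "open \<Omega>" "bounded \<Omega>" "weak_gradient \<Omega> v G" "test_function \<Omega> \<psi> D"
  shows "integrable (lebesgue_on \<Omega>) (\<lambda>x. v x *\<^sub>R D x)" "integrable (lebesgue_on \<Omega>) (\<lambda>x. \<psi> x *\<^sub>R G x)"
proof -
  interpret finite_measure "lebesgue_on \<Omega>" by (rule finite_measure_lebesgue_on[OF assms(1,2)])
  have v: "square_integrable (lebesgue_on \<Omega>) v" "v \<in> borel_measurable (lebesgue_on \<Omega>)"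
    and Gm: "G \<in> borel_measurable (lebesgue_on \<Omega>)"
    and Gs: "square_integrable (lebesgue_on \<Omega>) (\<lambda>x. norm (G x))"
    using assms(3) by (auto simp: weak_gradient_def L2_iff square_integrable_def)
  obtain B where B: "\<And>x. \<bar>\<psi> x\<bar> \<le> B" "\<And>x. norm (D x) \<le> B" using test_function_bounded[OF assms(4)] by blast
  have B0: "B \<ge> 0" using B(1)[of 0] by linarith
  have \<psi>m: "\<psi> \<in> borel_measurable (lebesgue_on \<Omega>)" "D \<in> borel_measurable (lebesgue_on \<Omega>)"
    using test_function_measurable[OF assms(4)] borel_imp_lebesgue_on_measurable by blast+
  show "integrable (lebesgue_on \<Omega>) (\<lambda>x. v x *\<^sub>R D x)"
  proof (rule Bochner_Integration.integrable_bound)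
    show "integrable (lebesgue_on \<Omega>) (\<lambda>x. B * v x)"
      using integrable_of_square_integrable[OF finite_measure_axioms v(1)] by simp
    show "(\<lambda>x. v x *\<^sub>R D x) \<in> borel_measurable (lebesgue_on \<Omega>)" using v(2) \<psi>m(2) by simp
    have "norm (v x *\<^sub>R D x) \<le> norm (B * v x)" for x
      using mult_right_mono[OF B(2)[of x], of "\<bar>v x\<bar>"] B0 by (simp add: abs_mult mult.commute)
    then show "AE x in lebesgue_on \<Omega>. norm (v x *\<^sub>R D x) \<le> norm (B * v x)" by (rule AE_I2)
  qed
  show "integrable (lebesgue_on \<Omega>) (\<lambda>x. \<psi> x *\<^sub>R G x)"
  proof (rule Bochner_Integration.integrable_bound)
    show "integrable (lebesgue_on \<Omega>) (\<lambda>x. B * norm (G x))"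
      using integrable_of_square_integrable[OF finite_measure_axioms Gs] by simp
    show "(\<lambda>x. \<psi> x *\<^sub>R G x) \<in> borel_measurable (lebesgue_on \<Omega>)" using \<psi>m(1) Gm by simp
    have "norm (\<psi> x *\<^sub>R G x) \<le> norm (B * norm (G x))" for x
      using mult_right_mono[OF B(1)[of x], of "norm (G x)"] B0 by (simp add: abs_mult)
    then show "AE x in lebesgue_on \<Omega>. norm (\<psi> x *\<^sub>R G x) \<le> norm (B * norm (G x))" by (rule AE_I2)
  qed
qed

lemma weak_gradientD:
  assumes "weak_gradient \<Omega> v G"
  shows "square_integrable (lebesgue_on \<Omega>) v" "G \<in> borel_measurable (lebesgue_on \<Omega>)"
    "square_integrable (lebesgue_on \<Omega>) (\<lambda>x. norm (G x))"
    "\<And>\<psi> D. test_function \<Omega> \<psi> D \<Longrightarrow> (\<integral>x. v x *\<^sub>R D x \<partial>lebesgue_on \<Omega>) = - (\<integral>x. \<psi> x *\<^sub>R G x \<partial>lebesgue_on \<Omega>)"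
  using assms by (auto simp: weak_gradient_def L2_iff square_integrable_def)

lemma weak_gradient_inner_integrable:
  assumes "weak_gradient \<Omega> v G" "weak_gradient \<Omega> w H"
  shows "integrable (lebesgue_on \<Omega>) (\<lambda>x. G x \<bullet> H x)"
proof (rule Bochner_Integration.integrable_bound)
  show "integrable (lebesgue_on \<Omega>) (\<lambda>x. norm (G x) * norm (H x))"
    by (rule square_integrable_mult[OF weak_gradientD(3)[OF assms(1)] weak_gradientD(3)[OF assms(2)]])
  show "(\<lambda>x. G x \<bullet> H x) \<in> borel_measurable (lebesgue_on \<Omega>)"
    using weak_gradientD(2)[OF assms(1)] weak_gradientD(2)[OF assms(2)] by simp
  show "AE x in lebesgue_on \<Omega>. norm (G x \<bullet> H x) \<le> norm (norm (G x) * norm (H x))"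
    by (rule AE_I2) (simp add: Cauchy_Schwarz_ineq2)
qed

lemma weak_gradient_add_cmult:
  fixes \<Omega> :: "'a::euclidean_space set"
  assumes \<Omega>: "open \<Omega>" "bounded \<Omega>" and v: "weak_gradient \<Omega> v G" and w: "weak_gradient \<Omega> w H"
  shows "weak_gradient \<Omega> (\<lambda>x. v x + c * w x) (\<lambda>x. G x + c *\<^sub>R H x)"
  unfolding weak_gradient_def
proof (intro conjI allI impI)
  note vD = weak_gradientD[OF v] and wD = weak_gradientD[OF w]
  show "(\<lambda>x. v x + c * w x) \<in> L2 \<Omega>"
    unfolding L2_iff by (rule square_integrable_add[OF vD(1) square_integrable_cmult[OF wD(1)]])
  show m: "(\<lambda>x. G x + c *\<^sub>R H x) \<in> borel_measurable (lebesgue_on \<Omega>)" using vD(2) wD(2) by simp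
  have "square_integrable (lebesgue_on \<Omega>) (\<lambda>x. norm (G x + c *\<^sub>R H x))"
  proof (rule square_integrable_bound)
    show "square_integrable (lebesgue_on \<Omega>) (\<lambda>x. norm (G x) + \<bar>c\<bar> * norm (H x))"
      by (rule square_integrable_add[OF vD(3) square_integrable_cmult[OF wD(3)]])
    show "(\<lambda>x. norm (G x + c *\<^sub>R H x)) \<in> borel_measurable (lebesgue_on \<Omega>)"
      by (rule measurable_compose[OF m borel_measurable_norm])
    have "\<bar>norm (G x + c *\<^sub>R H x)\<bar> \<le> \<bar>norm (G x) + \<bar>c\<bar> * norm (H x)\<bar>" for x
      using norm_triangle_ineq[of "G x" "c *\<^sub>R H x"] by simp
    then show "AE x in lebesgue_on \<Omega>. \<bar>norm (G x + c *\<^sub>R H x)\<bar> \<le> \<bar>norm (G x) + \<bar>c\<bar> * norm (H x)\<bar>"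
      by (rule AE_I2)
  qed
  then show "integrable (lebesgue_on \<Omega>) (\<lambda>x. (norm (G x + c *\<^sub>R H x))\<^sup>2)"
    by (rule square_integrableD(2))
  fix \<psi> D assume \<psi>: "test_function \<Omega> \<psi> D"
  note vi = weak_gradient_integrable[OF \<Omega> v \<psi>] and wi = weak_gradient_integrable[OF \<Omega> w \<psi>]
  have "(\<integral>x. (v x + c * w x) *\<^sub>R D x \<partial>lebesgue_on \<Omega>) = (\<integral>x. v x *\<^sub>R D x + c *\<^sub>R (w x *\<^sub>R D x) \<partial>lebesgue_on \<Omega>)"
    by (simp add: scaleR_add_left)
  also have "\<dots> = (\<integral>x. v x *\<^sub>R D x \<partial>lebesgue_on \<Omega>) + c *\<^sub>R (\<integral>x. w x *\<^sub>R D x \<partial>lebesgue_on \<Omega>)"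
    by (simp only: Bochner_Integration.integral_add[OF vi(1) integrable_scaleR_right[OF wi(1)]]
        integral_scaleR_right)
  also have "\<dots> = - ((\<integral>x. \<psi> x *\<^sub>R G x \<partial>lebesgue_on \<Omega>) + c *\<^sub>R (\<integral>x. \<psi> x *\<^sub>R H x \<partial>lebesgue_on \<Omega>))"
    unfolding vD(4)[OF \<psi>] wD(4)[OF \<psi>] by simp
  also have "(\<integral>x. \<psi> x *\<^sub>R G x \<partial>lebesgue_on \<Omega>) + c *\<^sub>R (\<integral>x. \<psi> x *\<^sub>R H x \<partial>lebesgue_on \<Omega>)
     = (\<integral>x. \<psi> x *\<^sub>R G x + c *\<^sub>R (\<psi> x *\<^sub>R H x) \<partial>lebesgue_on \<Omega>)"
    by (simp only: Bochner_Integration.integral_add[OF vi(2) integrable_scaleR_right[OF wi(2)]]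
        integral_scaleR_right)
  also have "\<dots> = (\<integral>x. \<psi> x *\<^sub>R (G x + c *\<^sub>R H x) \<partial>lebesgue_on \<Omega>)"
    by (simp add: scaleR_add_right mult.commute)
  finally show "(\<integral>x. (v x + c * w x) *\<^sub>R D x \<partial>lebesgue_on \<Omega>) = - (\<integral>x. \<psi> x *\<^sub>R (G x + c *\<^sub>R H x) \<partial>lebesgue_on \<Omega>)" .
qed

lemma neumann_laplacianE:
  assumes "neumann_laplacian \<Omega> v g"
  obtains G where "square_integrable (lebesgue_on \<Omega>) g" "weak_gradient \<Omega> v G"
    "\<And>\<psi> K. weak_gradient \<Omega> \<psi> K \<Longrightarrow>
       (\<integral>x. G x \<bullet> K x \<partial>lebesgue_on \<Omega>) + (\<integral>x. g x * \<psi> x \<partial>lebesgue_on \<Omega>) = 0"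
  using assms unfolding neumann_laplacian_def L2_iff by blast

lemma neumann_laplacian_add_cmult:
  fixes \<Omega> :: "'a::euclidean_space set"
  assumes \<Omega>: "open \<Omega>" "bounded \<Omega>" and v: "neumann_laplacian \<Omega> v g" and w: "neumann_laplacian \<Omega> w h"
  shows "neumann_laplacian \<Omega> (\<lambda>x. v x + c * w x) (\<lambda>x. g x + c * h x)"
proof -
  obtain G where g: "square_integrable (lebesgue_on \<Omega>) g" and G: "weak_gradient \<Omega> v G"
    and eG: "\<And>\<psi> K. weak_gradient \<Omega> \<psi> K \<Longrightarrow> (\<integral>x. G x \<bullet> K x \<partial>lebesgue_on \<Omega>) + (\<integral>x. g x * \<psi> x \<partial>lebesgue_on \<Omega>) = 0"
    by (rule neumann_laplacianE[OF v], rule that)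
  obtain H where h: "square_integrable (lebesgue_on \<Omega>) h" and H: "weak_gradient \<Omega> w H"
    and eH: "\<And>\<psi> K. weak_gradient \<Omega> \<psi> K \<Longrightarrow> (\<integral>x. H x \<bullet> K x \<partial>lebesgue_on \<Omega>) + (\<integral>x. h x * \<psi> x \<partial>lebesgue_on \<Omega>) = 0"
    by (rule neumann_laplacianE[OF w], rule that)
  show ?thesis
    unfolding neumann_laplacian_def L2_iff
  proof (intro conjI exI[of _ "\<lambda>x. G x + c *\<^sub>R H x"] allI impI)
    show "square_integrable (lebesgue_on \<Omega>) (\<lambda>x. g x + c * h x)"
      by (rule square_integrable_add[OF g square_integrable_cmult[OF h]])
    show "weak_gradient \<Omega> (\<lambda>x. v x + c * w x) (\<lambda>x. G x + c *\<^sub>R H x)"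
      by (rule weak_gradient_add_cmult[OF \<Omega> G H])
    fix \<psi> K assume K: "weak_gradient \<Omega> \<psi> K"
    note gi = square_integrable_mult[OF g weak_gradientD(1)[OF K]]
    note hi = square_integrable_mult[OF h weak_gradientD(1)[OF K]]
    have "(\<integral>x. (G x + c *\<^sub>R H x) \<bullet> K x \<partial>lebesgue_on \<Omega>) = (\<integral>x. G x \<bullet> K x + c * (H x \<bullet> K x) \<partial>lebesgue_on \<Omega>)"
      by (simp add: inner_add_left)
    also have "\<dots> = (\<integral>x. G x \<bullet> K x \<partial>lebesgue_on \<Omega>) + c * (\<integral>x. H x \<bullet> K x \<partial>lebesgue_on \<Omega>)"
      using weak_gradient_inner_integrable[OF G K] weak_gradient_inner_integrable[OF H K]
      by (subst Bochner_Integration.integral_add) simp_all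
    finally have 1: "(\<integral>x. (G x + c *\<^sub>R H x) \<bullet> K x \<partial>lebesgue_on \<Omega>)
       = (\<integral>x. G x \<bullet> K x \<partial>lebesgue_on \<Omega>) + c * (\<integral>x. H x \<bullet> K x \<partial>lebesgue_on \<Omega>)" .
    have "(\<integral>x. (g x + c * h x) * \<psi> x \<partial>lebesgue_on \<Omega>) = (\<integral>x. g x * \<psi> x + c * (h x * \<psi> x) \<partial>lebesgue_on \<Omega>)"
      by (simp add: distrib_right mult.assoc)
    also have "\<dots> = (\<integral>x. g x * \<psi> x \<partial>lebesgue_on \<Omega>) + c * (\<integral>x. h x * \<psi> x \<partial>lebesgue_on \<Omega>)"
      using gi hi by (subst Bochner_Integration.integral_add) simp_all
    finally have 2: "(\<integral>x. (g x + c * h x) * \<psi> x \<partial>lebesgue_on \<Omega>)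
       = (\<integral>x. g x * \<psi> x \<partial>lebesgue_on \<Omega>) + c * (\<integral>x. h x * \<psi> x \<partial>lebesgue_on \<Omega>)" .
    show "(\<integral>x. (G x + c *\<^sub>R H x) \<bullet> K x \<partial>lebesgue_on \<Omega>) + (\<integral>x. (g x + c * h x) * \<psi> x \<partial>lebesgue_on \<Omega>) = 0"
    proof -
      have "(\<integral>x. (G x + c *\<^sub>R H x) \<bullet> K x \<partial>lebesgue_on \<Omega>) + (\<integral>x. (g x + c * h x) * \<psi> x \<partial>lebesgue_on \<Omega>)
        = ((\<integral>x. G x \<bullet> K x \<partial>lebesgue_on \<Omega>) + (\<integral>x. g x * \<psi> x \<partial>lebesgue_on \<Omega>))
         + c * ((\<integral>x. H x \<bullet> K x \<partial>lebesgue_on \<Omega>) + (\<integral>x. h x * \<psi> x \<partial>lebesgue_on \<Omega>))"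
        unfolding 1 2 by (simp add: algebra_simps)
      then show ?thesis unfolding eG[OF K] eH[OF K] by simp
    qed
  qed
qed

lemma neumann_laplacian_zero: "neumann_laplacian \<Omega> (\<lambda>x. 0) (\<lambda>x. 0)"
  unfolding neumann_laplacian_def weak_gradient_def L2_iff
  by (auto simp: square_integrable_zero intro!: exI[of _ "\<lambda>x. 0"])

lemma neumann_laplacian_cong:
  assumes "neumann_laplacian \<Omega> v g" "h \<in> borel_measurable (lebesgue_on \<Omega>)" "AE x in lebesgue_on \<Omega>. g x = h x"
  shows "neumann_laplacian \<Omega> v h"
proof -
  obtain G where g: "square_integrable (lebesgue_on \<Omega>) g" and G: "weak_gradient \<Omega> v G"
    and eG: "\<And>\<psi> K. weak_gradient \<Omega> \<psi> K \<Longrightarrow> (\<integral>x. G x \<bullet> K x \<partial>lebesgue_on \<Omega>) + (\<integral>x. g x * \<psi> x \<partial>lebesgue_on \<Omega>) = 0"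
    by (rule neumann_laplacianE[OF assms(1)], rule that)
  have gm: "g \<in> borel_measurable (lebesgue_on \<Omega>)" by (rule square_integrableD(1)[OF g])
  have h: "square_integrable (lebesgue_on \<Omega>) h"
  proof (rule square_integrable_bound[OF g assms(2)])
    show "AE x in lebesgue_on \<Omega>. \<bar>h x\<bar> \<le> \<bar>g x\<bar>"
      using assms(3) by (rule AE_mp) (rule AE_I2, simp)
  qed
  have "(\<integral>x. h x * \<psi> x \<partial>lebesgue_on \<Omega>) = (\<integral>x. g x * \<psi> x \<partial>lebesgue_on \<Omega>)" if "weak_gradient \<Omega> \<psi> K" for \<psi> K
  proof (rule integral_cong_AE)
    show "AE x in lebesgue_on \<Omega>. h x * \<psi> x = g x * \<psi> x"
      using assms(3) by (rule AE_mp) (rule AE_I2, simp)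
  qed (use gm assms(2) square_integrableD(1)[OF weak_gradientD(1)[OF that]] in simp_all)
  then show ?thesis
    unfolding neumann_laplacian_def L2_iff using h G eG by auto
qed

section \<open>Coefficients with respect to the eigenfunctions\<close>

locale neumann_eigensystem =
  fixes \<Omega> :: "'a::euclidean_space set" and c0 :: real and lam :: "nat \<Rightarrow> real" and \<phi> :: "nat \<Rightarrow> 'a \<Rightarrow> real"
  assumes d3: "DIM('a) \<le> 3" and polyhedral: "convex_polyhedral_domain \<Omega>" and c0: "c0 > 0"
    and eigensystem: "eigensystem_A \<Omega> c0 lam \<phi>"
begin

abbreviation "M \<equiv> lebesgue_on \<Omega>"

lemma domain: "open \<Omega>" "bounded \<Omega>" "convex \<Omega>" "\<Omega> \<noteq> {}"
proof -
  obtain P where P: "polytope P" "\<Omega> = interior P" "\<Omega> \<noteq> {}"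
    using polyhedral unfolding convex_polyhedral_domain_def by blast
  then show "open \<Omega>" "bounded \<Omega>" "convex \<Omega>" "\<Omega> \<noteq> {}"
    using polytope_imp_bounded polytope_imp_convex
    by (auto intro: bounded_subset[OF _ interior_subset] convex_interior)
qed

lemma finM: "finite_measure M" by (rule finite_measure_lebesgue_on[OF domain(1,2)])

definition coef :: "('a \<Rightarrow> real) \<Rightarrow> nat \<Rightarrow> real" where
  "coef v l = L2_inner \<Omega> v (\<phi> l)"

text \<open>\<open>op_A\<close> is built from a chosen version of the Laplacian; membership in
  \<open>op_A_dom\<close> makes this choice genuine, and the eigenvalue equation holds almost
  everywhere. Replacing the chosen version by the explicit multiple removes the choice from all that
  follows.\<close>

lemma eigenfunction_laplacian: "neumann_laplacian \<Omega> (\<phi> l) (\<lambda>x. (c0 - lam l) * \<phi> l x)"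
proof -
  define g where "g = (SOME g. neumann_laplacian \<Omega> (\<phi> l) g)"
  have "\<exists>g. neumann_laplacian \<Omega> (\<phi> l) g"
    using eigensystem unfolding eigensystem_A_def op_A_dom_def by blast
  then have g: "neumann_laplacian \<Omega> (\<phi> l) g" unfolding g_def by (rule someI_ex)
  have "AE x in M. op_A \<Omega> c0 (\<phi> l) x = lam l * \<phi> l x"
    using eigensystem unfolding eigensystem_A_def by blast
  then have "AE x in M. - g x + c0 * \<phi> l x = lam l * \<phi> l x"
    unfolding op_A_def g_def .
  then have "AE x in M. g x = (c0 - lam l) * \<phi> l x"
    by (rule AE_mp) (rule AE_I2, simp add: left_diff_distrib)
  moreover have "(\<lambda>x. (c0 - lam l) * \<phi> l x) \<in> borel_measurable M"
  proof -
    obtain G where "weak_gradient \<Omega> (\<phi> l) G" by (rule neumann_laplacianE[OF g], rule that)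
    from square_integrableD(1)[OF weak_gradientD(1)[OF this]] show ?thesis by simp
  qed
  ultimately show ?thesis using neumann_laplacian_cong[OF g] by blast
qed

lemma phi_si: "square_integrable M (\<phi> l)"
proof -
  obtain G where "weak_gradient \<Omega> (\<phi> l) G" by (rule neumann_laplacianE[OF eigenfunction_laplacian], rule that)
  then show ?thesis by (rule weak_gradientD(1))
qed

lemma orthonormal: "(\<integral>x. \<phi> k x * \<phi> l x \<partial>M) = (if k = l then 1 else 0)"
  using eigensystem unfolding eigensystem_A_def L2_inner_def by blast

lemma complete:
  assumes "square_integrable M v" "\<And>l. coef v l = 0"
  shows "AE x in M. v x = 0"
proof -
  have *: "\<forall>v\<in>L2 \<Omega>. (\<forall>l. L2_inner \<Omega> v (\<phi> l) = 0) \<longrightarrow> (AE x in M. v x = 0)"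
    using eigensystem unfolding eigensystem_A_def by (elim conjE)
  have "v \<in> L2 \<Omega>" "\<forall>l. L2_inner \<Omega> v (\<phi> l) = 0"
    using assms by (simp_all add: coef_def L2_iff)
  from mp[OF bspec[OF * this(1)] this(2)] show ?thesis .
qed

text \<open>Symmetry of the weak formulation: the identity for v is tested with the eigenfunction
  and the identity for the eigenfunction with v, which leaves the same gradient integral in
  both.\<close>

lemma coef_laplacian:
  assumes "neumann_laplacian \<Omega> v g"
  shows "coef g l = (c0 - lam l) * coef v l"
proof -
  obtain G where g: "square_integrable M g" and G: "weak_gradient \<Omega> v G"
    and eG: "\<And>\<psi> K. weak_gradient \<Omega> \<psi> K \<Longrightarrow> (\<integral>x. G x \<bullet> K x \<partial>M) + (\<integral>x. g x * \<psi> x \<partial>M) = 0"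
    by (rule neumann_laplacianE[OF assms], rule that)
  obtain H where H: "weak_gradient \<Omega> (\<phi> l) H"
    and eH: "\<And>\<psi> K. weak_gradient \<Omega> \<psi> K \<Longrightarrow> (\<integral>x. H x \<bullet> K x \<partial>M) + (\<integral>x. (c0 - lam l) * \<phi> l x * \<psi> x \<partial>M) = 0"
    by (rule neumann_laplacianE[OF eigenfunction_laplacian[of l]], rule that)
  have "(\<integral>x. g x * \<phi> l x \<partial>M) = - (\<integral>x. G x \<bullet> H x \<partial>M)" using eG[OF H] by linarith
  also have "\<dots> = - (\<integral>x. H x \<bullet> G x \<partial>M)" by (simp add: inner_commute)
  also have "\<dots> = (\<integral>x. (c0 - lam l) * \<phi> l x * v x \<partial>M)" using eH[OF G] by linarith
  also have "\<dots> = (\<integral>x. (c0 - lam l) * (v x * \<phi> l x) \<partial>M)" by (simp add: mult_ac)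
  also have "\<dots> = (c0 - lam l) * (\<integral>x. v x * \<phi> l x \<partial>M)" by simp
  finally show ?thesis by (simp add: coef_def L2_inner_def)
qed

text \<open>Testing the eigenfunction equation with the eigenfunction identifies
  \<open>lam l - c0\<close> with its Dirichlet integral.\<close>

lemma lam_ge: "lam l \<ge> c0"
proof -
  obtain H where H: "weak_gradient \<Omega> (\<phi> l) H"
    and eH: "\<And>\<psi> K. weak_gradient \<Omega> \<psi> K \<Longrightarrow> (\<integral>x. H x \<bullet> K x \<partial>M) + (\<integral>x. (c0 - lam l) * \<phi> l x * \<psi> x \<partial>M) = 0"
    by (rule neumann_laplacianE[OF eigenfunction_laplacian[of l]], rule that)
  have "(\<integral>x. (c0 - lam l) * \<phi> l x * \<phi> l x \<partial>M) = (c0 - lam l) * (\<integral>x. \<phi> l x * \<phi> l x \<partial>M)"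
    by (simp add: mult.assoc)
  then have "(\<integral>x. H x \<bullet> H x \<partial>M) = lam l - c0" using eH[OF H] orthonormal[of l l] by simp
  moreover have "(\<integral>x. H x \<bullet> H x \<partial>M) \<ge> 0" by simp
  ultimately show ?thesis by linarith
qed

lemma lam_pos: "lam l > 0" using lam_ge[of l] c0 by linarith

lemma sum_laplacian:
  assumes "finite F"
  shows "neumann_laplacian \<Omega> (\<lambda>x. \<Sum>l\<in>F. c l * \<phi> l x) (\<lambda>x. \<Sum>l\<in>F. c l * (c0 - lam l) * \<phi> l x)"
  using assms
proof (induction F)
  case empty
  then show ?case using neumann_laplacian_zero by simp
next
  case (insert a F)
  have "neumann_laplacian \<Omega> (\<lambda>x. (\<Sum>l\<in>F. c l * \<phi> l x) + c a * \<phi> a x)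
     (\<lambda>x. (\<Sum>l\<in>F. c l * (c0 - lam l) * \<phi> l x) + c a * ((c0 - lam a) * \<phi> a x))"
    by (rule neumann_laplacian_add_cmult[OF domain(1,2) insert.IH eigenfunction_laplacian])
  then show ?case using insert.hyps by (simp add: add.commute mult.assoc)
qed

lemma sum_si: "square_integrable M (\<lambda>x. \<Sum>l\<in>F. c l * \<phi> l x)"
  by (rule square_integrable_sum) (rule square_integrable_cmult[OF phi_si])

lemma inner_sum:
  assumes "square_integrable M v" "finite F"
  shows "(\<integral>x. v x * (\<Sum>l\<in>F. c l * \<phi> l x) \<partial>M) = (\<Sum>l\<in>F. c l * coef v l)"
proof -
  have "(\<integral>x. v x * (\<Sum>l\<in>F. c l * \<phi> l x) \<partial>M) = (\<integral>x. (\<Sum>l\<in>F. c l * (v x * \<phi> l x)) \<partial>M)"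
    by (simp add: sum_distrib_left mult_ac)
  also have "\<dots> = (\<Sum>l\<in>F. \<integral>x. c l * (v x * \<phi> l x) \<partial>M)"
    by (rule Bochner_Integration.integral_sum) (intro integrable_mult_right square_integrable_mult assms phi_si)
  finally show ?thesis by (simp add: coef_def L2_inner_def)
qed

lemma coef_sum:
  assumes "finite F"
  shows "coef (\<lambda>x. \<Sum>l\<in>F. c l * \<phi> l x) k = (if k \<in> F then c k else 0)"
proof -
  have "coef (\<lambda>x. \<Sum>l\<in>F. c l * \<phi> l x) k = (\<integral>x. \<phi> k x * (\<Sum>l\<in>F. c l * \<phi> l x) \<partial>M)"
    by (simp add: coef_def L2_inner_def mult.commute)
  also have "\<dots> = (\<Sum>l\<in>F. c l * coef (\<phi> k) l)" by (rule inner_sum[OF phi_si assms])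
  also have "\<dots> = (\<Sum>l\<in>F. if k = l then c l else 0)"
    by (rule sum.cong) (simp_all add: coef_def L2_inner_def orthonormal)
  finally show ?thesis using assms by simp
qed

lemma l2norm_sum:
  assumes "finite F"
  shows "(l2norm M (\<lambda>x. \<Sum>l\<in>F. c l * \<phi> l x))\<^sup>2 = (\<Sum>l\<in>F. (c l)\<^sup>2)"
proof -
  have "(l2norm M (\<lambda>x. \<Sum>l\<in>F. c l * \<phi> l x))\<^sup>2 = (\<integral>x. (\<Sum>l\<in>F. c l * \<phi> l x) * (\<Sum>l\<in>F. c l * \<phi> l x) \<partial>M)"
    unfolding l2norm_power2 by (simp add: power2_eq_square)
  also have "\<dots> = (\<Sum>l\<in>F. c l * coef (\<lambda>x. \<Sum>l\<in>F. c l * \<phi> l x) l)" by (rule inner_sum[OF sum_si assms])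
  also have "\<dots> = (\<Sum>l\<in>F. (c l)\<^sup>2)"
    by (rule sum.cong) (simp_all add: coef_sum[OF assms] power2_eq_square)
  finally show ?thesis .
qed

text \<open>The inner product of v with its partial sum S equals |S|^2, so Cauchy-Schwarz gives |S|
  <= |v|.\<close>

lemma bessel:
  assumes v: "square_integrable M v" and F: "finite F"
  shows "(\<Sum>l\<in>F. (coef v l)\<^sup>2) \<le> (l2norm M v)\<^sup>2"
proof -
  let ?S = "\<lambda>x. \<Sum>l\<in>F. coef v l * \<phi> l x"
  have "(\<Sum>l\<in>F. (coef v l)\<^sup>2) = (\<integral>x. v x * ?S x \<partial>M)"
    unfolding inner_sum[OF v F] by (simp add: power2_eq_square)
  also have "\<dots> \<le> l2norm M v * l2norm M ?S" using l2_Cauchy_Schwarz[OF v sum_si, of "coef v" F] by linarith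
  finally have "(l2norm M ?S)\<^sup>2 \<le> l2norm M v * l2norm M ?S" unfolding l2norm_sum[OF F] .
  then have "l2norm M ?S \<le> l2norm M v"
    using l2norm_nonneg[of M ?S] l2norm_nonneg[of M v]
    by (cases "l2norm M ?S = 0") (simp_all add: power2_eq_square)
  then have "(l2norm M ?S)\<^sup>2 \<le> (l2norm M v)\<^sup>2" by (rule power_mono[OF _ l2norm_nonneg])
  then show ?thesis unfolding l2norm_sum[OF F] .
qed

lemma coef_diff:
  assumes "square_integrable M v" "square_integrable M w"
  shows "coef (\<lambda>x. v x - w x) l = coef v l - coef w l"
proof -
  have "(\<integral>x. (v x - w x) * \<phi> l x \<partial>M) = (\<integral>x. v x * \<phi> l x - w x * \<phi> l x \<partial>M)"
    by (simp add: left_diff_distrib)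
  also have "\<dots> = (\<integral>x. v x * \<phi> l x \<partial>M) - (\<integral>x. w x * \<phi> l x \<partial>M)"
    by (rule Bochner_Integration.integral_diff) (intro square_integrable_mult assms phi_si)+
  finally show ?thesis by (simp add: coef_def L2_inner_def)
qed

lemma coef_bound:
  assumes "square_integrable M v"
  shows "\<bar>coef v l\<bar> \<le> l2norm M v"
proof -
  have "l2norm M (\<phi> l) = 1"
    using orthonormal[of l l] by (simp add: l2norm_def power2_eq_square)
  then show ?thesis using l2_Cauchy_Schwarz[OF assms phi_si, of l] by (simp add: coef_def L2_inner_def)
qed

lemma coef_cong_AE:
  assumes "v \<in> borel_measurable M" "w \<in> borel_measurable M" "AE x in M. v x = w x"
  shows "coef v l = coef w l"
  unfolding coef_def L2_inner_def
proof (rule integral_cong_AE)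
  show "AE x in M. v x * \<phi> l x = w x * \<phi> l x" using assms(3) by (rule AE_mp) (rule AE_I2, simp)
qed (use assms square_integrableD(1)[OF phi_si] in simp_all)

lemma coef_add_cmult:
  assumes "square_integrable M v" "square_integrable M w"
  shows "coef (\<lambda>x. v x + c * w x) l = coef v l + c * coef w l"
proof -
  have "(\<integral>x. (v x + c * w x) * \<phi> l x \<partial>M) = (\<integral>x. v x * \<phi> l x + c * (w x * \<phi> l x) \<partial>M)"
    by (simp add: distrib_right mult.assoc)
  also have "\<dots> = (\<integral>x. v x * \<phi> l x \<partial>M) + c * (\<integral>x. w x * \<phi> l x \<partial>M)"
    using square_integrable_mult[OF assms(1) phi_si[of l]] square_integrable_mult[OF assms(2) phi_si[of l]]
    by (subst Bochner_Integration.integral_add) simp_all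
  finally show ?thesis by (simp add: coef_def L2_inner_def)
qed

section \<open>Embedding of the domains of fractional powers into the bounded functions\<close>

lemma window_sup_bound:
  "\<exists>C>0. \<forall>F c \<Lambda>. finite F \<and> \<Lambda> \<ge> c0 \<and> (\<forall>l\<in>F. lam l \<le> \<Lambda>) \<longrightarrow>
    (AE x in M. \<bar>\<Sum>l\<in>F. c l * \<phi> l x\<bar> \<le> C * \<Lambda> powr (real DIM('a) / 4) * sqrt (\<Sum>l\<in>F. (c l)\<^sup>2))"
proof -
  let ?d = "real DIM('a)"
  obtain C R0 where C: "C > 0" "R0 > 0" and ub0: "\<forall>v g R. neumann_laplacian \<Omega> v g \<and> 0 < R \<and> R \<le> R0 \<longrightarrow>
    (AE x in M. \<bar>v x\<bar> \<le> C * (R powr (- ?d / 2) * L2_norm \<Omega> v + R powr (2 - ?d / 2) * L2_norm \<Omega> g))"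
    using neumann_sup_bound[OF domain d3] by metis
  \<comment> \<open>With this factor the scale R chosen below is admissible, R <= R0, for every
    \<Lambda> >= c0.\<close>
  define \<kappa> where "\<kappa> = R0 * sqrt c0"
  have \<kappa>: "\<kappa> > 0" using C c0 by (simp add: \<kappa>_def)
  define C1 where "C1 = C * (\<kappa> powr (- ?d / 2) + \<kappa> powr (2 - ?d / 2))"
  have C1: "C1 > 0" using C \<kappa> by (simp add: C1_def add_pos_pos)
  show ?thesis
  proof (intro exI[of _ C1] conjI C1 allI impI; elim conjE)
    fix F :: "nat set" and c :: "nat \<Rightarrow> real" and \<Lambda> :: real
    assume F: "finite F" and \<Lambda>: "c0 \<le> \<Lambda>" and lamF: "\<forall>l\<in>F. lam l \<le> \<Lambda>"
    have \<Lambda>0: "\<Lambda> > 0" using \<Lambda> c0 by linarith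
    let ?v = "\<lambda>x. \<Sum>l\<in>F. c l * \<phi> l x" and ?g = "\<lambda>x. \<Sum>l\<in>F. c l * (c0 - lam l) * \<phi> l x"
    let ?q = "sqrt (\<Sum>l\<in>F. (c l)\<^sup>2)"
    have nv: "L2_norm \<Omega> ?v = ?q"
      unfolding L2_norm_eq using l2norm_sum[OF F, of c] l2norm_nonneg[of M ?v] by (simp add: real_sqrt_unique)
    \<comment> \<open>On a span of eigenfunctions with eigenvalues in [c0, \<Lambda>] the Laplacian
      costs at most a factor \<Lambda>; inserted in the sup bound this yields an inequality of
      Bernstein type.\<close>
    have "(\<Sum>l\<in>F. (c l * (c0 - lam l))\<^sup>2) \<le> (\<Sum>l\<in>F. \<Lambda>\<^sup>2 * (c l)\<^sup>2)"
    proof (rule sum_mono)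
      fix l assume "l \<in> F"
      then have "\<bar>c0 - lam l\<bar> \<le> \<bar>\<Lambda>\<bar>" using lamF lam_ge[of l] \<Lambda>0 c0 by auto
      then have "(c0 - lam l)\<^sup>2 \<le> \<Lambda>\<^sup>2" by (simp only: abs_le_square_iff)
      then have "(c l)\<^sup>2 * (c0 - lam l)\<^sup>2 \<le> (c l)\<^sup>2 * \<Lambda>\<^sup>2" by (rule mult_left_mono) simp
      then show "(c l * (c0 - lam l))\<^sup>2 \<le> \<Lambda>\<^sup>2 * (c l)\<^sup>2" by (simp add: power_mult_distrib mult.commute)
    qed
    also have "\<dots> = (\<Lambda> * ?q)\<^sup>2" by (simp add: sum_distrib_left[symmetric] power_mult_distrib sum_nonneg)
    finally have "(L2_norm \<Omega> ?g)\<^sup>2 \<le> (\<Lambda> * ?q)\<^sup>2"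
      unfolding L2_norm_eq l2norm_sum[OF F, of "\<lambda>l. c l * (c0 - lam l)"] .
    then have ng: "L2_norm \<Omega> ?g \<le> \<Lambda> * ?q"
      by (rule power2_le_imp_le) (use \<Lambda>0 in \<open>simp add: sum_nonneg\<close>)
    \<comment> \<open>At this scale the two terms of the sup bound have the same order in \<open>\<Lambda>\<close>.\<close>
    define R where "R = \<kappa> * \<Lambda> powr (- 1 / 2)"
    have R: "0 < R" using \<kappa> \<Lambda>0 by (simp add: R_def)
    have R': "R \<le> R0"
    proof -
      have "sqrt c0 \<le> sqrt \<Lambda>" using \<Lambda> by simp
      then have "R0 * sqrt c0 / sqrt \<Lambda> \<le> R0" using C \<Lambda>0 by (simp add: field_simps)
      moreover have "\<Lambda> powr (- 1 / 2) = 1 / sqrt \<Lambda>"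
        using \<Lambda>0 by (simp add: powr_half_sqrt[symmetric] powr_minus_divide)
      ultimately show ?thesis by (simp add: R_def \<kappa>_def)
    qed
    have e1: "R powr (- ?d / 2) = \<kappa> powr (- ?d / 2) * \<Lambda> powr (?d / 4)"
      using \<kappa> \<Lambda>0 by (simp add: R_def powr_mult powr_powr)
    have e2: "R powr (2 - ?d / 2) * \<Lambda> = \<kappa> powr (2 - ?d / 2) * \<Lambda> powr (?d / 4)"
    proof -
      define a where "a = - 1 / 2 * (2 - ?d / 2)"
      have 1: "R powr (2 - ?d / 2) = \<kappa> powr (2 - ?d / 2) * \<Lambda> powr a"
        using \<kappa> \<Lambda>0 by (simp add: R_def powr_mult powr_powr a_def)
      have 2: "\<Lambda> powr a * \<Lambda> = \<Lambda> powr (a + 1)"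
        using \<Lambda>0 by (simp only: powr_add powr_one)
      have 3: "a + 1 = ?d / 4" by (simp add: a_def field_simps)
      show ?thesis unfolding 1 mult.assoc 2 3 ..
    qed
    have "C * (R powr (- ?d / 2) * L2_norm \<Omega> ?v + R powr (2 - ?d / 2) * L2_norm \<Omega> ?g)
       \<le> C * (R powr (- ?d / 2) * ?q + R powr (2 - ?d / 2) * (\<Lambda> * ?q))"
      unfolding nv using C ng by (intro mult_left_mono add_left_mono) simp_all
    also have "R powr (2 - ?d / 2) * (\<Lambda> * ?q) = (R powr (2 - ?d / 2) * \<Lambda>) * ?q" by simp
    also have "C * (R powr (- ?d / 2) * ?q + (R powr (2 - ?d / 2) * \<Lambda>) * ?q) = C1 * \<Lambda> powr (?d / 4) * ?q"
      unfolding e1 e2 C1_def by (simp add: algebra_simps)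
    finally have le: "C * (R powr (- ?d / 2) * L2_norm \<Omega> ?v + R powr (2 - ?d / 2) * L2_norm \<Omega> ?g)
      \<le> C1 * \<Lambda> powr (?d / 4) * ?q" .
    have "AE x in M. \<bar>?v x\<bar> \<le> C * (R powr (- ?d / 2) * L2_norm \<Omega> ?v + R powr (2 - ?d / 2) * L2_norm \<Omega> ?g)"
      using ub0 sum_laplacian[OF F] R R' by simp
    then show "AE x in M. \<bar>?v x\<bar> \<le> C1 * \<Lambda> powr (?d / 4) * ?q"
      by (rule AE_mp) (rule AE_I2, use le in linarith)
  qed
qed

text \<open>Eigenvalues are grouped into dyadic windows; the contributions decay since \<open>\<gamma> > d/2\<close>.\<close>

lemma finite_sum_sup_bound:
  assumes \<gamma>: "real DIM('a) / 2 < \<gamma>"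
  shows "\<exists>C>0. \<forall>F c. finite F \<longrightarrow>
    (AE x in M. \<bar>\<Sum>l\<in>F. c l * \<phi> l x\<bar> \<le> C * sqrt (\<Sum>l\<in>F. lam l powr \<gamma> * (c l)\<^sup>2))"
proof -
  let ?d = "real DIM('a)"
  obtain C where C: "C > 0" and win: "\<forall>F c \<Lambda>. finite F \<and> \<Lambda> \<ge> c0 \<and> (\<forall>l\<in>F. lam l \<le> \<Lambda>) \<longrightarrow>
    (AE x in M. \<bar>\<Sum>l\<in>F. c l * \<phi> l x\<bar> \<le> C * \<Lambda> powr (?d / 4) * sqrt (\<Sum>l\<in>F. (c l)\<^sup>2))"
    by (rule exE[OF window_sup_bound], elim conjE, rule that)
  \<comment> \<open>The ratio between neighbouring windows: the sup bound grows by 2^(d/4) while the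
    weight \<open>lam l powr \<gamma>\<close> gains 2^(-\<gamma>/2).\<close>
  define \<theta> where "\<theta> = 2 powr (?d / 4 - \<gamma> / 2)"
  have \<theta>: "0 < \<theta>" "\<theta> < 1"
    using \<gamma> powr_less_mono[of "?d / 4 - \<gamma> / 2" 0 2] by (simp_all add: \<theta>_def)
  define K where "K = C * (2 * c0) powr (?d / 4) * c0 powr (- \<gamma> / 2)"
  have K: "K > 0" using C c0 by (simp add: K_def)
  \<comment> \<open>The index of the window [c0 2^j, 2 c0 2^j] that contains the eigenvalue; it is
    defined for all of them because \<open>lam l\<close> is at least \<open>c0\<close>, so that the
    logarithm is nonnegative.\<close>
  define j where "j l = nat \<lfloor>log 2 (lam l / c0)\<rfloor>" for l
  have j: "c0 * 2 powr real (j l) \<le> lam l" "lam l \<le> 2 * c0 * 2 powr real (j l)" for l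
  proof -
    have "lam l / c0 \<ge> 1" using lam_ge[of l] c0 by simp
    then have l0: "log 2 (lam l / c0) \<ge> 0" by simp
    have pos: "lam l / c0 > 0" using lam_pos c0 by simp
    have jr: "real (j l) = of_int \<lfloor>log 2 (lam l / c0)\<rfloor>" using l0 by (simp add: j_def)
    have "real (j l) \<le> log 2 (lam l / c0)" "log 2 (lam l / c0) \<le> real (j l) + 1"
      unfolding jr by linarith+
    then have "2 powr real (j l) \<le> 2 powr log 2 (lam l / c0)" "2 powr log 2 (lam l / c0) \<le> 2 powr (real (j l) + 1)"
      by (intro powr_mono; simp)+
    then have "2 powr real (j l) \<le> lam l / c0" "lam l / c0 \<le> 2 * 2 powr real (j l)"
      using pos by (simp_all add: powr_add)
    then show "c0 * 2 powr real (j l) \<le> lam l" "lam l \<le> 2 * c0 * 2 powr real (j l)"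
      using c0 by (simp_all add: field_simps)
  qed
  have main: "AE x in M. \<bar>\<Sum>l\<in>F. c l * \<phi> l x\<bar> \<le> K / (1 - \<theta>) * sqrt (\<Sum>l\<in>F. lam l powr \<gamma> * (c l)\<^sup>2)"
    if F: "finite F" for F c
  proof -
    define Q where "Q = (\<Sum>l\<in>F. lam l powr \<gamma> * (c l)\<^sup>2)"
    have Q: "Q \<ge> 0" by (simp add: Q_def sum_nonneg)
    have piece: "AE x in M. \<bar>\<Sum>l\<in>{l\<in>F. j l = i}. c l * \<phi> l x\<bar> \<le> K * \<theta> ^ i * sqrt Q" for i
    proof -
      let ?F = "{l\<in>F. j l = i}" and ?\<Lambda> = "2 * c0 * 2 powr real i" and ?\<mu> = "c0 * 2 powr real i"
      have \<mu>: "?\<mu> > 0" using c0 by simp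
      have "1 \<le> 2 powr real i" by (simp add: ge_one_powr_ge_zero)
      then have "c0 * 1 \<le> (2 * c0) * 2 powr real i" using c0 by (intro mult_mono) simp_all
      then have "?\<Lambda> \<ge> c0" by simp
      moreover have "\<forall>l\<in>?F. lam l \<le> ?\<Lambda>" using j(2) by auto
      ultimately have ae: "AE x in M. \<bar>\<Sum>l\<in>?F. c l * \<phi> l x\<bar> \<le> C * ?\<Lambda> powr (?d / 4) * sqrt (\<Sum>l\<in>?F. (c l)\<^sup>2)"
        using win F by simp
      have "(\<Sum>l\<in>?F. (c l)\<^sup>2) \<le> (\<Sum>l\<in>?F. ?\<mu> powr (- \<gamma>) * (lam l powr \<gamma> * (c l)\<^sup>2))"
      proof (rule sum_mono)
        fix l assume l: "l \<in> ?F"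
        have "?\<mu> powr \<gamma> \<le> lam l powr \<gamma>" using j(1)[of l] l \<mu> \<gamma> by (intro powr_mono2) auto
        moreover have "?\<mu> powr \<gamma> > 0" using c0 by simp
        ultimately have "1 \<le> lam l powr \<gamma> / ?\<mu> powr \<gamma>"
          by (simp only: le_divide_eq_1_pos)
        then have "1 \<le> ?\<mu> powr (- \<gamma>) * lam l powr \<gamma>"
          by (simp only: powr_minus_divide times_divide_eq_left mult_1_left)
        then have "1 * (c l)\<^sup>2 \<le> (?\<mu> powr (- \<gamma>) * lam l powr \<gamma>) * (c l)\<^sup>2" by (rule mult_right_mono) simp
        then show "(c l)\<^sup>2 \<le> ?\<mu> powr (- \<gamma>) * (lam l powr \<gamma> * (c l)\<^sup>2)" by (simp add: mult.assoc)
      qed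
      also have "\<dots> = ?\<mu> powr (- \<gamma>) * (\<Sum>l\<in>?F. lam l powr \<gamma> * (c l)\<^sup>2)" by (rule sum_distrib_left[symmetric])
      also have "\<dots> \<le> ?\<mu> powr (- \<gamma>) * Q"
        unfolding Q_def using F by (intro mult_left_mono sum_mono2) auto
      finally have "sqrt (\<Sum>l\<in>?F. (c l)\<^sup>2) \<le> sqrt (?\<mu> powr (- \<gamma>) * Q)" by (rule real_sqrt_le_mono)
      also have "\<dots> = ?\<mu> powr (- \<gamma> / 2) * sqrt Q"
        using \<mu> by (simp add: real_sqrt_mult powr_half_sqrt[symmetric] powr_powr)
      finally have "C * ?\<Lambda> powr (?d / 4) * sqrt (\<Sum>l\<in>?F. (c l)\<^sup>2) \<le> C * ?\<Lambda> powr (?d / 4) * (?\<mu> powr (- \<gamma> / 2) * sqrt Q)"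
        using C by (intro mult_left_mono) simp_all
      also have "\<dots> = K * \<theta> ^ i * sqrt Q"
      proof -
        have 1: "?\<Lambda> powr (?d / 4) = (2 * c0) powr (?d / 4) * 2 powr (real i * (?d / 4))"
          using c0 by (simp add: powr_mult powr_powr)
        have 2: "?\<mu> powr (- \<gamma> / 2) = c0 powr (- \<gamma> / 2) * 2 powr (real i * (- \<gamma> / 2))"
          using c0 by (simp add: powr_mult powr_powr)
        have 3: "2 powr (real i * (?d / 4)) * 2 powr (real i * (- \<gamma> / 2)) = \<theta> ^ i"
        proof -
          have "\<theta> ^ i = \<theta> powr real i" using \<theta> by (simp add: powr_realpow)
          also have "\<dots> = 2 powr ((?d / 4 - \<gamma> / 2) * real i)" unfolding \<theta>_def by (rule powr_powr)
          also have "(?d / 4 - \<gamma> / 2) * real i = real i * (?d / 4) + real i * (- \<gamma> / 2)"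
            by (simp add: algebra_simps)
          finally show ?thesis by (simp only: powr_add)
        qed
        show ?thesis unfolding K_def 1 2 3[symmetric] by (simp add: mult_ac)
      qed
      finally have le: "C * ?\<Lambda> powr (?d / 4) * sqrt (\<Sum>l\<in>?F. (c l)\<^sup>2) \<le> K * \<theta> ^ i * sqrt Q" .
      show ?thesis using ae by (rule AE_mp) (rule AE_I2, use le in linarith)
    qed
    have "AE x in M. \<forall>i. \<bar>\<Sum>l\<in>{l\<in>F. j l = i}. c l * \<phi> l x\<bar> \<le> K * \<theta> ^ i * sqrt Q"
      unfolding AE_all_countable using piece by blast
    then show ?thesis
    proof (rule AE_mp, intro AE_I2 impI)
      fix x assume A: "\<forall>i. \<bar>\<Sum>l\<in>{l\<in>F. j l = i}. c l * \<phi> l x\<bar> \<le> K * \<theta> ^ i * sqrt Q"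
      have "(\<Sum>l\<in>F. c l * \<phi> l x) = (\<Sum>i\<in>j ` F. \<Sum>l\<in>{l\<in>F. j l = i}. c l * \<phi> l x)"
        by (rule sum.image_gen[OF F])
      then have "\<bar>\<Sum>l\<in>F. c l * \<phi> l x\<bar> \<le> (\<Sum>i\<in>j ` F. \<bar>\<Sum>l\<in>{l\<in>F. j l = i}. c l * \<phi> l x\<bar>)"
        by (simp only: sum_abs)
      also have "\<dots> \<le> (\<Sum>i\<in>j ` F. \<theta> ^ i * (K * sqrt Q))"
        by (rule sum_mono) (use A in \<open>simp add: mult_ac\<close>)
      also have "\<dots> = (\<Sum>i\<in>j ` F. \<theta> ^ i) * (K * sqrt Q)" by (rule sum_distrib_right[symmetric])
      also have "\<dots> \<le> (1 / (1 - \<theta>)) * (K * sqrt Q)"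
      proof (rule mult_right_mono)
        have "(\<Sum>i\<in>j ` F. \<theta> ^ i) \<le> (\<Sum>i. \<theta> ^ i)"
          using \<theta> F by (intro sum_le_suminf summable_geometric) simp_all
        also have "\<dots> = 1 / (1 - \<theta>)" using \<theta> by (intro suminf_geometric) simp
        finally show "(\<Sum>i\<in>j ` F. \<theta> ^ i) \<le> 1 / (1 - \<theta>)" .
      qed (use K Q in simp)
      finally show "\<bar>\<Sum>l\<in>F. c l * \<phi> l x\<bar> \<le> K / (1 - \<theta>) * sqrt (\<Sum>l\<in>F. lam l powr \<gamma> * (c l)\<^sup>2)"
        by (simp add: Q_def)
    qed
  qed
  show ?thesis
  proof (intro exI[of _ "K / (1 - \<theta>)"] conjI allI impI)
    show "0 < K / (1 - \<theta>)" using K \<theta> by simp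
  qed (rule main)
qed

text \<open>Blocks of the expansion are controlled by increments of the convergent sequence Q, so
  the partial sums are Cauchy almost everywhere and bounded by C B; their limit has the coefficients
  of v and equals v by completeness. The hypothesis is a bound on the coefficient sums themselves,
  because it will be applied to functions whose coefficients have been estimated one by one.\<close>

theorem sobolev_embedding:
  assumes \<gamma>: "real DIM('a) / 2 < \<gamma>"
  shows "\<exists>C>0. \<forall>v B. square_integrable M v \<and> B \<ge> 0 \<and> (\<forall>n. (\<Sum>l<n. lam l powr \<gamma> * (coef v l)\<^sup>2) \<le> B\<^sup>2) \<longrightarrow>
    (AE x in M. \<bar>v x\<bar> \<le> C * B)"
proof -
  obtain C where C: "C > 0" and fin: "\<forall>F c. finite F \<longrightarrow>
    (AE x in M. \<bar>\<Sum>l\<in>F. c l * \<phi> l x\<bar> \<le> C * sqrt (\<Sum>l\<in>F. lam l powr \<gamma> * (c l)\<^sup>2))"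
    by (rule exE[OF finite_sum_sup_bound[OF \<gamma>]], elim conjE, rule that)
  interpret finite_measure M by (rule finM)
  have main: "AE x in M. \<bar>v x\<bar> \<le> C * B"
    if v: "square_integrable M v" and B: "B \<ge> 0" and le: "\<And>n. (\<Sum>l<n. lam l powr \<gamma> * (coef v l)\<^sup>2) \<le> B\<^sup>2" for v B
  proof -
    define S where "S n x = (\<Sum>l<n. coef v l * \<phi> l x)" for n x
    define Q where "Q n = (\<Sum>l<n. lam l powr \<gamma> * (coef v l)\<^sup>2)" for n
    have Qinc: "incseq Q" unfolding Q_def by (intro monoI sum_mono2) auto
    have "bdd_above (range Q)" unfolding Q_def using le by (intro bdd_aboveI2) auto
    then obtain q where q: "Q \<longlonglongrightarrow> q" using LIMSEQ_incseq_SUP[OF _ Qinc] by blast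
    have Ssi: "square_integrable M (S n)" for n unfolding S_def by (rule sum_si)
    have Sm: "S n \<in> borel_measurable M" for n by (rule square_integrableD(1)[OF Ssi])
    have diff: "AE x in M. \<bar>S n x - S m x\<bar> \<le> C * sqrt (Q n - Q m)" if "m \<le> n" for m n
    proof -
      have split: "(\<Sum>l<n. f l) - (\<Sum>l<m. f l) = (\<Sum>l\<in>{m..<n}. f l)" for f :: "nat \<Rightarrow> real"
        using that by (simp add: sum_diff[symmetric] lessThan_minus_lessThan)
      have "AE x in M. \<bar>\<Sum>l\<in>{m..<n}. coef v l * \<phi> l x\<bar> \<le> C * sqrt (\<Sum>l\<in>{m..<n}. lam l powr \<gamma> * (coef v l)\<^sup>2)"
        using fin by simp
      then show ?thesis unfolding S_def Q_def split .
    qed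
    have "AE x in M. \<forall>m n. m \<le> n \<longrightarrow> \<bar>S n x - S m x\<bar> \<le> C * sqrt (Q n - Q m)"
      unfolding AE_all_countable
    proof (intro allI)
      fix m n show "AE x in M. m \<le> n \<longrightarrow> \<bar>S n x - S m x\<bar> \<le> C * sqrt (Q n - Q m)"
        using diff[of m n] by (cases "m \<le> n") simp_all
    qed
    moreover have "Cauchy (\<lambda>n. S n x)" if d: "\<forall>m n. m \<le> n \<longrightarrow> \<bar>S n x - S m x\<bar> \<le> C * sqrt (Q n - Q m)" for x
    proof (rule metric_CauchyI)
      fix e :: real assume e: "e > 0"
      have "Cauchy Q" using q by (rule LIMSEQ_imp_Cauchy)
      have "(e / C)\<^sup>2 > 0" using e C by simp
      then obtain N where N: "\<And>m n. m \<ge> N \<Longrightarrow> n \<ge> N \<Longrightarrow> dist (Q m) (Q n) < (e / C)\<^sup>2"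
        using metric_CauchyD[OF \<open>Cauchy Q\<close>] by metis
      have ord: "\<bar>S n x - S m x\<bar> < e" if "m \<ge> N" "n \<ge> N" "m \<le> n" for m n
      proof -
        have "Q n - Q m < (e / C)\<^sup>2" using N[OF that(1,2)] by (simp add: dist_real_def)
        then have "sqrt (Q n - Q m) < sqrt ((e / C)\<^sup>2)" by (rule real_sqrt_less_mono)
        then have "sqrt (Q n - Q m) < e / C" using e C by simp
        then have "C * sqrt (Q n - Q m) < e" using C by (simp add: field_simps)
        then show ?thesis using d that(3) by force
      qed
      show "\<exists>N. \<forall>m\<ge>N. \<forall>n\<ge>N. dist (S m x) (S n x) < e"
      proof (intro exI[of _ N] allI impI)
        fix m n assume "N \<le> m" "N \<le> n"
        then show "dist (S m x) (S n x) < e"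
          using ord[of m n] ord[of n m] by (cases "m \<le> n") (simp_all add: dist_real_def abs_minus_commute)
      qed
    qed
    ultimately have good: "AE x in M. (\<lambda>n. S n x) \<longlonglongrightarrow> lim (\<lambda>n. S n x) \<and> (\<forall>n. \<bar>S n x\<bar> \<le> C * B)"
    proof (elim AE_mp, intro AE_I2 impI)
      fix x assume d: "\<forall>m n. m \<le> n \<longrightarrow> \<bar>S n x - S m x\<bar> \<le> C * sqrt (Q n - Q m)"
        and ca: "\<And>x. \<forall>m n. m \<le> n \<longrightarrow> \<bar>S n x - S m x\<bar> \<le> C * sqrt (Q n - Q m) \<Longrightarrow> Cauchy (\<lambda>n. S n x)"
      have "\<bar>S n x\<bar> \<le> C * B" for n
      proof -
        have "\<bar>S n x - S 0 x\<bar> \<le> C * sqrt (Q n - Q 0)" using d by blast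
        then have "\<bar>S n x\<bar> \<le> C * sqrt (Q n)" by (simp add: S_def Q_def)
        also have "\<dots> \<le> C * sqrt (B\<^sup>2)"
          using C le[of n] by (intro mult_left_mono real_sqrt_le_mono) (simp_all add: Q_def)
        finally show ?thesis using B by simp
      qed
      then show "(\<lambda>n. S n x) \<longlonglongrightarrow> lim (\<lambda>n. S n x) \<and> (\<forall>n. \<bar>S n x\<bar> \<le> C * B)"
        using ca[OF d] by (simp add: convergent_LIMSEQ_iff[symmetric] Cauchy_convergent_iff)
    qed
    define w where "w x = lim (\<lambda>n. S n x)" for x
    have wm: "w \<in> borel_measurable M" unfolding w_def by (rule borel_measurable_lim_metric[OF Sm])
    have wb: "AE x in M. \<bar>w x\<bar> \<le> C * B"
      using good
    proof (rule AE_mp, intro AE_I2 impI)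
      fix x assume a: "(\<lambda>n. S n x) \<longlonglongrightarrow> lim (\<lambda>n. S n x) \<and> (\<forall>n. \<bar>S n x\<bar> \<le> C * B)"
      then have "(\<lambda>n. \<bar>S n x\<bar>) \<longlonglongrightarrow> \<bar>w x\<bar>" by (intro tendsto_rabs) (simp add: w_def)
      then show "\<bar>w x\<bar> \<le> C * B" by (rule LIMSEQ_le_const2) (use a in auto)
    qed
    have wsi: "square_integrable M w" by (rule square_integrable_bounded[OF finM wm wb])
    have conv: "(\<lambda>n. l2norm M (\<lambda>x. S n x - w x)) \<longlonglongrightarrow> 0"
    proof (rule l2_tendsto_dominated)
      show "square_integrable M (\<lambda>x. 2 * (C * B))"
        by (rule square_integrable_bounded[OF finM, of _ "\<bar>2 * (C * B)\<bar>"]) simp_all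
      show "(\<lambda>x. S n x - w x) \<in> borel_measurable M" for n using Sm wm by simp
      show "AE x in M. \<bar>S n x - w x\<bar> \<le> 2 * (C * B)" for n
        using good wb
      proof eventually_elim
        case (elim x)
        then have "\<bar>S n x\<bar> \<le> C * B" by blast
        then show ?case using elim(2) by linarith
      qed
      show "AE x in M. (\<lambda>n. S n x - w x) \<longlonglongrightarrow> 0"
        using good
      proof (rule AE_mp, intro AE_I2 impI)
        fix x assume a: "(\<lambda>n. S n x) \<longlonglongrightarrow> lim (\<lambda>n. S n x) \<and> (\<forall>n. \<bar>S n x\<bar> \<le> C * B)"
        then have "(\<lambda>n. S n x - w x) \<longlonglongrightarrow> w x - w x" by (intro tendsto_diff tendsto_const) (simp add: w_def)
        then show "(\<lambda>n. S n x - w x) \<longlonglongrightarrow> 0" by simp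
      qed
    qed
    \<comment> \<open>The k-th coefficient of the partial sums is that of v as soon as n > k, while
      L^2 convergence carries it to that of w.\<close>
    have "coef (\<lambda>x. v x - w x) k = 0" for k
    proof -
      have "\<bar>coef v k - coef w k\<bar> \<le> l2norm M (\<lambda>x. S n x - w x)" if "n > k" for n
      proof -
        have "coef (\<lambda>x. S n x - w x) k = coef (S n) k - coef w k" by (rule coef_diff[OF Ssi wsi])
        moreover have "coef (S n) k = coef v k" unfolding S_def using coef_sum[of "{..<n}" "coef v" k] that by simp
        ultimately show ?thesis using coef_bound[OF square_integrable_diff[OF Ssi wsi], of n k] by simp
      qed
      then have "\<bar>coef v k - coef w k\<bar> \<le> 0"
        by (intro LIMSEQ_le_const[OF conv]) (auto intro!: exI[of _ "Suc k"])
      then show ?thesis using coef_diff[OF v wsi, of k] by simp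
    qed
    from complete[OF square_integrable_diff[OF v wsi] this]
    have "AE x in M. v x - w x = 0" .
    then show ?thesis using wb by eventually_elim simp
  qed
  show ?thesis
  proof (intro exI[of _ C] conjI C allI impI; elim conjE)
    fix v B assume "square_integrable M v" "0 \<le> B" "\<forall>n. (\<Sum>l<n. lam l powr \<gamma> * (coef v l)\<^sup>2) \<le> B\<^sup>2"
    then show "AE x in M. \<bar>v x\<bar> \<le> C * B" by (intro main) simp_all
  qed
qed

end

section \<open>Fractional integrals and derivatives\<close>

text \<open>The Riemann-Liouville kernel, extended by 0 so that all convolutions run over the whole
  line and Fubini needs no limits of integration.\<close>

definition frac_kernel :: "real \<Rightarrow> real \<Rightarrow> real" where
  "frac_kernel a t = (if t > 0 then t powr (a - 1) / Gamma a else 0)"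

text \<open>For \<open>f\<close> vanishing on the negative axis this is the Riemann--Liouville integral of order \<open>a\<close>.\<close>

definition frac_conv :: "real \<Rightarrow> (real \<Rightarrow> real) \<Rightarrow> real \<Rightarrow> real" where
  "frac_conv a f t = (\<integral>s. frac_kernel a (t - s) * f s \<partial>lborel)"

lemma frac_kernel_measurable [measurable]: "frac_kernel a \<in> borel_measurable borel"
  unfolding frac_kernel_def by measurable

lemma frac_kernel_nonneg: "a > 0 \<Longrightarrow> 0 \<le> frac_kernel a t"
  by (simp add: frac_kernel_def Gamma_real_pos less_imp_le)

lemma frac_kernel_pos: "a > 0 \<Longrightarrow> t > 0 \<Longrightarrow> 0 < frac_kernel a t"
  by (simp add: frac_kernel_def Gamma_real_pos)

lemma frac_kernel_nonpos_arg: "t \<le> 0 \<Longrightarrow> frac_kernel a t = 0"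
  by (simp add: frac_kernel_def)

lemma frac_kernel_one: "frac_kernel 1 t = indicator {0<..} t"
  by (simp add: frac_kernel_def indicator_def)

text \<open>The semigroup law of fractional integration. The substitution s = r + (t - r) v turns
  the left-hand side into a Beta integral. Nonnegative integrals are used so that the identity also
  supplies the integrability required later.\<close>

lemma frac_kernel_convolution:
  assumes a: "a > 0" and b: "b > 0"
  shows "(\<integral>\<^sup>+s. ennreal (frac_kernel a (t - s) * frac_kernel b (s - r)) \<partial>lborel) = ennreal (frac_kernel (a + b) (t - r))"
proof (cases "t > r")
  case False
  then have z: "frac_kernel a (t - s) * frac_kernel b (s - r) = 0" for s
    by (cases "s > r") (simp_all add: frac_kernel_def)
  show ?thesis unfolding z using False by (simp add: frac_kernel_nonpos_arg)
next
  case True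
  define x where "x = t - r"
  have x: "x > 0" using True by (simp add: x_def)
  let ?c = "x powr (a - 1) * x powr (b - 1) / (Gamma a * Gamma b)"
  have c: "?c \<ge> 0" using a b by (simp add: Gamma_real_pos less_imp_le)
  have G: "Gamma a > 0" "Gamma b > 0" "Gamma (a + b) > 0" using a b by (simp_all add: Gamma_real_pos)
  have "(\<integral>\<^sup>+s. ennreal (frac_kernel a (t - s) * frac_kernel b (s - r)) \<partial>lborel)
     = ennreal \<bar>x\<bar> * (\<integral>\<^sup>+v. ennreal (frac_kernel a (t - (r + x * v)) * frac_kernel b (r + x * v - r)) \<partial>lborel)"
    by (rule nn_integral_real_affine) (use x in simp_all)
  also have "(\<integral>\<^sup>+v. ennreal (frac_kernel a (t - (r + x * v)) * frac_kernel b (r + x * v - r)) \<partial>lborel)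
     = (\<integral>\<^sup>+v. ennreal ?c * (ennreal (v powr (b - 1) * (1 - v) powr (a - 1)) * indicator {0..1} v) \<partial>lborel)"
  proof (rule nn_integral_cong_AE)
    have "AE v in lborel. v \<notin> {0, 1::real}"
      by (rule AE_not_in) (simp add: finite_imp_null_set_lborel)
    then show "AE v in lborel. ennreal (frac_kernel a (t - (r + x * v)) * frac_kernel b (r + x * v - r))
       = ennreal ?c * (ennreal (v powr (b - 1) * (1 - v) powr (a - 1)) * indicator {0..1} v)"
    proof (rule AE_mp, intro AE_I2 impI)
      fix v :: real assume v: "v \<notin> {0, 1}"
      have e1: "t - (r + x * v) = x * (1 - v)" "r + x * v - r = x * v" by (simp_all add: x_def algebra_simps)
      show "ennreal (frac_kernel a (t - (r + x * v)) * frac_kernel b (r + x * v - r))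
       = ennreal ?c * (ennreal (v powr (b - 1) * (1 - v) powr (a - 1)) * indicator {0..1} v)"
      proof (cases "0 < v \<and> v < 1")
        case True
        then have eq: "frac_kernel a (x * (1 - v)) * frac_kernel b (x * v) = ?c * (v powr (b - 1) * (1 - v) powr (a - 1))"
          using x by (simp add: frac_kernel_def powr_mult)
        have ind: "indicator {0..1} v = (1 :: ennreal)" using True by simp
        show ?thesis unfolding e1 eq ind mult_1_right by (rule ennreal_mult'[OF c])
      next
        case False
        then have "v < 0 \<or> v > 1" using v by auto
        then have eq: "frac_kernel a (x * (1 - v)) * frac_kernel b (x * v) = 0"
          using x by (auto simp: frac_kernel_def zero_less_mult_iff)
        have "v \<notin> {0..1}" using \<open>v < 0 \<or> v > 1\<close> by auto
        then show ?thesis unfolding e1 eq by simp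
      qed
    qed
  qed
  also have "\<dots> = ennreal ?c * (\<integral>\<^sup>+v. ennreal (v powr (b - 1) * (1 - v) powr (a - 1)) * indicator {0..1} v \<partial>lborel)"
    by (rule nn_integral_cmult) simp
  also have "(\<integral>\<^sup>+v. ennreal (v powr (b - 1) * (1 - v) powr (a - 1)) * indicator {0..1} v \<partial>lborel) = ennreal (Beta b a)"
    by (rule nn_integral_has_integral_lebesgue'[OF _ has_integral_Beta_real[OF b a]]) simp
  also have "ennreal \<bar>x\<bar> * (ennreal ?c * ennreal (Beta b a)) = ennreal (x * (?c * Beta b a))"
    by (simp only: abs_of_pos[OF x] ennreal_mult'[OF c, symmetric] ennreal_mult'[OF less_imp_le[OF x], symmetric])
  also have "x * (?c * Beta b a) = frac_kernel (a + b) (t - r)"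
  proof -
    have "x * (x powr (a - 1) * x powr (b - 1)) = x powr (1 + ((a - 1) + (b - 1)))"
      using x by (simp only: powr_add powr_one)
    also have "1 + ((a - 1) + (b - 1)) = a + b - 1" by simp
    finally have *: "x * (x powr (a - 1) * x powr (b - 1)) = x powr (a + b - 1)" .
    have "x * (?c * Beta b a) = x * (x powr (a - 1) * x powr (b - 1)) / Gamma (a + b)"
      using G by (simp add: Beta_def add.commute)
    then show ?thesis unfolding * using x by (simp add: frac_kernel_def x_def)
  qed
  finally show ?thesis .
qed

lemma frac_kernel_le:
  assumes "c \<ge> 1" "u \<le> t"
  shows "frac_kernel c u \<le> frac_kernel c t"
proof (cases "u > 0")
  case True
  then show ?thesis
    using assms by (simp add: frac_kernel_def divide_right_mono powr_mono2 Gamma_real_pos less_imp_le)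
next
  case False
  then show ?thesis using frac_kernel_nonneg[of c t] assms by (simp add: frac_kernel_nonpos_arg)
qed

lemma frac_conv_measurable:
  assumes "f \<in> borel_measurable borel"
  shows "frac_conv a f \<in> borel_measurable borel"
proof -
  have "(\<lambda>t. \<integral>s. frac_kernel a (t - s) * f s \<partial>lborel) \<in> borel_measurable borel"
    by (rule lborel.borel_measurable_lebesgue_integral) (use assms in measurable)
  then show ?thesis unfolding frac_conv_def[abs_def] .
qed

lemma frac_conv_one: "frac_conv 1 f t = (\<integral>s. indicator {..<t} s * f s \<partial>lborel)"
  unfolding frac_conv_def frac_kernel_one
  by (rule Bochner_Integration.integral_cong) (auto simp: indicator_def)

lemma frac_conv_cong:
  assumes "\<And>s. s < t \<Longrightarrow> f s = g s"
  shows "frac_conv a f t = frac_conv a g t"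
  unfolding frac_conv_def
proof (rule Bochner_Integration.integral_cong[OF refl])
  fix s show "frac_kernel a (t - s) * f s = frac_kernel a (t - s) * g s"
    using assms[of s] by (cases "s < t") (simp_all add: frac_kernel_nonpos_arg)
qed

lemma frac_conv_at_nonpos:
  assumes "\<And>s. s < 0 \<Longrightarrow> f s = 0" "t \<le> 0"
  shows "frac_conv a f t = 0"
proof -
  have "frac_conv a f t = frac_conv a (\<lambda>s. 0) t"
    by (rule frac_conv_cong) (use assms in simp)
  then show ?thesis by (simp add: frac_conv_def)
qed

text \<open>For a + b >= 1 the kernel of order a + b is nondecreasing, hence bounded by its value at
  t along the support of f. Therefore Fubini applies at every t, and the identity holds everywhere
  and not just almost everywhere.\<close>

lemma frac_conv_assoc:
  fixes f :: "real \<Rightarrow> real"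
  assumes a: "a > 0" and b: "b > 0" and ab: "a + b \<ge> 1"
    and f: "integrable lborel f" "\<And>s. s < 0 \<Longrightarrow> f s = 0"
  shows "frac_conv a (frac_conv b f) t = frac_conv (a + b) f t"
    "integrable lborel (\<lambda>s. frac_kernel a (t - s) * frac_conv b f s)"
    "integrable lborel (\<lambda>s. frac_kernel (a + b) (t - s) * f s)"
proof -
  let ?F = "\<lambda>s r. frac_kernel a (t - s) * frac_kernel b (s - r) * f r"
  have fm [measurable]: "f \<in> borel_measurable borel" using borel_measurable_integrable[OF f(1)] by simp
  have Fm: "(\<lambda>p. ?F (fst p) (snd p)) \<in> borel_measurable (lborel \<Otimes>\<^sub>M lborel)" by measurable
  have nn: "0 \<le> frac_kernel a x" "0 \<le> frac_kernel b x" "0 \<le> frac_kernel (a + b) x" for x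
    using a b by (simp_all add: frac_kernel_nonneg)
  show int3: "integrable lborel (\<lambda>s. frac_kernel (a + b) (t - s) * f s)"
  proof (rule Bochner_Integration.integrable_bound)
    show "integrable lborel (\<lambda>s. frac_kernel (a + b) t * f s)" using f(1) by simp
    show "(\<lambda>s. frac_kernel (a + b) (t - s) * f s) \<in> borel_measurable lborel" by measurable
    have "norm (frac_kernel (a + b) (t - s) * f s) \<le> norm (frac_kernel (a + b) t * f s)" for s
    proof (cases "s < 0")
      case False
      then show ?thesis
        using frac_kernel_le[OF ab, of "t - s" t] nn(3) by (simp add: abs_mult mult_right_mono)
    qed (simp add: f(2))
    then show "AE s in lborel. norm (frac_kernel (a + b) (t - s) * f s) \<le> norm (frac_kernel (a + b) t * f s)"
      by (rule AE_I2)
  qed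
  have inner: "(\<integral>\<^sup>+s. ennreal (norm (?F s r)) \<partial>lborel) = ennreal (norm (frac_kernel (a + b) (t - r) * f r))" for r
  proof -
    have "(\<integral>\<^sup>+s. ennreal (norm (?F s r)) \<partial>lborel)
       = (\<integral>\<^sup>+s. ennreal (frac_kernel a (t - s) * frac_kernel b (s - r)) * ennreal \<bar>f r\<bar> \<partial>lborel)"
      by (rule nn_integral_cong) (simp add: abs_mult nn ennreal_mult[symmetric])
    also have "\<dots> = (\<integral>\<^sup>+s. ennreal (frac_kernel a (t - s) * frac_kernel b (s - r)) \<partial>lborel) * ennreal \<bar>f r\<bar>"
      by (rule nn_integral_multc) simp
    also have "\<dots> = ennreal (norm (frac_kernel (a + b) (t - r) * f r))"
      unfolding frac_kernel_convolution[OF a b] using nn by (simp add: abs_mult ennreal_mult)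
    finally show ?thesis .
  qed
  have int: "integrable (lborel \<Otimes>\<^sub>M lborel) (\<lambda>(s, r). ?F s r)"
  proof (rule integrableI_bounded)
    show "(\<lambda>(s, r). ?F s r) \<in> borel_measurable (lborel \<Otimes>\<^sub>M lborel)" using Fm by (simp add: case_prod_beta)
    have "(\<integral>\<^sup>+p. ennreal (norm (case p of (s, r) \<Rightarrow> ?F s r)) \<partial>(lborel \<Otimes>\<^sub>M lborel))
      = (\<integral>\<^sup>+r. (\<integral>\<^sup>+s. ennreal (norm (?F s r)) \<partial>lborel) \<partial>lborel)"
      by (subst lborel_pair.nn_integral_snd[symmetric]) (use Fm in \<open>simp_all add: case_prod_beta\<close>)
    also have "\<dots> = (\<integral>\<^sup>+r. ennreal (norm (frac_kernel (a + b) (t - r) * f r)) \<partial>lborel)"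
      by (simp only: inner)
    also have "\<dots> < \<infinity>" using int3 by (simp add: integrable_iff_bounded)
    finally show "(\<integral>\<^sup>+p. ennreal (norm (case p of (s, r) \<Rightarrow> ?F s r)) \<partial>(lborel \<Otimes>\<^sub>M lborel)) < \<infinity>" .
  qed
  have pull: "(\<integral>r. ?F s r \<partial>lborel) = frac_kernel a (t - s) * frac_conv b f s" for s
    by (simp add: frac_conv_def mult.assoc)
  show "integrable lborel (\<lambda>s. frac_kernel a (t - s) * frac_conv b f s)"
    using lborel_pair.integrable_fst[OF int] unfolding pull .
  have inner2: "(\<integral>s. ?F s r \<partial>lborel) = frac_kernel (a + b) (t - r) * f r" for r
  proof -
    have "(\<integral>s. frac_kernel a (t - s) * frac_kernel b (s - r) \<partial>lborel) = frac_kernel (a + b) (t - r)"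
      using frac_kernel_convolution[OF a b, of t r] nn
      by (subst integral_eq_nn_integral) simp_all
    then show ?thesis by simp
  qed
  have "frac_conv a (frac_conv b f) t = (\<integral>s. (\<integral>r. ?F s r \<partial>lborel) \<partial>lborel)"
    unfolding pull by (simp add: frac_conv_def)
  also have "\<dots> = (\<integral>r. (\<integral>s. ?F s r \<partial>lborel) \<partial>lborel)"
    using lborel_pair.Fubini_integral[OF int] by simp
  also have "\<dots> = frac_conv (a + b) f t" unfolding inner2 by (simp add: frac_conv_def)
  finally show "frac_conv a (frac_conv b f) t = frac_conv (a + b) f t" .
qed

lemma frac_kernel_integrable:
  assumes "a > 0"
  shows "integrable lborel (\<lambda>s. frac_kernel a (t - s) * indicator {0..} s)"
    "(\<integral>s. frac_kernel a (t - s) * indicator {0..} s \<partial>lborel) = frac_kernel (a + 1) t"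
proof -
  have eq: "AE s in lborel. ennreal (frac_kernel a (t - s) * indicator {0..} s) = ennreal (frac_kernel a (t - s) * frac_kernel 1 (s - 0))"
  proof -
    have "AE s in lborel. s \<noteq> (0::real)" by (rule AE_lborel_singleton)
    then show ?thesis by (rule AE_mp) (rule AE_I2, simp add: frac_kernel_one indicator_def)
  qed
  have "(\<integral>\<^sup>+s. ennreal (frac_kernel a (t - s) * indicator {0..} s) \<partial>lborel) = ennreal (frac_kernel (a + 1) (t - 0))"
    unfolding nn_integral_cong_AE[OF eq] by (rule frac_kernel_convolution) (use assms in simp_all)
  moreover have nn: "0 \<le> frac_kernel a (t - s) * indicator {0..} s" for s
    using frac_kernel_nonneg[OF assms] by simp
  moreover have m: "(\<lambda>s. frac_kernel a (t - s) * indicator {0..} s) \<in> borel_measurable lborel" by simp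
  ultimately show "integrable lborel (\<lambda>s. frac_kernel a (t - s) * indicator {0..} s)"
    by (intro integrableI_nonneg) (simp_all add: AE_I2)
  show "(\<integral>s. frac_kernel a (t - s) * indicator {0..} s \<partial>lborel) = frac_kernel (a + 1) t"
    using \<open>(\<integral>\<^sup>+s. ennreal (frac_kernel a (t - s) * indicator {0..} s) \<partial>lborel) = ennreal (frac_kernel (a + 1) (t - 0))\<close> nn m
      frac_kernel_nonneg[of "a + 1" t] assms
    by (subst integral_eq_nn_integral) (simp_all add: AE_I2)
qed

lemma frac_conv_integrable_bounded:
  assumes "a > 0" "f \<in> borel_measurable borel" "\<And>s. s < 0 \<Longrightarrow> f s = 0" "\<And>s. s < t \<Longrightarrow> \<bar>f s\<bar> \<le> B"
  shows "integrable lborel (\<lambda>s. frac_kernel a (t - s) * f s)"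
proof (rule Bochner_Integration.integrable_bound)
  show "integrable lborel (\<lambda>s. B * (frac_kernel a (t - s) * indicator {0..} s))"
    using frac_kernel_integrable(1)[OF assms(1)] by simp
  show "(\<lambda>s. frac_kernel a (t - s) * f s) \<in> borel_measurable lborel"
    using assms(2) by simp
  have "norm (frac_kernel a (t - s) * f s) \<le> norm (B * (frac_kernel a (t - s) * indicator {0..} s))" for s
  proof (cases "0 \<le> s \<and> s < t")
    case True
    then have "\<bar>f s\<bar> \<le> \<bar>B\<bar>" using assms(4)[of s] by simp
    then show ?thesis using True frac_kernel_nonneg[OF assms(1)] by (simp add: abs_mult mult.commute mult_right_mono)
  next
    case False
    then show ?thesis using assms(3)[of s] by (cases "s < 0") (simp_all add: frac_kernel_nonpos_arg)
  qed
  then show "AE s in lborel. norm (frac_kernel a (t - s) * f s) \<le> norm (B * (frac_kernel a (t - s) * indicator {0..} s))"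
    by (rule AE_I2)
qed

lemma frac_conv_reflect: "frac_conv a f t = (\<integral>u. frac_kernel a u * f (t - u) \<partial>lborel)"
  unfolding frac_conv_def
  by (subst lborel_integral_real_affine[of "-1" _ t]) simp_all

text \<open>In reflected form the singular kernel stays fixed and t moves only the bounded function,
  so a multiple of the kernel, restricted to u <= T, dominates.\<close>

lemma frac_conv_continuous:
  assumes a: "a > 0" and h: "continuous_on {0..T} h"
  shows "continuous_on {0..T} (frac_conv a (\<lambda>s. indicator {0..T} s * h s))"
  unfolding continuous_on_sequentially
proof (intro allI ballI impI)
  let ?f = "\<lambda>s. indicator {0..T} s * h s"
  fix x t assume t: "t \<in> {0..T}" and x: "(\<forall>n. x n \<in> {0..T}) \<and> x \<longlonglongrightarrow> t"
  have fm [measurable]: "?f \<in> borel_measurable borel"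
    using borel_measurable_continuous_on_indicator[OF _ h] by simp
  have "bounded (h ` {0..T})" by (intro compact_imp_bounded compact_continuous_image h) simp
  then obtain B where "\<forall>y\<in>h ` {0..T}. norm y \<le> B" unfolding bounded_iff by blast
  then have B: "\<bar>h s\<bar> \<le> B" if "s \<in> {0..T}" for s using that by simp
  have "T \<ge> 0" using t by simp
  then have B0: "B \<ge> 0" using B[of 0] by simp
  have fb: "\<bar>?f s\<bar> \<le> B" for s using B[of s] B0 by (cases "s \<in> {0..T}") auto
  have "(\<lambda>n. \<integral>u. frac_kernel a u * ?f (x n - u) \<partial>lborel) \<longlonglongrightarrow> (\<integral>u. frac_kernel a u * ?f (t - u) \<partial>lborel)"
  proof (rule integral_dominated_convergence[where w="\<lambda>u. B * (frac_kernel a u * indicator {..T} u)"])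
    have "integrable lborel (\<lambda>u. frac_kernel a (T - (T + -1 * u)) * indicator {0..} (T + -1 * u))"
      by (rule lborel_integrable_real_affine[OF frac_kernel_integrable(1)[OF a, of T]]) simp
    moreover have "(\<lambda>u. frac_kernel a (T - (T + -1 * u)) * indicator {0..} (T + -1 * u)) = (\<lambda>u. frac_kernel a u * indicator {..T} u)"
      by (auto simp: fun_eq_iff indicator_def)
    ultimately show "integrable lborel (\<lambda>u. B * (frac_kernel a u * indicator {..T} u))" by simp
    show "(\<lambda>u. frac_kernel a u * ?f (t - u)) \<in> borel_measurable lborel"
      "\<And>n. (\<lambda>u. frac_kernel a u * ?f (x n - u)) \<in> borel_measurable lborel"
      using measurable_compose[OF _ fm] by simp_all
    have "norm (frac_kernel a u * ?f (x n - u)) \<le> B * (frac_kernel a u * indicator {..T} u)" for n u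
    proof (cases "u \<le> T")
      case True
      then show ?thesis
        using mult_left_mono[OF fb[of "x n - u"] frac_kernel_nonneg[OF a, of u]] frac_kernel_nonneg[OF a, of u]
        by (simp add: abs_mult mult.commute)
    next
      case False
      then have "x n - u \<notin> {0..T}" using x by (auto dest: spec[of _ n])
      then show ?thesis using False by simp
    qed
    then show "AE u in lborel. norm (frac_kernel a u * ?f (x n - u)) \<le> B * (frac_kernel a u * indicator {..T} u)" for n
      by (rule AE_I2)
    \<comment> \<open>At these two points the shifted argument hits an end of [0,T], where the
      cutoff function may jump.\<close>
    have "AE u in lborel. u \<notin> {t, t - T}" by (rule AE_not_in) (simp add: finite_imp_null_set_lborel)
    then show "AE u in lborel. (\<lambda>n. frac_kernel a u * ?f (x n - u)) \<longlonglongrightarrow> frac_kernel a u * ?f (t - u)"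
    proof (rule AE_mp, intro AE_I2 impI)
      fix u assume u: "u \<notin> {t, t - T}"
      have lim: "(\<lambda>n. x n - u) \<longlonglongrightarrow> t - u" using x by (intro tendsto_diff tendsto_const) simp
      have "(\<lambda>n. ?f (x n - u)) \<longlonglongrightarrow> ?f (t - u)"
      proof (cases "t - u \<in> {0<..<T}")
        case True
        have "isCont h (t - u)"
          using h True continuous_on_interior[of "{0..T}" h "t - u"] by simp
        then have 1: "(\<lambda>n. h (x n - u)) \<longlonglongrightarrow> h (t - u)" by (rule isCont_tendsto_compose[OF _ lim])
        have "\<forall>\<^sub>F n in sequentially. x n - u \<in> {0<..<T}"
          by (rule topological_tendstoD[OF lim _ True]) simp
        then have "\<forall>\<^sub>F n in sequentially. h (x n - u) = ?f (x n - u)"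
          by (rule eventually_mono) simp
        from Lim_transform_eventually[OF 1 this] show ?thesis using True by simp
      next
        case False
        then have out: "t - u \<in> - {0..T}" using u by auto
        have "\<forall>\<^sub>F n in sequentially. x n - u \<in> - {0..T}"
          by (rule topological_tendstoD[OF lim _ out]) (simp add: open_Compl)
        then have "\<forall>\<^sub>F n in sequentially. 0 = ?f (x n - u)"
          by (rule eventually_mono) simp
        from Lim_transform_eventually[OF tendsto_const this] show ?thesis using out by simp
      qed
      then show "(\<lambda>n. frac_kernel a u * ?f (x n - u)) \<longlonglongrightarrow> frac_kernel a u * ?f (t - u)"
        by (rule tendsto_mult[OF tendsto_const])
    qed
  qed
  then show "(frac_conv a ?f \<circ> x) \<longlonglongrightarrow> frac_conv a ?f t"
    unfolding o_def frac_conv_reflect .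
qed

section \<open>Comparison principle for the fractional Volterra equation\<close>

lemma frac_kernel_antimono:
  assumes "0 < a" "a \<le> 1" "0 < u" "u \<le> t"
  shows "frac_kernel a t \<le> frac_kernel a u"
  using assms by (simp add: frac_kernel_def divide_right_mono powr_mono2' Gamma_real_pos less_imp_le)

text \<open>Past t0 the difference t - s stays away from the singularity of the kernel; half the
  distance from t0 to t serves as lower bound near t.\<close>

lemma frac_conv_isCont_beyond_support:
  assumes a: "0 < a" "a \<le> 1" and g: "integrable lborel g" "\<And>s. s \<ge> t0 \<Longrightarrow> g s = 0" and t: "t0 < t"
  shows "isCont (frac_conv a g) t"
  unfolding continuous_at_sequentially
proof (intro allI impI)
  fix x :: "nat \<Rightarrow> real" assume x: "x \<longlonglongrightarrow> t"
  define \<eta> where "\<eta> = (t - t0) / 2"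
  have \<eta>: "\<eta> > 0" "t0 + \<eta> < t" using t by (simp_all add: \<eta>_def field_simps)
  have "\<forall>\<^sub>F n in sequentially. x n > t0 + \<eta>" by (rule order_tendstoD(1)[OF x \<eta>(2)])
  then obtain N where N: "\<And>n. n \<ge> N \<Longrightarrow> x n > t0 + \<eta>" unfolding eventually_sequentially by blast
  have gm: "g \<in> borel_measurable borel" using borel_measurable_integrable[OF g(1)] by simp
  have "(\<lambda>n. \<integral>s. frac_kernel a (x (n + N) - s) * g s \<partial>lborel) \<longlonglongrightarrow> (\<integral>s. frac_kernel a (t - s) * g s \<partial>lborel)"
  proof (rule integral_dominated_convergence[where w="\<lambda>s. frac_kernel a \<eta> * norm (g s)"])
    show "integrable lborel (\<lambda>s. frac_kernel a \<eta> * norm (g s))" using g(1) by simp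
    show "(\<lambda>s. frac_kernel a (t - s) * g s) \<in> borel_measurable lborel"
      "\<And>n. (\<lambda>s. frac_kernel a (x (n + N) - s) * g s) \<in> borel_measurable lborel"
      using gm by simp_all
    have "norm (frac_kernel a (x (n + N) - s) * g s) \<le> frac_kernel a \<eta> * norm (g s)" for n s
    proof (cases "s \<ge> t0")
      case False
      then have "frac_kernel a (x (n + N) - s) \<le> frac_kernel a \<eta>"
        using N[of "n + N"] \<eta> a by (intro frac_kernel_antimono) simp_all
      then show ?thesis using frac_kernel_nonneg[OF a(1)] by (simp add: abs_mult mult_right_mono)
    qed (simp add: g(2))
    then show "AE s in lborel. norm (frac_kernel a (x (n + N) - s) * g s) \<le> frac_kernel a \<eta> * norm (g s)" for n
      by (rule AE_I2)
    have "(\<lambda>n. frac_kernel a (x (n + N) - s) * g s) \<longlonglongrightarrow> frac_kernel a (t - s) * g s" for s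
    proof (cases "s \<ge> t0")
      case False
      have lim: "(\<lambda>n. x (n + N) - s) \<longlonglongrightarrow> t - s"
        by (intro tendsto_diff tendsto_const LIMSEQ_ignore_initial_segment x)
      have "(\<lambda>n. (x (n + N) - s) powr (a - 1) / Gamma a) \<longlonglongrightarrow> (t - s) powr (a - 1) / Gamma a"
        using False t less_imp_neq[OF Gamma_real_pos[OF a(1)]]
        by (intro tendsto_divide tendsto_powr lim tendsto_const) simp_all
      moreover have "frac_kernel a (x (n + N) - s) = (x (n + N) - s) powr (a - 1) / Gamma a" for n
        using N[of "n + N"] False \<eta> by (simp add: frac_kernel_def)
      moreover have "frac_kernel a (t - s) = (t - s) powr (a - 1) / Gamma a"
        using t False by (simp add: frac_kernel_def)
      ultimately show ?thesis by (simp only:) (rule tendsto_mult[OF _ tendsto_const])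
    qed (simp add: g(2))
    then show "AE s in lborel. (\<lambda>n. frac_kernel a (x (n + N) - s) * g s) \<longlonglongrightarrow> frac_kernel a (t - s) * g s"
      by (rule AE_I2)
  qed
  then have "(\<lambda>n. frac_conv a g (x (n + N))) \<longlonglongrightarrow> frac_conv a g t" unfolding frac_conv_def .
  then show "(frac_conv a g \<circ> x) \<longlonglongrightarrow> frac_conv a g t"
    unfolding o_def by (rule LIMSEQ_offset)
qed

text \<open>
  Truncating \<open>z = k\<^sub>\<alpha> * g \<ge> 0\<close> at \<open>t0\<close> and convolving with the Sonine kernel \<open>k\<^sub>1\<^sub>-\<^sub>\<alpha>\<close> gives a function
  that agrees with the primitive of \<open>g\<close> up to \<open>t0\<close> and decreases afterwards, because \<open>k\<^sub>1\<^sub>-\<^sub>\<alpha>\<close> does.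
\<close>

lemma frac_conv_extension_nonneg:
  assumes \<alpha>: "0 < \<alpha>" "\<alpha> < 1" and g: "integrable lborel g" "\<And>s. s < 0 \<Longrightarrow> g s = 0" "\<And>s. s \<ge> t0 \<Longrightarrow> g s = 0"
    and z: "\<And>t. t < t0 \<Longrightarrow> 0 \<le> frac_conv \<alpha> g t \<and> frac_conv \<alpha> g t \<le> B" and t: "t0 < t" and t00: "0 < t0"
  shows "0 \<le> frac_conv \<alpha> g t"
proof (rule ccontr)
  assume neg: "\<not> 0 \<le> frac_conv \<alpha> g t"
  define Y where "Y = frac_conv \<alpha> g"
  define z1 where "z1 s = indicator {..<t0} s * Y s" for s
  define H where "H = frac_conv (1 - \<alpha>) z1"
  define P where "P = frac_conv 1 g"
  \<comment> \<open>Up to t0, and beyond, \<open>N\<close> is the convolution of k_(1-\<alpha>) with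
    \<open>Y - z1\<close>, the part of \<open>Y\<close> after t0. It is 0 up to t0 and nondecreasing
    afterwards, since \<open>P\<close> becomes constant and \<open>H\<close> decreases.\<close>
  define N where "N r = P r - H r" for r
  have gm: "g \<in> borel_measurable borel" using borel_measurable_integrable[OF g(1)] by simp
  have Ym: "Y \<in> borel_measurable borel" unfolding Y_def by (rule frac_conv_measurable[OF gm])
  have Y0: "Y s = 0" if "s \<le> 0" for s unfolding Y_def by (rule frac_conv_at_nonpos[OF g(2) that])
  have z1m: "z1 \<in> borel_measurable borel" unfolding z1_def using Ym by simp
  have z10: "z1 s = 0" if "s < 0" for s using Y0[of s] that by (simp add: z1_def)
  have B: "B \<ge> 0" using z[of 0] t00 by linarith
  have z1b: "0 \<le> z1 s" "\<bar>z1 s\<bar> \<le> B" for s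
    using z[of s] B by (cases "s < t0"; simp add: z1_def Y_def)+
  have z1i: "integrable lborel z1"
  proof (rule Bochner_Integration.integrable_bound)
    show "integrable lborel (\<lambda>s. B * indicator {0..t0} s)" by (intro integrable_mult_right integrable_real_indicator) (use t00 in simp_all)
    show "z1 \<in> borel_measurable lborel" using z1m by simp
    have "norm (z1 s) \<le> norm (B * indicator {0..t0} s)" for s
    proof (cases "0 \<le> s \<and> s < t0")
      case True
      then show ?thesis using z1b(2)[of s] B by simp
    next
      case False
      then show ?thesis using z10[of s] by (cases "s < 0") (simp_all add: z1_def)
    qed
    then show "AE s in lborel. norm (z1 s) \<le> norm (B * indicator {0..t0} s)" by (rule AE_I2)
  qed
  have \<alpha>': "1 - \<alpha> > 0" "1 - \<alpha> \<le> 1" using \<alpha> by simp_all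
  have HP: "H r = P r" if "r \<le> t0" for r
  proof -
    have "H r = frac_conv (1 - \<alpha>) Y r"
      unfolding H_def by (rule frac_conv_cong) (use that in \<open>simp add: z1_def\<close>)
    also have "\<dots> = frac_conv (1 - \<alpha> + \<alpha>) g r"
      unfolding Y_def by (rule frac_conv_assoc(1)[OF \<alpha>'(1) \<alpha>(1) _ g(1,2)]) simp_all
    finally show ?thesis by (simp add: P_def)
  qed
  have Pc: "P r = P t0" if "t0 \<le> r" for r
  proof -
    have "indicator {..<r} s * g s = indicator {..<t0} s * g s" for s
      using g(3)[of s] that by (cases "s < t0") simp_all
    then show ?thesis unfolding P_def frac_conv_one by presburger
  qed
  have Hdec: "H r' \<le> H r" if "t0 \<le> r" "r \<le> r'" for r r'
    unfolding H_def frac_conv_def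
  proof (rule integral_mono)
    show "integrable lborel (\<lambda>s. frac_kernel (1 - \<alpha>) (r' - s) * z1 s)"
      "integrable lborel (\<lambda>s. frac_kernel (1 - \<alpha>) (r - s) * z1 s)"
      by (rule frac_conv_integrable_bounded[OF \<alpha>'(1) z1m z10 z1b(2)]; simp)+
    fix s
    show "frac_kernel (1 - \<alpha>) (r' - s) * z1 s \<le> frac_kernel (1 - \<alpha>) (r - s) * z1 s"
    proof (cases "s < t0")
      case True
      then have "frac_kernel (1 - \<alpha>) (r' - s) \<le> frac_kernel (1 - \<alpha>) (r - s)"
        using that by (intro frac_kernel_antimono[OF \<alpha>']) simp_all
      then show ?thesis by (rule mult_right_mono[OF _ z1b(1)])
    qed (simp add: z1_def)
  qed
  have Nmono: "N r \<le> N r'" if "r \<le> r'" for r r'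
  proof -
    consider "r' \<le> t0" | "r \<le> t0" "t0 \<le> r'" | "t0 \<le> r" by linarith
    then show ?thesis
    proof cases
      case 1
      then show ?thesis using HP[of r] HP[of r'] that by (simp add: N_def)
    next
      case 2
      then show ?thesis using HP[of r] HP[of t0] Pc[of r'] Hdec[of t0 r'] by (simp add: N_def)
    next
      case 3
      then show ?thesis using Pc[of r] Pc[of r'] Hdec[of r r'] that by (simp add: N_def)
    qed
  qed
  note aP = frac_conv_assoc[OF \<alpha>(1) zero_less_one _ g(1,2), folded P_def]
  note aH = frac_conv_assoc[OF \<alpha>(1) \<alpha>'(1) _ z1i z10, folded H_def]
  note aY = frac_conv_assoc[OF zero_less_one \<alpha>(1) _ g(1,2), folded Y_def]
  have Ni: "integrable lborel (\<lambda>s. frac_kernel \<alpha> (r - s) * N s)" for r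
    unfolding N_def right_diff_distrib
    by (rule Bochner_Integration.integrable_diff) (rule aP(2) aH(2); use \<alpha> in simp)+
  \<comment> \<open>The convolution with k_\<alpha> undoes k_(1-\<alpha>) up to one integration:
    what results is the primitive of \<open>Y - z1\<close>. It inherits monotonicity from
    \<open>N\<close>, because the kernel is nonnegative.\<close>
  have Nc: "frac_conv \<alpha> N r = frac_conv 1 Y r - frac_conv 1 z1 r" for r
  proof -
    have "frac_conv \<alpha> N r = frac_conv \<alpha> P r - frac_conv \<alpha> H r"
      unfolding frac_conv_def N_def right_diff_distrib
      by (rule Bochner_Integration.integral_diff) (rule aP(2) aH(2); use \<alpha> in simp)+
    also have "frac_conv \<alpha> P r = frac_conv (\<alpha> + 1) g r" by (rule aP(1)) (use \<alpha> in simp_all)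
    also have "\<dots> = frac_conv 1 Y r" using aY(1)[of r] \<alpha> by (simp add: add.commute)
    also have "frac_conv \<alpha> H r = frac_conv 1 z1 r" using aH(1)[of r] \<alpha> by simp
    finally show ?thesis .
  qed
  have z1c: "frac_conv 1 z1 r = frac_conv 1 z1 t0" if "t0 \<le> r" for r
  proof -
    have "indicator {..<r} s * z1 s = indicator {..<t0} s * z1 s" for s
      using that by (cases "s < t0") (simp_all add: z1_def)
    then show ?thesis unfolding frac_conv_one by presburger
  qed
  have Ncmono: "frac_conv \<alpha> N r \<le> frac_conv \<alpha> N r'" if "r \<le> r'" for r r'
    unfolding frac_conv_reflect
  proof (rule integral_mono)
    have *: "integrable lborel (\<lambda>u. frac_kernel \<alpha> u * N (q - u))" for q
      using lborel_integrable_real_affine[OF Ni[of q], of "-1" q] by simp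
    show "integrable lborel (\<lambda>u. frac_kernel \<alpha> u * N (r - u))" "integrable lborel (\<lambda>u. frac_kernel \<alpha> u * N (r' - u))"
      by (rule *)+
    show "frac_kernel \<alpha> u * N (r - u) \<le> frac_kernel \<alpha> u * N (r' - u)" for u
      by (intro mult_left_mono Nmono frac_kernel_nonneg[OF \<alpha>(1)]) (use that in simp)
  qed
  have Fmono: "frac_conv 1 Y r \<le> frac_conv 1 Y r'" if "t0 \<le> r" "r \<le> r'" for r r'
    using Ncmono[OF that(2)] z1c[of r] z1c[of r'] that unfolding Nc by simp
  have cont: "isCont Y t" unfolding Y_def
    by (rule frac_conv_isCont_beyond_support[OF \<alpha>(1) _ g(1,3) t]) (use \<alpha> in simp)
  have Yt: "Y t < 0" using neg by (simp add: Y_def)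
  then have "Y t < Y t / 2" by simp
  from order_tendstoD(2)[OF cont[unfolded isCont_def] this]
  obtain e where e: "e > 0" "\<And>s. s \<noteq> t \<Longrightarrow> dist s t < e \<Longrightarrow> Y s < Y t / 2"
    unfolding eventually_at by blast
  \<comment> \<open>A point between t0 and t, close enough to t for \<open>Y\<close> to be below
    \<open>Y t / 2\<close> on [r, t). The primitive of \<open>Y\<close> would then strictly decrease
    from r to t.\<close>
  define r where "r = max ((t + t0) / 2) (t - e / 2)"
  have r: "t0 \<le> r" "r < t" "t - r < e" using t e by (auto simp: r_def max_def field_simps)
  have Yi: "integrable lborel (\<lambda>s. indicator {..<q} s * Y s)" for q
  proof -
    have "integrable lborel (\<lambda>s. frac_kernel 1 (q - s) * Y s)" by (rule aY(2)) (use \<alpha> in simp)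
    moreover have "(\<lambda>s. frac_kernel 1 (q - s) * Y s) = (\<lambda>s. indicator {..<q} s * Y s)"
      by (simp add: fun_eq_iff frac_kernel_one indicator_def)
    ultimately show ?thesis by simp
  qed
  have "frac_conv 1 Y t - frac_conv 1 Y r = (\<integral>s. indicator {..<t} s * Y s - indicator {..<r} s * Y s \<partial>lborel)"
    unfolding frac_conv_one by (rule Bochner_Integration.integral_diff[symmetric]) (rule Yi)+
  also have "\<dots> \<le> (\<integral>s. (Y t / 2) * indicator {r..<t} s \<partial>lborel)"
  proof (rule integral_mono)
    show "integrable lborel (\<lambda>s. indicator {..<t} s * Y s - indicator {..<r} s * Y s)"
      by (rule Bochner_Integration.integrable_diff) (rule Yi)+
    show "integrable lborel (\<lambda>s. (Y t / 2) * indicator {r..<t} s)"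
      by (intro integrable_mult_right integrable_real_indicator) (use r in simp_all)
    fix s
    show "indicator {..<t} s * Y s - indicator {..<r} s * Y s \<le> (Y t / 2) * indicator {r..<t} s"
    proof (cases "s \<in> {r..<t}")
      case True
      then have "Y s < Y t / 2" using r by (intro e(2)) (auto simp: dist_real_def)
      then show ?thesis using True by simp
    next
      case False
      then show ?thesis using r by (cases "s < r") simp_all
    qed
  qed
  also have "\<dots> = (Y t / 2) * (t - r)" using r by simp
  also have "\<dots> < 0" using Yt r by (simp add: mult_less_0_iff)
  finally show False using Fmono[OF r(1) less_imp_le[OF r(2)]] by simp
qed

lemma continuous_cutoff_bounded:
  assumes "continuous_on {0..T} (h :: real \<Rightarrow> real)"
  shows "\<exists>B\<ge>0. \<forall>s. \<bar>indicator {0..T} s * h s\<bar> \<le> B"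
proof -
  have "bounded (h ` {0..T})" by (intro compact_imp_bounded compact_continuous_image assms) simp
  then obtain B where B: "\<forall>y\<in>h ` {0..T}. norm y \<le> B" unfolding bounded_iff by blast
  have "\<bar>indicator {0..T} s * h s\<bar> \<le> \<bar>B\<bar>" for s
  proof (cases "s \<in> {0..T}")
    case True
    then have "\<bar>h s\<bar> \<le> B" using B by auto
    then show ?thesis using True by simp
  qed simp
  then show ?thesis by (intro exI[of _ "\<bar>B\<bar>"]) simp
qed

lemma continuous_cutoff_measurable:
  assumes "continuous_on {0..T} (h :: real \<Rightarrow> real)"
  shows "(\<lambda>s. indicator {0..T} s * h s) \<in> borel_measurable borel"
  using borel_measurable_continuous_on_indicator[OF _ assms] by simp

lemma frac_conv_continuous_integrable:
  assumes "0 < a" "continuous_on {0..T} h"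
  shows "integrable lborel (\<lambda>s. frac_kernel a (t - s) * (indicator {0..T} s * h s))"
proof -
  obtain B where B: "\<And>s. \<bar>indicator {0..T} s * h s\<bar> \<le> B" using continuous_cutoff_bounded[OF assms(2)] by blast
  show ?thesis
    by (rule frac_conv_integrable_bounded[OF assms(1) continuous_cutoff_measurable[OF assms(2)] _ B]) simp
qed

lemma continuous_cutoff_integrable:
  assumes "continuous_on {0..T} (h :: real \<Rightarrow> real)"
  shows "integrable lborel (\<lambda>s. indicator {0..T} s * h s)"
  using borel_integrable_compact[OF _ assms] by simp

lemma frac_conv_linear:
  assumes "0 < a" "continuous_on {0..T} p" "continuous_on {0..T} q"
  shows "frac_conv a (\<lambda>s. indicator {0..T} s * (p s + c * q s)) t
    = frac_conv a (\<lambda>s. indicator {0..T} s * p s) t + c * frac_conv a (\<lambda>s. indicator {0..T} s * q s) t"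
proof -
  note i = frac_conv_continuous_integrable[OF assms(1,2), of t] frac_conv_continuous_integrable[OF assms(1,3), of t]
  have "frac_conv a (\<lambda>s. indicator {0..T} s * (p s + c * q s)) t
    = (\<integral>s. frac_kernel a (t - s) * (indicator {0..T} s * p s) + c * (frac_kernel a (t - s) * (indicator {0..T} s * q s)) \<partial>lborel)"
    unfolding frac_conv_def by (rule Bochner_Integration.integral_cong) (simp_all add: algebra_simps)
  also have "\<dots> = (\<integral>s. frac_kernel a (t - s) * (indicator {0..T} s * p s) \<partial>lborel)
      + c * (\<integral>s. frac_kernel a (t - s) * (indicator {0..T} s * q s) \<partial>lborel)"
    using i by (subst Bochner_Integration.integral_add) simp_all
  finally show ?thesis by (simp add: frac_conv_def)
qed

lemma frac_conv_nonneg: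
  assumes "0 < a" "\<And>s. s < t \<Longrightarrow> 0 \<le> f s"
  shows "0 \<le> frac_conv a f t"
  unfolding frac_conv_def
proof (rule Bochner_Integration.integral_nonneg)
  fix s show "0 \<le> frac_kernel a (t - s) * f s"
    using assms(2)[of s] frac_kernel_nonneg[OF assms(1)]
    by (cases "s < t") (simp_all add: frac_kernel_nonpos_arg)
qed

lemma frac_kernel_cutoff_integrable:
  assumes "0 < a"
  shows "integrable lborel (\<lambda>s. indicator {0..T} s * frac_kernel a s)"
proof -
  have "integrable lborel (\<lambda>u. frac_kernel a (T - (T + -1 * u)) * indicator {0..} (T + -1 * u))"
    by (rule lborel_integrable_real_affine[OF frac_kernel_integrable(1)[OF assms, of T]]) simp
  moreover have "(\<lambda>u. frac_kernel a (T - (T + -1 * u)) * indicator {0..} (T + -1 * u)) = (\<lambda>s. indicator {0..T} s * frac_kernel a s)"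
    by (auto simp: fun_eq_iff indicator_def frac_kernel_def)
  ultimately show ?thesis by simp
qed

text \<open>The kernels of orders \<alpha> and 1 - \<alpha> convolve to the constant 1. Hence a
  constant is itself a fractional integral, with a density that is positive for s > 0.\<close>

lemma frac_conv_sonine:
  assumes \<alpha>: "0 < \<alpha>" "\<alpha> < 1" and t: "0 < t" "t \<le> T"
  shows "frac_conv \<alpha> (\<lambda>s. indicator {0..T} s * frac_kernel (1 - \<alpha>) s) t = 1"
    "integrable lborel (\<lambda>s. frac_kernel \<alpha> (t - s) * (indicator {0..T} s * frac_kernel (1 - \<alpha>) s))"
proof -
  have \<alpha>': "0 < 1 - \<alpha>" using \<alpha> by simp
  have eq: "frac_kernel \<alpha> (t - s) * (indicator {0..T} s * frac_kernel (1 - \<alpha>) s) = frac_kernel \<alpha> (t - s) * frac_kernel (1 - \<alpha>) (s - 0)" for s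
    using t by (auto simp: indicator_def frac_kernel_def)
  have nn: "0 \<le> frac_kernel \<alpha> (t - s) * frac_kernel (1 - \<alpha>) (s - 0)" for s
    by (intro mult_nonneg_nonneg frac_kernel_nonneg \<alpha>(1) \<alpha>')
  have "(\<integral>\<^sup>+s. ennreal (frac_kernel \<alpha> (t - s) * frac_kernel (1 - \<alpha>) (s - 0)) \<partial>lborel) = ennreal 1"
    unfolding frac_kernel_convolution[OF \<alpha>(1) \<alpha>'] using t by (simp add: frac_kernel_one)
  moreover have "(\<lambda>s. frac_kernel \<alpha> (t - s) * frac_kernel (1 - \<alpha>) (s - 0)) \<in> borel_measurable lborel" by simp
  ultimately have "has_bochner_integral lborel (\<lambda>s. frac_kernel \<alpha> (t - s) * frac_kernel (1 - \<alpha>) (s - 0)) 1"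
    by (intro has_bochner_integral_nn_integral AE_I2 nn) simp_all
  then show "frac_conv \<alpha> (\<lambda>s. indicator {0..T} s * frac_kernel (1 - \<alpha>) s) t = 1"
    "integrable lborel (\<lambda>s. frac_kernel \<alpha> (t - s) * (indicator {0..T} s * frac_kernel (1 - \<alpha>) s))"
    unfolding frac_conv_def eq by (auto simp: has_bochner_integral_iff)
qed

text \<open>
  At a negative minimum \<open>m = y(t\<^sub>*)\<close> the function \<open>y - m\<close> is the fractional integral of a function
  that is positive just before \<open>t\<^sub>*\<close>, and its earlier values contribute nonnegatively.
\<close>

theorem frac_comparison:
  assumes \<alpha>: "0 < \<alpha>" "\<alpha> < 1"
    and cont: "continuous_on {0..T} y" "continuous_on {0..T} h" "continuous_on {0..T} a"
    and nonneg: "b \<ge> 0" "\<And>s. s \<in> {0..T} \<Longrightarrow> h s \<ge> 0" "\<And>s. s \<in> {0..T} \<Longrightarrow> a s \<ge> 0"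
    and eq: "\<And>t. t \<in> {0..T} \<Longrightarrow> y t = b + frac_conv \<alpha> (\<lambda>s. indicator {0..T} s * (h s - a s * y s)) t"
    and t: "t \<in> {0..T}"
  shows "y t \<ge> 0"
proof (rule ccontr)
  assume "\<not> y t \<ge> 0"
  have "{0..T} \<noteq> {}" using t by blast
  from continuous_attains_inf[OF compact_Icc this cont(1)]
  obtain ts where ts: "ts \<in> {0..T}" "\<And>s. s \<in> {0..T} \<Longrightarrow> y ts \<le> y s"
    by blast
  define m where "m = y ts"
  have m: "m < 0" using ts(2)[OF t] \<open>\<not> y t \<ge> 0\<close> by (simp add: m_def)
  have \<alpha>': "0 < 1 - \<alpha>" using \<alpha> by simp
  let ?i = "\<lambda>s. indicator {0..T} s :: real"
  have "y 0 = b" using eq[of 0] t frac_conv_at_nonpos[of "\<lambda>s. ?i s * (h s - a s * y s)" 0 \<alpha>] by simp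
  then have ts0: "0 < ts" using ts(1) m nonneg(1) by (cases "ts = 0") (auto simp: m_def)
  have ch: "continuous_on {0..T} (\<lambda>s. h s - a s * y s)" by (intro continuous_intros cont)
  \<comment> \<open>By the Sonine identity the constant b - m is the fractional integral of (b - m)
    k_(1-\<alpha>), so \<open>gt\<close> is a density for y - m. Since b >= 0 > m, the added term is
    strictly positive inside (0,T].\<close>
  define gt where "gt s = ?i s * (h s - a s * y s) + (b - m) * (?i s * frac_kernel (1 - \<alpha>) s)" for s
  have gti: "integrable lborel gt"
    unfolding gt_def by (intro Bochner_Integration.integrable_add integrable_mult_right
        continuous_cutoff_integrable[OF ch] frac_kernel_cutoff_integrable[OF \<alpha>'])
  have gtk: "integrable lborel (\<lambda>s. frac_kernel \<alpha> (r - s) * gt s)" "frac_conv \<alpha> gt r = y r - m"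
    if r: "0 < r" "r \<le> T" for r
  proof -
    have e: "frac_kernel \<alpha> (r - s) * gt s = frac_kernel \<alpha> (r - s) * (?i s * (h s - a s * y s))
        + (b - m) * (frac_kernel \<alpha> (r - s) * (?i s * frac_kernel (1 - \<alpha>) s))" for s
      by (simp add: gt_def algebra_simps)
    note i1 = frac_conv_continuous_integrable[OF \<alpha>(1) ch, of r]
    note i2 = frac_conv_sonine[OF \<alpha> r]
    show "integrable lborel (\<lambda>s. frac_kernel \<alpha> (r - s) * gt s)"
      unfolding e by (intro Bochner_Integration.integrable_add integrable_mult_right i1 i2)
    have "frac_conv \<alpha> gt r = frac_conv \<alpha> (\<lambda>s. ?i s * (h s - a s * y s)) r
        + (b - m) * frac_conv \<alpha> (\<lambda>s. ?i s * frac_kernel (1 - \<alpha>) s) r"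
      unfolding frac_conv_def e using i1 i2(2) by (subst Bochner_Integration.integral_add) simp_all
    then show "frac_conv \<alpha> gt r = y r - m" using eq[of r] r unfolding i2(1) by simp
  qed
  have "(y \<longlongrightarrow> y ts) (at ts within {0..T})" using cont(1) ts(1) by (simp add: continuous_on)
  then have "\<forall>\<^sub>F s in at ts within {0..T}. y s < 0"
    by (rule order_tendstoD(2)) (use m in \<open>simp add: m_def\<close>)
  then obtain d where d: "d > 0" "\<And>s. s \<in> {0..T} \<Longrightarrow> s \<noteq> ts \<Longrightarrow> dist s ts < d \<Longrightarrow> y s < 0"
    unfolding eventually_at by blast
  \<comment> \<open>Close enough to \<open>ts\<close> for y to be negative on [t0, ts), where both
    parts of \<open>gt\<close> then have a favourable sign; positive, as the extension lemma
    demands.\<close>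
  define t0 where "t0 = max (ts / 2) (ts - d / 2)"
  have t0: "0 < t0" "t0 < ts" "ts - t0 < d" using ts0 d by (auto simp: t0_def max_def field_simps)
  have gtpos: "gt s > 0" if s: "t0 \<le> s" "s < ts" for s
  proof -
    have sT: "s \<in> {0..T}" using s t0 ts(1) by auto
    have "y s < 0" using s t0 by (intro d(2) sT) (auto simp: dist_real_def)
    then have "a s * y s \<le> 0" using nonneg(3)[OF sT] by (simp add: mult_nonneg_nonpos)
    moreover have "(b - m) * frac_kernel (1 - \<alpha>) s > 0"
      using m nonneg(1) frac_kernel_pos[OF \<alpha>', of s] s t0 by simp
    ultimately show ?thesis using nonneg(2)[OF sT] sT by (simp add: gt_def)
  qed
  define g1 where "g1 s = indicator {..<t0} s * gt s" for s
  have g1i: "integrable lborel g1"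
    unfolding g1_def using integrable_mult_indicator[OF _ gti, of "{..<t0}"] by simp
  obtain B where B: "\<And>s. \<bar>?i s * y s\<bar> \<le> B" using continuous_cutoff_bounded[OF cont(1)] by blast
  \<comment> \<open>The history before t0 generates y - m >= 0 up to t0, so by the extension lemma
    it still contributes nonnegatively at \<open>ts\<close>. The total at \<open>ts\<close> is 0,
    hence the nonnegative contribution of [t0, ts) must vanish although \<open>gt\<close> is
    positive there.\<close>
  have Y1: "0 \<le> frac_conv \<alpha> g1 ts"
  proof (rule frac_conv_extension_nonneg[OF \<alpha> g1i _ _ _ t0(2,1)])
    show "g1 s = 0" if "s < 0" for s using that by (simp add: g1_def gt_def)
    show "g1 s = 0" if "t0 \<le> s" for s using that by (simp add: g1_def)
    fix r assume r: "r < t0"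
    show "0 \<le> frac_conv \<alpha> g1 r \<and> frac_conv \<alpha> g1 r \<le> B - m"
    proof (cases "r \<le> 0")
      case True
      have "frac_conv \<alpha> g1 r = 0"
        by (rule frac_conv_at_nonpos[OF _ True]) (simp add: g1_def gt_def)
      then show ?thesis using m B[of 0] by simp
    next
      case False
      have rT: "r \<in> {0..T}" using False r t0 ts(1) by auto
      have "frac_conv \<alpha> g1 r = frac_conv \<alpha> gt r"
        by (rule frac_conv_cong) (use r in \<open>simp add: g1_def\<close>)
      also have "\<dots> = y r - m" using gtk(2)[of r] False rT by simp
      finally show ?thesis using ts(2)[OF rT] B[of r] rT by (simp add: m_def)
    qed
  qed
  have i0: "integrable lborel (\<lambda>s. frac_kernel \<alpha> (ts - s) * gt s)" using gtk(1)[of ts] ts0 ts(1) by simp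
  have i1: "integrable lborel (\<lambda>s. frac_kernel \<alpha> (ts - s) * g1 s)"
    using integrable_mult_indicator[OF _ i0, of "{..<t0}"] by (simp add: g1_def mult_ac)
  have i2: "integrable lborel (\<lambda>s. frac_kernel \<alpha> (ts - s) * gt s - frac_kernel \<alpha> (ts - s) * g1 s)"
    by (rule Bochner_Integration.integrable_diff[OF i0 i1])
  have sub: "(\<integral>s. frac_kernel \<alpha> (ts - s) * gt s - frac_kernel \<alpha> (ts - s) * g1 s \<partial>lborel) = frac_conv \<alpha> gt ts - frac_conv \<alpha> g1 ts"
    unfolding frac_conv_def by (rule Bochner_Integration.integral_diff[OF i0 i1])
  have pw: "0 \<le> frac_kernel \<alpha> (ts - s) * gt s - frac_kernel \<alpha> (ts - s) * g1 s" for s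
  proof (cases "t0 \<le> s \<and> s < ts")
    case True
    then have "0 \<le> frac_kernel \<alpha> (ts - s) * gt s"
      using gtpos[of s] by (intro mult_nonneg_nonneg frac_kernel_nonneg \<alpha>(1)) simp
    then show ?thesis using True by (simp add: g1_def)
  next
    case False
    then show ?thesis by (cases "s < t0") (simp_all add: g1_def frac_kernel_nonpos_arg)
  qed
  have z: "frac_conv \<alpha> gt ts = 0" using gtk(2)[of ts] ts0 ts(1) by (simp add: m_def)
  have "(\<integral>s. frac_kernel \<alpha> (ts - s) * gt s - frac_kernel \<alpha> (ts - s) * g1 s \<partial>lborel) \<ge> 0"
    by (rule Bochner_Integration.integral_nonneg) (rule pw)
  then have "(\<integral>s. frac_kernel \<alpha> (ts - s) * gt s - frac_kernel \<alpha> (ts - s) * g1 s \<partial>lborel) = 0"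
    using sub z Y1 by linarith
  then have "AE s in lborel. frac_kernel \<alpha> (ts - s) * gt s - frac_kernel \<alpha> (ts - s) * g1 s = 0"
    using integral_nonneg_eq_0_iff_AE[OF i2 AE_I2[OF pw]] by simp
  then have "AE s in lborel. s \<notin> {t0..<ts}"
  proof (rule AE_mp, intro AE_I2 impI notI)
    fix s assume s: "frac_kernel \<alpha> (ts - s) * gt s - frac_kernel \<alpha> (ts - s) * g1 s = 0" "s \<in> {t0..<ts}"
    then have "frac_kernel \<alpha> (ts - s) * gt s > 0"
      using gtpos[of s] frac_kernel_pos[OF \<alpha>(1), of "ts - s"] by simp
    moreover have "g1 s = 0" using s(2) by (simp add: g1_def)
    ultimately show False using s(1) by (simp only: mult_zero_right diff_zero less_irrefl)
  qed
  then have "{t0..<ts} \<in> null_sets lborel" by (subst AE_iff_null_sets) simp_all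
  then have "emeasure lborel {t0..<ts} = 0" by (rule null_setsD1)
  then show False using t0 by simp
qed

text \<open>The barrier w = |b| + I^\<alpha> |h| ignores the damping term. Consequently w - y and w
  + y solve equations with the same \<open>a\<close> and with nonnegative data, the forcing being
  |h| - h or |h| + h plus a w.\<close>

lemma frac_comparison_abs:
  assumes \<alpha>: "0 < \<alpha>" "\<alpha> < 1"
    and cont: "continuous_on {0..T} y" "continuous_on {0..T} h" "continuous_on {0..T} a"
    and a: "\<And>s. s \<in> {0..T} \<Longrightarrow> a s \<ge> 0"
    and eq: "\<And>t. t \<in> {0..T} \<Longrightarrow> y t = b + frac_conv \<alpha> (\<lambda>s. indicator {0..T} s * (h s - a s * y s)) t"
    and t: "t \<in> {0..T}"
  shows "\<bar>y t\<bar> \<le> \<bar>b\<bar> + frac_conv \<alpha> (\<lambda>s. indicator {0..T} s * \<bar>h s\<bar>) t"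
proof -
  have ca: "continuous_on {0..T} (\<lambda>s. \<bar>h s\<bar>)" by (intro continuous_intros cont)
  define w where "w t = \<bar>b\<bar> + frac_conv \<alpha> (\<lambda>s. indicator {0..T} s * \<bar>h s\<bar>) t" for t
  have cw: "continuous_on {0..T} w"
    unfolding w_def by (intro continuous_intros frac_conv_continuous[OF \<alpha>(1) ca])
  have ch: "continuous_on {0..T} (\<lambda>s. h s - a s * y s)" by (intro continuous_intros cont)
  have main: "0 \<le> w t - c * y t" if c: "\<bar>c\<bar> = 1" for c :: real
  proof (rule frac_comparison[OF \<alpha>, where T=T and b="\<bar>b\<bar> - c * b" and a=a
        and h="\<lambda>s. \<bar>h s\<bar> - c * h s + a s * w s" and y="\<lambda>t. w t - c * y t"])
    show "continuous_on {0..T} (\<lambda>t. w t - c * y t)" "continuous_on {0..T} (\<lambda>s. \<bar>h s\<bar> - c * h s + a s * w s)"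
      by (intro continuous_intros cont cw)+
    have cc: "c * x \<le> \<bar>x\<bar>" for x using c by (metis abs_ge_self abs_mult mult_1)
    show "0 \<le> \<bar>b\<bar> - c * b" using cc[of b] by simp
    fix s assume s: "s \<in> {0..T}"
    have "0 \<le> w s" unfolding w_def
      by (intro add_nonneg_nonneg frac_conv_nonneg[OF \<alpha>(1)]) simp_all
    then show "0 \<le> \<bar>h s\<bar> - c * h s + a s * w s" using cc[of "h s"] a[OF s] by simp
    have "frac_conv \<alpha> (\<lambda>r. indicator {0..T} r * (\<bar>h r\<bar> - c * h r + a r * w r - a r * (w r - c * y r))) s
       = frac_conv \<alpha> (\<lambda>r. indicator {0..T} r * (\<bar>h r\<bar> + (- c) * (h r - a r * y r))) s"
      by (simp add: algebra_simps)
    also have "\<dots> = frac_conv \<alpha> (\<lambda>r. indicator {0..T} r * \<bar>h r\<bar>) s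
        + (- c) * frac_conv \<alpha> (\<lambda>r. indicator {0..T} r * (h r - a r * y r)) s"
      by (rule frac_conv_linear[OF \<alpha>(1) ca ch])
    also have "\<dots> = (w s - \<bar>b\<bar>) - c * (y s - b)" using eq[OF s] by (simp add: w_def)
    finally show "w s - c * y s = \<bar>b\<bar> - c * b
      + frac_conv \<alpha> (\<lambda>r. indicator {0..T} r * (\<bar>h r\<bar> - c * h r + a r * w r - a r * (w r - c * y r))) s"
      by (simp add: algebra_simps)
  qed (use cont a t in auto)
  show ?thesis using main[of 1] main[of "-1"] by (simp add: w_def)
qed

text \<open>For a constant forcing f the constant barrier |b| + |f| / \<mu> works, because a w >=
  \<mu> w >= |f|. No factor depending on time arises.\<close>

lemma frac_comparison_decay:
  assumes \<alpha>: "0 < \<alpha>" "\<alpha> < 1"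
    and cont: "continuous_on {0..T} y" "continuous_on {0..T} a"
    and a: "\<And>s. s \<in> {0..T} \<Longrightarrow> a s \<ge> \<mu>" and \<mu>: "\<mu> > 0"
    and eq: "\<And>t. t \<in> {0..T} \<Longrightarrow> y t = b + frac_conv \<alpha> (\<lambda>s. indicator {0..T} s * (f - a s * y s)) t"
    and t: "t \<in> {0..T}"
  shows "\<bar>y t\<bar> \<le> \<bar>b\<bar> + \<bar>f\<bar> / \<mu>"
proof -
  define w where "w = \<bar>b\<bar> + \<bar>f\<bar> / \<mu>"
  have w: "w \<ge> 0" using \<mu> by (simp add: w_def)
  have ch: "continuous_on {0..T} (\<lambda>s. f - a s * y s)" by (intro continuous_intros cont)
  have main: "0 \<le> w - c * y t" if c: "\<bar>c\<bar> = 1" for c :: real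
  proof (rule frac_comparison[OF \<alpha>, where T=T and b="w - c * b" and a=a
        and h="\<lambda>s. - c * f + a s * w" and y="\<lambda>t. w - c * y t"])
    show "continuous_on {0..T} (\<lambda>t. w - c * y t)" "continuous_on {0..T} (\<lambda>s. - c * f + a s * w)"
      by (intro continuous_intros cont)+
    have cc: "c * x \<le> \<bar>x\<bar>" for x using c by (metis abs_ge_self abs_mult mult_1)
    have "0 \<le> \<bar>f\<bar> / \<mu>" using \<mu> by simp
    then show "0 \<le> w - c * b" using cc[of b] unfolding w_def by linarith
    fix s assume s: "s \<in> {0..T}"
    have "\<bar>f\<bar> = \<mu> * (\<bar>f\<bar> / \<mu>)" using \<mu> by simp
    also have "\<dots> \<le> \<mu> * w" using \<mu> by (intro mult_left_mono) (simp_all add: w_def)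
    also have "\<dots> \<le> a s * w" using a[OF s] w by (rule mult_right_mono)
    finally show "0 \<le> - c * f + a s * w" using cc[of f] by simp
    show "0 \<le> a s" using a[OF s] \<mu> by simp
    have "frac_conv \<alpha> (\<lambda>r. indicator {0..T} r * (- c * f + a r * w - a r * (w - c * y r))) s
       = frac_conv \<alpha> (\<lambda>r. indicator {0..T} r * (0 + (- c) * (f - a r * y r))) s"
      by (simp add: algebra_simps)
    also have "\<dots> = frac_conv \<alpha> (\<lambda>r. indicator {0..T} r * 0) s
        + (- c) * frac_conv \<alpha> (\<lambda>r. indicator {0..T} r * (f - a r * y r)) s"
      by (rule frac_conv_linear[OF \<alpha>(1) _ ch]) simp
    also have "frac_conv \<alpha> (\<lambda>r. indicator {0..T} r * 0) s = 0" by (simp add: frac_conv_def)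
    finally show "w - c * y s = w - c * b
      + frac_conv \<alpha> (\<lambda>r. indicator {0..T} r * (- c * f + a r * w - a r * (w - c * y r))) s"
      using eq[OF s] by (simp add: algebra_simps)
  qed (use cont t in auto)
  show ?thesis using main[of 1] main[of "-1"] by (simp add: w_def)
qed

section \<open>The Caputo derivative as a fractional integral\<close>

lemma lebesgue_on_measurable_AE:
  fixes f g :: "real \<Rightarrow> real"
  assumes "S \<in> sets borel" "g \<in> borel_measurable borel" "AE x in lebesgue_on S. f x = g x"
  shows "f \<in> borel_measurable (lebesgue_on S)"
proof -
  have S: "S \<in> sets lebesgue" using assms(1) by simp
  have 1: "(\<lambda>x. if x \<in> S then g x else 0) \<in> borel_measurable lebesgue"
    using assms(1,2) by (intro measurable_completion) simp
  have "AE x in lborel. x \<in> S \<longrightarrow> f x = g x"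
    using assms(3) unfolding AE_lebesgue_on_iff[OF assms(1)] .
  then have "AE x in lborel. (if x \<in> S then g x else 0) = (if x \<in> S then f x else 0)"
    by (rule AE_mp) (rule AE_I2, simp)
  then have 2: "AE x in lebesgue. (if x \<in> S then g x else 0) = (if x \<in> S then f x else 0)"
    by (rule AE_completion)
  from borel_measurable_AE[OF 1 2] show ?thesis
    using borel_measurable_if[OF S, of f] by blast
qed

text \<open>Integrability is not assumed: the integrals agree, default value included. The interval
  is open at t to match the kernel, which is 0 at the argument 0.\<close>

lemma integral_density_interval:
  fixes f d k :: "real \<Rightarrow> real"
  assumes d: "d \<in> borel_measurable borel" "\<And>s. s < 0 \<Longrightarrow> d s = 0" and k: "k \<in> borel_measurable borel"
    and ae: "AE s in lebesgue_on {0..T}. f s = d s" and t: "t \<in> {0..T}"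
  shows "(\<integral>s. k s * f s \<partial>lebesgue_on {0..t}) = (\<integral>s. indicator {..<t} s * (k s * d s) \<partial>lborel)"
proof -
  have B: "{0..t} \<in> sets borel" "{0..T} \<in> sets borel" by simp_all
  have "AE s in lborel. s \<in> {0..T} \<longrightarrow> f s = d s"
    using ae unfolding AE_lebesgue_on_iff[OF B(2)] .
  then have "AE s in lborel. s \<in> {0..t} \<longrightarrow> f s = d s"
    by (rule AE_mp) (rule AE_I2, use t in simp)
  then have ae': "AE s in lebesgue_on {0..t}. f s = d s"
    unfolding AE_lebesgue_on_iff[OF B(1)] .
  have fm: "f \<in> borel_measurable (lebesgue_on {0..t})"
    by (rule lebesgue_on_measurable_AE[OF B(1) d(1) ae'])
  have "(\<integral>s. k s * f s \<partial>lebesgue_on {0..t}) = (\<integral>s. k s * d s \<partial>lebesgue_on {0..t})"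
  proof (rule integral_cong_AE)
    show "AE s in lebesgue_on {0..t}. k s * f s = k s * d s"
      using ae' by (rule AE_mp) (rule AE_I2, simp)
  qed (use fm borel_imp_lebesgue_on_measurable[OF k] borel_imp_lebesgue_on_measurable[OF d(1)] in simp_all)
  also have "\<dots> = (\<integral>s. indicator {0..t} s *\<^sub>R (k s * d s) \<partial>lborel)"
    by (rule lebesgue_on_integral_borel(1)[OF B(1)]) (use k d(1) in simp)
  also have "\<dots> = (\<integral>s. indicator {..<t} s * (k s * d s) \<partial>lborel)"
  proof (rule integral_cong_AE)
    have "AE s in lborel. s \<noteq> t" by (rule AE_lborel_singleton)
    then show "AE s in lborel. indicator {0..t} s *\<^sub>R (k s * d s) = indicator {..<t} s * (k s * d s)"
    proof (rule AE_mp, intro AE_I2 impI)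
      fix s assume "s \<noteq> t"
      then show "indicator {0..t} s *\<^sub>R (k s * d s) = indicator {..<t} s * (k s * d s)"
        using d(2)[of s] by (cases "s < 0"; cases "s < t") simp_all
    qed
  qed (use k d(1) in simp_all)
  finally show ?thesis .
qed

lemma caputo_eq_frac_conv:
  assumes \<alpha>: "\<alpha> < 1" and d: "d \<in> borel_measurable borel" "\<And>s. s < 0 \<Longrightarrow> d s = 0"
    and ae: "AE s in lebesgue_on {0..T}. deriv g s = d s" and t: "t \<in> {0..T}"
  shows "caputo \<alpha> g t = frac_conv (1 - \<alpha>) d t"
proof -
  have "caputo \<alpha> g t = 1 / Gamma (1 - \<alpha>) * (\<integral>s. indicator {..<t} s * ((t - s) powr (- \<alpha>) * d s) \<partial>lborel)"
    unfolding caputo_def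
    by (subst integral_density_interval[OF d _ ae t, of "\<lambda>s. (t - s) powr (- \<alpha>)"]) simp_all
  also have "\<dots> = (\<integral>s. 1 / Gamma (1 - \<alpha>) * (indicator {..<t} s * ((t - s) powr (- \<alpha>) * d s)) \<partial>lborel)"
    by (rule integral_mult_right_zero[symmetric])
  also have "\<dots> = frac_conv (1 - \<alpha>) d t"
    unfolding frac_conv_def
    by (rule Bochner_Integration.integral_cong) (auto simp: frac_kernel_def indicator_def)
  finally show ?thesis .
qed

lemma caputo_differentiable_density:
  assumes "caputo_differentiable \<alpha> T g"
  shows "\<exists>d. integrable lborel d \<and> (\<forall>s. s \<notin> {0..T} \<longrightarrow> d s = 0) \<and>
    (AE s in lebesgue_on {0..T}. deriv g s = d s) \<and> (\<forall>t\<in>{0..T}. g t = g 0 + frac_conv 1 d t)"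
proof -
  note unf = assms[unfolded caputo_differentiable_def]
  have int: "integrable (lebesgue_on {0..T}) (deriv g)"
    by (rule unf[THEN conjunct2, THEN conjunct1])
  have eq: "g t = g 0 + (\<integral>s. deriv g s \<partial>lebesgue_on {0..t})" if "t \<in> {0..T}" for t
    by (rule bspec[OF unf[THEN conjunct2, THEN conjunct2, THEN conjunct1] that])
  have B: "{0..T} \<in> sets borel" by simp
  obtain d where d: "d \<in> borel_measurable borel" "\<And>s. s \<notin> {0..T} \<Longrightarrow> d s = 0" "AE s in lebesgue_on {0..T}. deriv g s = d s"
    using borel_representative_real[OF B borel_measurable_integrable[OF int]] by blast
  have "integrable (lebesgue_on {0..T}) d"
    using int integrable_cong_AE[OF borel_measurable_integrable[OF int]
        borel_imp_lebesgue_on_measurable[OF d(1)] d(3)] by simp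
  then have "integrable lborel d"
    using lborel_off_domain(2)[OF B d(1,2)] by simp
  moreover have "g t = g 0 + frac_conv 1 d t" if "t \<in> {0..T}" for t
    using eq[OF that] integral_density_interval[OF d(1) _ _ d(3) that, of "\<lambda>s. 1"] d(2)
    by (simp add: frac_conv_one)
  ultimately show ?thesis using d(2,3) by blast
qed

text \<open>The Caputo derivative is the fractional integral of order 1 - \<alpha> of the density of
  g; a further one of order \<alpha> produces the primitive of the density, which is g -
  g(0).\<close>

lemma caputo_inverse:
  assumes \<alpha>: "0 < \<alpha>" "\<alpha> < 1" and g: "caputo_differentiable \<alpha> T g" and t: "t \<in> {0..T}"
  shows "g t = g 0 + frac_conv \<alpha> (\<lambda>s. indicator {0..T} s * caputo \<alpha> g s) t"
    "integrable lborel (\<lambda>s. frac_kernel \<alpha> (t - s) * (indicator {0..T} s * caputo \<alpha> g s))"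
proof -
  obtain d where d: "integrable lborel d" "\<And>s. s \<notin> {0..T} \<Longrightarrow> d s = 0"
    "AE s in lebesgue_on {0..T}. deriv g s = d s" "\<And>t. t \<in> {0..T} \<Longrightarrow> g t = g 0 + frac_conv 1 d t"
    using caputo_differentiable_density[OF g] by blast
  have dm: "d \<in> borel_measurable borel" using borel_measurable_integrable[OF d(1)] by simp
  have d0: "d s = 0" if "s < 0" for s using d(2)[of s] that by simp
  have \<alpha>': "0 < 1 - \<alpha>" using \<alpha> by simp
  note as = frac_conv_assoc[OF \<alpha>(1) \<alpha>' _ d(1) d0]
  have c: "indicator {0..T} s * caputo \<alpha> g s = frac_conv (1 - \<alpha>) d s" if "s < t" for s
  proof (cases "s < 0")
    case True
    then show ?thesis using frac_conv_at_nonpos[of d s "1 - \<alpha>"] d0 by simp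
  next
    case False
    then have "s \<in> {0..T}" using that t by simp
    then show ?thesis using caputo_eq_frac_conv[OF \<alpha>(2) dm d0 d(3)] by simp
  qed
  have "frac_conv \<alpha> (\<lambda>s. indicator {0..T} s * caputo \<alpha> g s) t = frac_conv \<alpha> (frac_conv (1 - \<alpha>) d) t"
    by (rule frac_conv_cong) (rule c)
  also have "\<dots> = frac_conv 1 d t" using as(1)[of t] by simp
  finally show "g t = g 0 + frac_conv \<alpha> (\<lambda>s. indicator {0..T} s * caputo \<alpha> g s) t"
    using d(4)[OF t] by simp
  have "(\<lambda>s. frac_kernel \<alpha> (t - s) * (indicator {0..T} s * caputo \<alpha> g s)) = (\<lambda>s. frac_kernel \<alpha> (t - s) * frac_conv (1 - \<alpha>) d s)"
  proof
    fix s show "frac_kernel \<alpha> (t - s) * (indicator {0..T} s * caputo \<alpha> g s) = frac_kernel \<alpha> (t - s) * frac_conv (1 - \<alpha>) d s"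
      using c[of s] by (cases "s < t") (simp_all add: frac_kernel_nonpos_arg)
  qed
  then show "integrable lborel (\<lambda>s. frac_kernel \<alpha> (t - s) * (indicator {0..T} s * caputo \<alpha> g s))"
    using as(2)[of t] by simp
qed

text \<open>Two caveats make this more than linearity: \<open>deriv\<close> is additive only where
  both functions are differentiable, and the integral splits only when both singular integrals
  converge at t. The first and last clauses of \<open>caputo_differentiable\<close> supply
  this.\<close>

lemma caputo_diff:
  assumes \<alpha>: "0 < \<alpha>" "\<alpha> < 1" and g: "caputo_differentiable \<alpha> T g" and h: "caputo_differentiable \<alpha> T h"
    and t: "t \<in> {0<..T}"
  shows "caputo \<alpha> (\<lambda>s. g s - h s) t = caputo \<alpha> g t - caputo \<alpha> h t"
proof -
  have B: "{0..T} \<in> sets borel" "{0..t} \<in> sets borel" by simp_all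
  have t': "t \<in> {0..T}" using t by simp
  obtain d where d: "integrable lborel d" "\<And>s. s \<notin> {0..T} \<Longrightarrow> d s = 0" "AE s in lebesgue_on {0..T}. deriv g s = d s"
    using caputo_differentiable_density[OF g] by blast
  obtain e where e: "integrable lborel e" "\<And>s. s \<notin> {0..T} \<Longrightarrow> e s = 0" "AE s in lebesgue_on {0..T}. deriv h s = e s"
    using caputo_differentiable_density[OF h] by blast
  have dm: "d \<in> borel_measurable borel" "e \<in> borel_measurable borel"
    using borel_measurable_integrable[OF d(1)] borel_measurable_integrable[OF e(1)] by simp_all
  have d0: "d s = 0" "e s = 0" if "s < 0" for s using d(2)[of s] e(2)[of s] that by simp_all
  have "AE s in lebesgue_on {0..T}. g differentiable (at s)" "AE s in lebesgue_on {0..T}. h differentiable (at s)"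
    using g h by (simp_all add: caputo_differentiable_def)
  then have ae: "AE s in lebesgue_on {0..T}. deriv (\<lambda>s. g s - h s) s = d s - e s"
    using d(3) e(3)
  proof eventually_elim
    case (elim s)
    then have "deriv (\<lambda>s. g s - h s) s = deriv g s - deriv h s"
      by (intro deriv_diff) (simp_all add: real_differentiable_def field_differentiable_def)
    then show ?case using elim by simp
  qed
  have i: "integrable lborel (\<lambda>s. frac_kernel (1 - \<alpha>) (t - s) * f s)"
    if q: "caputo_differentiable \<alpha> T q" and f: "f \<in> borel_measurable borel" "\<And>s. s < 0 \<Longrightarrow> f s = 0"
      "AE s in lebesgue_on {0..T}. deriv q s = f s" for q f
  proof -
    have int: "integrable (lebesgue_on {0..t}) (\<lambda>s. (t - s) powr (- \<alpha>) * deriv q s)"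
      using q t by (simp add: caputo_differentiable_def)
    have "AE s in lborel. s \<in> {0..T} \<longrightarrow> deriv q s = f s"
      using f(3) unfolding AE_lebesgue_on_iff[OF B(1)] .
    then have "AE s in lborel. s \<in> {0..t} \<longrightarrow> (t - s) powr (- \<alpha>) * f s = (t - s) powr (- \<alpha>) * deriv q s"
      by (rule AE_mp) (rule AE_I2, use t in simp)
    then have ae': "AE s in lebesgue_on {0..t}. (t - s) powr (- \<alpha>) * f s = (t - s) powr (- \<alpha>) * deriv q s"
      unfolding AE_lebesgue_on_iff[OF B(2)] .
    have m: "(\<lambda>s. (t - s) powr (- \<alpha>) * f s) \<in> borel_measurable borel" using f(1) by simp
    have "integrable (lebesgue_on {0..t}) (\<lambda>s. (t - s) powr (- \<alpha>) * f s) \<longleftrightarrow> integrable (lebesgue_on {0..t}) (\<lambda>s. (t - s) powr (- \<alpha>) * deriv q s)"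
      by (rule integrable_cong_AE[OF borel_imp_lebesgue_on_measurable[OF m] borel_measurable_integrable[OF int] ae'])
    then have "integrable lborel (\<lambda>s. indicator {0..t} s *\<^sub>R ((t - s) powr (- \<alpha>) * f s))"
      using lebesgue_on_integral_borel(2)[OF B(2) m] int by simp
    then have "integrable lborel (\<lambda>s. (1 / Gamma (1 - \<alpha>)) * (indicator {0..t} s *\<^sub>R ((t - s) powr (- \<alpha>) * f s)))"
      by (rule integrable_mult_right)
    moreover have "(1 / Gamma (1 - \<alpha>)) * (indicator {0..t} s *\<^sub>R ((t - s) powr (- \<alpha>) * f s)) = frac_kernel (1 - \<alpha>) (t - s) * f s" for s
      using f(2)[of s] by (cases "s < 0"; cases "s < t"; cases "s = t") (simp_all add: frac_kernel_def)
    ultimately show ?thesis by simp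
  qed
  have 1: "caputo \<alpha> (\<lambda>s. g s - h s) t = frac_conv (1 - \<alpha>) (\<lambda>s. d s - e s) t"
    by (rule caputo_eq_frac_conv[OF \<alpha>(2) _ _ ae t']) (use dm d0 in simp_all)
  have 2: "caputo \<alpha> g t = frac_conv (1 - \<alpha>) d t" by (rule caputo_eq_frac_conv[OF \<alpha>(2) dm(1) d0(1) d(3) t'])
  have 3: "caputo \<alpha> h t = frac_conv (1 - \<alpha>) e t" by (rule caputo_eq_frac_conv[OF \<alpha>(2) dm(2) d0(2) e(3) t'])
  show ?thesis unfolding 1 2 3 frac_conv_def right_diff_distrib
    by (rule Bochner_Integration.integral_diff[OF i[OF g dm(1) d0(1) d(3)] i[OF h dm(2) d0(2) e(3)]])
qed

text \<open>A violation inside \<Omega> would persist on a nonempty open set, which has positive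
  measure; continuity carries the bound to the boundary.\<close>

lemma AE_bound_imp_closure_bound:
  fixes \<Omega> :: "'a::euclidean_space set" and v :: "'a \<Rightarrow> real"
  assumes \<Omega>: "open \<Omega>" and v: "continuous_on (closure \<Omega>) v" and ae: "AE x in lebesgue_on \<Omega>. \<bar>v x\<bar> \<le> K"
    and x: "x \<in> closure \<Omega>"
  shows "\<bar>v x\<bar> \<le> K"
proof -
  have vO: "continuous_on \<Omega> v" by (rule continuous_on_subset[OF v closure_subset])
  have in\<Omega>: "\<bar>v y\<bar> \<le> K" if y: "y \<in> \<Omega>" for y
  proof (rule ccontr)
    assume n: "\<not> \<bar>v y\<bar> \<le> K"
    let ?A = "\<Omega> \<inter> (\<lambda>x. \<bar>v x\<bar>) -` {K<..}"
    have "open ?A"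
      by (rule continuous_open_preimage[OF _ \<Omega>]) (intro continuous_intros vO, simp)
    moreover have "?A \<noteq> {}" using y n by auto
    ultimately have "\<not> negligible ?A" by (rule open_not_negligible)
    moreover have "AE x in lborel. x \<in> \<Omega> \<longrightarrow> \<bar>v x\<bar> \<le> K"
      using ae AE_lebesgue_on_iff[of \<Omega>] \<Omega> by simp
    then have "AE x in lborel. x \<notin> ?A" by (rule AE_mp) (rule AE_I2, auto)
    then have "?A \<in> null_sets lborel" using \<open>open ?A\<close> by (subst AE_iff_null_sets) simp_all
    then have "negligible ?A" by (simp add: negligible_iff_null_sets null_sets_completionI)
    ultimately show False by simp
  qed
  have "closedin (top_of_set (closure \<Omega>)) (closure \<Omega> \<inter> (\<lambda>x. \<bar>v x\<bar>) -` {..K})"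
    by (rule continuous_closedin_preimage) (intro continuous_intros v, simp)
  then have "closed (closure \<Omega> \<inter> (\<lambda>x. \<bar>v x\<bar>) -` {..K})"
    by (rule closedin_closed_trans) simp
  moreover have "\<Omega> \<subseteq> closure \<Omega> \<inter> (\<lambda>x. \<bar>v x\<bar>) -` {..K}"
    using in\<Omega> closure_subset by auto
  ultimately have "closure \<Omega> \<subseteq> closure \<Omega> \<inter> (\<lambda>x. \<bar>v x\<bar>) -` {..K}" by (rule closure_minimal[rotated])
  then show ?thesis using x by auto
qed

section \<open>Coefficients and norms in the domains of the powers of A\<close>

context neumann_eigensystem
begin

abbreviation "DA' s \<equiv> DA \<Omega> lam \<phi> s"
abbreviation "DAn s \<equiv> DA_norm \<Omega> lam \<phi> s"

lemma DA_si: "v \<in> DA' s \<Longrightarrow> square_integrable M v"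
  by (simp add: DA_def L2_iff)

lemma is_A_powD:
  assumes "is_A_pow \<Omega> lam \<phi> s v w"
  shows "square_integrable M w"
    "(\<lambda>n. l2norm M (\<lambda>x. w x - (\<Sum>l<n. (lam l powr s * coef v l) * \<phi> l x))) \<longlonglongrightarrow> 0"
  using assms unfolding is_A_pow_def L2_norm_eq L2_iff coef_def by simp_all

text \<open>The k-th coefficient of the partial sums is constant from n = k + 1 on, and coefficients
  are continuous in L^2.\<close>

lemma is_A_pow_coef:
  assumes "is_A_pow \<Omega> lam \<phi> s v w"
  shows "coef w k = lam k powr s * coef v k"
proof -
  note D = is_A_powD[OF assms]
  let ?S = "\<lambda>n x. \<Sum>l<n. (lam l powr s * coef v l) * \<phi> l x"
  have "\<bar>coef w k - lam k powr s * coef v k\<bar> \<le> l2norm M (\<lambda>x. w x - ?S n x)" if "n \<ge> Suc k" for n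
  proof -
    have "coef (\<lambda>x. w x - ?S n x) k = coef w k - coef (?S n) k" by (rule coef_diff[OF D(1) sum_si])
    moreover have "coef (?S n) k = lam k powr s * coef v k"
      using coef_sum[of "{..<n}" "\<lambda>l. lam l powr s * coef v l" k] that by simp
    moreover have "square_integrable M (\<lambda>x. w x - ?S n x)"
      by (rule square_integrable_diff[OF D(1) sum_si])
    ultimately show ?thesis using coef_bound[of "\<lambda>x. w x - ?S n x" k] by simp
  qed
  then have "\<bar>coef w k - lam k powr s * coef v k\<bar> \<le> 0"
    by (intro LIMSEQ_le_const[OF D(2)] exI[of _ "Suc k"]) simp
  then show ?thesis by simp
qed

lemma DA_norm_bessel:
  assumes "v \<in> DA' s" "finite F"
  shows "(\<Sum>l\<in>F. (lam l powr s * coef v l)\<^sup>2) \<le> (DAn s v)\<^sup>2"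
proof -
  have "\<exists>w. is_A_pow \<Omega> lam \<phi> s v w" using assms(1) by (simp add: DA_def)
  then have w: "is_A_pow \<Omega> lam \<phi> s v (A_pow \<Omega> lam \<phi> s v)"
    unfolding A_pow_def by (rule someI_ex)
  have "(\<Sum>l\<in>F. (coef (A_pow \<Omega> lam \<phi> s v) l)\<^sup>2) \<le> (DAn s v)\<^sup>2"
    unfolding DA_norm_def L2_norm_eq by (rule bessel[OF is_A_powD(1)[OF w] assms(2)])
  then show ?thesis unfolding is_A_pow_coef[OF w] .
qed

lemma DA_norm_nonneg: "0 \<le> DAn s v"
  by (simp add: DA_norm_def L2_norm_eq l2norm_nonneg)

lemma coef_le_DA_norm:
  assumes "v \<in> DA' s"
  shows "\<bar>coef v l\<bar> \<le> lam l powr (- s) * DAn s v"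
proof -
  have "(lam l powr s * coef v l)\<^sup>2 \<le> (DAn s v)\<^sup>2" using DA_norm_bessel[OF assms, of "{l}"] by simp
  then have "\<bar>lam l powr s * coef v l\<bar> \<le> DAn s v"
    using DA_norm_nonneg by (simp add: abs_le_square_iff[symmetric])
  then have "lam l powr (- s) * (lam l powr s * \<bar>coef v l\<bar>) \<le> lam l powr (- s) * DAn s v"
    by (intro mult_left_mono) (simp_all add: abs_mult)
  moreover have "lam l powr (- s) * (lam l powr s * \<bar>coef v l\<bar>) = \<bar>coef v l\<bar>"
    using lam_pos[of l] by (simp add: powr_minus field_simps)
  ultimately show ?thesis by simp
qed

lemma DA_diff:
  assumes v: "v \<in> DA' s" and w: "w \<in> DA' s"
  shows "(\<lambda>x. v x - w x) \<in> DA' s"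
proof -
  obtain p where p: "is_A_pow \<Omega> lam \<phi> s v p" using v by (auto simp: DA_def)
  obtain q where q: "is_A_pow \<Omega> lam \<phi> s w q" using w by (auto simp: DA_def)
  note pD = is_A_powD[OF p] and qD = is_A_powD[OF q]
  let ?P = "\<lambda>n x. \<Sum>l<n. (lam l powr s * coef v l) * \<phi> l x"
  let ?Q = "\<lambda>n x. \<Sum>l<n. (lam l powr s * coef w l) * \<phi> l x"
  let ?R = "\<lambda>n x. \<Sum>l<n. (lam l powr s * coef (\<lambda>x. v x - w x) l) * \<phi> l x"
  have R: "?R n x = ?P n x - ?Q n x" for n x
    unfolding coef_diff[OF DA_si[OF v] DA_si[OF w]] by (simp add: sum_subtractf algebra_simps)
  have "(\<lambda>n. l2norm M (\<lambda>x. (p x - q x) - ?R n x)) \<longlonglongrightarrow> 0"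
  proof (rule tendsto_sandwich[OF _ _ tendsto_const])
    show "\<forall>\<^sub>F n in sequentially. 0 \<le> l2norm M (\<lambda>x. (p x - q x) - ?R n x)" by (simp add: l2norm_nonneg)
    have "l2norm M (\<lambda>x. (p x - q x) - ?R n x) \<le> l2norm M (\<lambda>x. p x - ?P n x) + l2norm M (\<lambda>x. q x - ?Q n x)" for n
    proof -
      have e: "(\<lambda>x. (p x - q x) - ?R n x) = (\<lambda>x. (p x - ?P n x) + (?Q n x - q x))"
        unfolding R by (simp add: fun_eq_iff)
      show ?thesis
        unfolding e l2norm_diff_commute[of M q "?Q n"]
        by (rule l2norm_triangle[OF square_integrable_diff[OF pD(1) sum_si] square_integrable_diff[OF sum_si qD(1)]])
    qed
    then show "\<forall>\<^sub>F n in sequentially. l2norm M (\<lambda>x. (p x - q x) - ?R n x)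
       \<le> l2norm M (\<lambda>x. p x - ?P n x) + l2norm M (\<lambda>x. q x - ?Q n x)" by simp
    show "(\<lambda>n. l2norm M (\<lambda>x. p x - ?P n x) + l2norm M (\<lambda>x. q x - ?Q n x)) \<longlonglongrightarrow> 0"
      using tendsto_add[OF pD(2) qD(2)] by simp
  qed
  then have "is_A_pow \<Omega> lam \<phi> s (\<lambda>x. v x - w x) (\<lambda>x. p x - q x)"
    using square_integrable_diff[OF pD(1) qD(1)] unfolding is_A_pow_def L2_norm_eq L2_iff coef_def by simp
  then show ?thesis
    using square_integrable_diff[OF DA_si[OF v] DA_si[OF w]] by (auto simp: DA_def L2_iff)
qed

lemma lam_powr_square: "(lam l powr s)\<^sup>2 = lam l powr (2 * s)"
  using lam_pos[of l] by (simp add: power2_eq_square powr_add[symmetric])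

lemma sobolev_pointwise:
  assumes \<gamma>: "real DIM('a) / 2 < \<gamma>"
  shows "\<exists>C>0. \<forall>v B. square_integrable M v \<and> continuous_on (closure \<Omega>) v \<and> B \<ge> 0 \<and>
      (\<forall>n. (\<Sum>l<n. lam l powr \<gamma> * (coef v l)\<^sup>2) \<le> B\<^sup>2) \<longrightarrow> (\<forall>x\<in>closure \<Omega>. \<bar>v x\<bar> \<le> C * B)"
proof -
  obtain C where C: "C > 0" and sob: "\<forall>v B. square_integrable M v \<and> B \<ge> 0 \<and> (\<forall>n. (\<Sum>l<n. lam l powr \<gamma> * (coef v l)\<^sup>2) \<le> B\<^sup>2) \<longrightarrow>
    (AE x in M. \<bar>v x\<bar> \<le> C * B)"
    by (rule exE[OF sobolev_embedding[OF \<gamma>]], elim conjE, rule that)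
  show ?thesis
  proof (intro exI[of _ C] conjI C allI impI ballI; elim conjE)
    fix v B x
    assume v: "square_integrable M v" "continuous_on (closure \<Omega>) v" "0 \<le> B"
      "\<forall>n. (\<Sum>l<n. lam l powr \<gamma> * (coef v l)\<^sup>2) \<le> B\<^sup>2" and x: "x \<in> closure \<Omega>"
    have "AE x in M. \<bar>v x\<bar> \<le> C * B" using sob v by simp
    from AE_bound_imp_closure_bound[OF domain(1) v(2) this x] show "\<bar>v x\<bar> \<le> C * B" .
  qed
qed

lemma DA_sobolev_sum:
  assumes "v \<in> DA' (\<gamma> / 2)"
  shows "(\<Sum>l<n. lam l powr \<gamma> * (coef v l)\<^sup>2) \<le> (DAn (\<gamma> / 2) v)\<^sup>2"
  using DA_norm_bessel[OF assms, of "{..<n}"] by (simp add: power_mult_distrib lam_powr_square)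

text \<open>A fixed choice, so that the final constant can be written down before the order
  \<alpha>, the potentials and the data are introduced.\<close>

definition sobolev_const :: "real \<Rightarrow> real" where
  "sobolev_const \<gamma> = (SOME C. C > 0 \<and> (\<forall>v B. square_integrable M v \<and> continuous_on (closure \<Omega>) v \<and> B \<ge> 0 \<and>
      (\<forall>n. (\<Sum>l<n. lam l powr \<gamma> * (coef v l)\<^sup>2) \<le> B\<^sup>2) \<longrightarrow> (\<forall>x\<in>closure \<Omega>. \<bar>v x\<bar> \<le> C * B)))"

lemma sobolev_const:
  assumes "real DIM('a) / 2 < \<gamma>"
  shows "sobolev_const \<gamma> > 0"
    "\<And>v B x. square_integrable M v \<Longrightarrow> continuous_on (closure \<Omega>) v \<Longrightarrow> B \<ge> 0 \<Longrightarrow>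
      (\<And>n. (\<Sum>l<n. lam l powr \<gamma> * (coef v l)\<^sup>2) \<le> B\<^sup>2) \<Longrightarrow> x \<in> closure \<Omega> \<Longrightarrow> \<bar>v x\<bar> \<le> sobolev_const \<gamma> * B"
proof -
  note s = someI_ex[OF sobolev_pointwise[OF assms], folded sobolev_const_def]
  show "sobolev_const \<gamma> > 0" by (rule conjunct1[OF s])
  fix v B x
  assume "square_integrable M v" "continuous_on (closure \<Omega>) v" "B \<ge> 0"
    "\<And>n. (\<Sum>l<n. lam l powr \<gamma> * (coef v l)\<^sup>2) \<le> B\<^sup>2" and x: "x \<in> closure \<Omega>"
  then have "square_integrable M v \<and> continuous_on (closure \<Omega>) v \<and> B \<ge> 0 \<and>
      (\<forall>n. (\<Sum>l<n. lam l powr \<gamma> * (coef v l)\<^sup>2) \<le> B\<^sup>2)" by simp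
  from mp[OF spec[OF spec[OF conjunct2[OF s]]] this] x show "\<bar>v x\<bar> \<le> sobolev_const \<gamma> * B" by blast
qed

lemma sobolev_DA:
  assumes "real DIM('a) / 2 < \<gamma>" "v \<in> DA' (\<gamma> / 2)" "continuous_on (closure \<Omega>) v" "x \<in> closure \<Omega>"
  shows "\<bar>v x\<bar> \<le> sobolev_const \<gamma> * DAn (\<gamma> / 2) v"
  by (rule sobolev_const(2)[OF assms(1) DA_si[OF assms(2)] assms(3) DA_norm_nonneg DA_sobolev_sum[OF assms(2)] assms(4)])

end

section \<open>Solutions of the subdiffusion equation\<close>

lemma integrable_product_kernel:
  fixes p :: "'a::euclidean_space \<Rightarrow> real" and q :: "'b::euclidean_space \<Rightarrow> real"
  assumes p: "integrable lborel p" and q: "integrable lborel q"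
  shows "integrable (lborel \<Otimes>\<^sub>M lborel) (\<lambda>z. p (fst z) * q (snd z))"
proof (rule integrableI_bounded)
  have [measurable]: "p \<in> borel_measurable borel" "q \<in> borel_measurable borel"
    using borel_measurable_integrable[OF p] borel_measurable_integrable[OF q] by simp_all
  show m: "(\<lambda>z. p (fst z) * q (snd z)) \<in> borel_measurable (lborel \<Otimes>\<^sub>M lborel)" by measurable
  have "(\<integral>\<^sup>+z. ennreal (norm (p (fst z) * q (snd z))) \<partial>(lborel \<Otimes>\<^sub>M lborel))
     = (\<integral>\<^sup>+x. (\<integral>\<^sup>+y. ennreal (norm (p x * q y)) \<partial>lborel) \<partial>lborel)"
    by (subst lborel.nn_integral_fst[symmetric]) simp_all
  also have "\<dots> = (\<integral>\<^sup>+x. ennreal (norm (p x)) * (\<integral>\<^sup>+y. ennreal (norm (q y)) \<partial>lborel) \<partial>lborel)"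
  proof (rule nn_integral_cong)
    fix x
    have "(\<integral>\<^sup>+y. ennreal (norm (p x * q y)) \<partial>lborel) = (\<integral>\<^sup>+y. ennreal (norm (p x)) * ennreal (norm (q y)) \<partial>lborel)"
      by (rule nn_integral_cong) (simp add: abs_mult ennreal_mult)
    also have "\<dots> = ennreal (norm (p x)) * (\<integral>\<^sup>+y. ennreal (norm (q y)) \<partial>lborel)"
      by (rule nn_integral_cmult) simp
    finally show "(\<integral>\<^sup>+y. ennreal (norm (p x * q y)) \<partial>lborel) = ennreal (norm (p x)) * (\<integral>\<^sup>+y. ennreal (norm (q y)) \<partial>lborel)" .
  qed
  also have "\<dots> = (\<integral>\<^sup>+x. ennreal (norm (p x)) \<partial>lborel) * (\<integral>\<^sup>+y. ennreal (norm (q y)) \<partial>lborel)"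
    by (rule nn_integral_multc) simp
  also have "\<dots> < \<infinity>"
    using p q by (simp add: integrable_iff_bounded ennreal_mult_less_top)
  finally show "(\<integral>\<^sup>+z. ennreal (norm (p (fst z) * q (snd z))) \<partial>(lborel \<Otimes>\<^sub>M lborel)) < \<infinity>" .
qed

section \<open>One solution: pointwise control and the equations of its coefficients\<close>

locale subdiffusion_solution = neumann_eigensystem \<Omega> c0 lam \<phi>
  for \<Omega> :: "'a::euclidean_space set" and c0 :: real and lam :: "nat \<Rightarrow> real" and \<phi> :: "nat \<Rightarrow> 'a \<Rightarrow> real" +
  fixes \<gamma> T \<alpha> crho :: real and \<rho> :: "real \<Rightarrow> real" and u0 f :: "'a \<Rightarrow> real" and u :: "real \<Rightarrow> 'a \<Rightarrow> real"
  assumes \<gamma>: "real DIM('a) / 2 < \<gamma>" and T: "T > 0" and \<alpha>: "0 < \<alpha>" "\<alpha> < 1"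
    and \<rho>: "\<rho> \<in> admissible T crho" and u0: "u0 \<in> DA \<Omega> lam \<phi> (1 + \<gamma> / 2)" and f: "f \<in> DA \<Omega> lam \<phi> (\<gamma> / 2)"
    and sol: "is_solution \<Omega> T lam \<phi> \<gamma> \<alpha> \<rho> u0 f u"
begin

lemma rho: "continuous_on {0..T} \<rho>" "t \<in> {0..T} \<Longrightarrow> 0 \<le> \<rho> t" "t \<in> {0..T} \<Longrightarrow> \<rho> t \<le> crho"
  using \<rho> by (auto simp: admissible_def)

text \<open>One choice of the continuous extension of the Caputo derivative to [0,T]. At t = 0 only
  its class in D(A^(\<gamma>/2)) is known; continuity in x and agreement with \<open>caputo\<close>
  are available on (0,T].\<close>

definition D :: "real \<Rightarrow> 'a \<Rightarrow> real" where
  "D = (SOME D. cont_DA \<Omega> lam \<phi> (\<gamma> / 2) T D \<and>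
        (\<forall>t\<in>{0<..T}. continuous_on (closure \<Omega>) (D t) \<and>
           (\<forall>x\<in>closure \<Omega>. D t x = caputo \<alpha> (\<lambda>s. u s x) t)))"

lemma sol_parts:
  "\<forall>t\<in>{0..T}. continuous_on (closure \<Omega>) (u t)" (is ?A)
  "cont_DA \<Omega> lam \<phi> (1 + \<gamma> / 2) T u" (is ?B)
  "\<forall>x\<in>closure \<Omega>. caputo_differentiable \<alpha> T (\<lambda>s. u s x)" (is ?C)
  "cont_DA \<Omega> lam \<phi> (\<gamma> / 2) T D \<and> (\<forall>t\<in>{0<..T}. continuous_on (closure \<Omega>) (D t) \<and>
           (\<forall>x\<in>closure \<Omega>. D t x = caputo \<alpha> (\<lambda>s. u s x) t))" (is ?D)
  "\<forall>t\<in>{0<..T}. \<exists>g. neumann_laplacian \<Omega> (u t) g \<and>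
        (AE x in M. caputo \<alpha> (\<lambda>s. u s x) t - g x + \<rho> t * u t x = f x)" (is ?E)
  "AE x in M. u 0 x = u0 x" (is ?F)
proof -
  note s = sol[unfolded is_solution_def]
  show ?A by (rule s[THEN conjunct1])
  show ?B by (rule s[THEN conjunct2, THEN conjunct2, THEN conjunct1])
  show ?C by (rule s[THEN conjunct2, THEN conjunct2, THEN conjunct2, THEN conjunct1])
  show ?D
    by (rule someI_ex[OF s[THEN conjunct2, THEN conjunct2, THEN conjunct2, THEN conjunct2, THEN conjunct1], folded D_def])
  show ?E by (rule s[THEN conjunct2, THEN conjunct2, THEN conjunct2, THEN conjunct2, THEN conjunct2, THEN conjunct1])
  show ?F by (rule s[THEN conjunct2, THEN conjunct2, THEN conjunct2, THEN conjunct2, THEN conjunct2, THEN conjunct2])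
qed

lemma u_continuous: "t \<in> {0..T} \<Longrightarrow> continuous_on (closure \<Omega>) (u t)" using sol_parts(1) by blast

lemma u_DA: "t \<in> {0..T} \<Longrightarrow> u t \<in> DA' (1 + \<gamma> / 2)" using sol_parts(2) unfolding cont_DA_def by blast

lemma u_si: "t \<in> {0..T} \<Longrightarrow> square_integrable M (u t)" by (rule DA_si[OF u_DA])

lemma u_lim: "t \<in> {0..T} \<Longrightarrow> ((\<lambda>r. DAn (1 + \<gamma> / 2) (\<lambda>x. u r x - u t x)) \<longlongrightarrow> 0) (at t within {0..T})"
  using sol_parts(2) unfolding cont_DA_def by blast

lemma u_caputo: "x \<in> closure \<Omega> \<Longrightarrow> caputo_differentiable \<alpha> T (\<lambda>s. u s x)"
  by (rule bspec[OF sol_parts(3)])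

lemma D_DA: "t \<in> {0..T} \<Longrightarrow> D t \<in> DA' (\<gamma> / 2)" using sol_parts(4) unfolding cont_DA_def by blast

lemma D_lim: "t \<in> {0..T} \<Longrightarrow> ((\<lambda>r. DAn (\<gamma> / 2) (\<lambda>x. D r x - D t x)) \<longlongrightarrow> 0) (at t within {0..T})"
  using sol_parts(4) unfolding cont_DA_def by blast

lemma D_continuous: "t \<in> {0<..T} \<Longrightarrow> continuous_on (closure \<Omega>) (D t)"
  by (rule bspec[OF conjunct2[OF sol_parts(4)], THEN conjunct1])

lemma D_eq: "t \<in> {0<..T} \<Longrightarrow> x \<in> closure \<Omega> \<Longrightarrow> D t x = caputo \<alpha> (\<lambda>s. u s x) t"
  by (rule bspec[OF bspec[OF conjunct2[OF sol_parts(4)], THEN conjunct2]])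

lemma D_close:
  assumes "s \<in> {0<..T}" "t \<in> {0<..T}" "x \<in> closure \<Omega>"
  shows "\<bar>D s x - D t x\<bar> \<le> sobolev_const \<gamma> * DAn (\<gamma> / 2) (\<lambda>x. D s x - D t x)"
proof -
  have "(\<lambda>x. D s x - D t x) \<in> DA' (\<gamma> / 2)" by (rule DA_diff) (use assms in \<open>auto intro: D_DA\<close>)
  moreover have "continuous_on (closure \<Omega>) (\<lambda>x. D s x - D t x)"
    by (intro continuous_on_diff D_continuous assms)
  ultimately show ?thesis by (rule sobolev_DA[OF \<gamma> _ _ assms(3)])
qed

lemma D_pointwise_lim:
  assumes "t \<in> {0<..T}"
  shows "\<forall>e>0. \<exists>d>0. \<forall>s\<in>{0<..T}. \<bar>s - t\<bar> < d \<longrightarrow> (\<forall>x\<in>closure \<Omega>. \<bar>D s x - D t x\<bar> < e)"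
proof (intro allI impI)
  fix e :: real assume e: "e > 0"
  have C: "sobolev_const \<gamma> > 0" by (rule sobolev_const(1)[OF \<gamma>])
  have "e / sobolev_const \<gamma> > 0" using e C by simp
  from order_tendstoD(2)[OF D_lim this] assms
  have "\<forall>\<^sub>F s in at t within {0..T}. DAn (\<gamma> / 2) (\<lambda>x. D s x - D t x) < e / sobolev_const \<gamma>" by simp
  then obtain d where d: "d > 0" "\<And>s. s \<in> {0..T} \<Longrightarrow> s \<noteq> t \<Longrightarrow> dist s t < d \<Longrightarrow> DAn (\<gamma> / 2) (\<lambda>x. D s x - D t x) < e / sobolev_const \<gamma>"
    unfolding eventually_at by blast
  show "\<exists>d>0. \<forall>s\<in>{0<..T}. \<bar>s - t\<bar> < d \<longrightarrow> (\<forall>x\<in>closure \<Omega>. \<bar>D s x - D t x\<bar> < e)"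
  proof (intro exI[of _ d] conjI d(1) ballI impI)
    fix s x assume s: "s \<in> {0<..T}" "\<bar>s - t\<bar> < d" and x: "x \<in> closure \<Omega>"
    show "\<bar>D s x - D t x\<bar> < e"
    proof (cases "s = t")
      case False
      have "\<bar>D s x - D t x\<bar> \<le> sobolev_const \<gamma> * DAn (\<gamma> / 2) (\<lambda>x. D s x - D t x)" by (rule D_close[OF s(1) assms x])
      also have "\<dots> < sobolev_const \<gamma> * (e / sobolev_const \<gamma>)"
        using d(2)[of s] s False C by (intro mult_strict_left_mono) (simp_all add: dist_real_def)
      finally show ?thesis using C by simp
    qed (use e in simp)
  qed
qed

text \<open>Local bounds plus compactness of [0,T]. The centre t = 0 must be covered although
  \<open>D 0\<close> has no continuous representative at hand. So the embedding is applied to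
  \<open>D s\<close> for s > 0, with coefficient sums estimated through those of
  \<open>D s - D t\<close> and of \<open>D t\<close>.\<close>

lemma D_bounded: "\<exists>K. \<forall>t\<in>{0<..T}. \<forall>x\<in>closure \<Omega>. \<bar>D t x\<bar> \<le> K"
proof -
  have C: "sobolev_const \<gamma> > 0" by (rule sobolev_const(1)[OF \<gamma>])
  have loc: "\<exists>d>0. \<exists>K. \<forall>s\<in>{0<..T}. \<bar>s - t\<bar> < d \<longrightarrow> (\<forall>x\<in>closure \<Omega>. \<bar>D s x\<bar> \<le> K)" if t: "t \<in> {0..T}" for t
  proof -
    have "\<forall>\<^sub>F s in at t within {0..T}. DAn (\<gamma> / 2) (\<lambda>x. D s x - D t x) < 1"
      by (rule order_tendstoD(2)[OF D_lim[OF t]]) simp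
    then obtain d where d: "d > 0" "\<And>s. s \<in> {0..T} \<Longrightarrow> s \<noteq> t \<Longrightarrow> dist s t < d \<Longrightarrow> DAn (\<gamma> / 2) (\<lambda>x. D s x - D t x) < 1"
      unfolding eventually_at by blast
    define N where "N = DAn (\<gamma> / 2) (D t)"
    have N: "N \<ge> 0" unfolding N_def by (rule DA_norm_nonneg)
    have "\<bar>D s x\<bar> \<le> sobolev_const \<gamma> * (2 * (1 + N))" if s: "s \<in> {0<..T}" "\<bar>s - t\<bar> < d" and x: "x \<in> closure \<Omega>" for s x
    proof -
      have sT: "s \<in> {0..T}" using s by simp
      have "(\<Sum>l<n. lam l powr \<gamma> * (coef (D s) l)\<^sup>2) \<le> (2 * (1 + N))\<^sup>2" for n
      proof (cases "s = t")
        case True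
        have "(\<Sum>l<n. lam l powr \<gamma> * (coef (D s) l)\<^sup>2) \<le> N\<^sup>2"
          unfolding True N_def by (rule DA_sobolev_sum[OF D_DA[OF t]])
        also have "\<dots> \<le> (2 * (1 + N))\<^sup>2" using N by (intro power_mono) simp_all
        finally show ?thesis .
      next
        case False
        let ?E = "\<lambda>x. D s x - D t x"
        have E: "?E \<in> DA' (\<gamma> / 2)" by (rule DA_diff[OF D_DA[OF sT] D_DA[OF t]])
        have "DAn (\<gamma> / 2) ?E < 1" using d(2)[OF sT False] s(2) by (simp add: dist_real_def)
        have "(\<Sum>l<n. lam l powr \<gamma> * (coef (D s) l)\<^sup>2)
          \<le> (\<Sum>l<n. 2 * (lam l powr \<gamma> * (coef ?E l)\<^sup>2) + 2 * (lam l powr \<gamma> * (coef (D t) l)\<^sup>2))"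
        proof (rule sum_mono)
          fix l
          have "coef (D s) l = coef ?E l + coef (D t) l"
            using coef_diff[OF DA_si[OF D_DA[OF sT]] DA_si[OF D_DA[OF t]], of l] by simp
          moreover have "(a + b)\<^sup>2 \<le> 2 * a\<^sup>2 + 2 * b\<^sup>2" for a b :: real
            using sum_squares_bound[of a b] unfolding power2_sum by linarith
          ultimately have "(coef (D s) l)\<^sup>2 \<le> 2 * (coef ?E l)\<^sup>2 + 2 * (coef (D t) l)\<^sup>2" by simp
          then have "lam l powr \<gamma> * (coef (D s) l)\<^sup>2 \<le> lam l powr \<gamma> * (2 * (coef ?E l)\<^sup>2 + 2 * (coef (D t) l)\<^sup>2)"
            by (intro mult_left_mono) simp_all
          then show "lam l powr \<gamma> * (coef (D s) l)\<^sup>2 \<le> 2 * (lam l powr \<gamma> * (coef ?E l)\<^sup>2) + 2 * (lam l powr \<gamma> * (coef (D t) l)\<^sup>2)"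
            by (simp add: algebra_simps)
        qed
        also have "\<dots> = 2 * (\<Sum>l<n. lam l powr \<gamma> * (coef ?E l)\<^sup>2) + 2 * (\<Sum>l<n. lam l powr \<gamma> * (coef (D t) l)\<^sup>2)"
          by (simp add: sum.distrib sum_distrib_left)
        also have "\<dots> \<le> 2 * (DAn (\<gamma> / 2) ?E)\<^sup>2 + 2 * N\<^sup>2"
          unfolding N_def by (intro add_mono mult_left_mono DA_sobolev_sum E D_DA[OF t]) simp_all
        also have "\<dots> \<le> 2 * 1\<^sup>2 + 2 * N\<^sup>2"
          using \<open>DAn (\<gamma> / 2) ?E < 1\<close> DA_norm_nonneg[of "\<gamma> / 2" ?E] by (intro add_right_mono mult_left_mono power_mono) simp_all
        also have "\<dots> \<le> (2 * (1 + N))\<^sup>2" using N by (simp add: power2_eq_square algebra_simps)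
        finally show ?thesis .
      qed
      then show ?thesis using N
        by (intro sobolev_const(2)[OF \<gamma> DA_si[OF D_DA[OF sT]] D_continuous[OF s(1)] _ _ x]) simp_all
    qed
    then show ?thesis using d(1) by blast
  qed
  then obtain d K where dK: "\<And>t. t \<in> {0..T} \<Longrightarrow> d t > 0"
    "\<And>t s x. t \<in> {0..T} \<Longrightarrow> s \<in> {0<..T} \<Longrightarrow> \<bar>s - t\<bar> < d t \<Longrightarrow> x \<in> closure \<Omega> \<Longrightarrow> \<bar>D s x\<bar> \<le> K t"
    by metis
  have "{0..T} \<subseteq> (\<Union>t\<in>{0..T}. ball t (d t))" using dK(1) by fastforce
  then obtain F where F: "F \<subseteq> {0..T}" "finite F" "{0..T} \<subseteq> (\<Union>t\<in>F. ball t (d t))"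
    using compactE_image[OF compact_Icc, of "{0..T}" "\<lambda>t. ball t (d t)" 0 T] by (metis open_ball)
  have "\<bar>D s x\<bar> \<le> (\<Sum>t\<in>F. \<bar>K t\<bar>)" if s: "s \<in> {0<..T}" and x: "x \<in> closure \<Omega>" for s x
  proof -
    have "s \<in> {0..T}" using s by simp
    then obtain t where t: "t \<in> F" "s \<in> ball t (d t)" using F(3) by blast
    then have "\<bar>D s x\<bar> \<le> K t" using F(1) s x by (intro dK(2)) (auto simp: dist_real_def)
    also have "\<dots> \<le> \<bar>K t\<bar>" by simp
    also have "\<dots> \<le> (\<Sum>t\<in>F. \<bar>K t\<bar>)" by (rule member_le_sum) (use t F in auto)
    finally show ?thesis .
  qed
  then show ?thesis by blast
qed

lemma coef_u_continuous: "continuous_on {0..T} (\<lambda>t. coef (u t) l)"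
  unfolding continuous_on
proof
  fix t assume t: "t \<in> {0..T}"
  have "((\<lambda>r. coef (u r) l - coef (u t) l) \<longlongrightarrow> 0) (at t within {0..T})"
  proof (rule Lim_null_comparison)
    show "\<forall>\<^sub>F r in at t within {0..T}. norm (coef (u r) l - coef (u t) l)
        \<le> lam l powr (- (1 + \<gamma> / 2)) * DAn (1 + \<gamma> / 2) (\<lambda>x. u r x - u t x)"
      unfolding eventually_at_filter
    proof (rule always_eventually, intro allI impI)
      fix r assume r: "r \<in> {0..T}"
      have "coef (u r) l - coef (u t) l = coef (\<lambda>x. u r x - u t x) l"
        by (rule coef_diff[OF u_si[OF r] u_si[OF t], symmetric])
      then show "norm (coef (u r) l - coef (u t) l) \<le> lam l powr (- (1 + \<gamma> / 2)) * DAn (1 + \<gamma> / 2) (\<lambda>x. u r x - u t x)"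
        using coef_le_DA_norm[OF DA_diff[OF u_DA[OF r] u_DA[OF t]], of l] by simp
    qed
    show "((\<lambda>r. lam l powr (- (1 + \<gamma> / 2)) * DAn (1 + \<gamma> / 2) (\<lambda>x. u r x - u t x)) \<longlongrightarrow> 0) (at t within {0..T})"
      using tendsto_mult_left[OF u_lim[OF t], of "lam l powr (- (1 + \<gamma> / 2))"] by simp
  qed
  then show "((\<lambda>t. coef (u t) l) \<longlongrightarrow> coef (u t) l) (at t within {0..T})"
    by (simp add: LIM_zero_iff)
qed

text \<open>The equation at time t is paired with an eigenfunction; -\<Delta> contributes the factor
  \<open>lam l - c0\<close>.\<close>

lemma coef_D:
  assumes t: "t \<in> {0<..T}"
  shows "coef (D t) l = coef f l - (lam l - c0 + \<rho> t) * coef (u t) l"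
proof -
  have tT: "t \<in> {0..T}" using t by simp
  obtain g where g: "neumann_laplacian \<Omega> (u t) g" "AE x in M. caputo \<alpha> (\<lambda>s. u s x) t - g x + \<rho> t * u t x = f x"
    using sol_parts(5) t by blast
  have gsi: "square_integrable M g" by (rule neumann_laplacianE[OF g(1)])
  have "AE x in M. x \<in> \<Omega>" by (rule AE_I2) simp
  then have ae: "AE x in M. D t x = (f x + 1 * g x) + (- \<rho> t) * u t x"
    using g(2)
  proof eventually_elim
    case (elim x)
    then have "x \<in> closure \<Omega>" using closure_subset by blast
    then show ?case using elim D_eq[OF t, of x] by simp
  qed
  have s1: "square_integrable M (\<lambda>x. f x + 1 * g x)"
    by (rule square_integrable_add[OF DA_si[OF f] square_integrable_cmult[OF gsi]])
  have s2: "square_integrable M (\<lambda>x. (f x + 1 * g x) + (- \<rho> t) * u t x)"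
    by (rule square_integrable_add[OF s1 square_integrable_cmult[OF u_si[OF tT]]])
  have "coef (D t) l = coef (\<lambda>x. (f x + 1 * g x) + (- \<rho> t) * u t x) l"
    by (rule coef_cong_AE[OF square_integrableD(1)[OF DA_si[OF D_DA[OF tT]]] square_integrableD(1)[OF s2] ae])
  also have "\<dots> = (coef f l + 1 * coef g l) + (- \<rho> t) * coef (u t) l"
    unfolding coef_add_cmult[OF s1 u_si[OF tT]] coef_add_cmult[OF DA_si[OF f] gsi] ..
  also have "\<dots> = coef f l - (lam l - c0 + \<rho> t) * coef (u t) l"
    unfolding coef_laplacian[OF g(1)] by (simp add: algebra_simps)
  finally show ?thesis .
qed

lemma coef_u0: "coef (u 0) l = coef u0 l"
  by (rule coef_cong_AE[OF square_integrableD(1)[OF u_si] square_integrableD(1)[OF DA_si[OF u0]] sol_parts(6)])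
    (use T in simp)

text \<open>Convergence in time is uniform in space, so continuity in x at fixed t suffices. The
  purpose is measurability on the product space, which Fubini requires.\<close>

lemma D_jointly_continuous: "continuous_on ({0<..T} \<times> \<Omega>) (\<lambda>p. D (fst p) (snd p))"
  unfolding continuous_on_iff
proof (intro ballI allI impI)
  fix p e assume p: "p \<in> {0<..T} \<times> \<Omega>" and e: "(e::real) > 0"
  obtain t x where tx: "p = (t, x)" "t \<in> {0<..T}" "x \<in> \<Omega>" using p by auto
  have e2: "e / 2 > 0" using e by simp
  obtain d1 where d1: "d1 > 0" "\<And>s y. s \<in> {0<..T} \<Longrightarrow> \<bar>s - t\<bar> < d1 \<Longrightarrow> y \<in> closure \<Omega> \<Longrightarrow> \<bar>D s y - D t y\<bar> < e / 2"
    using D_pointwise_lim[OF tx(2)] e2 by meson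
  have "x \<in> closure \<Omega>" using tx(3) closure_subset by blast
  then obtain d2 where d2: "d2 > 0" "\<And>y. y \<in> closure \<Omega> \<Longrightarrow> dist y x < d2 \<Longrightarrow> dist (D t y) (D t x) < e / 2"
    using D_continuous[OF tx(2)] e2 unfolding continuous_on_iff by meson
  show "\<exists>d>0. \<forall>p'\<in>{0<..T} \<times> \<Omega>. dist p' p < d \<longrightarrow> dist (D (fst p') (snd p')) (D (fst p) (snd p)) < e"
  proof (intro exI[of _ "min d1 d2"] conjI ballI impI)
    show "0 < min d1 d2" using d1 d2 by simp
    fix p' assume p': "p' \<in> {0<..T} \<times> \<Omega>" and dp: "dist p' p < min d1 d2"
    obtain s y where sy: "p' = (s, y)" "s \<in> {0<..T}" "y \<in> \<Omega>" using p' by auto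
    have yc: "y \<in> closure \<Omega>" using sy(3) closure_subset by blast
    have "dist s t \<le> dist p' p" "dist y x \<le> dist p' p"
      using dist_fst_le[of p' p] dist_snd_le[of p' p] by (simp_all add: sy tx)
    then have "\<bar>s - t\<bar> < d1" "dist y x < d2" using dp by (simp_all add: dist_real_def)
    then have "\<bar>D s y - D t y\<bar> < e / 2" "\<bar>D t y - D t x\<bar> < e / 2"
      using d1(2)[OF sy(2) _ yc] d2(2)[OF yc] by (simp_all add: dist_real_def)
    then have "\<bar>D s y - D t x\<bar> < e" by linarith
    then show "dist (D (fst p') (snd p')) (D (fst p) (snd p)) < e"
      by (simp add: sy tx dist_real_def)
  qed
qed

text \<open>The Caputo derivative is inverted at every point x, the result is paired with the
  eigenfunction, and the integrals over time and space are exchanged. The uniform bound on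
  \<open>D\<close> makes the double integral absolutely convergent despite the singular
  kernel.\<close>

theorem coef_equation:
  assumes t: "t \<in> {0..T}"
  shows "coef (u t) l = coef u0 l + frac_conv \<alpha> (\<lambda>s. indicator {0..T} s * (coef f l - (lam l - c0 + \<rho> s) * coef (u s) l)) t"
proof -
  have Om: "\<Omega> \<in> sets borel" using domain(1) by simp
  have \<phi>m: "\<phi> l \<in> borel_measurable M" by (rule square_integrableD(1)[OF phi_si])
  obtain p where p: "p \<in> borel_measurable borel" "\<And>x. x \<notin> \<Omega> \<Longrightarrow> p x = 0" "AE x in M. \<phi> l x = p x"
    using borel_representative_real[OF Om \<phi>m] by blast
  have pm: "p \<in> borel_measurable M" by (rule borel_imp_lebesgue_on_measurable[OF p(1)])
  have pint: "integrable lborel p"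
  proof -
    have "integrable M (\<phi> l)" by (rule integrable_of_square_integrable[OF finM phi_si])
    then have "integrable M p" using integrable_cong_AE[OF \<phi>m pm p(3)] by simp
    then show ?thesis using lborel_off_domain(2)[OF Om p(1,2)] by simp
  qed
  define A where "A = {0<..T} \<times> \<Omega>"
  \<comment> \<open>The extension by 0 of \<open>D\<close> from (0,T] times \<Omega> to the whole
    product space. Time 0 is left out because \<open>D 0\<close> need not agree with the Caputo
    integral there; it is a null set.\<close>
  define E where "E s x = indicator A (s, x) * D s x" for s x
  have Am: "A \<in> sets borel" unfolding A_def by (intro borel_Times) (use Om in simp_all)
  have Em0: "(\<lambda>z. E (fst z) (snd z)) \<in> borel_measurable borel"
    using borel_measurable_continuous_on_indicator[OF Am D_jointly_continuous[folded A_def]]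
    by (simp add: E_def)
  have Em [measurable]: "(\<lambda>z. E (fst z) (snd z)) \<in> borel_measurable (lborel \<Otimes>\<^sub>M lborel)"
    using Em0 unfolding lborel_prod by simp
  have Es: "(\<lambda>s. E s x) \<in> borel_measurable borel" for x
  proof -
    have "(\<lambda>s::real. (s, x)) \<in> borel_measurable borel" by (intro borel_measurable_continuous_onI continuous_intros)
    from measurable_compose[OF this Em0] show ?thesis by simp
  qed
  have Ex: "(\<lambda>x. E s x) \<in> borel_measurable borel" for s
  proof -
    have "(\<lambda>x::'a. (s, x)) \<in> borel_measurable borel" by (intro borel_measurable_continuous_onI continuous_intros)
    from measurable_compose[OF this Em0] show ?thesis by simp
  qed
  obtain K where K: "\<And>s x. s \<in> {0<..T} \<Longrightarrow> x \<in> closure \<Omega> \<Longrightarrow> \<bar>D s x\<bar> \<le> K" using D_bounded by blast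
  have K0: "\<bar>E s x\<bar> \<le> \<bar>K\<bar> * indicator {0..} s" for s x
  proof (cases "(s, x) \<in> A")
    case True
    then have "s \<in> {0<..T}" "x \<in> closure \<Omega>" using closure_subset by (auto simp: A_def)
    then show ?thesis using True K[of s x] by (simp add: E_def)
  qed (simp add: E_def)
  let ?k = "\<lambda>s. frac_kernel \<alpha> (t - s)"
  let ?F = "\<lambda>s x. ?k s * E s x * p x"
  have int: "integrable (lborel \<Otimes>\<^sub>M lborel) (\<lambda>(s, x). ?F s x)"
  proof (rule Bochner_Integration.integrable_bound)
    show "integrable (lborel \<Otimes>\<^sub>M lborel) (\<lambda>z. (?k (fst z) * indicator {0..} (fst z)) * (\<bar>K\<bar> * p (snd z)))"
      by (rule integrable_product_kernel[OF frac_kernel_integrable(1)[OF \<alpha>(1)]]) (use pint in simp)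
    show "(\<lambda>(s, x). ?F s x) \<in> borel_measurable (lborel \<Otimes>\<^sub>M lborel)"
      using p(1) unfolding case_prod_beta by measurable
    have "norm (case z of (s, x) \<Rightarrow> ?F s x) \<le> norm ((?k (fst z) * indicator {0..} (fst z)) * (\<bar>K\<bar> * p (snd z)))" for z
    proof -
      have "\<bar>?k (fst z)\<bar> * \<bar>E (fst z) (snd z)\<bar> * \<bar>p (snd z)\<bar> \<le> \<bar>?k (fst z)\<bar> * (\<bar>K\<bar> * indicator {0..} (fst z)) * \<bar>p (snd z)\<bar>"
        by (intro mult_right_mono mult_left_mono K0) simp_all
      then show ?thesis by (simp add: case_prod_beta abs_mult mult_ac)
    qed
    then show "AE z in lborel \<Otimes>\<^sub>M lborel. norm (case z of (s, x) \<Rightarrow> ?F s x) \<le> norm ((?k (fst z) * indicator {0..} (fst z)) * (\<bar>K\<bar> * p (snd z)))"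
      by (rule AE_I2)
  qed
  define W where "W x = (\<integral>s. ?k s * E s x \<partial>lborel)" for x
  have W: "u t x - u 0 x = W x" if x: "x \<in> \<Omega>" for x
  proof -
    have xc: "x \<in> closure \<Omega>" using x closure_subset by blast
    note ci = caputo_inverse[OF \<alpha> u_caputo[OF xc] t]
    have "u t x - u 0 x = (\<integral>s. ?k s * (indicator {0..T} s * caputo \<alpha> (\<lambda>s. u s x) s) \<partial>lborel)"
      using ci(1) by (simp add: frac_conv_def)
    also have "\<dots> = W x"
      unfolding W_def
    proof (rule integral_cong_AE)
      show "(\<lambda>s. ?k s * (indicator {0..T} s * caputo \<alpha> (\<lambda>s. u s x) s)) \<in> borel_measurable lborel"
        by (rule borel_measurable_integrable[OF ci(2)])
      show "(\<lambda>s. ?k s * E s x) \<in> borel_measurable lborel" using Es[of x] by simp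
      have "AE s in lborel. s \<noteq> (0::real)" by (rule AE_lborel_singleton)
      then show "AE s in lborel. ?k s * (indicator {0..T} s * caputo \<alpha> (\<lambda>s. u s x) s) = ?k s * E s x"
      proof (rule AE_mp, intro AE_I2 impI)
        fix s :: real assume s: "s \<noteq> 0"
        show "?k s * (indicator {0..T} s * caputo \<alpha> (\<lambda>s. u s x) s) = ?k s * E s x"
        proof (cases "s \<in> {0<..T}")
          case True
          then show ?thesis using D_eq[OF True xc] x by (simp add: E_def A_def)
        next
          case False
          then have "indicator {0..T} s = (0::real)" "indicator A (s, x) = (0::real)"
            using s by (auto simp: A_def indicator_def)
          then show ?thesis by (simp add: E_def)
        qed
      qed
    qed
    finally show ?thesis .
  qed
  have Wpm: "(\<lambda>x. W x * p x) \<in> borel_measurable borel"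
  proof -
    have "(\<lambda>x. \<integral>s. ?k s * E s x \<partial>lborel) \<in> borel_measurable lborel"
    proof (rule lborel.borel_measurable_lebesgue_integral)
      have [measurable]: "(\<lambda>z. E (snd z) (fst z)) \<in> borel_measurable (lborel \<Otimes>\<^sub>M lborel)"
        using measurable_compose[OF measurable_Pair[OF measurable_snd measurable_fst] Em] by simp
      show "(\<lambda>(x, s). ?k s * E s x) \<in> borel_measurable (lborel \<Otimes>\<^sub>M lborel)"
        unfolding case_prod_beta by measurable
    qed
    then show ?thesis using p(1) unfolding W_def by simp
  qed
  have "coef (u t) l - coef (u 0) l = coef (\<lambda>x. u t x - u 0 x) l"
    by (rule coef_diff[symmetric]) (use T t in \<open>auto intro: u_si\<close>)
  also have "\<dots> = (\<integral>x. W x * p x \<partial>M)"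
    unfolding coef_def L2_inner_def
  proof (rule integral_cong_AE)
    have "square_integrable M (\<lambda>x. u t x - u 0 x)"
      by (rule square_integrable_diff) (use T t in \<open>auto intro: u_si\<close>)
    from borel_measurable_times[OF square_integrableD(1)[OF this] \<phi>m]
    show "(\<lambda>x. (u t x - u 0 x) * \<phi> l x) \<in> borel_measurable M" .
    show "(\<lambda>x. W x * p x) \<in> borel_measurable M" by (rule borel_imp_lebesgue_on_measurable[OF Wpm])
    have "AE x in M. x \<in> \<Omega>" by (rule AE_I2) simp
    then show "AE x in M. (u t x - u 0 x) * \<phi> l x = W x * p x"
      using p(3) by eventually_elim (simp add: W)
  qed
  also have "\<dots> = (\<integral>x. W x * p x \<partial>lborel)"
    by (rule lborel_off_domain(1)[OF Om Wpm]) (simp add: p(2))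
  also have "\<dots> = (\<integral>x. (\<integral>s. ?F s x \<partial>lborel) \<partial>lborel)"
    unfolding W_def by simp
  also have "\<dots> = (\<integral>s. (\<integral>x. ?F s x \<partial>lborel) \<partial>lborel)"
    by (rule lborel_pair.Fubini_integral[OF int])
  also have "\<dots> = (\<integral>s. ?k s * (indicator {0<..T} s * (coef f l - (lam l - c0 + \<rho> s) * coef (u s) l)) \<partial>lborel)"
  proof (rule Bochner_Integration.integral_cong[OF refl])
    fix s :: real
    show "(\<integral>x. ?F s x \<partial>lborel) = ?k s * (indicator {0<..T} s * (coef f l - (lam l - c0 + \<rho> s) * coef (u s) l))"
    proof (cases "s \<in> {0<..T}")
      case True
      have sT: "s \<in> {0..T}" using True by simp
      have Epm: "(\<lambda>x. E s x * p x) \<in> borel_measurable borel" using Ex p(1) by simp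
      have "(\<integral>x. ?F s x \<partial>lborel) = ?k s * (\<integral>x. E s x * p x \<partial>lborel)"
        by (simp add: mult.assoc)
      also have "(\<integral>x. E s x * p x \<partial>lborel) = (\<integral>x. E s x * p x \<partial>M)"
        by (rule lborel_off_domain(1)[OF Om Epm, symmetric]) (simp add: p(2))
      also have "\<dots> = coef (D s) l"
        unfolding coef_def L2_inner_def
      proof (rule integral_cong_AE)
        show "(\<lambda>x. E s x * p x) \<in> borel_measurable M" by (rule borel_imp_lebesgue_on_measurable[OF Epm])
        show "(\<lambda>x. D s x * \<phi> l x) \<in> borel_measurable M"
          using \<phi>m square_integrableD(1)[OF DA_si[OF D_DA[OF sT]]] by simp
        have "AE x in M. x \<in> \<Omega>" by (rule AE_I2) simp
        then show "AE x in M. E s x * p x = D s x * \<phi> l x"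
          using p(3) by eventually_elim (use True in \<open>simp add: E_def A_def\<close>)
      qed
      finally show ?thesis using True by (simp add: coef_D[OF True])
    next
      case False
      then have "indicator {0<..T} s = (0::real)" "\<And>x. indicator A (s, x) = (0::real)"
        by (auto simp: A_def indicator_def)
      then show ?thesis by (simp add: E_def)
    qed
  qed
  also have "\<dots> = frac_conv \<alpha> (\<lambda>s. indicator {0..T} s * (coef f l - (lam l - c0 + \<rho> s) * coef (u s) l)) t"
    unfolding frac_conv_def
  proof (rule integral_cong_AE)
    have c: "continuous_on {0..T} (\<lambda>s. coef f l - (lam l - c0 + \<rho> s) * coef (u s) l)"
      by (intro continuous_intros rho(1) coef_u_continuous)
    note m = continuous_cutoff_measurable[OF c]
    show "(\<lambda>s. ?k s * (indicator {0..T} s * (coef f l - (lam l - c0 + \<rho> s) * coef (u s) l))) \<in> borel_measurable lborel"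
      using m by simp
    have "(\<lambda>s. ?k s * (indicator {0<..T} s * (indicator {0..T} s * (coef f l - (lam l - c0 + \<rho> s) * coef (u s) l)))) \<in> borel_measurable lborel"
      using m by simp
    moreover have "indicator {0<..T} s * (indicator {0..T} s * r) = indicator {0<..T} s * r" for s r :: real
      by (auto simp: indicator_def)
    ultimately show "(\<lambda>s. ?k s * (indicator {0<..T} s * (coef f l - (lam l - c0 + \<rho> s) * coef (u s) l))) \<in> borel_measurable lborel"
      by simp
    have "AE s in lborel. s \<noteq> (0::real)" by (rule AE_lborel_singleton)
    then show "AE s in lborel. ?k s * (indicator {0<..T} s * (coef f l - (lam l - c0 + \<rho> s) * coef (u s) l))
        = ?k s * (indicator {0..T} s * (coef f l - (lam l - c0 + \<rho> s) * coef (u s) l))"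
      by (rule AE_mp) (rule AE_I2, auto simp: indicator_def)
  qed
  finally show ?thesis unfolding coef_u0 by simp
qed

text \<open>
  For \<open>lam l \<ge> 2 c0\<close> the zeroth order coefficient of the scalar equation is at least \<open>lam l / 2\<close>; for
  the remaining eigenvalues the forcing is simply integrated up to time \<open>T\<close>.
\<close>

definition coef_const :: real where
  "coef_const = 2 + 2 * c0 * frac_kernel (\<alpha> + 1) T"

text \<open>The factor \<open>1 / lam l\<close> is what allows \<open>f\<close> to be one power of A
  less regular than \<open>u0\<close>. The bound is uniform in t and the same for all nonnegative
  potentials, so it can serve as a fixed profile for the source in the equation of the
  difference.\<close>

lemma coef_u_bound:
  assumes t: "t \<in> {0..T}"
  shows "\<bar>coef (u t) l\<bar> \<le> \<bar>coef u0 l\<bar> + coef_const * \<bar>coef f l\<bar> / lam l"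
proof -
  have k: "frac_kernel (\<alpha> + 1) T \<ge> 0" by (rule frac_kernel_nonneg) (use \<alpha> in simp)
  have ca: "continuous_on {0..T} (\<lambda>s. lam l - c0 + \<rho> s)" by (intro continuous_intros rho(1))
  have fl: "\<bar>coef f l\<bar> / lam l \<ge> 0" using lam_pos[of l] by simp
  show ?thesis
  proof (cases "lam l \<ge> 2 * c0")
    case True
    have a: "lam l - c0 + \<rho> s \<ge> lam l / 2" if "s \<in> {0..T}" for s using rho(2)[OF that] True by linarith
    have p: "lam l / 2 > 0" using lam_pos[of l] by simp
    have "\<bar>coef (u t) l\<bar> \<le> \<bar>coef u0 l\<bar> + \<bar>coef f l\<bar> / (lam l / 2)"
      by (rule frac_comparison_decay[OF \<alpha> coef_u_continuous ca a p coef_equation t])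
    also have "\<bar>coef f l\<bar> / (lam l / 2) = 2 * (\<bar>coef f l\<bar> / lam l)" by simp
    also have "\<dots> \<le> coef_const * (\<bar>coef f l\<bar> / lam l)"
      unfolding coef_const_def using k c0 fl by (intro mult_right_mono) simp_all
    finally show ?thesis by simp
  next
    case False
    have a: "lam l - c0 + \<rho> s \<ge> 0" if "s \<in> {0..T}" for s using rho(2)[OF that] lam_ge[of l] by linarith
    have "\<bar>coef (u t) l\<bar> \<le> \<bar>coef u0 l\<bar> + frac_conv \<alpha> (\<lambda>s. indicator {0..T} s * \<bar>coef f l\<bar>) t"
      by (rule frac_comparison_abs[OF \<alpha> coef_u_continuous continuous_on_const ca a coef_equation t])
    also have "frac_conv \<alpha> (\<lambda>s. indicator {0..T} s * \<bar>coef f l\<bar>) t = \<bar>coef f l\<bar> * frac_kernel (\<alpha> + 1) t"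
    proof -
      have "frac_conv \<alpha> (\<lambda>s. indicator {0..T} s * \<bar>coef f l\<bar>) t = (\<integral>s. \<bar>coef f l\<bar> * (frac_kernel \<alpha> (t - s) * indicator {0..} s) \<partial>lborel)"
        unfolding frac_conv_def
        by (rule Bochner_Integration.integral_cong) (use t in \<open>auto simp: indicator_def frac_kernel_def\<close>)
      then show ?thesis using frac_kernel_integrable(2)[OF \<alpha>(1), of t] by simp
    qed
    also have "\<bar>coef f l\<bar> * frac_kernel (\<alpha> + 1) t \<le> \<bar>coef f l\<bar> * frac_kernel (\<alpha> + 1) T"
      using t \<alpha> by (intro mult_left_mono frac_kernel_le) simp_all
    also have "\<dots> = lam l * frac_kernel (\<alpha> + 1) T * (\<bar>coef f l\<bar> / lam l)" using lam_pos[of l] by simp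
    also have "\<dots> \<le> coef_const * (\<bar>coef f l\<bar> / lam l)"
    proof (rule mult_right_mono[OF _ fl])
      have "lam l * frac_kernel (\<alpha> + 1) T \<le> 2 * c0 * frac_kernel (\<alpha> + 1) T"
        using False k by (intro mult_right_mono) simp_all
      then show "lam l * frac_kernel (\<alpha> + 1) T \<le> coef_const" by (simp add: coef_const_def)
    qed
    finally show ?thesis by simp
  qed
qed

end

section \<open>The difference of two solutions\<close>

locale subdiffusion_pair = neumann_eigensystem \<Omega> c0 lam \<phi> +
    S1: subdiffusion_solution \<Omega> c0 lam \<phi> \<gamma> T \<alpha> crho \<rho>1 u0 f u1 +
    S2: subdiffusion_solution \<Omega> c0 lam \<phi> \<gamma> T \<alpha> crho \<rho>2 u0 f u2
  for \<Omega> :: "'a::euclidean_space set" and c0 :: real and lam :: "nat \<Rightarrow> real" and \<phi> :: "nat \<Rightarrow> 'a \<Rightarrow> real"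
    and \<gamma> T \<alpha> crho :: real and \<rho>1 \<rho>2 :: "real \<Rightarrow> real" and u0 f :: "'a \<Rightarrow> real" and u1 u2 :: "real \<Rightarrow> 'a \<Rightarrow> real"
begin

definition rho_conv :: "real \<Rightarrow> real" where
  "rho_conv t = frac_conv \<alpha> (\<lambda>s. indicator {0..T} s * \<bar>\<rho>1 s - \<rho>2 s\<bar>) t"

lemma rho_conv_nonneg: "0 \<le> rho_conv t"
  unfolding rho_conv_def by (rule frac_conv_nonneg[OF S1.\<alpha>(1)]) simp

lemma rho_diff_continuous: "continuous_on {0..T} (\<lambda>s. \<bar>\<rho>1 s - \<rho>2 s\<bar>)"
  by (intro continuous_intros S1.rho(1) S2.rho(1))

text \<open>Writing \<rho>1 u1 - \<rho>2 u2 as (\<rho>1 - \<rho>2) u1 + \<rho>2 (u1 - u2) keeps the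
  nonnegative coefficient on the left and puts only a coefficient of u1, bounded by its profile,
  into the source. The initial values cancel, so nothing but the fractional integral
  remains.\<close>

lemma coef_diff_bound:
  assumes t: "t \<in> {0..T}"
  shows "\<bar>coef (u1 t) l - coef (u2 t) l\<bar> \<le> (\<bar>coef u0 l\<bar> + S1.coef_const * \<bar>coef f l\<bar> / lam l) * rho_conv t"
proof -
  define m where "m = \<bar>coef u0 l\<bar> + S1.coef_const * \<bar>coef f l\<bar> / lam l"
  let ?h = "\<lambda>s. (\<rho>2 s - \<rho>1 s) * coef (u1 s) l"
  note cont = S1.coef_u_continuous[of l] S2.coef_u_continuous[of l] S1.rho(1) S2.rho(1)
  have ch: "continuous_on {0..T} ?h" by (intro continuous_intros cont)
  have ca: "continuous_on {0..T} (\<lambda>s. lam l - c0 + \<rho>2 s)" by (intro continuous_intros cont)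
  have eq: "coef (u1 r) l - coef (u2 r) l = 0 + frac_conv \<alpha> (\<lambda>s. indicator {0..T} s *
      (?h s - (lam l - c0 + \<rho>2 s) * (coef (u1 s) l - coef (u2 s) l))) r" if r: "r \<in> {0..T}" for r
  proof -
    have c1: "continuous_on {0..T} (\<lambda>s. coef f l - (lam l - c0 + \<rho>1 s) * coef (u1 s) l)"
      by (intro continuous_intros cont)
    have c2: "continuous_on {0..T} (\<lambda>s. coef f l - (lam l - c0 + \<rho>2 s) * coef (u2 s) l)"
      by (intro continuous_intros cont)
    have "coef (u1 r) l - coef (u2 r) l = frac_conv \<alpha> (\<lambda>s. indicator {0..T} s * ((coef f l - (lam l - c0 + \<rho>1 s) * coef (u1 s) l)
        + (-1) * (coef f l - (lam l - c0 + \<rho>2 s) * coef (u2 s) l))) r"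
      unfolding frac_conv_linear[OF S1.\<alpha>(1) c1 c2] S1.coef_equation[OF r, of l] S2.coef_equation[OF r, of l]
      by simp
    also have "(\<lambda>s. indicator {0..T} s * ((coef f l - (lam l - c0 + \<rho>1 s) * coef (u1 s) l)
        + (-1) * (coef f l - (lam l - c0 + \<rho>2 s) * coef (u2 s) l)))
      = (\<lambda>s. indicator {0..T} s * (?h s - (lam l - c0 + \<rho>2 s) * (coef (u1 s) l - coef (u2 s) l)))"
      by (simp add: fun_eq_iff algebra_simps)
    finally show ?thesis by simp
  qed
  have a: "lam l - c0 + \<rho>2 s \<ge> 0" if "s \<in> {0..T}" for s using S2.rho(2)[OF that] lam_ge[of l] by linarith
  have cw: "continuous_on {0..T} (\<lambda>s. coef (u1 s) l - coef (u2 s) l)" by (intro continuous_intros cont)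
  have "\<bar>coef (u1 t) l - coef (u2 t) l\<bar> \<le> \<bar>0\<bar> + frac_conv \<alpha> (\<lambda>s. indicator {0..T} s * \<bar>?h s\<bar>) t"
    by (rule frac_comparison_abs[OF S1.\<alpha> cw ch ca a eq t])
  also have "\<dots> \<le> m * rho_conv t"
  proof -
    have p: "continuous_on {0..T} (\<lambda>s. m * \<bar>\<rho>1 s - \<rho>2 s\<bar>)" and q: "continuous_on {0..T} (\<lambda>s. \<bar>?h s\<bar>)"
      by (intro continuous_intros cont)+
    have "0 \<le> frac_conv \<alpha> (\<lambda>s. indicator {0..T} s * (m * \<bar>\<rho>1 s - \<rho>2 s\<bar> + (-1) * \<bar>?h s\<bar>)) t"
    proof (rule frac_conv_nonneg[OF S1.\<alpha>(1)])
      fix s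
      show "0 \<le> indicator {0..T} s * (m * \<bar>\<rho>1 s - \<rho>2 s\<bar> + (-1) * \<bar>?h s\<bar>)"
      proof (cases "s \<in> {0..T}")
        case True
        have "\<bar>\<rho>1 s - \<rho>2 s\<bar> * \<bar>coef (u1 s) l\<bar> \<le> \<bar>\<rho>1 s - \<rho>2 s\<bar> * m"
          using S1.coef_u_bound[OF True, of l] by (intro mult_left_mono) (simp_all add: m_def)
        then show ?thesis by (simp add: abs_mult abs_minus_commute mult.commute)
      qed simp
    qed
    then have "frac_conv \<alpha> (\<lambda>s. indicator {0..T} s * \<bar>?h s\<bar>) t \<le> frac_conv \<alpha> (\<lambda>s. indicator {0..T} s * (m * \<bar>\<rho>1 s - \<rho>2 s\<bar>)) t"
      unfolding frac_conv_linear[OF S1.\<alpha>(1) p q] by simp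
    also have "\<dots> = m * rho_conv t"
      using frac_conv_linear[OF S1.\<alpha>(1) continuous_on_const rho_diff_continuous, of 0 m t]
      by (simp add: rho_conv_def) (simp add: frac_conv_def)
    finally show ?thesis by simp
  qed
  finally show ?thesis unfolding m_def .
qed

definition data_const :: real where
  "data_const = sqrt (2 * (DAn (1 + \<gamma> / 2) u0)\<^sup>2 + 2 * S1.coef_const\<^sup>2 * (DAn (\<gamma> / 2) f)\<^sup>2)"

lemma data_const_nonneg: "0 \<le> data_const" by (simp add: data_const_def)

text \<open>The weight \<open>lam l powr (\<gamma> / 2)\<close> together with the extra factor
  \<open>lam l\<close> turns the profile into lam^(1+\<gamma>/2) |u0_l| + K lam^(\<gamma>/2) |f_l|.
  Both parts are square summable by the norms of the data, and the factor 2 in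
  \<open>data_const\<close> comes from squaring their sum.\<close>

lemma weighted_diff_bound:
  assumes t: "t \<in> {0..T}"
  shows "(\<Sum>l<n. lam l powr \<gamma> * (lam l * (coef (u1 t) l - coef (u2 t) l))\<^sup>2) \<le> (data_const * rho_conv t)\<^sup>2"
proof -
  let ?I = "rho_conv t" and ?K = "S1.coef_const"
  have summand: "lam l powr \<gamma> * (lam l * (coef (u1 t) l - coef (u2 t) l))\<^sup>2
     \<le> ?I\<^sup>2 * (2 * (lam l powr (1 + \<gamma> / 2) * coef u0 l)\<^sup>2 + 2 * ?K\<^sup>2 * (lam l powr (\<gamma> / 2) * coef f l)\<^sup>2)" for l
  proof -
    have l: "lam l > 0" by (rule lam_pos)
    have "(lam l * \<bar>coef (u1 t) l - coef (u2 t) l\<bar>)\<^sup>2 \<le> (lam l * ((\<bar>coef u0 l\<bar> + ?K * \<bar>coef f l\<bar> / lam l) * ?I))\<^sup>2"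
      using l coef_diff_bound[OF t, of l] by (intro power_mono mult_left_mono) simp_all
    also have "lam l * ((\<bar>coef u0 l\<bar> + ?K * \<bar>coef f l\<bar> / lam l) * ?I) = ?I * (lam l * \<bar>coef u0 l\<bar> + ?K * \<bar>coef f l\<bar>)"
      using l by (simp add: field_simps)
    also have "(?I * (lam l * \<bar>coef u0 l\<bar> + ?K * \<bar>coef f l\<bar>))\<^sup>2 \<le> ?I\<^sup>2 * (2 * (lam l * coef u0 l)\<^sup>2 + 2 * ?K\<^sup>2 * (coef f l)\<^sup>2)"
    proof -
      have "(a + b)\<^sup>2 \<le> 2 * a\<^sup>2 + 2 * b\<^sup>2" for a b :: real
        using sum_squares_bound[of a b] unfolding power2_sum by linarith
      from this[of "lam l * \<bar>coef u0 l\<bar>" "?K * \<bar>coef f l\<bar>"]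
      have "(lam l * \<bar>coef u0 l\<bar> + ?K * \<bar>coef f l\<bar>)\<^sup>2 \<le> 2 * (lam l * coef u0 l)\<^sup>2 + 2 * ?K\<^sup>2 * (coef f l)\<^sup>2"
        by (simp add: power_mult_distrib)
      then show ?thesis unfolding power_mult_distrib[of ?I] by (intro mult_left_mono) simp_all
    qed
    finally have "lam l powr \<gamma> * (lam l * (coef (u1 t) l - coef (u2 t) l))\<^sup>2
      \<le> lam l powr \<gamma> * (?I\<^sup>2 * (2 * (lam l * coef u0 l)\<^sup>2 + 2 * ?K\<^sup>2 * (coef f l)\<^sup>2))"
      by (intro mult_left_mono) (simp_all add: power_mult_distrib)
    also have "\<dots> = ?I\<^sup>2 * (2 * (lam l powr (1 + \<gamma> / 2) * coef u0 l)\<^sup>2 + 2 * ?K\<^sup>2 * (lam l powr (\<gamma> / 2) * coef f l)\<^sup>2)"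
      using l by (simp add: power_mult_distrib powr_add lam_powr_square[simplified] algebra_simps)
    finally show ?thesis .
  qed
  have "(\<Sum>l<n. lam l powr \<gamma> * (lam l * (coef (u1 t) l - coef (u2 t) l))\<^sup>2)
     \<le> (\<Sum>l<n. ?I\<^sup>2 * (2 * (lam l powr (1 + \<gamma> / 2) * coef u0 l)\<^sup>2 + 2 * ?K\<^sup>2 * (lam l powr (\<gamma> / 2) * coef f l)\<^sup>2))"
    by (rule sum_mono) (rule summand)
  also have "\<dots> = ?I\<^sup>2 * (2 * (\<Sum>l<n. (lam l powr (1 + \<gamma> / 2) * coef u0 l)\<^sup>2) + 2 * ?K\<^sup>2 * (\<Sum>l<n. (lam l powr (\<gamma> / 2) * coef f l)\<^sup>2))"
    by (simp only: sum.distrib sum_distrib_left[symmetric])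
  also have "\<dots> \<le> ?I\<^sup>2 * (2 * (DAn (1 + \<gamma> / 2) u0)\<^sup>2 + 2 * ?K\<^sup>2 * (DAn (\<gamma> / 2) f)\<^sup>2)"
    by (intro mult_left_mono add_mono DA_norm_bessel S1.u0 S1.f) simp_all
  also have "\<dots> = (data_const * ?I)\<^sup>2" by (simp add: data_const_def power_mult_distrib)
  finally show ?thesis .
qed

text \<open>All eigenvalues are at least c0, so giving up the extra factor \<open>lam l\<close>
  costs 1 / c0.\<close>

lemma u_diff_bound:
  assumes t: "t \<in> {0..T}" and x: "x \<in> closure \<Omega>"
  shows "\<bar>u1 t x - u2 t x\<bar> \<le> sobolev_const \<gamma> * (data_const * rho_conv t / c0)"
proof (rule sobolev_const(2)[OF S1.\<gamma>, of "\<lambda>x. u1 t x - u2 t x"])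
  show "square_integrable M (\<lambda>x. u1 t x - u2 t x)" by (rule square_integrable_diff[OF S1.u_si[OF t] S2.u_si[OF t]])
  show "continuous_on (closure \<Omega>) (\<lambda>x. u1 t x - u2 t x)"
    by (intro continuous_intros S1.u_continuous[OF t] S2.u_continuous[OF t])
  show "0 \<le> data_const * rho_conv t / c0" using data_const_nonneg rho_conv_nonneg c0 by simp
  show "x \<in> closure \<Omega>" by (rule x)
  fix n
  have "lam l powr \<gamma> * (coef (\<lambda>x. u1 t x - u2 t x) l)\<^sup>2 \<le> (lam l powr \<gamma> * (lam l * (coef (u1 t) l - coef (u2 t) l))\<^sup>2) / c0\<^sup>2" for l
  proof -
    have "c0\<^sup>2 * (coef (u1 t) l - coef (u2 t) l)\<^sup>2 \<le> (lam l)\<^sup>2 * (coef (u1 t) l - coef (u2 t) l)\<^sup>2"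
      using lam_ge[of l] c0 by (intro mult_right_mono power_mono) simp_all
    then have "(coef (u1 t) l - coef (u2 t) l)\<^sup>2 \<le> (lam l * (coef (u1 t) l - coef (u2 t) l))\<^sup>2 / c0\<^sup>2"
      using c0 unfolding power_mult_distrib by (simp add: pos_le_divide_eq mult.commute)
    from mult_left_mono[OF this, of "lam l powr \<gamma>"] show ?thesis
      unfolding coef_diff[OF S1.u_si[OF t] S2.u_si[OF t]] by simp
  qed
  then have "(\<Sum>l<n. lam l powr \<gamma> * (coef (\<lambda>x. u1 t x - u2 t x) l)\<^sup>2)
     \<le> (\<Sum>l<n. (lam l powr \<gamma> * (lam l * (coef (u1 t) l - coef (u2 t) l))\<^sup>2) / c0\<^sup>2)"
    by (rule sum_mono)
  also have "\<dots> = (\<Sum>l<n. lam l powr \<gamma> * (lam l * (coef (u1 t) l - coef (u2 t) l))\<^sup>2) / c0\<^sup>2"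
    by (rule sum_divide_distrib[symmetric])
  also have "\<dots> \<le> (data_const * rho_conv t)\<^sup>2 / c0\<^sup>2"
    by (rule divide_right_mono[OF weighted_diff_bound[OF t]]) simp
  finally show "(\<Sum>l<n. lam l powr \<gamma> * (coef (\<lambda>x. u1 t x - u2 t x) l)\<^sup>2) \<le> (data_const * rho_conv t / c0)\<^sup>2"
    by (simp add: power_divide)
qed

text \<open>By the equation \<open>D + \<rho> u\<close> is f + \<Delta>u, so the quantity bounded
  here is \<Delta>(u1 - u2) at x. In this guise it comes with a continuous representative, and its
  coefficients are at most \<open>lam l\<close> times those of the difference.\<close>

lemma laplacian_diff_bound:
  assumes t: "t \<in> {0<..T}" and x: "x \<in> closure \<Omega>"
  shows "\<bar>(S1.D t x - S2.D t x) + (\<rho>1 t * u1 t x - \<rho>2 t * u2 t x)\<bar> \<le> sobolev_const \<gamma> * (data_const * rho_conv t)"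
proof -
  have tT: "t \<in> {0..T}" using t by simp
  let ?Z1 = "\<lambda>x. S1.D t x + \<rho>1 t * u1 t x" and ?Z2 = "\<lambda>x. S2.D t x + \<rho>2 t * u2 t x"
  note si = DA_si[OF S1.D_DA[OF tT]] S1.u_si[OF tT] DA_si[OF S2.D_DA[OF tT]] S2.u_si[OF tT]
  have s1: "square_integrable M ?Z1" by (rule square_integrable_add[OF si(1) square_integrable_cmult[OF si(2)]])
  have s2: "square_integrable M ?Z2" by (rule square_integrable_add[OF si(3) square_integrable_cmult[OF si(4)]])
  have c: "coef (\<lambda>x. ?Z1 x - ?Z2 x) l = - ((lam l - c0) * (coef (u1 t) l - coef (u2 t) l))" for l
    unfolding coef_diff[OF s1 s2] coef_add_cmult[OF si(1,2)] coef_add_cmult[OF si(3,4)]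
      S1.coef_D[OF t] S2.coef_D[OF t] by (simp add: algebra_simps)
  have "\<bar>?Z1 x - ?Z2 x\<bar> \<le> sobolev_const \<gamma> * (data_const * rho_conv t)"
  proof (rule sobolev_const(2)[OF S1.\<gamma> _ _ _ _ x])
    show "square_integrable M (\<lambda>x. ?Z1 x - ?Z2 x)" by (rule square_integrable_diff[OF s1 s2])
    show "continuous_on (closure \<Omega>) (\<lambda>x. ?Z1 x - ?Z2 x)"
      by (intro continuous_intros S1.u_continuous[OF tT] S2.u_continuous[OF tT] S1.D_continuous[OF t] S2.D_continuous[OF t])
    show "0 \<le> data_const * rho_conv t" using data_const_nonneg rho_conv_nonneg by simp
    fix n
    have "lam l powr \<gamma> * (coef (\<lambda>x. ?Z1 x - ?Z2 x) l)\<^sup>2 \<le> lam l powr \<gamma> * (lam l * (coef (u1 t) l - coef (u2 t) l))\<^sup>2" for l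
    proof -
      have "(lam l - c0)\<^sup>2 * (coef (u1 t) l - coef (u2 t) l)\<^sup>2 \<le> (lam l)\<^sup>2 * (coef (u1 t) l - coef (u2 t) l)\<^sup>2"
        using lam_ge[of l] c0 by (intro mult_right_mono power_mono) simp_all
      then show ?thesis unfolding c by (intro mult_left_mono) (simp_all add: power_mult_distrib)
    qed
    then have "(\<Sum>l<n. lam l powr \<gamma> * (coef (\<lambda>x. ?Z1 x - ?Z2 x) l)\<^sup>2)
      \<le> (\<Sum>l<n. lam l powr \<gamma> * (lam l * (coef (u1 t) l - coef (u2 t) l))\<^sup>2)" by (rule sum_mono)
    also have "\<dots> \<le> (data_const * rho_conv t)\<^sup>2" by (rule weighted_diff_bound[OF tT])
    finally show "(\<Sum>l<n. lam l powr \<gamma> * (coef (\<lambda>x. ?Z1 x - ?Z2 x) l)\<^sup>2) \<le> (data_const * rho_conv t)\<^sup>2" .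
  qed
  then show ?thesis by (simp add: algebra_simps)
qed

lemma caputo_diff_eq:
  assumes t: "t \<in> {0<..T}" and x: "x \<in> closure \<Omega>"
  shows "caputo \<alpha> (\<lambda>s. u1 s x - u2 s x) t = S1.D t x - S2.D t x"
  unfolding caputo_diff[OF S1.\<alpha> S1.u_caputo[OF x] S2.u_caputo[OF x] t] S1.D_eq[OF t x] S2.D_eq[OF t x] ..

theorem potential_diff_bound:
  assumes t: "t \<in> {0<..T}" and x: "x \<in> closure \<Omega>" and cl: "0 < cl" "cl \<le> u1 t x"
  shows "\<bar>\<rho>1 t - \<rho>2 t\<bar> \<le> \<bar>caputo \<alpha> (\<lambda>s. u1 s x - u2 s x) t\<bar> / cl
     + sobolev_const \<gamma> * data_const * (1 + crho / c0) / cl * rho_conv t"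
proof -
  have tT: "t \<in> {0..T}" using t by simp
  let ?g = "S1.D t x - S2.D t x" and ?w = "u1 t x - u2 t x"
  let ?B = "sobolev_const \<gamma> * (data_const * rho_conv t)"
  have w: "\<bar>?w\<bar> \<le> ?B / c0" using u_diff_bound[OF tT x] by simp
  have w': "\<bar>\<rho>2 t * ?w\<bar> \<le> crho * (?B / c0)"
    using mult_mono[OF S2.rho(3)[OF tT] w] S2.rho(2)[OF tT] S2.rho(3)[OF tT] by (simp add: abs_mult)
  have "(\<rho>1 t - \<rho>2 t) * u1 t x = (?g + (\<rho>1 t * u1 t x - \<rho>2 t * u2 t x)) - ?g - \<rho>2 t * ?w"
    by (simp add: algebra_simps)
  then have "\<bar>(\<rho>1 t - \<rho>2 t) * u1 t x\<bar> \<le> ?B + \<bar>?g\<bar> + crho * (?B / c0)"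
    using laplacian_diff_bound[OF t x] w' by linarith
  moreover have "cl * \<bar>\<rho>1 t - \<rho>2 t\<bar> \<le> \<bar>(\<rho>1 t - \<rho>2 t) * u1 t x\<bar>"
    using mult_right_mono[OF cl(2), of "\<bar>\<rho>1 t - \<rho>2 t\<bar>"] cl by (simp add: abs_mult mult.commute)
  \<comment> \<open>In the factor \<open>1 + crho / c0\<close> the 1 stems from the Laplacian and
    the quotient from the term \<rho>2 (u1 - u2).\<close>
  ultimately have "cl * \<bar>\<rho>1 t - \<rho>2 t\<bar> \<le> \<bar>?g\<bar> + ?B * (1 + crho / c0)"
    by (simp add: algebra_simps)
  then have "\<bar>\<rho>1 t - \<rho>2 t\<bar> \<le> (\<bar>?g\<bar> + ?B * (1 + crho / c0)) / cl"
    using cl(1) by (simp add: pos_le_divide_eq mult.commute)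
  then show ?thesis unfolding caputo_diff_eq[OF t x] by (simp add: add_divide_distrib algebra_simps)
qed

lemma caputo_diff_continuous:
  assumes x: "x \<in> closure \<Omega>"
  shows "continuous_on {0<..T} (caputo \<alpha> (\<lambda>s. u1 s x - u2 s x))"
proof -
  have "continuous_on {0<..T} (\<lambda>t. S1.D t x)"
    unfolding continuous_on_iff dist_real_def using S1.D_pointwise_lim x by meson
  moreover have "continuous_on {0<..T} (\<lambda>t. S2.D t x)"
    unfolding continuous_on_iff dist_real_def using S2.D_pointwise_lim x by meson
  ultimately have "continuous_on {0<..T} (\<lambda>t. S1.D t x - S2.D t x)" by (rule continuous_on_diff)
  then show ?thesis by (rule continuous_on_eq) (rule caputo_diff_eq[OF _ x, symmetric])
qed

lemma caputo_diff_bounded: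
  assumes x: "x \<in> closure \<Omega>"
  shows "\<exists>K. \<forall>t\<in>{0<..T}. \<bar>caputo \<alpha> (\<lambda>s. u1 s x - u2 s x) t\<bar> \<le> K"
proof -
  obtain K1 where K1: "\<forall>t\<in>{0<..T}. \<forall>x\<in>closure \<Omega>. \<bar>S1.D t x\<bar> \<le> K1" by (rule exE[OF S1.D_bounded])
  obtain K2 where K2: "\<forall>t\<in>{0<..T}. \<forall>x\<in>closure \<Omega>. \<bar>S2.D t x\<bar> \<le> K2" by (rule exE[OF S2.D_bounded])
  have "\<bar>caputo \<alpha> (\<lambda>s. u1 s x - u2 s x) t\<bar> \<le> K1 + K2" if t: "t \<in> {0<..T}" for t
    using bspec[OF bspec[OF K1 t] x] bspec[OF bspec[OF K2 t] x] unfolding caputo_diff_eq[OF t x] by linarith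
  then show ?thesis by blast
qed

end

section \<open>A fractional Gronwall inequality in Lebesgue spaces\<close>

text \<open>Convexity of the power on the open half line. The point x = 0 lies outside it and is
  checked directly: the left-hand side is then (1 - p) m^p, which is not positive.\<close>

lemma powr_above_tangent:
  fixes x m p :: real
  assumes x: "0 \<le> x" and m: "0 < m" and p: "1 \<le> p"
  shows "m powr p + p * m powr (p - 1) * (x - m) \<le> x powr p"
proof (cases "x = 0")
  case True
  have "m powr (p - 1) * m = m powr p" using m powr_add[of m "p - 1" 1] by simp
  then have "m powr p + p * m powr (p - 1) * (x - m) = (1 - p) * m powr p" using True by (simp add: algebra_simps)
  also have "\<dots> \<le> 0" using p by (simp add: mult_le_0_iff)
  finally show ?thesis using True by simp
next
  case False
  have d: "((\<lambda>x. x powr p) has_real_derivative (p * m powr (p - 1))) (at m within {0<..})"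
    by (rule DERIV_subset[OF has_real_derivative_powr[OF m]]) simp
  have "x powr p - m powr p \<ge> p * m powr (p - 1) * (x - m)"
    by (rule convex_on_imp_above_tangent[OF powr_convex[OF p] _ _ _ d])
      (use False x m in \<open>simp_all add: interior_open\<close>)
  then show ?thesis by simp
qed

lemma powr_add_le:
  fixes a b p :: real
  assumes "0 \<le> a" "0 \<le> b" "1 \<le> p"
  shows "(a + b) powr p \<le> 2 powr p * (a powr p + b powr p)"
proof -
  have "(a + b) powr p \<le> (2 * max a b) powr p" using assms by (intro powr_mono2) simp_all
  also have "\<dots> = 2 powr p * (max a b) powr p" using assms by (simp add: powr_mult)
  also have "(max a b) powr p \<le> a powr p + b powr p" by (simp add: max_def)
  finally show ?thesis by simp
qed

lemma shifted_kernel_integrable: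
  fixes \<kappa> g :: "real \<Rightarrow> real"
  assumes \<kappa>: "integrable lborel \<kappa>" and g: "g \<in> borel_measurable borel" "\<And>s. \<bar>g s\<bar> \<le> B"
  shows "integrable lborel (\<lambda>s. \<kappa> (t - s) * g s)"
proof (rule Bochner_Integration.integrable_bound)
  have sh: "integrable lborel (\<lambda>s. \<kappa> (t + -1 * s))" by (rule lborel_integrable_real_affine[OF \<kappa>]) simp
  then show "integrable lborel (\<lambda>s. B * \<kappa> (t - s))" by simp
  show "(\<lambda>s. \<kappa> (t - s) * g s) \<in> borel_measurable lborel"
    using borel_measurable_integrable[OF sh] g(1) by simp
  have "norm (\<kappa> (t - s) * g s) \<le> norm (B * \<kappa> (t - s))" for s
  proof -
    have "\<bar>g s\<bar> * \<bar>\<kappa> (t - s)\<bar> \<le> \<bar>B\<bar> * \<bar>\<kappa> (t - s)\<bar>" using g(2)[of s] by (intro mult_right_mono) simp_all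
    then show ?thesis by (simp add: abs_mult mult.commute)
  qed
  then show "AE s in lborel. norm (\<kappa> (t - s) * g s) \<le> norm (B * \<kappa> (t - s))" by (rule AE_I2)
qed

lemma shifted_kernel_integral: "(\<integral>s. \<kappa> (t - s) \<partial>lborel) = (\<integral>s. \<kappa> s \<partial>lborel)" for \<kappa> :: "real \<Rightarrow> real"
  using lborel_integral_real_affine[of "-1" \<kappa> t] by simp

text \<open>Tonelli and translation invariance. The bound on g makes the inner integral finite at
  every t, so the Bochner and the nonnegative integral agree there.\<close>

lemma kernel_average_integral:
  fixes \<kappa> g :: "real \<Rightarrow> real"
  assumes \<kappa>: "integrable lborel \<kappa>" "\<And>s. 0 \<le> \<kappa> s"
    and g: "integrable lborel g" "\<And>s. 0 \<le> g s" "\<And>s. g s \<le> B"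
  shows "integrable lborel (\<lambda>t. \<integral>s. \<kappa> (t - s) * g s \<partial>lborel)"
    "(\<integral>t. (\<integral>s. \<kappa> (t - s) * g s \<partial>lborel) \<partial>lborel) = (\<integral>s. \<kappa> s \<partial>lborel) * (\<integral>s. g s \<partial>lborel)"
proof -
  have [measurable]: "\<kappa> \<in> borel_measurable borel" "g \<in> borel_measurable borel"
    using borel_measurable_integrable[OF \<kappa>(1)] borel_measurable_integrable[OF g(1)] by simp_all
  have gB: "\<bar>g s\<bar> \<le> B" for s using g(2,3)[of s] by simp
  let ?H = "\<lambda>t. \<integral>s. \<kappa> (t - s) * g s \<partial>lborel"
  have Hm: "?H \<in> borel_measurable lborel" by (rule lborel.borel_measurable_lebesgue_integral) measurable
  have H0: "0 \<le> ?H t" for t by (rule Bochner_Integration.integral_nonneg) (simp add: \<kappa>(2) g(2))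
  have "(\<integral>\<^sup>+t. ennreal (?H t) \<partial>lborel) = (\<integral>\<^sup>+t. (\<integral>\<^sup>+s. ennreal (\<kappa> (t - s) * g s) \<partial>lborel) \<partial>lborel)"
    by (rule nn_integral_cong, rule nn_integral_eq_integral[symmetric])
      (use shifted_kernel_integrable[OF \<kappa>(1) _ gB] \<kappa>(2) g(2) in simp_all)
  also have "\<dots> = (\<integral>\<^sup>+s. (\<integral>\<^sup>+t. ennreal (\<kappa> (t - s) * g s) \<partial>lborel) \<partial>lborel)"
    by (rule lborel_pair.Fubini') measurable
  also have "\<dots> = (\<integral>\<^sup>+s. ennreal (\<integral>s. \<kappa> s \<partial>lborel) * ennreal (g s) \<partial>lborel)"
  proof (rule nn_integral_cong)
    fix s
    have "integrable lborel (\<lambda>t. \<kappa> (- s + 1 * t))" by (rule lborel_integrable_real_affine[OF \<kappa>(1)]) simp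
    then have i: "integrable lborel (\<lambda>t. \<kappa> (t - s))" by simp
    have "(\<integral>\<^sup>+t. ennreal (\<kappa> (t - s) * g s) \<partial>lborel) = (\<integral>\<^sup>+t. ennreal (\<kappa> (t - s)) * ennreal (g s) \<partial>lborel)"
      using \<kappa>(2) g(2) by (simp add: ennreal_mult)
    also have "\<dots> = (\<integral>\<^sup>+t. ennreal (\<kappa> (t - s)) \<partial>lborel) * ennreal (g s)" by (rule nn_integral_multc) measurable
    also have "(\<integral>\<^sup>+t. ennreal (\<kappa> (t - s)) \<partial>lborel) = ennreal (\<integral>t. \<kappa> (t - s) \<partial>lborel)"
      by (rule nn_integral_eq_integral[OF i]) (simp add: \<kappa>(2))
    also have "(\<integral>t. \<kappa> (t - s) \<partial>lborel) = (\<integral>s. \<kappa> s \<partial>lborel)"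
      using lborel_integral_real_affine[of 1 \<kappa> "- s"] by simp
    finally show "(\<integral>\<^sup>+t. ennreal (\<kappa> (t - s) * g s) \<partial>lborel) = ennreal (\<integral>s. \<kappa> s \<partial>lborel) * ennreal (g s)" .
  qed
  also have "\<dots> = ennreal (\<integral>s. \<kappa> s \<partial>lborel) * (\<integral>\<^sup>+s. ennreal (g s) \<partial>lborel)" by (rule nn_integral_cmult) measurable
  also have "(\<integral>\<^sup>+s. ennreal (g s) \<partial>lborel) = ennreal (\<integral>s. g s \<partial>lborel)"
    by (rule nn_integral_eq_integral[OF g(1)]) (simp add: g(2))
  also have "ennreal (\<integral>s. \<kappa> s \<partial>lborel) * ennreal (\<integral>s. g s \<partial>lborel) = ennreal ((\<integral>s. \<kappa> s \<partial>lborel) * (\<integral>s. g s \<partial>lborel))"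
    using \<kappa>(2) g(2) by (simp add: ennreal_mult)
  finally have "has_bochner_integral lborel ?H ((\<integral>s. \<kappa> s \<partial>lborel) * (\<integral>s. g s \<partial>lborel))"
    by (intro has_bochner_integral_nn_integral Hm AE_I2 H0) (use \<kappa>(2) g(2) in simp_all)
  then show "integrable lborel ?H" "(\<integral>t. ?H t \<partial>lborel) = (\<integral>s. \<kappa> s \<partial>lborel) * (\<integral>s. g s \<partial>lborel)"
    by (auto simp: has_bochner_integral_iff)
qed

text \<open>
  An upper bound \<open>K\<close> for the mass of the kernel suffices: in the integrated tangent inequality the
  mass is multiplied by \<open>1 - p \<le> 0\<close>.
\<close>

lemma kernel_average_jensen:
  fixes \<kappa> R :: "real \<Rightarrow> real"
  assumes \<kappa>: "integrable lborel \<kappa>" "\<And>s. 0 \<le> \<kappa> s" "(\<integral>s. \<kappa> s \<partial>lborel) \<le> K" "0 < K"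
    and R: "R \<in> borel_measurable borel" "\<And>s. 0 \<le> R s" "\<And>s. R s \<le> B" and p: "1 \<le> p"
  shows "(\<integral>s. \<kappa> (t - s) * R s \<partial>lborel) powr p \<le> K powr (p - 1) * (\<integral>s. \<kappa> (t - s) * R s powr p \<partial>lborel)"
proof -
  have RB: "\<bar>R s\<bar> \<le> B" "\<bar>R s powr p\<bar> \<le> B powr p" for s using R(2,3)[of s] p by (simp_all add: powr_mono2)
  have i1: "integrable lborel (\<lambda>s. \<kappa> (t - s) * R s)" by (rule shifted_kernel_integrable[OF \<kappa>(1) R(1) RB(1)])
  have i2: "integrable lborel (\<lambda>s. \<kappa> (t - s) * R s powr p)"
    by (rule shifted_kernel_integrable[OF \<kappa>(1) _ RB(2)]) (use R(1) in simp)
  have i3: "integrable lborel (\<lambda>s. \<kappa> (t - s))" using shifted_kernel_integrable[OF \<kappa>(1), of "\<lambda>_. 1" 1 t] by simp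
  define I where "I = (\<integral>s. \<kappa> (t - s) * R s \<partial>lborel)"
  have I0: "0 \<le> I" unfolding I_def by (rule Bochner_Integration.integral_nonneg) (simp add: \<kappa>(2) R(2))
  have X0: "0 \<le> (\<integral>s. \<kappa> (t - s) * R s powr p \<partial>lborel)" by (rule Bochner_Integration.integral_nonneg) (simp add: \<kappa>(2))
  show ?thesis
  proof (cases "I = 0")
    case True
    then show ?thesis using X0 by (simp add: I_def[symmetric])
  next
    case False
    \<comment> \<open>The point of tangency is the average of R with K in place of the mass of the
      kernel. It is positive since \<open>I = 0\<close> has been treated separately.\<close>
    define m where "m = I / K"
    have m: "m > 0" using False I0 \<kappa>(4) by (simp add: m_def)
    have mm: "m powr (p - 1) * m = m powr p" using m powr_add[of m "p - 1" 1] by simp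
    let ?k = "\<integral>s. \<kappa> s \<partial>lborel"
    have "K * m powr p \<le> (1 - p) * m powr p * ?k + p * m powr (p - 1) * I"
    proof -
      have "(1 - p) * m powr p * K \<le> (1 - p) * m powr p * ?k"
        by (rule mult_left_mono_neg[OF \<kappa>(3)]) (use p in \<open>simp add: mult_le_0_iff\<close>)
      moreover have "p * m powr (p - 1) * I = p * m powr p * K"
      proof -
        have "I = m * K" using \<kappa>(4) by (simp add: m_def)
        then show ?thesis unfolding mm[symmetric] by simp
      qed
      moreover have "K * m powr p = (1 - p) * m powr p * K + p * m powr p * K" by (simp add: algebra_simps)
      ultimately show ?thesis by linarith
    qed
    also have "\<dots> = (\<integral>s. (1 - p) * m powr p * \<kappa> (t - s) + p * m powr (p - 1) * (\<kappa> (t - s) * R s) \<partial>lborel)"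
      using i1 i3 by (subst Bochner_Integration.integral_add) (simp_all add: I_def shifted_kernel_integral)
    also have "\<dots> \<le> (\<integral>s. \<kappa> (t - s) * R s powr p \<partial>lborel)"
    proof (rule integral_mono)
      show "integrable lborel (\<lambda>s. (1 - p) * m powr p * \<kappa> (t - s) + p * m powr (p - 1) * (\<kappa> (t - s) * R s))"
        using i1 i3 by simp
      fix s
      have "\<kappa> (t - s) * (m powr p + p * m powr (p - 1) * (R s - m)) \<le> \<kappa> (t - s) * R s powr p"
        by (rule mult_left_mono[OF powr_above_tangent[OF R(2) m p] \<kappa>(2)])
      moreover have "m powr p + p * m powr (p - 1) * (R s - m) = (1 - p) * m powr p + p * m powr (p - 1) * R s"
        unfolding mm[symmetric] by (simp add: algebra_simps)
      ultimately have "\<kappa> (t - s) * ((1 - p) * m powr p + p * m powr (p - 1) * R s) \<le> \<kappa> (t - s) * R s powr p" by simp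
      then show "(1 - p) * m powr p * \<kappa> (t - s) + p * m powr (p - 1) * (\<kappa> (t - s) * R s) \<le> \<kappa> (t - s) * R s powr p"
        by (simp add: algebra_simps)
    qed (rule i2)
    finally have "K powr (p - 1) * (K * m powr p) \<le> K powr (p - 1) * (\<integral>s. \<kappa> (t - s) * R s powr p \<partial>lborel)"
      by (rule mult_left_mono) simp
    moreover have "K powr (p - 1) * (K * m powr p) = I powr p"
    proof -
      have "K powr (p - 1) * K = K powr p" using \<kappa>(4) powr_add[of K "p - 1" 1] by simp
      then have "K powr (p - 1) * (K * m powr p) = (K * m) powr p"
        using \<kappa>(4) m by (simp add: powr_mult mult.assoc[symmetric])
      then show ?thesis using \<kappa>(4) by (simp add: m_def)
    qed
    ultimately show ?thesis by (simp add: I_def)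
  qed
qed

lemma powr_integrable_bounded_support:
  fixes Q :: "real \<Rightarrow> real"
  assumes Q: "Q \<in> borel_measurable borel" "\<And>s. 0 \<le> Q s" "\<And>s. Q s \<le> B" "\<And>s. s \<notin> {0<..<T} \<Longrightarrow> Q s = 0" and p: "1 \<le> p"
  shows "integrable lborel (\<lambda>t. Q t powr p)"
proof (rule Bochner_Integration.integrable_bound)
  show "integrable lborel (\<lambda>s. B powr p * indicator {0..T} s)"
    by (intro integrable_mult_right integrable_real_indicator) (simp_all add: emeasure_lborel_Icc_eq)
  show "(\<lambda>t. Q t powr p) \<in> borel_measurable lborel" using Q(1) by simp
  have "norm (Q s powr p) \<le> norm (B powr p * indicator {0..T} s)" for s
    using Q(2-4)[of s] p by (cases "s \<in> {0<..<T}") (simp_all add: powr_mono2)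
  then show "AE s in lborel. norm (Q s powr p) \<le> norm (B powr p * indicator {0..T} s)" by (rule AE_I2)
qed

text \<open>After raising to the power p, the convolution term carries 2^p (C K)^p <= 2^p 4^(-p) <=
  1/2 for every p >= 1, and is absorbed on the left. This is where the threshold 1/4 comes from.
  Boundedness and bounded support guarantee that the absorbed integral is finite.\<close>

lemma small_kernel_Lp_bound:
  fixes \<kappa> R A :: "real \<Rightarrow> real"
  assumes \<kappa>: "integrable lborel \<kappa>" "\<And>s. 0 \<le> \<kappa> s" "(\<integral>s. \<kappa> s \<partial>lborel) \<le> K" "0 < K" and C: "0 \<le> C" "C * K \<le> 1 / 4"
    and R: "R \<in> borel_measurable borel" "\<And>s. 0 \<le> R s" "\<And>s. R s \<le> B" "\<And>s. s \<notin> {0<..<T} \<Longrightarrow> R s = 0"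
    and A: "A \<in> borel_measurable borel" "\<And>s. 0 \<le> A s" "\<And>s. A s \<le> B" "\<And>s. s \<notin> {0<..<T} \<Longrightarrow> A s = 0"
    and le: "\<And>t. t \<in> {0<..<T} \<Longrightarrow> R t \<le> A t + C * (\<integral>s. \<kappa> (t - s) * R s \<partial>lborel)"
    and p: "1 \<le> p"
  shows "(\<integral>t. R t powr p \<partial>lborel) \<le> 4 powr p * (\<integral>t. A t powr p \<partial>lborel)"
proof -
  have Ri: "integrable lborel (\<lambda>t. R t powr p)" by (rule powr_integrable_bounded_support[OF R p])
  have Ai: "integrable lborel (\<lambda>t. A t powr p)" by (rule powr_integrable_bounded_support[OF A p])
  have RB: "R s powr p \<le> B powr p" for s using R(2,3)[of s] p by (simp add: powr_mono2)
  let ?H = "\<lambda>t. \<integral>s. \<kappa> (t - s) * R s powr p \<partial>lborel"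
  note H = kernel_average_integral[OF \<kappa>(1,2) Ri _ RB]
  have H0: "0 \<le> ?H t" for t by (rule Bochner_Integration.integral_nonneg) (simp add: \<kappa>(2))
  have pw: "R t powr p \<le> 2 powr p * A t powr p + (1 / 2) powr p / K * ?H t" for t
  proof (cases "t \<in> {0<..<T}")
    case True
    let ?I = "\<integral>s. \<kappa> (t - s) * R s \<partial>lborel"
    have I0: "0 \<le> ?I" by (rule Bochner_Integration.integral_nonneg) (simp add: \<kappa>(2) R(2))
    have "R t powr p \<le> (A t + C * ?I) powr p" using R(2) le[OF True] p by (intro powr_mono2) simp_all
    also have "\<dots> \<le> 2 powr p * (A t powr p + (C * ?I) powr p)"
      by (rule powr_add_le) (use A(2) C(1) I0 p in simp_all)
    also have "(C * ?I) powr p = C powr p * ?I powr p" using C(1) I0 by (simp add: powr_mult)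
    also have "C powr p * ?I powr p \<le> C powr p * (K powr (p - 1) * ?H t)"
      by (intro mult_left_mono kernel_average_jensen[OF \<kappa> R(1-3) p]) simp
    also have "\<dots> = (C * K) powr p / K * ?H t"
      using C(1) \<kappa>(4) powr_add[of K "p - 1" 1] by (simp add: powr_mult field_simps)
    also have "\<dots> \<le> (1 / 4) powr p / K * ?H t"
      using C \<kappa>(4) p H0[of t] by (intro mult_right_mono divide_right_mono powr_mono2) simp_all
    also have "2 powr p * (A t powr p + (1 / 4) powr p / K * ?H t)
       = 2 powr p * A t powr p + (2 powr p * (1 / 4) powr p) / K * ?H t" by (simp add: algebra_simps)
    also have "2 powr p * (1 / 4) powr p = (1 / 2 :: real) powr p" by (simp add: powr_mult[symmetric])
    finally show ?thesis by simp
  next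
    case False
    then show ?thesis using R(4) H0[of t] \<kappa>(4) by simp
  qed
  let ?X = "\<integral>t. R t powr p \<partial>lborel" and ?Y = "\<integral>t. A t powr p \<partial>lborel"
  have X0: "0 \<le> ?X" and Y0: "0 \<le> ?Y" by (rule Bochner_Integration.integral_nonneg, simp)+
  have "?X \<le> (\<integral>t. 2 powr p * A t powr p + (1 / 2) powr p / K * ?H t \<partial>lborel)"
    by (rule integral_mono[OF Ri _ pw]) (use Ai H(1) in simp)
  also have "\<dots> = 2 powr p * ?Y + (1 / 2) powr p / K * (\<integral>t. ?H t \<partial>lborel)"
    using Ai H(1) by (subst Bochner_Integration.integral_add) simp_all
  also have "\<dots> = 2 powr p * ?Y + (1 / 2) powr p / K * ((\<integral>s. \<kappa> s \<partial>lborel) * ?X)" using H(2) by simp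
  also have "\<dots> \<le> 2 powr p * ?Y + (1 / 2) powr p / K * (K * ?X)"
    using \<kappa>(3,4) X0 by (intro add_left_mono mult_left_mono mult_right_mono) simp_all
  also have "\<dots> \<le> 2 powr p * ?Y + 1 / 2 * ?X"
  proof -
    have "(1 / 2 :: real) powr p \<le> (1 / 2) powr 1" using p by (intro powr_mono') simp_all
    then show ?thesis using \<kappa>(4) mult_right_mono[OF _ X0, of "(1 / 2) powr p" "1 / 2"] by simp
  qed
  finally have "?X \<le> 2 * 2 powr p * ?Y" by simp
  also have "\<dots> \<le> 4 powr p * ?Y"
  proof (rule mult_right_mono[OF _ Y0])
    have "2 * 2 powr p \<le> 2 powr p * (2::real) powr p"
      using powr_mono[OF p, of 2] by simp
    also have "\<dots> = 4 powr p" by (simp add: powr_mult[symmetric])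
    finally show "2 * 2 powr p \<le> (4::real) powr p" .
  qed
  finally show "?X \<le> 4 powr p * ?Y" .
qed

text \<open>As \<sigma> runs through the integers the weighted kernel tends to 0 pointwise and is
  dominated by the kernel itself. The weight depends on \<alpha>, T and K, but on no exponent
  p.\<close>

lemma small_exponential_weight:
  assumes \<alpha>: "0 < \<alpha>" and K: "0 < K"
  shows "\<exists>\<sigma>\<ge>0. integrable lborel (\<lambda>s. indicator {0..T} s * frac_kernel \<alpha> s * exp (- \<sigma> * s)) \<and>
    (\<integral>s. indicator {0..T} s * frac_kernel \<alpha> s * exp (- \<sigma> * s) \<partial>lborel) \<le> K"
proof -
  let ?f = "\<lambda>n s. indicator {0..T} s * frac_kernel \<alpha> s * exp (- real n * s)"
  have dom: "integrable lborel (\<lambda>s. indicator {0..T} s * frac_kernel \<alpha> s)" by (rule frac_kernel_cutoff_integrable[OF \<alpha>])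
  have le: "norm (?f n s) \<le> indicator {0..T} s * frac_kernel \<alpha> s" for n s
  proof (cases "s \<ge> 0")
    case True
    then have "exp (- real n * s) \<le> 1" by simp
    from mult_left_mono[OF this, of "indicator {0..T} s * frac_kernel \<alpha> s"] show ?thesis
      using frac_kernel_nonneg[OF \<alpha>] by (simp add: abs_mult)
  qed simp
  have lim: "(\<lambda>n. ?f n s) \<longlonglongrightarrow> 0" for s
  proof (cases "s > 0")
    case True
    have "(\<lambda>n. exp (- s) ^ n) \<longlonglongrightarrow> 0" using True by (intro LIMSEQ_realpow_zero) simp_all
    moreover have "exp (- s) ^ n = exp (- real n * s)" for n by (simp add: exp_of_nat_mult[symmetric])
    ultimately have "(\<lambda>n. exp (- real n * s)) \<longlonglongrightarrow> 0" by simp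
    from tendsto_mult_left[OF this, of "indicator {0..T} s * frac_kernel \<alpha> s"] show ?thesis by simp
  qed (simp add: frac_kernel_nonpos_arg)
  have m: "?f n \<in> borel_measurable lborel" for n by simp
  have "(\<lambda>n. \<integral>s. ?f n s \<partial>lborel) \<longlonglongrightarrow> 0"
    using integral_dominated_convergence[OF borel_measurable_const m dom AE_I2[OF lim] AE_I2[OF le]] by (simp only: integral_zero)
  then have "\<forall>\<^sub>F n in sequentially. (\<integral>s. ?f n s \<partial>lborel) < K" using K by (rule order_tendstoD)
  then obtain n where "(\<integral>s. ?f n s \<partial>lborel) < K" unfolding eventually_sequentially by blast
  moreover have "integrable lborel (?f n)"
    by (rule Bochner_Integration.integrable_bound[OF dom m])
      (use order_trans[OF le abs_ge_self] in \<open>simp only: real_norm_def AE_I2\<close>)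
  ultimately show ?thesis by (intro exI[of _ "real n"] conjI) (simp_all only: of_nat_0_le_iff less_imp_le)
qed

section \<open>Norms on (0,T), including the essential supremum\<close>

lemma Lp_norm_cong:
  assumes "\<And>t. t \<in> {0<..<T} \<Longrightarrow> \<bar>f t\<bar> = \<bar>g t\<bar>"
  shows "Lp_norm p T f = Lp_norm p T g"
proof -
  let ?M = "lebesgue_on {0<..<T}"
  have "(\<integral>t. \<bar>f t\<bar> powr q \<partial>?M) = (\<integral>t. \<bar>g t\<bar> powr q \<partial>?M)" for q
    by (rule Bochner_Integration.integral_cong) (use assms in simp_all)
  moreover have "esssup ?M (\<lambda>t. ereal \<bar>f t\<bar>) = esssup ?M (\<lambda>t. ereal \<bar>g t\<bar>)"
  proof -
    \<comment> \<open>\<open>esssup\<close> distinguishes measurable from nonmeasurable functions,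
      so measurability of the two sides has to be compared as well.\<close>
    have "(\<lambda>t. ereal \<bar>f t\<bar>) \<in> borel_measurable ?M \<longleftrightarrow> (\<lambda>t. ereal \<bar>g t\<bar>) \<in> borel_measurable ?M"
      by (rule measurable_cong) (use assms in simp)
    moreover have "AE t in ?M. ereal \<bar>f t\<bar> = ereal \<bar>g t\<bar>" by (rule AE_I2) (use assms in simp)
    then have "Limsup (ae_filter ?M) (\<lambda>t. ereal \<bar>f t\<bar>) = Limsup (ae_filter ?M) (\<lambda>t. ereal \<bar>g t\<bar>)" by (rule Limsup_eq)
    ultimately show ?thesis by (simp add: esssup_def)
  qed
  ultimately show ?thesis by (simp add: Lp_norm_def)
qed

text \<open>For a bounded function the essential supremum lies between 0 and B, so its conversion to
  a real number loses nothing. The lower end uses that (0,T) has positive measure.\<close>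

lemma Lp_norm_infinity:
  assumes T: "0 < T" and g: "g \<in> borel_measurable borel" "\<And>s. \<bar>g s\<bar> \<le> B"
  shows "AE t in lebesgue_on {0<..<T}. \<bar>g t\<bar> \<le> Lp_norm \<infinity> T g"
    "\<And>N. AE t in lebesgue_on {0<..<T}. \<bar>g t\<bar> \<le> N \<Longrightarrow> Lp_norm \<infinity> T g \<le> N"
    "0 \<le> Lp_norm \<infinity> T g"
proof -
  let ?M = "lebesgue_on {0<..<T}" and ?E = "esssup (lebesgue_on {0<..<T}) (\<lambda>t. ereal \<bar>g t\<bar>)"
  have m: "(\<lambda>t. ereal \<bar>g t\<bar>) \<in> borel_measurable ?M"
    by (rule borel_measurable_ereal[OF borel_measurable_abs[OF borel_imp_lebesgue_on_measurable[OF g(1)]]])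
  have M0: "emeasure ?M (space ?M) \<noteq> 0"
    using T by (simp add: emeasure_restrict_space)
  have "esssup ?M (\<lambda>t. 0 :: ereal) \<le> ?E" by (rule esssup_mono) simp_all
  then have E0: "0 \<le> ?E" unfolding esssup_const[OF M0] .
  have "?E \<le> ereal B" by (rule esssup_I[OF m]) (rule AE_I2, simp add: g(2))
  then obtain e where e: "?E = ereal e" using E0 by (cases ?E) auto
  then have n: "Lp_norm \<infinity> T g = e" by (simp add: Lp_norm_def)
  show "AE t in ?M. \<bar>g t\<bar> \<le> Lp_norm \<infinity> T g"
    using esssup_AE[of "\<lambda>t. ereal \<bar>g t\<bar>" ?M] unfolding n e by simp
  show "0 \<le> Lp_norm \<infinity> T g" using E0 unfolding n e by simp
  fix N assume "AE t in ?M. \<bar>g t\<bar> \<le> N"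
  then have "AE t in ?M. ereal \<bar>g t\<bar> \<le> ereal N" by simp
  then have "?E \<le> ereal N" by (rule esssup_I[OF m])
  then show "Lp_norm \<infinity> T g \<le> N" unfolding n e by simp
qed

text \<open>The essential supremum S of R is finite and satisfies S <= N + S/4. The constant 4 is
  generous and is kept equal to the one for finite p.\<close>

lemma small_kernel_sup_bound:
  fixes \<kappa> R A :: "real \<Rightarrow> real"
  assumes T: "0 < T" and \<kappa>: "integrable lborel \<kappa>" "\<And>s. 0 \<le> \<kappa> s" "(\<integral>s. \<kappa> s \<partial>lborel) \<le> K"
    and C: "0 \<le> C" "C * K \<le> 1 / 4"
    and R: "R \<in> borel_measurable borel" "\<And>s. 0 \<le> R s" "\<And>s. R s \<le> B" "\<And>s. s \<notin> {0<..<T} \<Longrightarrow> R s = 0"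
    and N: "0 \<le> N" "AE t in lebesgue_on {0<..<T}. A t \<le> N"
    and le: "\<And>t. t \<in> {0<..<T} \<Longrightarrow> R t \<le> A t + C * (\<integral>s. \<kappa> (t - s) * R s \<partial>lborel)"
  shows "AE t in lebesgue_on {0<..<T}. R t \<le> 4 * N"
proof -
  let ?M = "lebesgue_on {0<..<T}"
  define S where "S = Lp_norm \<infinity> T R"
  have RB: "\<bar>R s\<bar> \<le> B" for s using R(2,3)[of s] by simp
  note L = Lp_norm_infinity[OF T R(1) RB, folded S_def]
  have i3: "integrable lborel (\<lambda>s. \<kappa> (t - s))" for t using shifted_kernel_integrable[OF \<kappa>(1), of "\<lambda>_. 1" 1 t] by simp
  have "AE s in lborel. s \<in> {0<..<T} \<longrightarrow> \<bar>R s\<bar> \<le> S" using L(1) by (simp add: AE_lebesgue_on_iff)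
  then have RS: "AE s in lborel. R s \<le> S"
  proof (rule AE_mp, intro AE_I2 impI)
    fix s assume "s \<in> {0<..<T} \<longrightarrow> \<bar>R s\<bar> \<le> S"
    then show "R s \<le> S" using R(4)[of s] L(3) by (cases "s \<in> {0<..<T}") simp_all
  qed
  have I: "C * (\<integral>s. \<kappa> (t - s) * R s \<partial>lborel) \<le> 1 / 4 * S" for t
  proof -
    have "(\<integral>s. \<kappa> (t - s) * R s \<partial>lborel) \<le> (\<integral>s. \<kappa> (t - s) * S \<partial>lborel)"
    proof (rule integral_mono_AE)
      show "integrable lborel (\<lambda>s. \<kappa> (t - s) * R s)" by (rule shifted_kernel_integrable[OF \<kappa>(1) R(1) RB])
      show "AE s in lborel. \<kappa> (t - s) * R s \<le> \<kappa> (t - s) * S"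
        using RS by (rule AE_mp) (rule AE_I2, simp add: mult_left_mono \<kappa>(2))
    qed (use i3 in simp)
    also have "\<dots> = (\<integral>s. \<kappa> s \<partial>lborel) * S" by (simp add: shifted_kernel_integral)
    also have "\<dots> \<le> K * S" by (rule mult_right_mono[OF \<kappa>(3) L(3)])
    finally have "C * (\<integral>s. \<kappa> (t - s) * R s \<partial>lborel) \<le> C * (K * S)" by (rule mult_left_mono[OF _ C(1)])
    also have "\<dots> \<le> 1 / 4 * S" using mult_right_mono[OF C(2) L(3)] by (simp add: mult.assoc)
    finally show ?thesis .
  qed
  have J: "AE t in ?M. t \<in> {0<..<T}" by (rule AE_I2) simp
  from J N(2) have "AE t in ?M. \<bar>R t\<bar> \<le> N + 1 / 4 * S"
  proof eventually_elim
    case (elim t)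
    show ?case using le[OF elim(1)] I[of t] R(2)[of t] elim(2) by linarith
  qed
  from L(2)[OF this] have "S \<le> 4 * N" using N(1) by linarith
  then show ?thesis using L(1) by (rule_tac AE_mp[OF L(1)], intro AE_I2 impI) linarith
qed

text \<open>The functions, their bound and the exponent are quantified inside, so a constant chosen
  for this predicate depends on \<alpha>, T and C only and serves all p at once.\<close>

definition Lp_gronwall_constant :: "real \<Rightarrow> real \<Rightarrow> real \<Rightarrow> real \<Rightarrow> bool" where
  "Lp_gronwall_constant \<alpha> T C c \<longleftrightarrow> (\<forall>r a B p. r \<in> borel_measurable borel \<and> a \<in> borel_measurable borel \<and>
      (\<forall>s. 0 \<le> r s \<and> r s \<le> B \<and> 0 \<le> a s \<and> a s \<le> B) \<and> (\<forall>s. s \<notin> {0<..<T} \<longrightarrow> r s = 0 \<and> a s = 0) \<and>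
      (\<forall>t\<in>{0<..<T}. r t \<le> a t + C * frac_conv \<alpha> r t) \<and> 1 \<le> p \<longrightarrow> Lp_norm p T r \<le> c * Lp_norm p T a)"

theorem fractional_gronwall_Lp:
  assumes \<alpha>: "0 < \<alpha>" and T: "0 < T" and C: "0 \<le> C"
  shows "\<exists>c. Lp_gronwall_constant \<alpha> T C c"
proof -
  \<comment> \<open>The mass that the weighted kernel may have at most: C K <= 1/4 is the smallness
    required by the absorption lemmas, and C + 1 covers C = 0.\<close>
  define K where "K = 1 / (4 * (C + 1))"
  have K: "0 < K" "C * K \<le> 1 / 4" using C by (simp_all add: K_def field_simps)
  obtain \<sigma> where \<sigma>: "\<sigma> \<ge> 0" and \<kappa>i: "integrable lborel (\<lambda>s. indicator {0..T} s * frac_kernel \<alpha> s * exp (- \<sigma> * s))"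
    and \<kappa>K: "(\<integral>s. indicator {0..T} s * frac_kernel \<alpha> s * exp (- \<sigma> * s) \<partial>lborel) \<le> K"
    by (rule exE[OF small_exponential_weight[OF \<alpha> K(1)]], elim conjE, rule that)
  define \<kappa> where "\<kappa> s = indicator {0..T} s * frac_kernel \<alpha> s * exp (- \<sigma> * s)" for s
  have \<kappa>0: "0 \<le> \<kappa> s" for s using frac_kernel_nonneg[OF \<alpha>] by (simp add: \<kappa>_def)
  note \<kappa> = \<kappa>i[folded \<kappa>_def] \<kappa>0 \<kappa>K[folded \<kappa>_def]
  \<comment> \<open>4 is the constant of the absorption lemmas, and exp(\<sigma> T) is the price of
    removing the weight on (0,T).\<close>
  define c where "c = 4 * exp (\<sigma> * T)"
  have main: "Lp_norm p T r \<le> c * Lp_norm p T a"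
    if rm: "r \<in> borel_measurable borel" and am: "a \<in> borel_measurable borel"
      and rb: "\<And>s. 0 \<le> r s" "\<And>s. r s \<le> B" and ab: "\<And>s. 0 \<le> a s" "\<And>s. a s \<le> B"
      and r0: "\<And>s. s \<notin> {0<..<T} \<Longrightarrow> r s = 0" and a0: "\<And>s. s \<notin> {0<..<T} \<Longrightarrow> a s = 0"
      and le: "\<And>t. t \<in> {0<..<T} \<Longrightarrow> r t \<le> a t + C * frac_conv \<alpha> r t" and p: "1 \<le> p" for r a B p
  proof -
    define R where "R t = exp (- \<sigma> * t) * r t" for t
    define A where "A t = exp (- \<sigma> * t) * a t" for t
    have E1: "exp (- \<sigma> * t) \<le> 1" if "t \<in> {0<..<T}" for t using that \<sigma> by simp
    have RR: "R \<in> borel_measurable borel" "0 \<le> R s" "R s \<le> B" "s \<notin> {0<..<T} \<Longrightarrow> R s = 0" "R s \<le> r s" for s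
    proof -
      show "R \<in> borel_measurable borel" unfolding R_def using rm by measurable
      show "0 \<le> R s" using rb by (simp add: R_def)
      show z: "R s = 0" if "s \<notin> {0<..<T}" for s using r0[OF that] by (simp add: R_def)
      show rr: "R s \<le> r s"
        using mult_right_mono[OF E1 rb(1), of s s] z[of s] rb(1)[of s] by (cases "s \<in> {0<..<T}") (simp_all add: R_def)
      then show "R s \<le> B" using rb(2)[of s] by linarith
    qed
    have AA: "A \<in> borel_measurable borel" "0 \<le> A s" "A s \<le> B" "s \<notin> {0<..<T} \<Longrightarrow> A s = 0" "A s \<le> a s" for s
    proof -
      show "A \<in> borel_measurable borel" unfolding A_def using am by measurable
      show "0 \<le> A s" using ab by (simp add: A_def)
      show z: "A s = 0" if "s \<notin> {0<..<T}" for s using a0[OF that] by (simp add: A_def)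
      show rr: "A s \<le> a s"
        using mult_right_mono[OF E1 ab(1), of s s] z[of s] ab(1)[of s] by (cases "s \<in> {0<..<T}") (simp_all add: A_def)
      then show "A s \<le> B" using ab(2)[of s] by linarith
    qed
    have rR: "r t \<le> exp (\<sigma> * T) * R t" for t
    proof (cases "t \<in> {0<..<T}")
      case True
      have "r t = exp (\<sigma> * t) * R t" by (simp add: R_def exp_minus)
      also have "\<dots> \<le> exp (\<sigma> * T) * R t" using True \<sigma> RR(2) by (intro mult_right_mono) (simp_all add: mult_left_mono)
      finally show ?thesis .
    qed (use r0 RR(2) in simp)
    have leR: "R t \<le> A t + C * (\<integral>s. \<kappa> (t - s) * R s \<partial>lborel)" if t: "t \<in> {0<..<T}" for t
    proof -
      \<comment> \<open>The weight factors as exp(-\<sigma>(t - s)) exp(-\<sigma> s): one part goes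
        into the kernel, the other turns r into R. Since 0 < s < t < T wherever the integrand is
        nonzero, cutting the kernel off at T changes nothing.\<close>
      have "exp (- \<sigma> * t) * frac_conv \<alpha> r t = (\<integral>s. exp (- \<sigma> * t) * (frac_kernel \<alpha> (t - s) * r s) \<partial>lborel)"
        by (simp add: frac_conv_def)
      also have "\<dots> = (\<integral>s. \<kappa> (t - s) * R s \<partial>lborel)"
      proof (rule Bochner_Integration.integral_cong[OF refl])
        fix s
        have e: "exp (- \<sigma> * t) = exp (- \<sigma> * (t - s)) * exp (- \<sigma> * s)"
          by (simp add: exp_add[symmetric] algebra_simps)
        show "exp (- \<sigma> * t) * (frac_kernel \<alpha> (t - s) * r s) = \<kappa> (t - s) * R s"
        proof (cases "s \<in> {0<..<T} \<and> s < t")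
          case True
          then have "indicator {0..T} (t - s) = (1::real)" using t by simp
          then show ?thesis unfolding e by (simp add: \<kappa>_def R_def)
        next
          case False
          then show ?thesis using r0[of s] RR(4)[of s] by (cases "s < t") (auto simp: \<kappa>_def frac_kernel_nonpos_arg)
        qed
      qed
      finally have eq: "exp (- \<sigma> * t) * frac_conv \<alpha> r t = (\<integral>s. \<kappa> (t - s) * R s \<partial>lborel)" .
      have "R t \<le> exp (- \<sigma> * t) * (a t + C * frac_conv \<alpha> r t)"
        unfolding R_def by (rule mult_left_mono[OF le[OF t]]) simp
      also have "\<dots> = A t + C * (exp (- \<sigma> * t) * frac_conv \<alpha> r t)" by (simp add: A_def algebra_simps)
      finally show ?thesis unfolding eq .
    qed
    have rabs: "\<bar>r s\<bar> \<le> B" "\<bar>a s\<bar> \<le> B" for s using rb ab by simp_all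
    let ?M = "lebesgue_on {0<..<T}"
    show ?thesis
    proof (cases "p = \<infinity>")
      case True
      note La = Lp_norm_infinity[OF T am rabs(2)] and Lr = Lp_norm_infinity[OF T rm rabs(1)]
      have N: "AE t in ?M. A t \<le> Lp_norm \<infinity> T a"
      proof (rule AE_mp[OF La(1)], intro AE_I2 impI)
        fix t assume "\<bar>a t\<bar> \<le> Lp_norm \<infinity> T a"
        then show "A t \<le> Lp_norm \<infinity> T a" using AA(5)[of t] by linarith
      qed
      have RN: "AE t in ?M. R t \<le> 4 * Lp_norm \<infinity> T a"
        by (rule small_kernel_sup_bound[OF T \<kappa> C K(2) RR(1-4) La(3) N leR])
      have "AE t in ?M. \<bar>r t\<bar> \<le> c * Lp_norm \<infinity> T a"
      proof (rule AE_mp[OF RN], intro AE_I2 impI)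
        fix t assume h: "R t \<le> 4 * Lp_norm \<infinity> T a"
        have "\<bar>r t\<bar> \<le> exp (\<sigma> * T) * R t" using rR[of t] rb(1)[of t] by simp
        also have "\<dots> \<le> exp (\<sigma> * T) * (4 * Lp_norm \<infinity> T a)" using h by (rule mult_left_mono) simp
        finally show "\<bar>r t\<bar> \<le> c * Lp_norm \<infinity> T a" by (simp add: c_def mult_ac)
      qed
      then show ?thesis unfolding True by (rule Lr(2))
    next
      case False
      define q where "q = enn2real p"
      have q: "1 \<le> q" using p False enn2real_mono[of 1 p] by (simp add: q_def top.not_eq_extremum infinity_ennreal_def)
      have finite_p: "Lp_norm p T g = (\<integral>t. g t powr q \<partial>lborel) powr (1 / q)"
        if "g \<in> borel_measurable borel" "\<And>s. 0 \<le> g s" "\<And>s. s \<notin> {0<..<T} \<Longrightarrow> g s = 0" for g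
      proof -
        have m: "(\<lambda>t. \<bar>g t\<bar> powr q) \<in> borel_measurable borel" using that(1) by simp
        have "(\<integral>t. \<bar>g t\<bar> powr q \<partial>?M) = (\<integral>t. indicator {0<..<T} t *\<^sub>R (\<bar>g t\<bar> powr q) \<partial>lborel)"
          by (rule lebesgue_on_integral_borel(1)[OF _ m]) simp
        also have "\<dots> = (\<integral>t. g t powr q \<partial>lborel)"
        proof (rule Bochner_Integration.integral_cong[OF refl])
          fix t show "indicator {0<..<T} t *\<^sub>R (\<bar>g t\<bar> powr q) = g t powr q"
            using that(2)[of t] that(3)[of t] by (cases "t \<in> {0<..<T}") simp_all
        qed
        finally show ?thesis using False by (simp add: Lp_norm_def q_def)
      qed
      note b = small_kernel_Lp_bound[OF \<kappa> K(1) C K(2) RR(1-4) AA(1-4) leR q]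
      have rqi: "integrable lborel (\<lambda>t. r t powr q)" and aqi: "integrable lborel (\<lambda>t. a t powr q)"
        and Rqi: "integrable lborel (\<lambda>t. R t powr q)" and Aqi: "integrable lborel (\<lambda>t. A t powr q)"
        by (rule powr_integrable_bounded_support[OF _ _ _ _ q], (fact rm am rb ab r0 a0 RR AA)+)+
      have "(\<integral>t. r t powr q \<partial>lborel) \<le> (\<integral>t. exp (\<sigma> * T) powr q * R t powr q \<partial>lborel)"
      proof (rule integral_mono[OF rqi])
        show "integrable lborel (\<lambda>t. exp (\<sigma> * T) powr q * R t powr q)" using Rqi by simp
        fix t
        have "r t powr q \<le> (exp (\<sigma> * T) * R t) powr q" using rR rb(1) q by (intro powr_mono2) simp_all
        then show "r t powr q \<le> exp (\<sigma> * T) powr q * R t powr q" using RR(2) by (simp add: powr_mult)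
      qed
      also have "\<dots> = exp (\<sigma> * T) powr q * (\<integral>t. R t powr q \<partial>lborel)" by simp
      also have "\<dots> \<le> exp (\<sigma> * T) powr q * (4 powr q * (\<integral>t. A t powr q \<partial>lborel))"
        by (rule mult_left_mono[OF b powr_ge_zero])
      also have "\<dots> \<le> exp (\<sigma> * T) powr q * (4 powr q * (\<integral>t. a t powr q \<partial>lborel))"
        by (intro mult_left_mono integral_mono Aqi aqi powr_mono2 AA) (use q in simp_all)
      also have "\<dots> = c powr q * (\<integral>t. a t powr q \<partial>lborel)" by (simp add: c_def powr_mult)
      finally have "(\<integral>t. r t powr q \<partial>lborel) powr (1 / q) \<le> (c powr q * (\<integral>t. a t powr q \<partial>lborel)) powr (1 / q)"
        using q by (intro powr_mono2) (simp_all add: Bochner_Integration.integral_nonneg)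
      also have "\<dots> = c * (\<integral>t. a t powr q \<partial>lborel) powr (1 / q)"
        using q by (simp add: powr_mult powr_powr c_def)
      finally have "(\<integral>t. r t powr q \<partial>lborel) powr (1 / q) \<le> c * (\<integral>t. a t powr q \<partial>lborel) powr (1 / q)" .
      moreover have "Lp_norm p T r = (\<integral>t. r t powr q \<partial>lborel) powr (1 / q)" by (rule finite_p[OF rm rb(1) r0])
      moreover have "Lp_norm p T a = (\<integral>t. a t powr q \<partial>lborel) powr (1 / q)" by (rule finite_p[OF am ab(1) a0])
      ultimately show ?thesis by simp
    qed
  qed
  show ?thesis
    unfolding Lp_gronwall_constant_def
  proof (intro exI[of _ c] allI impI, elim conjE)
    fix r a :: "real \<Rightarrow> real" and B and p :: ennreal
    assume "r \<in> borel_measurable borel" "a \<in> borel_measurable borel"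
      "\<forall>s. 0 \<le> r s \<and> r s \<le> B \<and> 0 \<le> a s \<and> a s \<le> B" "\<forall>s. s \<notin> {0<..<T} \<longrightarrow> r s = 0 \<and> a s = 0"
      "\<forall>t\<in>{0<..<T}. r t \<le> a t + C * frac_conv \<alpha> r t" "1 \<le> p"
    then show "Lp_norm p T r \<le> c * Lp_norm p T a" by (intro main[where B=B]) simp_all
  qed
qed

section \<open>Stability of the potential\<close>

lemma Lp_norm_cmult:
  assumes c: "0 < c" and p: "1 \<le> p"
  shows "Lp_norm p T (\<lambda>t. c * g t) = c * Lp_norm p T g"
proof (cases "p = \<infinity>")
  case True
  have "esssup (lebesgue_on {0<..<T}) (\<lambda>t. ereal c * ereal \<bar>g t\<bar>) = ereal c * esssup (lebesgue_on {0<..<T}) (\<lambda>t. ereal \<bar>g t\<bar>)"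
    by (rule esssup_cmult[OF c])
  then show ?thesis using c True by (simp add: Lp_norm_def abs_mult)
next
  case False
  define q where "q = enn2real p"
  have q: "1 \<le> q" using p False enn2real_mono[of 1 p] by (simp add: q_def top.not_eq_extremum infinity_ennreal_def)
  have "(\<integral>t. \<bar>c * g t\<bar> powr q \<partial>lebesgue_on {0<..<T}) = c powr q * (\<integral>t. \<bar>g t\<bar> powr q \<partial>lebesgue_on {0<..<T})"
    using c by (simp add: abs_mult powr_mult)
  then show ?thesis
    using False q c by (simp add: Lp_norm_def q_def[symmetric] powr_mult powr_powr)
qed

context subdiffusion_pair
begin

lemma Lp_stability:
  assumes x: "x \<in> closure \<Omega>" and cl: "0 < cl" "\<And>t. t \<in> {0..T} \<Longrightarrow> cl \<le> u1 t x" and p: "1 \<le> p"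
    and c: "Lp_gronwall_constant \<alpha> T (sobolev_const \<gamma> * data_const * (1 + crho / c0) / cl) c"
  shows "Lp_norm p T (\<lambda>t. \<rho>1 t - \<rho>2 t) \<le> c / cl * Lp_norm p T (caputo \<alpha> (\<lambda>s. u1 s x - u2 s x))"
proof -
  let ?g = "caputo \<alpha> (\<lambda>s. u1 s x - u2 s x)" and ?J = "{0<..<T}"
  \<comment> \<open>Both functions are cut off to the open interval: the norms do not see the end
    points, and the Caputo derivative is controlled only for t > 0.\<close>
  define r where "r s = indicator ?J s * \<bar>\<rho>1 s - \<rho>2 s\<bar>" for s
  define a where "a s = indicator ?J s * (1 / cl * \<bar>?g s\<bar>)" for s
  have sub: "?J \<subseteq> {0..T}" "?J \<subseteq> {0<..T}" by auto
  have J: "?J \<in> sets borel" by simp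
  have rm: "r \<in> borel_measurable borel"
    using borel_measurable_continuous_on_indicator[OF J continuous_on_subset[OF rho_diff_continuous sub(1)]]
    unfolding r_def[abs_def] by simp
  have ca: "continuous_on ?J (\<lambda>s. 1 / cl * \<bar>?g s\<bar>)"
    by (intro continuous_intros continuous_on_subset[OF caputo_diff_continuous[OF x] sub(2)])
  have am: "a \<in> borel_measurable borel"
    using borel_measurable_continuous_on_indicator[OF J ca] unfolding a_def[abs_def] real_scaleR_def .
  obtain K where K: "\<forall>t\<in>{0<..T}. \<bar>?g t\<bar> \<le> K" by (rule exE[OF caputo_diff_bounded[OF x]])
  obtain B0 where B0: "B0 \<ge> 0" "\<And>s. \<bar>indicator {0..T} s * \<bar>\<rho>1 s - \<rho>2 s\<bar>\<bar> \<le> B0"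
    using continuous_cutoff_bounded[OF rho_diff_continuous] by blast
  define B where "B = B0 + \<bar>K\<bar> / cl"
  have B1: "B0 \<le> B" "\<bar>K\<bar> / cl \<le> B" "0 \<le> B" using B0(1) cl(1) by (simp_all add: B_def)
  have b: "0 \<le> r s \<and> r s \<le> B \<and> 0 \<le> a s \<and> a s \<le> B" for s
  proof (cases "s \<in> ?J")
    case True
    then have "\<bar>\<rho>1 s - \<rho>2 s\<bar> \<le> B0" using B0(2)[of s] by simp
    moreover have "\<bar>?g s\<bar> / cl \<le> \<bar>K\<bar> / cl"
    proof (rule divide_right_mono)
      have "\<bar>?g s\<bar> \<le> K" using bspec[OF K, of s] True by simp
      then show "\<bar>?g s\<bar> \<le> \<bar>K\<bar>" by linarith
    qed (use cl in simp)
    ultimately show ?thesis using True B1 cl(1) by (simp add: r_def a_def)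
  next
    case False
    then show ?thesis using B1(3) by (simp add: r_def a_def)
  qed
  have conv: "rho_conv t = frac_conv \<alpha> r t" if t: "t \<in> ?J" for t
    unfolding rho_conv_def frac_conv_def
  proof (rule integral_cong_AE)
    show "(\<lambda>s. frac_kernel \<alpha> (t - s) * (indicator {0..T} s * \<bar>\<rho>1 s - \<rho>2 s\<bar>)) \<in> borel_measurable lborel"
      using continuous_cutoff_measurable[OF rho_diff_continuous] by simp
    show "(\<lambda>s. frac_kernel \<alpha> (t - s) * r s) \<in> borel_measurable lborel" using rm by simp
    have "AE s in lborel. s \<noteq> (0::real)" by (rule AE_lborel_singleton)
    then show "AE s in lborel. frac_kernel \<alpha> (t - s) * (indicator {0..T} s * \<bar>\<rho>1 s - \<rho>2 s\<bar>) = frac_kernel \<alpha> (t - s) * r s"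
    proof (rule AE_mp, intro AE_I2 impI)
      fix s :: real assume "s \<noteq> 0"
      then show "frac_kernel \<alpha> (t - s) * (indicator {0..T} s * \<bar>\<rho>1 s - \<rho>2 s\<bar>) = frac_kernel \<alpha> (t - s) * r s"
        using t by (cases "s < t") (auto simp: r_def indicator_def frac_kernel_nonpos_arg)
    qed
  qed
  have le: "r t \<le> a t + sobolev_const \<gamma> * data_const * (1 + crho / c0) / cl * frac_conv \<alpha> r t" if t: "t \<in> ?J" for t
  proof -
    have t': "t \<in> {0<..T}" "t \<in> {0..T}" using t by simp_all
    show ?thesis using potential_diff_bound[OF t'(1) x cl(1) cl(2)[OF t'(2)]] t
      unfolding conv[OF t, symmetric] by (simp add: r_def a_def)
  qed
  have "Lp_norm p T (\<lambda>t. \<rho>1 t - \<rho>2 t) = Lp_norm p T r"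
    by (rule Lp_norm_cong) (simp add: r_def)
  also have "\<dots> \<le> c * Lp_norm p T a"
  proof (rule mp[OF c[unfolded Lp_gronwall_constant_def, THEN spec, THEN spec, THEN spec, THEN spec, of r a B p]], intro conjI allI ballI impI)
    fix s assume "s \<notin> ?J"
    then show "r s = 0" "a s = 0" by (simp_all add: r_def a_def)
  qed (use rm am b le p in simp_all)
  also have "Lp_norm p T a = Lp_norm p T (\<lambda>t. 1 / cl * ?g t)"
    by (rule Lp_norm_cong) (use cl(1) in \<open>simp add: a_def abs_mult\<close>)
  also have "\<dots> = 1 / cl * Lp_norm p T ?g" by (rule Lp_norm_cmult) (use cl p in simp_all)
  finally show ?thesis by simp
qed

end

theorem theorem3p2:
  fixes \<Omega> :: "'a::euclidean_space set"
    and T c0 \<gamma> :: real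
    and lam :: "nat \<Rightarrow> real"
    and \<phi> :: "nat \<Rightarrow> 'a \<Rightarrow> real"
  assumes "DIM('a) \<le> 3"
    and "convex_polyhedral_domain \<Omega>"
    and "T > 0"
    and "c0 > 0"
    and "eigensystem_A \<Omega> c0 lam \<phi>"
    and "real DIM('a) / 2 < \<gamma>" and "\<gamma> < 2"
  shows "\<exists>c :: real \<Rightarrow> real \<Rightarrow> real \<Rightarrow> real \<Rightarrow> real \<Rightarrow> real \<Rightarrow> real \<Rightarrow> real \<Rightarrow> real.
    \<forall>(\<alpha>::real) (c\<rho>::real) \<rho>1 \<rho>2 u0 f u1 u2 x0 (cl::real) (cu::real) (p::ennreal).
      0 < \<alpha> \<and> \<alpha> < 1 \<and> 0 < c\<rho> \<and>
      \<rho>1 \<in> admissible T c\<rho> \<and> \<rho>1 piecewise_C1_differentiable_on {0..T} \<and>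
      \<rho>2 \<in> admissible T c\<rho> \<and> \<rho>2 piecewise_C1_differentiable_on {0..T} \<and>
      u0 \<in> DA \<Omega> lam \<phi> (1 + \<gamma> / 2) \<and> f \<in> DA \<Omega> lam \<phi> (\<gamma> / 2) \<and>
      is_solution \<Omega> T lam \<phi> \<gamma> \<alpha> \<rho>1 u0 f u1 \<and>
      is_solution \<Omega> T lam \<phi> \<gamma> \<alpha> \<rho>2 u0 f u2 \<and>
      x0 \<in> closure \<Omega> \<and>
      0 < cl \<and> 0 < cu \<and>
      (\<forall>t\<in>{0..T}. cl \<le> u1 t x0 \<and> u1 t x0 \<le> cu \<and> cl \<le> u2 t x0 \<and> u2 t x0 \<le> cu) \<and>
      1 \<le> p \<longrightarrow>
      Lp_norm p T (\<lambda>t. \<rho>1 t - \<rho>2 t)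
        \<le> c cl cu \<alpha> c\<rho>
             (DA_norm \<Omega> lam \<phi> (\<gamma> / 2) f)
             (DA_norm \<Omega> lam \<phi> (1 + \<gamma> / 2) u0)
             (SUP t\<in>{0..T}. \<bar>point_value \<Omega> (op_A \<Omega> c0 (u1 t)) x0\<bar>)
             (SUP t\<in>{0<..T}. \<bar>caputo \<alpha> (\<lambda>s. u1 s x0) t\<bar>)
          * Lp_norm p T (caputo \<alpha> (\<lambda>s. u1 s x0 - u2 s x0))"
proof -
  interpret neumann_eigensystem \<Omega> c0 lam \<phi> by unfold_locales (fact assms)+
  \<comment> \<open>The constant has to be exhibited before \<alpha> and the data are fixed, so the
    Gronwall constant is turned into a function of \<alpha> and C by choice.\<close>
  define G where "G \<alpha> C = (SOME c. Lp_gronwall_constant \<alpha> T C c)" for \<alpha> C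
  have G: "Lp_gronwall_constant \<alpha> T C (G \<alpha> C)" if "0 < \<alpha>" "0 \<le> C" for \<alpha> C
    unfolding G_def by (rule someI_ex[OF fractional_gronwall_Lp[OF that(1) \<open>T > 0\<close> that(2)]])
  \<comment> \<open>The factor of the fractional integral in \<open>potential_diff_bound\<close>,
    written in terms of numbers only: the square root is \<open>data_const\<close>, with
    \<open>coef_const\<close> inserted and \<open>Nu\<close>, \<open>Nf\<close> for the norms of
    \<open>u0\<close> and \<open>f\<close>.\<close>
  define C where "C cl \<alpha> c\<rho> Nf Nu = sobolev_const \<gamma> * sqrt (2 * Nu\<^sup>2 + 2 * (2 + 2 * c0 * frac_kernel (\<alpha> + 1) T)\<^sup>2 * Nf\<^sup>2)
      * (1 + c\<rho> / c0) / cl" for cl \<alpha> c\<rho> Nf Nu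
  define c where "c cl cu \<alpha> c\<rho> Nf Nu Na Nd = G \<alpha> (C cl \<alpha> c\<rho> Nf Nu) / cl"
    for cl cu \<alpha> c\<rho> Nf Nu Na Nd :: real
  show ?thesis
  proof (intro exI[of _ c] allI impI, elim conjE)
    fix \<alpha> c\<rho> :: real and \<rho>1 \<rho>2 u0 f u1 u2 x0 and cl cu :: real and p :: ennreal
    assume \<alpha>: "0 < \<alpha>" "\<alpha> < 1" and c\<rho>: "0 < c\<rho>"
      and \<rho>: "\<rho>1 \<in> admissible T c\<rho>" "\<rho>2 \<in> admissible T c\<rho>"
      and data: "u0 \<in> DA \<Omega> lam \<phi> (1 + \<gamma> / 2)" "f \<in> DA \<Omega> lam \<phi> (\<gamma> / 2)"
      and sol: "is_solution \<Omega> T lam \<phi> \<gamma> \<alpha> \<rho>1 u0 f u1" "is_solution \<Omega> T lam \<phi> \<gamma> \<alpha> \<rho>2 u0 f u2"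
      and x0: "x0 \<in> closure \<Omega>" and cl: "0 < cl"
      and u: "\<forall>t\<in>{0..T}. cl \<le> u1 t x0 \<and> u1 t x0 \<le> cu \<and> cl \<le> u2 t x0 \<and> u2 t x0 \<le> cu"
      and p: "1 \<le> p"
    interpret subdiffusion_pair \<Omega> c0 lam \<phi> \<gamma> T \<alpha> c\<rho> \<rho>1 \<rho>2 u0 f u1 u2
      by unfold_locales (fact assms \<alpha> \<rho> data sol)+
    have C_eq: "C cl \<alpha> c\<rho> (DAn (\<gamma> / 2) f) (DAn (1 + \<gamma> / 2) u0) = sobolev_const \<gamma> * data_const * (1 + c\<rho> / c0) / cl"
      unfolding C_def data_const_def S1.coef_const_def ..
    have "0 \<le> C cl \<alpha> c\<rho> (DAn (\<gamma> / 2) f) (DAn (1 + \<gamma> / 2) u0)"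
      unfolding C_eq using sobolev_const(1)[OF assms(6)] data_const_nonneg c\<rho> c0 cl by simp
    from Lp_stability[OF x0 cl _ p G[OF \<alpha>(1) this, unfolded C_eq]] u
    show "Lp_norm p T (\<lambda>t. \<rho>1 t - \<rho>2 t)
        \<le> c cl cu \<alpha> c\<rho> (DA_norm \<Omega> lam \<phi> (\<gamma> / 2) f) (DA_norm \<Omega> lam \<phi> (1 + \<gamma> / 2) u0)
             (SUP t\<in>{0..T}. \<bar>point_value \<Omega> (op_A \<Omega> c0 (u1 t)) x0\<bar>)
             (SUP t\<in>{0<..T}. \<bar>caputo \<alpha> (\<lambda>s. u1 s x0) t\<bar>)
          * Lp_norm p T (caputo \<alpha> (\<lambda>s. u1 s x0 - u2 s x0))"
      unfolding c_def C_eq by simp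
  qed
qed

end
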